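(* Let $m\ge 1$ and $n\ge 2m+4$ be integers. Let $k:\mathbb{R}^n\to\mathbb{R}$ be a $C^1$ function which is bounded between two positive constants and satisfies $\nabla k(0)=0$. Let $\varepsilon>0$ be a number and let $\varphi:(0,1)\to(0,\infty)$ be a continuous function. Then there exists a $C^1$ positive function $K:\mathbb{R}^n\to\mathbb{R}$ satisfying $\nabla K(0)=0$, $K(0)=k(0)$, $K(x)=k(x)$ for $|x|\ge\varepsilon$, and $$\|K-k\|_{C^1(\mathbb{R}^n)}<\varepsilon,$$ such that the equation $$(-\Delta)^m u=K(x)\,u^{\frac{n+2m}{n-2m}}\qquad\text{in } \mathbb{R}^n\setminus\{0\}$$ has a $C^{2m}$ positive solution $u$ on $\mathbb{R}^n\setminus\{0\}$ satisfying $$u(x)\neq O(\varphi(|x|))\quad\text{as } |x|\to 0^+,$$ $$u(x)=O(|x|^{2m-n})\quad\text{as } |x|\to\infty,$$ and $$(-\Delta)^s u>0\quad\text{in } \mathbb{R}^n\setminus\{0\},\qquad s=1,2,\dots,m-1.$$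
   Context: $\Delta$ is the Laplacian on $\mathbb{R}^n$ and $(-\Delta)^s$ its $s$-th iterate (with sign). The statement $u(x)\ne O(\varphi(|x|))$ as $|x|\to0^+$ means that there are no constants $C,r>0$ with $u(x)\le C\varphi(|x|)$ for all $0<|x|<r$; i.e. $\limsup_{|x|\to0^+}u(x)/\varphi(|x|)=+\infty$. When $m=1$ the last condition (on $(-\Delta)^s u$) is vacuous. *)

theory Defs
  imports "HOL-Analysis.Analysis" "HOL-Library.Landau_Symbols"
begin

definition partial :: "'n::finite \<Rightarrow> (real ^ 'n \<Rightarrow> real) \<Rightarrow> real ^ 'n \<Rightarrow> real" where
  "partial i f x = frechet_derivative f (at x) (axis i 1)"

(* Only intended for open S, where "differentiable_on" is differentiability at every point of S. *)
primrec C_k_on :: "nat \<Rightarrow> (real ^ 'n::finite \<Rightarrow> real) \<Rightarrow> (real ^ 'n) set \<Rightarrow> bool" where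
  "C_k_on 0 f S \<longleftrightarrow> continuous_on S f"
| "C_k_on (Suc k) f S \<longleftrightarrow> f differentiable_on S \<and> (\<forall>i. C_k_on k (partial i f) S)"

definition gradient :: "(real ^ 'n::finite \<Rightarrow> real) \<Rightarrow> real ^ 'n \<Rightarrow> real ^ 'n" where
  "gradient f x = (\<chi> i. partial i f x)"

lemma gradient_GDERIV:
  assumes "f differentiable (at x)"
  shows "GDERIV f x :> gradient f x"
proof -
  have d: "(f has_derivative frechet_derivative f (at x)) (at x)"
    using assms by (simp add: frechet_derivative_works)
  then have lin: "linear (frechet_derivative f (at x))"
    by (rule has_derivative_linear)
  have "frechet_derivative f (at x) h = h \<bullet> gradient f x" for h
  proof -
    have "frechet_derivative f (at x) h =
        frechet_derivative f (at x) (\<Sum>i\<in>UNIV. (h $ i) *\<^sub>R axis i 1)"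
      using basis_expansion[of h] by (simp add: scalar_mult_eq_scaleR)
    also have "\<dots> = (\<Sum>i\<in>UNIV. h $ i * partial i f x)"
      by (simp add: linear_sum[OF lin] linear_scale[OF lin] partial_def)
    also have "\<dots> = h \<bullet> gradient f x"
      by (simp add: gradient_def inner_vec_def)
    finally show ?thesis .
  qed
  then have "frechet_derivative f (at x) = (\<lambda>h. h \<bullet> gradient f x)"
    by (rule ext)
  with d show ?thesis
    by (simp add: gderiv_def)
qed

definition laplacian :: "(real ^ 'n::finite \<Rightarrow> real) \<Rightarrow> real ^ 'n \<Rightarrow> real" where
  "laplacian f x = (\<Sum>i\<in>UNIV. partial i (partial i f) x)"

definition neg_laplacian_pow :: "nat \<Rightarrow> (real ^ 'n::finite \<Rightarrow> real) \<Rightarrow> real ^ 'n \<Rightarrow> real" where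
  "neg_laplacian_pow s f = ((\<lambda>v x. - laplacian v x) ^^ s) f"

(* Extended-real suprema, so that an unbounded function or gradient has norm \<infinity>
   rather than an unspecified real value. *)
definition C1_norm :: "(real ^ 'n::finite \<Rightarrow> real) \<Rightarrow> ereal" where
  "C1_norm f = (SUP x. ereal \<bar>f x\<bar>) + (SUP x. ereal (norm (gradient f x)))"

end

theory Submission
 imports Defs
begin

text \<open>The solution is a superposition of infinitely many bubbles.  Put \<open>N = n - 2 m\<close> and
 \<open>p = (n + 2 m) / (n - 2 m)\<close>.  For a constant curvature \<open>\<kappa>\<close> the equation has the explicit solutions
 \<open>psi \<kappa> \<mu> z\<close>, whose height at the centre \<open>z\<close> is a multiple of \<open>\<mu> powr (- N / 2)\<close> and which, away from \<open>z\<close>,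
 are at most a multiple of \<open>\<mu> powr (N / 2)\<close>.  Centring such bubbles at points \<open>z i\<close> that tend to the origin
 and choosing their widths \<open>\<mu> i\<close> small enough, one exceeds any prescribed size at the points \<open>z i\<close>,
 while the bubbles hardly see each other.

 The equation is solved in integral form.  Let \<open>T\<close> be the potential operator inverting the
 polyharmonic operator.  If \<open>u = T f\<close> with \<open>f > 0\<close>, then \<open>u\<close> solves the equation with curvature
 \<open>K = f / u powr p\<close>.  The density \<open>f\<close> is prescribed to be the density \<open>\<kappa> i * \<psi> i powr p\<close> of the bubble on
 a small core \<open>ball (z i) (r i)\<close>, where \<open>\<kappa> i = k (z i)\<close>, and it is required to be \<open>k * u powr p\<close> outside the
 doubled cores; a cutoff interpolates.  Since the nonlinearity is only active where all bubbles are small, a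
 multiple of the bubbles plus a small fixed bubble centred at the origin gives a supersolution, and monotone
 iteration gives \<open>f\<close> (\<open>fixed_point_below_supersolution\<close>, \<open>supersolution\<close>, \<open>bubble_solution\<close>).

 The price is that \<open>K\<close> differs from \<open>k\<close> on the doubled cores.  There
 \<open>K - k\<close> is a cutoff times \<open>\<kappa> i * (u / \<psi> i) powr (- p) - k\<close>, so \<open>u / \<psi> i\<close> has to be close to \<open>1\<close>, to an accuracy
 that is small compared with \<open>r i\<close> because differentiating the cutoff costs a factor \<open>1 / r i\<close>.  The
 difference \<open>u - \<psi> i\<close> is the potential of a density that vanishes on the core; it is bounded by the
 oscillation of \<open>k\<close> over the ring around the core and by a constant representing all other
 bubbles (\<open>deviation\<close>, \<open>ratio_bounds\<close>).  Relating the width and the core by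
 \<open>\<mu> = t powr (- 1 / 4) * r powr (3 / 2)\<close>, with \<open>t\<close> the distance of the centre from the origin, makes both
 contributions small; this is where \<open>N \<ge> 4\<close> enters (\<open>bubble_parameters\<close>).  The corrections of the curvature
 then tend to zero in \<open>C\<^sup>1\<close> and sum up to a \<open>C\<^sup>1\<close> function with vanishing gradient at the
 origin (\<open>gluing\<close>, \<open>glued_curvature\<close>).

 The potential theory behind this is elementary.  Potentials are differentiated by
 estimating increments of the kernel (\<open>GDERIV_pot\<close>); the last Laplacian, whose kernel is not
 integrable, is handled by regularising the Newtonian kernel (\<open>newton_representation\<close>); iterating
 gives \<open>neg_laplacian_pow_riesz\<close>.  That a bubble is the potential of its own density
 follows from a direct computation of its iterated Laplacians and Liouville's theorem
 (\<open>riesz_bubble\<close>).\<close>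
section \<open>Derivatives, gradients and classes of kernels\<close>

lemma GDERIV_imp_differentiable: "GDERIV f x :> D ==> f differentiable (at x)"
 unfolding gderiv_def differentiable_def by blast

lemma partial_eq:
 fixes f :: "real ^ 'n::finite => real"
 assumes "GDERIV f x :> D"
 shows "partial i f x = D $ i"
 using frechet_derivative_at[OF assms[unfolded gderiv_def], symmetric]
 by (simp add: partial_def inner_axis')

lemma gradient_nth [simp]: "gradient f x $ i = partial i f x"
 by (simp add: gradient_def)

lemma gradient_eq:
 fixes f :: "real ^ 'n::finite => real"
 assumes "GDERIV f x :> D"
 shows "gradient f x = D"
 using partial_eq[OF assms] by (simp add: vec_eq_iff)

lemma GDERIV_transform_open:
 assumes "GDERIV f x :> D" "open S" "x \<in> S" "\<And>y. y \<in> S ==> f y = g y"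
 shows "GDERIV g x :> D"
 using has_derivative_transform_within_open[OF assms(1)[unfolded gderiv_def] assms(2-4)]
 by (simp add: gderiv_def)

lemma partial_cong_open:
 assumes "open S" "x \<in> S" "\<And>y. y \<in> S ==> f y = g y"
 shows "partial i f x = partial i g x"
proof -
 have "(f has_derivative D) (at x) \<longleftrightarrow> (g has_derivative D) (at x)" for D
  using has_derivative_transform_within_open[OF _ assms(1,2), of f D UNIV g]
   has_derivative_transform_within_open[OF _ assms(1,2), of g D UNIV f] assms(3)
  by auto
 then show ?thesis
  by (simp add: partial_def frechet_derivative_def)
qed

lemma laplacian_cong_open:
 assumes "open S" "x \<in> S" "\<And>y. y \<in> S ==> f y = g y"
 shows "laplacian f x = laplacian g x"
 unfolding laplacian_def
 by (intro sum.cong refl partial_cong_open[OF assms(1,2)] partial_cong_open[OF assms(1)] assms(3))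

lemma C_k_on_cong:
 assumes "open S" "\<And>y. y \<in> S ==> f y = g y" "C_k_on k f S"
 shows "C_k_on k g S"
 using assms(2,3)
proof (induction k arbitrary: f g)
 case 0
 have "continuous_on S g = continuous_on S f"
  by (rule continuous_on_cong) (simp_all add: 0)
 then show ?case using 0 by simp
next
 case (Suc k)
 have "g differentiable (at x)" if "x \<in> S" for x
 proof -
  have "f differentiable (at x)"
   using Suc.prems(2) assms(1) that by (simp add: differentiable_on_eq_differentiable_at)
  from GDERIV_transform_open[OF gradient_GDERIV[OF this] assms(1) that, of g] Suc.prems(1)
  show ?thesis by (auto intro: GDERIV_imp_differentiable)
 qed
 moreover have "C_k_on k (partial i g) S" for i
 proof (rule Suc.IH[of "partial i f"])
  show "partial i f y = partial i g y" if "y \<in> S" for y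
   by (rule partial_cong_open[OF assms(1) that Suc.prems(1)])
 qed (use Suc.prems in simp)
 ultimately show ?case
  using assms(1) by (simp add: differentiable_on_eq_differentiable_at)
qed

lemma C_k_on_SucI:
 assumes "open S" "\<And>x. x \<in> S ==> GDERIV f x :> F x"
  and "\<And>i. C_k_on k (\<lambda>x. F x $ i) S"
 shows "C_k_on (Suc k) f S"
proof -
 have "C_k_on k (partial i f) S" for i
  by (rule C_k_on_cong[OF assms(1) _ assms(3)[of i]]) (simp add: partial_eq[OF assms(2)])
 moreover have "f differentiable_on S"
  unfolding differentiable_on_eq_differentiable_at[OF assms(1)]
 proof
  fix x assume "x \<in> S"
  then show "f differentiable (at x)"
   by (rule GDERIV_imp_differentiable[OF assms(2)])
 qed
 ultimately show ?thesis unfolding C_k_on.simps by (intro conjI allI)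
qed

lemma C_1_onI:
 fixes f :: "real ^ 'n::finite => real"
 assumes "open S" "\<And>x. x \<in> S ==> GDERIV f x :> F x" "continuous_on S F"
 shows "C_k_on 1 f S"
proof -
 have "continuous_on S (\<lambda>x. F x $ i)" for i
  using assms(3) by (rule continuous_on_component)
 then have "C_k_on 0 (\<lambda>x. F x $ i) S" for i
  unfolding C_k_on.simps .
 from C_k_on_SucI[OF assms(1,2) this] show ?thesis
  unfolding One_nat_def .
qed

lemma continuous_on_gradientI:
 assumes "\<And>i. continuous_on S (partial i f)"
 shows "continuous_on S (gradient f)"
proof -
 have "gradient f = (\<lambda>x. \<chi> i. partial i f x)" by (simp add: gradient_def fun_eq_iff)
 then show ?thesis using continuous_on_vec_lambda[of S "\<lambda>i. partial i f", OF assms] by simp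
qed

lemma C_1_onD:
 fixes f :: "real ^ 'n::finite => real"
 assumes "open S" "C_k_on 1 f S"
 shows "\<And>x. x \<in> S ==> GDERIV f x :> gradient f x" "continuous_on S (gradient f)"
  "continuous_on S f"
proof -
 have d: "f differentiable (at x)" if "x \<in> S" for x
  using assms that by (auto simp: differentiable_on_eq_differentiable_at)
 then show "\<And>x. x \<in> S ==> GDERIV f x :> gradient f x" by (rule gradient_GDERIV)
 show "continuous_on S (gradient f)"
  using assms by (intro continuous_on_gradientI) auto
 show "continuous_on S f"
  using d assms(1) by (intro continuous_at_imp_continuous_on) (auto intro: differentiable_imp_continuous_within)
qed

lemma C_k_on_local:
 assumes "open S" "\<And>x. x \<in> S ==> \<exists>T. open T \<and> x \<in> T \<and> C_k_on k f T"
 shows "C_k_on k f S"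
 using assms(2)
proof (induction k arbitrary: f)
 case 0
 have "isCont f x" if "x \<in> S" for x
  using 0[OF that] continuous_on_eq_continuous_at by auto
 then show ?case
  by (simp add: continuous_on_eq_continuous_at[OF assms(1)])
next
 case (Suc k)
 have "f differentiable (at x)" if "x \<in> S" for x
  using Suc.prems[OF that] by (auto simp: differentiable_on_eq_differentiable_at)
 moreover have "C_k_on k (partial i f) S" for i
  proof (rule Suc.IH)
  fix x assume "x \<in> S"
  from Suc.prems[OF this] obtain T where "open T" "x \<in> T" "C_k_on (Suc k) f T" by blast
  then show "\<exists>T. open T \<and> x \<in> T \<and> C_k_on k (partial i f) T" by auto
 qed
 ultimately show ?case using assms(1) by (auto simp: differentiable_on_eq_differentiable_at)
qed

lemma GDERIV_cmult:
 assumes "GDERIV f x :> D"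
 shows "GDERIV (\<lambda>x. c * f x) x :> c *\<^sub>R D"
 using GDERIV_mult[OF GDERIV_const[of c x] assms] by simp

lemma GDERIV_nth: "GDERIV (\<lambda>x::real^'n::finite. x $ j) x :> axis j 1"
 unfolding gderiv_def inner_axis
 by (auto intro!: derivative_eq_intros bounded_linear_imp_has_derivative bounded_linear_vec_nth)

lemma GDERIV_sum:
 assumes "\<And>i. i \<in> I ==> GDERIV (f i) x :> D i"
 shows "GDERIV (\<lambda>x. \<Sum>i\<in>I. f i x) x :> (\<Sum>i\<in>I. D i)"
 using assms
proof (induction I rule: infinite_finite_induct)
 case (insert i I)
 then show ?case using GDERIV_add[of "f i" x "D i" "\<lambda>x. \<Sum>i\<in>I. f i x"] by simp
qed (auto intro: GDERIV_const)

subsection \<open>Powers of quadratic forms\<close>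

definition qpow :: "real => real => 'a::real_inner => real" where
 "qpow c a x = (c + (norm x)\<^sup>2) powr a"

lemma norm_powr_eq_qpow: "norm x powr d = qpow 0 (d / 2) x"
 by (cases "x = 0") (auto simp: qpow_def powr_half_sqrt powr_def ln_realpow)

lemma qpow_nonneg [simp]: "0 \<le> qpow c a x"
 by (simp add: qpow_def)

lemma qpow_pos: "0 < c + (norm x)\<^sup>2 ==> 0 < qpow c a x"
 by (simp add: qpow_def)

lemma GDERIV_norm_square: "GDERIV (\<lambda>x. (norm x)\<^sup>2) x :> 2 *\<^sub>R (x::'a::real_inner)"
 unfolding gderiv_def power2_norm_eq_inner
 by (auto intro!: derivative_eq_intros simp: inner_commute)

lemma GDERIV_qpow:
 assumes "0 < c + (norm x)\<^sup>2"
 shows "GDERIV (qpow c a) x :> (2 * a * qpow c (a - 1) x) *\<^sub>R x"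
proof -
 have "GDERIV (\<lambda>x. c + (norm x)\<^sup>2) x :> 2 *\<^sub>R x"
  using GDERIV_add[OF GDERIV_const[of c x] GDERIV_norm_square[of x]] by simp
 moreover have "DERIV (\<lambda>s. s powr a) (c + (norm x)\<^sup>2) :> a * (c + (norm x)\<^sup>2) powr (a - 1)"
  using assms by (intro has_real_derivative_powr) auto
 ultimately have "GDERIV (\<lambda>x. (c + (norm x)\<^sup>2) powr a) x :>
   (a * (c + (norm x)\<^sup>2) powr (a - 1)) *\<^sub>R 2 *\<^sub>R x"
  by (rule GDERIV_DERIV_compose)
 then show ?thesis by (simp add: qpow_def[abs_def] mult_ac)
qed

lemma open_qdom: "open {x::'a::real_inner. 0 < c + (norm x)\<^sup>2}"
 by (intro open_Collect_less continuous_intros)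

lemma partial_qpow:
 fixes x :: "real ^ 'n::finite"
 assumes "0 < c + (norm x)\<^sup>2"
 shows "partial i (qpow c a) x = 2 * a * x $ i * qpow c (a - 1) x"
 using partial_eq[OF GDERIV_qpow[OF assms]] by simp

lemma GDERIV_partial_qpow:
 fixes x :: "real ^ 'n::finite"
 assumes x: "0 < c + (norm x)\<^sup>2"
 shows "GDERIV (partial i (qpow c a)) x :>
  (2 * a * qpow c (a - 1) x) *\<^sub>R axis i 1 + (4 * a * (a - 1) * x $ i * qpow c (a - 2) x) *\<^sub>R x"
proof (rule GDERIV_transform_open[OF _ open_qdom])
 have "GDERIV (\<lambda>x. (2 * a) * (x $ i * qpow c (a - 1) x)) x :>
   (2 * a) *\<^sub>R (x $ i *\<^sub>R ((2 * (a - 1) * qpow c (a - 1 - 1) x) *\<^sub>R x) + qpow c (a - 1) x *\<^sub>R axis i 1)"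
  by (intro GDERIV_cmult GDERIV_mult GDERIV_nth GDERIV_qpow x)
 then show "GDERIV (\<lambda>x. 2 * a * x $ i * qpow c (a - 1) x) x :>
  (2 * a * qpow c (a - 1) x) *\<^sub>R axis i 1 + (4 * a * (a - 1) * x $ i * qpow c (a - 2) x) *\<^sub>R x"
  by (simp add: algebra_simps)
qed (use x in \<open>auto simp: partial_qpow\<close>)

lemma qpow_mult_base:
 assumes "0 < c + (norm x)\<^sup>2"
 shows "(c + (norm x)\<^sup>2) * qpow c (a - 1) x = qpow c a x"
 using assms powr_add[of "c + (norm x)\<^sup>2" 1 "a - 1"] by (simp add: qpow_def)

lemma laplacian_qpow:
 fixes x :: "real ^ 'n::finite"
 assumes x: "0 < c + (norm x)\<^sup>2"
 shows "laplacian (qpow c a) x = 2 * a * (real CARD('n) + 2 * a - 2) * qpow c (a - 1) x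
  - 4 * a * (a - 1) * c * qpow c (a - 2) x"
proof -
 have "partial i (partial i (qpow c a)) x =
   2 * a * qpow c (a - 1) x + 4 * a * (a - 1) * qpow c (a - 2) x * (x $ i * x $ i)" for i
  using partial_eq[OF GDERIV_partial_qpow[OF x, of i a], of i] by simp
 then have "laplacian (qpow c a) x = 2 * a * real CARD('n) * qpow c (a - 1) x
   + 4 * a * (a - 1) * qpow c (a - 2) x * (norm x)\<^sup>2"
  by (simp add: laplacian_def sum.distrib power2_norm_eq_inner inner_vec_def sum_distrib_left)
 moreover have "qpow c (a - 2) x * (norm x)\<^sup>2 = qpow c (a - 1) x - c * qpow c (a - 2) x"
  using qpow_mult_base[OF x, of "a - 1"] by (simp add: algebra_simps)
 then have "4 * a * (a - 1) * qpow c (a - 2) x * (norm x)\<^sup>2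
   = 4 * a * (a - 1) * (qpow c (a - 1) x - c * qpow c (a - 2) x)"
  by (simp only: mult.assoc)
 ultimately have "laplacian (qpow c a) x = 2 * a * real CARD('n) * qpow c (a - 1) x
   + 4 * a * (a - 1) * (qpow c (a - 1) x - c * qpow c (a - 2) x)"
  by simp
 then show ?thesis by (simp add: algebra_simps)
qed

subsection \<open>Kernels of a given order of homogeneity\<close>

text \<open>The bounds are those that hold for a function homogeneous of degree \<open>d\<close>.  They are all that the
 estimates of potentials use of a kernel.\<close>

primrec kernel_class :: "nat => real => (real ^ 'n::finite => real) => bool" where
 "kernel_class 0 d f \<longleftrightarrow> continuous_on (- {0}) f \<and> (\<exists>C. \<forall>x. x \<noteq> 0 --> \<bar>f x\<bar> \<le> C * norm x powr d)"
| "kernel_class (Suc k) d f \<longleftrightarrow> (\<forall>x. x \<noteq> 0 --> f differentiable (at x)) \<and>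
   (\<exists>C. \<forall>x. x \<noteq> 0 --> \<bar>f x\<bar> \<le> C * norm x powr d) \<and> (\<forall>i. kernel_class k (d - 1) (partial i f))"

lemma kernel_class_bound:
 "kernel_class k d f ==> \<exists>C. \<forall>x. x \<noteq> 0 --> \<bar>f x\<bar> \<le> C * norm x powr d"
 by (cases k) auto

lemma kernel_class_cont: "kernel_class k d f ==> continuous_on (- {0}) f"
 by (cases k) (auto intro!: continuous_at_imp_continuous_on differentiable_imp_continuous_within)

lemma kernel_class_Suc_imp: "kernel_class (Suc k) d f ==> kernel_class k d f"
proof (induction k arbitrary: d f)
 case 0
 then show ?case using kernel_class_bound[OF 0] kernel_class_cont[OF 0] by simp
next
 case (Suc k)
 have "kernel_class k (d - 1) (partial i f)" for i
  by (rule Suc.IH) (use Suc.prems in \<open>simp del: kernel_class.simps add: kernel_class.simps(2)[of "Suc k"]\<close>)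
 then show ?case using Suc.prems by auto
qed

lemma kernel_class_antimono:
 assumes "j \<le> k" "kernel_class k d f"
 shows "kernel_class j d f"
 using assms by (induction rule: dec_induct) (blast dest: kernel_class_Suc_imp)+

lemma kernel_class_cong:
 assumes "\<And>x. x \<noteq> 0 ==> f x = g x" "kernel_class k d f"
 shows "kernel_class k d g"
 using assms
proof (induction k arbitrary: d f g)
 case 0
 have "continuous_on (- {0}) g"
  using 0 by (subst continuous_on_cong[OF refl, of _ g f]) auto
 then show ?case using 0 by auto
next
 case (Suc k)
 have "g differentiable (at x)" if "x \<noteq> 0" for x
 proof -
  have "GDERIV f x :> gradient f x"
   using Suc.prems(2) that by (intro gradient_GDERIV) simp
  then show ?thesis
   by (rule GDERIV_imp_differentiable[OF GDERIV_transform_open[where S = "- {0}"]])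
    (use Suc.prems(1) that in auto)
 qed
 moreover have "kernel_class k (d - 1) (partial i g)" for i
 proof (rule Suc.IH[of "partial i f"])
  show "partial i f y = partial i g y" if "y \<noteq> 0" for y
   by (rule partial_cong_open[of "- {0}"]) (use that Suc.prems(1) in auto)
 qed (use Suc.prems in simp)
 ultimately show ?case using Suc.prems by auto
qed

lemma kernel_class_add:
 assumes "kernel_class k d f" "kernel_class k d g"
 shows "kernel_class k d (\<lambda>x. f x + g x)"
 using assms
proof (induction k arbitrary: d f g)
 case 0
 then obtain C D where "\<forall>x. x \<noteq> 0 --> \<bar>f x\<bar> \<le> C * norm x powr d" "\<forall>x. x \<noteq> 0 --> \<bar>g x\<bar> \<le> D * norm x powr d"
  by auto
 then have "\<forall>x. x \<noteq> 0 --> \<bar>f x + g x\<bar> \<le> (C + D) * norm x powr d"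
  by (smt (verit) distrib_right)
 then show ?case using 0 by (auto intro!: continuous_intros)
next
 case (Suc k)
 obtain C D where "\<forall>x. x \<noteq> 0 --> \<bar>f x\<bar> \<le> C * norm x powr d" "\<forall>x. x \<noteq> 0 --> \<bar>g x\<bar> \<le> D * norm x powr d"
  using Suc.prems by auto
 then have 1: "\<forall>x. x \<noteq> 0 --> \<bar>f x + g x\<bar> \<le> (C + D) * norm x powr d"
  by (smt (verit) distrib_right)
 have G: "GDERIV (\<lambda>x. f x + g x) x :> gradient f x + gradient g x" if "x \<noteq> 0" for x
  using Suc.prems that by (intro GDERIV_add gradient_GDERIV) auto
 have "kernel_class k (d - 1) (partial i (\<lambda>x. f x + g x))" for i
  by (rule kernel_class_cong[OF _ Suc.IH[of "d - 1" "partial i f" "partial i g"]])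
   (use Suc.prems partial_eq[OF G, of _ i] in auto)
 then show ?case using 1 G by (auto intro: GDERIV_imp_differentiable)
qed

lemma kernel_class_mult:
 assumes "kernel_class k d f" "kernel_class k e g"
 shows "kernel_class k (d + e) (\<lambda>x. f x * g x)"
 using assms
proof (induction k arbitrary: d e f g)
 case 0
 then obtain C D where "\<forall>x. x \<noteq> 0 --> \<bar>f x\<bar> \<le> C * norm x powr d" "\<forall>x. x \<noteq> 0 --> \<bar>g x\<bar> \<le> D * norm x powr e"
  by auto
 then have "\<bar>f x * g x\<bar> \<le> (C * D) * norm x powr (d + e)" if "x \<noteq> 0" for x
  using that mult_mono[of "\<bar>f x\<bar>" "C * norm x powr d" "\<bar>g x\<bar>" "D * norm x powr e"]
  by (force simp: abs_mult powr_add mult_ac)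
 then show ?case using 0 by (auto intro!: continuous_intros)
next
 case (Suc k)
 obtain C D where "\<forall>x. x \<noteq> 0 --> \<bar>f x\<bar> \<le> C * norm x powr d" "\<forall>x. x \<noteq> 0 --> \<bar>g x\<bar> \<le> D * norm x powr e"
  using Suc.prems by auto
 then have 1: "\<bar>f x * g x\<bar> \<le> (C * D) * norm x powr (d + e)" if "x \<noteq> 0" for x
  using that mult_mono[of "\<bar>f x\<bar>" "C * norm x powr d" "\<bar>g x\<bar>" "D * norm x powr e"]
  by (force simp: abs_mult powr_add mult_ac)
 have G: "GDERIV (\<lambda>x. f x * g x) x :> f x *\<^sub>R gradient g x + g x *\<^sub>R gradient f x" if "x \<noteq> 0" for x
  using Suc.prems that by (intro GDERIV_mult gradient_GDERIV) auto
 have k: "kernel_class k d f" "kernel_class k e g"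
  using Suc.prems kernel_class_Suc_imp by blast+
 have "kernel_class k (d + e - 1) (partial i (\<lambda>x. f x * g x))" for i
 proof (rule kernel_class_cong[OF _ kernel_class_add])
  show "kernel_class k (d + e - 1) (\<lambda>x. f x * partial i g x)"
   using Suc.IH[of d f "e - 1" "partial i g"] k Suc.prems by (simp add: algebra_simps)
  show "kernel_class k (d + e - 1) (\<lambda>x. g x * partial i f x)"
   using Suc.IH[of e g "d - 1" "partial i f"] k Suc.prems by (simp add: algebra_simps)
 qed (use partial_eq[OF G, of _ i] in auto)
 then show ?case using 1 G by (auto intro: GDERIV_imp_differentiable)
qed

lemma partial_const [simp]: "partial i (\<lambda>x. c) = (\<lambda>x. 0)"
 by (simp add: partial_def fun_eq_iff)

lemma kernel_class_0: "kernel_class k d (\<lambda>x. 0)"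
 by (induction k arbitrary: d) (auto intro: exI[of _ 0])

lemma kernel_class_const: "kernel_class k 0 (\<lambda>x. c)"
 by (cases k) (auto intro: exI[of _ "\<bar>c\<bar>"] simp: kernel_class_0)

lemma kernel_class_cmult: "kernel_class k d f ==> kernel_class k d (\<lambda>x. c * f x)"
 using kernel_class_mult[OF kernel_class_const[of k c], of d f] by simp

lemma kernel_class_nth:
 fixes j :: "'n::finite"
 shows "kernel_class k 1 (\<lambda>x. x $ j)"
proof (cases k)
 case 0
 then show ?thesis
  by (auto intro!: continuous_intros exI[of _ 1] component_le_norm_cart)
next
 case (Suc l)
 have "partial i (\<lambda>x::real^'n. x $ j) = (\<lambda>x. axis j 1 $ i)" for i
  by (rule ext) (rule partial_eq[OF GDERIV_nth])
 then show ?thesis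
  using Suc by (auto intro!: exI[of _ 1] component_le_norm_cart kernel_class_const
    GDERIV_imp_differentiable GDERIV_nth)
qed

text \<open>Each derivative of a power of the norm is again such a power times a coordinate, so the
 product rule for the classes does all the work.\<close>

lemma kernel_class_qpow: "kernel_class k (2 * a) (qpow 0 a :: real ^ 'n::finite => real)"
proof (induction k arbitrary: a)
 case 0
 have "continuous_on (- {0}) (qpow 0 a :: real^'n => real)"
  unfolding qpow_def by (intro continuous_intros) auto
 then show ?case by (auto intro!: exI[of _ 1] simp: norm_powr_eq_qpow)
next
 case (Suc k)
 have d: "qpow 0 a differentiable (at x)" if "x \<noteq> 0" for x :: "real ^ 'n"
  using that by (intro GDERIV_imp_differentiable[OF GDERIV_qpow]) auto
 have "kernel_class k (1 + 2 * (a - 1)) (\<lambda>x::real^'n. x $ i * (2 * a * qpow 0 (a - 1) x))" for i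
  by (intro kernel_class_mult kernel_class_nth kernel_class_cmult Suc.IH)
 then have "kernel_class k (2 * a - 1) (\<lambda>x::real^'n. x $ i * (2 * a * qpow 0 (a - 1) x))" for i
  by (simp add: algebra_simps)
 then have "kernel_class k (2 * a - 1) (partial i (qpow 0 a :: real ^ 'n => real))" for i
  by (rule kernel_class_cong[rotated]) (auto simp: partial_qpow)
 then show ?case using d
  by (auto intro!: exI[of _ 1] simp: norm_powr_eq_qpow)
qed

lemma kernel_class_norm_powr: "kernel_class k d (\<lambda>x. norm x powr d)"
 using kernel_class_qpow[of k "d / 2"] by (simp add: norm_powr_eq_qpow[abs_def])

section \<open>Integrals of powers of the distance\<close>

lemma le_abs_mult: "y \<le> A * c ==> 0 \<le> c ==> y \<le> \<bar>A\<bar> * c" for A c y :: real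
 by (rule order_trans[OF _ mult_right_mono[of A]]) auto

lemma powr_less_1_of_base: "0 < x ==> x < 1 ==> 0 < b ==> x powr b < 1" for x b :: real
 using powr_less_mono2[of b x 1] by simp

lemma powr_pow_swap: "0 < x ==> (x ^ j) powr b = (x powr b) ^ j" for x b :: real
 by (induction j) (auto simp: powr_mult)

lemma suminf_geometric_ennreal:
 assumes "0 \<le> K" "0 \<le> q" "q < 1"
 shows "(\<Sum>j. ennreal (K * q ^ j)) = ennreal (K / (1 - q))"
proof -
 have "(\<lambda>j. K * q ^ j) sums (K * (1 / (1 - q)))"
  using assms by (intro sums_mult geometric_sums) auto
 moreover have "0 \<le> K * q ^ j" for j using assms by simp
 ultimately have "(\<Sum>j. ennreal (K * q ^ j)) = ennreal (K * (1 / (1 - q)))"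
  by (intro suminf_ennreal_eq)
 then show ?thesis by simp
qed

lemma dyadic_power_identity:
 fixes s c w b :: real
 assumes "0 < s" "0 < c"
 shows "(s * c) powr (b - real N) * (w * s ^ N) = w * c powr (b - real N) * s powr b"
proof -
 have "s powr (b - real N) * s ^ N = s powr b"
  using assms by (simp add: powr_realpow[symmetric] powr_add[symmetric])
 then show ?thesis using assms by (simp add: powr_mult)
qed

text \<open>A sum over dyadic shells takes the place of polar coordinates: on a shell the integrand is
 comparable with a constant and the contributions form a geometric series.\<close>

lemma nn_integral_near_powr:
 assumes b: "0 < b" "b \<le> real CARD('n::finite)"
 shows "\<exists>C>0. \<forall>(x::real^'n) \<rho>. 0 < \<rho> -->
  (\<integral>\<^sup>+y. ennreal (norm (x - y) powr (b - real CARD('n))) * indicator (ball x \<rho>) y \<partial>lborel)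
   \<le> ennreal (C * \<rho> powr b)"
proof -
 let ?n = "real CARD('n)"
 define \<omega> where "\<omega> = unit_ball_vol ?n"
 have \<omega>: "\<omega> > 0" by (simp add: \<omega>_def)
 define q where "q = (1/2) powr b"
 have q: "0 < q" "q < 1" using b by (auto simp: q_def powr_less_1_of_base powr_minus_divide)
 define C where "C = \<omega> * (1/2) powr (b - ?n) / (1 - q)"
 have "(\<integral>\<^sup>+y. ennreal (norm (x - y) powr (b - ?n)) * indicator (ball x \<rho>) y \<partial>lborel)
   \<le> ennreal (C * \<rho> powr b)" if \<rho>: "0 < \<rho>" for \<rho> and x :: "real^'n"
 proof -
  let ?g = "\<lambda>j y. ennreal ((\<rho> * (1/2) ^ j * (1/2)) powr (b - ?n)) * indicator (ball x (\<rho> * (1/2) ^ j)) y"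
  have le: "ennreal (norm (x - y) powr (b - ?n)) * indicator (ball x \<rho>) y \<le> (\<Sum>j. ?g j y)" for y
  proof (cases "y \<in> ball x \<rho> \<and> y \<noteq> x")
   case True
   let ?P = "\<lambda>j. \<rho> * (1/2) ^ j * (1/2) \<le> norm (x - y)"
   have "(\<lambda>j. \<rho> * (1/2) ^ j * (1/2)) \<longlonglongrightarrow> \<rho> * 0 * (1/2)"
    by (intro tendsto_intros LIMSEQ_power_zero) simp
   moreover have "0 < norm (x - y)" using True by auto
   ultimately have "\<exists>j. ?P j"
    using order_tendstoD(2)[of _ "\<rho> * 0 * (1/2)" sequentially "norm (x - y)"]
    by (metis (mono_tags, lifting) eventually_happens' less_imp_le mult_zero_left mult_zero_right sequentially_bot)
   then have P: "?P (LEAST j. ?P j)" and L: "\<And>j. j < (LEAST j. ?P j) ==> \<not> ?P j"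
    by (rule LeastI_ex) (rule not_less_Least)
   define j where "j = (LEAST j. ?P j)"
   have "norm (x - y) < \<rho> * (1/2) ^ j"
   proof (cases j)
    case 0
    then show ?thesis using True by (simp add: dist_norm)
   next
    case (Suc i)
    then show ?thesis using L[of i] by (simp add: j_def)
   qed
   then have "ennreal (norm (x - y) powr (b - ?n)) * indicator (ball x \<rho>) y \<le> ?g j y"
    using True P \<rho> b unfolding j_def[symmetric]
    by (auto intro!: ennreal_leI powr_mono2' simp: dist_norm)
   also have "\<dots> = (\<Sum>j\<in>{j}. ?g j y)" by (simp only: sum.insert finite.emptyI empty_iff not_False_eq_True sum.empty add_0_right)
   also have "\<dots> \<le> (\<Sum>j. ?g j y)" by (rule sum_le_suminf) auto
   finally show ?thesis .
  next
   case False
   then have "ennreal (norm (x - y) powr (b - ?n)) * indicator (ball x \<rho>) y = 0" by auto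
   then show ?thesis by (simp only: zero_le)
  qed
  have "(\<integral>\<^sup>+y. ennreal (norm (x - y) powr (b - ?n)) * indicator (ball x \<rho>) y \<partial>lborel)
    \<le> (\<integral>\<^sup>+y. (\<Sum>j. ?g j y) \<partial>lborel)"
   by (rule nn_integral_mono) (rule le)
  also have "\<dots> = (\<Sum>j. \<integral>\<^sup>+y. ?g j y \<partial>lborel)"
  proof (rule nn_integral_suminf)
   show "?g j \<in> borel_measurable lborel" for j
    by (rule borel_measurable_times_ennreal) (simp_all add: borel_measurable_indicator)
  qed
  also have "\<dots> = (\<Sum>j. ennreal (\<omega> * (1/2) powr (b - ?n) * \<rho> powr b * q ^ j))"
  proof (intro suminf_cong)
   fix j
   have "(\<integral>\<^sup>+y. ?g j y \<partial>lborel)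
     = ennreal ((\<rho> * (1/2) ^ j * (1/2)) powr (b - ?n)) * ennreal (\<omega> * (\<rho> * (1/2) ^ j) ^ CARD('n))"
    using \<rho> by (subst nn_integral_cmult_indicator) (auto simp: emeasure_ball \<omega>_def)
   also have "\<dots> = ennreal ((\<rho> * (1/2) ^ j * (1/2)) powr (b - ?n) * (\<omega> * (\<rho> * (1/2) ^ j) ^ CARD('n)))"
    using \<rho> \<omega> by (subst ennreal_mult) auto
   also have "(\<rho> * (1/2) ^ j * (1/2)) powr (b - ?n) * (\<omega> * (\<rho> * (1/2) ^ j) ^ CARD('n))
     = \<omega> * (1/2) powr (b - ?n) * (\<rho> * (1/2) ^ j) powr b"
    using \<rho> by (intro dyadic_power_identity) simp_all
   also have "(\<rho> * (1/2) ^ j) powr b = \<rho> powr b * q ^ j"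
    using \<rho> powr_pow_swap[of "1/2" j b] by (simp add: powr_mult q_def)
   finally show "(\<integral>\<^sup>+y. ?g j y \<partial>lborel) = ennreal (\<omega> * (1/2) powr (b - ?n) * \<rho> powr b * q ^ j)"
    by (simp add: mult_ac)
  qed
  also have "\<dots> = ennreal (C * \<rho> powr b)"
   using \<omega> q by (subst suminf_geometric_ennreal) (simp_all add: C_def)
  finally show ?thesis .
 qed
 moreover have "C > 0" using \<omega> q by (simp add: C_def)
 ultimately show ?thesis by blast
qed

lemma nn_integral_far_powr:
 assumes b: "0 < b"
 shows "\<exists>C>0. \<forall>(x::real^'n::finite) \<rho>. 0 < \<rho> -->
  (\<integral>\<^sup>+y. ennreal (norm (x - y) powr (- b - real CARD('n))) * indicator (- ball x \<rho>) y \<partial>lborel)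
   \<le> ennreal (C * \<rho> powr (- b))"
proof -
 let ?n = "real CARD('n)"
 define \<omega> where "\<omega> = unit_ball_vol ?n"
 have \<omega>: "\<omega> > 0" by (simp add: \<omega>_def)
 define q where "q = 2 powr (- b)"
 have q: "0 < q" "q < 1" using b powr_less_mono[of "- b" 0 2] by (auto simp: q_def)
 define C where "C = \<omega> * 2 powr ?n / (1 - q)"
 have "(\<integral>\<^sup>+y. ennreal (norm (x - y) powr (- b - ?n)) * indicator (- ball x \<rho>) y \<partial>lborel)
   \<le> ennreal (C * \<rho> powr (- b))" if \<rho>: "0 < \<rho>" for \<rho> and x :: "real^'n"
 proof -
  let ?g = "\<lambda>j y. ennreal ((\<rho> * 2 ^ j) powr (- b - ?n)) * indicator (ball x (\<rho> * 2 ^ j * 2)) y"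
  have le: "ennreal (norm (x - y) powr (- b - ?n)) * indicator (- ball x \<rho>) y \<le> (\<Sum>j. ?g j y)" for y
  proof (cases "y \<in> - ball x \<rho>")
   case True
   let ?P = "\<lambda>j. norm (x - y) < \<rho> * 2 ^ j * 2"
   obtain j0 where "norm (x - y) / \<rho> < 2 ^ j0"
    using real_arch_pow[of 2 "norm (x - y) / \<rho>"] by auto
   then have "norm (x - y) < \<rho> * 2 ^ j0" using \<rho> by (simp add: field_simps)
   also have "\<dots> \<le> \<rho> * 2 ^ j0 * 2" using \<rho> by simp
   finally have "?P j0" .
   then have P: "?P (LEAST j. ?P j)" and L: "\<And>j. j < (LEAST j. ?P j) ==> \<not> ?P j"
    by (rule LeastI) (rule not_less_Least)
   define j where "j = (LEAST j. ?P j)"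
   have "\<rho> * 2 ^ j \<le> norm (x - y)"
   proof (cases j)
    case 0
    then show ?thesis using True by (simp add: dist_norm)
   next
    case (Suc i)
    then show ?thesis using L[of i] by (simp add: j_def)
   qed
   then have "ennreal (norm (x - y) powr (- b - ?n)) * indicator (- ball x \<rho>) y \<le> ?g j y"
    using True P \<rho> b unfolding j_def[symmetric]
    by (auto intro!: ennreal_leI powr_mono2' simp: dist_norm)
   also have "\<dots> = (\<Sum>j\<in>{j}. ?g j y)" by (simp only: sum.insert finite.emptyI empty_iff not_False_eq_True sum.empty add_0_right)
   also have "\<dots> \<le> (\<Sum>j. ?g j y)" by (rule sum_le_suminf) auto
   finally show ?thesis .
  next
   case False
   then have "ennreal (norm (x - y) powr (- b - ?n)) * indicator (- ball x \<rho>) y = 0" by simp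
   then show ?thesis by (simp only: zero_le)
  qed
  have "(\<integral>\<^sup>+y. ennreal (norm (x - y) powr (- b - ?n)) * indicator (- ball x \<rho>) y \<partial>lborel)
    \<le> (\<integral>\<^sup>+y. (\<Sum>j. ?g j y) \<partial>lborel)"
   by (rule nn_integral_mono) (rule le)
  also have "\<dots> = (\<Sum>j. \<integral>\<^sup>+y. ?g j y \<partial>lborel)"
  proof (rule nn_integral_suminf)
   show "?g j \<in> borel_measurable lborel" for j
    by (rule borel_measurable_times_ennreal) (simp_all add: borel_measurable_indicator)
  qed
  also have "\<dots> = (\<Sum>j. ennreal (\<omega> * 2 powr ?n * \<rho> powr (- b) * q ^ j))"
  proof (intro suminf_cong)
   fix j
   have "(\<integral>\<^sup>+y. ?g j y \<partial>lborel)
     = ennreal ((\<rho> * 2 ^ j) powr (- b - ?n)) * ennreal (\<omega> * (\<rho> * 2 ^ j * 2) ^ CARD('n))"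
    using \<rho> by (subst nn_integral_cmult_indicator) (auto simp: emeasure_ball \<omega>_def)
   also have "\<dots> = ennreal ((\<rho> * 2 ^ j) powr (- b - ?n) * (\<omega> * (\<rho> * 2 ^ j * 2) ^ CARD('n)))"
    using \<rho> \<omega> by (subst ennreal_mult) auto
   also have "(\<rho> * 2 ^ j) powr (- b - ?n) * (\<omega> * (\<rho> * 2 ^ j * 2) ^ CARD('n))
     = (\<rho> * 2 ^ j * 1) powr (- b - ?n) * (\<omega> * 2 ^ CARD('n) * (\<rho> * 2 ^ j) ^ CARD('n))"
    by (simp only: power_mult_distrib mult_1_right) (simp only: mult_ac)
   also have "\<dots> = \<omega> * 2 ^ CARD('n) * 1 powr (- b - ?n) * (\<rho> * 2 ^ j) powr (- b)"
    using \<rho> by (intro dyadic_power_identity) simp_all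
   also have "(2::real) ^ CARD('n) = 2 powr ?n" by (simp add: powr_realpow)
   also have "(\<rho> * 2 ^ j) powr (- b) = \<rho> powr (- b) * q ^ j"
    using \<rho> powr_pow_swap[of 2 j "- b"] by (simp add: powr_mult q_def)
   finally show "(\<integral>\<^sup>+y. ?g j y \<partial>lborel) = ennreal (\<omega> * 2 powr ?n * \<rho> powr (- b) * q ^ j)"
    by (simp add: mult_ac)
  qed
  also have "\<dots> = ennreal (C * \<rho> powr (- b))"
   using \<omega> q by (subst suminf_geometric_ennreal) (simp_all add: C_def)
  finally show ?thesis .
 qed
 moreover have "C > 0" using \<omega> q by (simp add: C_def)
 ultimately show ?thesis by blast
qed

lemma nn_integral_lborel_affine:
 fixes g :: "'a::euclidean_space => ennreal"
 assumes c: "c \<noteq> 0" and g: "g \<in> borel_measurable borel"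
 shows "(\<integral>\<^sup>+y. g y \<partial>lborel) = ennreal (\<bar>c\<bar> ^ DIM('a)) * (\<integral>\<^sup>+y. g (t + c *\<^sub>R y) \<partial>lborel)"
proof -
 let ?M = "distr lborel borel (\<lambda>x. t + c *\<^sub>R x) :: 'a measure"
 have "(\<integral>\<^sup>+y. g y \<partial>lborel) = (\<integral>\<^sup>+y. g y \<partial>density ?M (\<lambda>_. ennreal (\<bar>c\<bar> ^ DIM('a))))"
  by (rule arg_cong[where f = "\<lambda>M. nn_integral M g"]) (rule lborel_affine[OF c])
 also have "\<dots> = (\<integral>\<^sup>+y. ennreal (\<bar>c\<bar> ^ DIM('a)) * g y \<partial>?M)"
  by (rule nn_integral_density) (simp_all add: g)
 also have "\<dots> = ennreal (\<bar>c\<bar> ^ DIM('a)) * (\<integral>\<^sup>+y. g y \<partial>?M)"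
  by (rule nn_integral_cmult) (simp add: g)
 also have "(\<integral>\<^sup>+y. g y \<partial>?M) = (\<integral>\<^sup>+y. g (t + c *\<^sub>R y) \<partial>lborel)"
  by (rule nn_integral_distr) (simp_all add: g)
 finally show ?thesis .
qed

lemma integral_lborel_affine:
 fixes g :: "'a::euclidean_space => real"
 assumes c: "c \<noteq> 0" and g: "g \<in> borel_measurable borel"
 shows "(LINT y|lborel. g y) = \<bar>c\<bar> ^ DIM('a) * (LINT y|lborel. g (t + c *\<^sub>R y))"
proof -
 let ?M = "distr lborel borel (\<lambda>x. t + c *\<^sub>R x) :: 'a measure"
 have "(LINT y|lborel. g y) = (LINT y|density ?M (\<lambda>_. ennreal (\<bar>c\<bar> ^ DIM('a))). g y)"
  by (rule arg_cong[where f = "\<lambda>M. integral\<^sup>L M g"]) (rule lborel_affine[OF c])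
 also have "\<dots> = (LINT y|?M. \<bar>c\<bar> ^ DIM('a) *\<^sub>R g y)"
  by (rule integral_density) (simp_all add: g)
 also have "\<dots> = \<bar>c\<bar> ^ DIM('a) * (LINT y|?M. g y)"
  by simp
 also have "(LINT y|?M. g y) = (LINT y|lborel. g (t + c *\<^sub>R y))"
  by (rule integral_distr) (simp_all add: g)
 finally show ?thesis .
qed

section \<open>Increments of kernels\<close>

lemma powr_comparable:
 fixes s :: real
 assumes "0 < z" "z / 2 \<le> w" "w \<le> 2 * z"
 shows "w powr s \<le> 2 powr \<bar>s\<bar> * z powr s"
proof (cases "0 \<le> s")
 case True
 have "w powr s \<le> (2 * z) powr s" using assms True by (intro powr_mono2) auto
 then show ?thesis using True assms by (simp add: powr_mult)
next
 case False
 have "w powr s \<le> (z / 2) powr s" using assms False by (intro powr_mono2') auto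
 also have "\<dots> = 2 powr (- s) * z powr s"
  using assms by (simp add: powr_divide powr_minus field_simps)
 finally show ?thesis using False by simp
qed

lemma mvt_segment:
 assumes "\<And>w. w \<in> closed_segment z (z + h) ==> GDERIV G w :> D w"
 shows "\<exists>w\<in>closed_segment z (z + h). G (z + h) - G z = h \<bullet> D w"
proof -
 have seg: "z + t *\<^sub>R h \<in> closed_segment z (z + h)" if "0 \<le> t" "t \<le> 1" for t
  using that unfolding closed_segment_def by (auto intro!: exI[of _ t] simp: algebra_simps)
 have "\<exists>t\<in>{0..1}. G (z + 1 *\<^sub>R h) - G (z + 0 *\<^sub>R h) = ((1 - 0) *\<^sub>R h) \<bullet> D (z + t *\<^sub>R h)"
 proof (rule mvt_very_simple[of 0 1 "\<lambda>t. G (z + t *\<^sub>R h)" "\<lambda>t s. (s *\<^sub>R h) \<bullet> D (z + t *\<^sub>R h)"])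
  fix t :: real assume "0 \<le> t" "t \<le> 1"
  from assms[OF seg[OF this]] have d: "(G has_derivative (\<lambda>h'. h' \<bullet> D (z + t *\<^sub>R h))) (at (z + t *\<^sub>R h))"
   by (simp add: gderiv_def)
  have "((\<lambda>t. z + t *\<^sub>R h) has_derivative (\<lambda>s. s *\<^sub>R h)) (at t within {0..1})"
   by (auto intro!: derivative_eq_intros)
  from has_derivative_compose[OF this d]
  show "((\<lambda>t. G (z + t *\<^sub>R h)) has_derivative (\<lambda>s. (s *\<^sub>R h) \<bullet> D (z + t *\<^sub>R h))) (at t within {0..1})" .
 qed simp
 then show ?thesis using seg by auto
qed

lemma segment_norm_bounds:
 fixes z h :: "'a::real_normed_vector"
 assumes "2 * norm h < norm z" "w \<in> closed_segment z (z + h)"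
 shows "norm (w - z) \<le> norm h" "norm z / 2 \<le> norm w" "norm w \<le> 2 * norm z" "w \<noteq> 0"
proof -
 obtain t where t: "0 \<le> t" "t \<le> 1" "w = z + t *\<^sub>R h"
  using assms(2) unfolding closed_segment_def by (auto simp: algebra_simps)
 have "norm (t *\<^sub>R h) \<le> norm h" using t by (simp add: mult_left_le_one_le)
 then show 1: "norm (w - z) \<le> norm h" using t by simp
 show "norm z / 2 \<le> norm w" using 1 assms(1) norm_triangle_ineq2[of z "z - w"]
  by (simp add: norm_minus_commute)
 then show "w \<noteq> 0" using assms(1) by auto
 show "norm w \<le> 2 * norm z"
  using 1 assms(1) norm_triangle_ineq[of z "w - z"] norm_ge_zero[of h] by (simp del: norm_ge_zero)
qed

lemma kernel_gradient_bound:
 fixes G :: "real ^ 'n::finite => real"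
 assumes "kernel_class 1 e G"
 shows "\<exists>C\<ge>0. \<forall>z. z \<noteq> 0 --> norm (gradient G z) \<le> C * norm z powr (e - 1)"
proof -
 have "\<forall>i. \<exists>C. \<forall>x. x \<noteq> 0 --> \<bar>partial i G x\<bar> \<le> C * norm x powr (e - 1)"
  using assms kernel_class_bound by simp
 then obtain C where C: "\<And>i x. x \<noteq> 0 ==> \<bar>partial i G x\<bar> \<le> C i * norm x powr (e - 1)"
  by metis
 have "norm (gradient G z) \<le> (\<Sum>i\<in>UNIV. \<bar>C i\<bar>) * norm z powr (e - 1)" if "z \<noteq> 0" for z
 proof -
  have "norm (gradient G z) \<le> (\<Sum>i\<in>UNIV. \<bar>gradient G z $ i\<bar>)" by (rule norm_le_l1_cart)
  also have "\<dots> \<le> (\<Sum>i\<in>UNIV. \<bar>C i\<bar> * norm z powr (e - 1))"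
   using C[OF that] by (intro sum_mono) (auto intro: le_abs_mult)
  finally show ?thesis by (simp add: sum_distrib_right)
 qed
 then show ?thesis by (intro exI[of _ "\<Sum>i\<in>UNIV. \<bar>C i\<bar>"]) (auto intro: sum_nonneg)
qed

lemma kernel_GDERIV:
 fixes G :: "real ^ 'n::finite => real"
 assumes "kernel_class (Suc k) e G" "z \<noteq> 0"
 shows "GDERIV G z :> gradient G z"
 using assms by (intro gradient_GDERIV) simp

lemma kernel_increment_far:
 fixes G :: "real ^ 'n::finite => real"
 assumes "kernel_class 1 e G"
 shows "\<exists>C\<ge>0. \<forall>z h. 2 * norm h < norm z --> (\<forall>w\<in>closed_segment z (z + h).
  \<bar>G w - G z\<bar> \<le> C * norm h * norm z powr (e - 1))"
proof -
 obtain C where C: "C \<ge> 0" "\<And>z. z \<noteq> 0 ==> norm (gradient G z) \<le> C * norm z powr (e - 1)"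
  using kernel_gradient_bound[OF assms] by blast
 let ?K = "C * 2 powr \<bar>e - 1\<bar>"
 have "\<bar>G w - G z\<bar> \<le> ?K * norm h * norm z powr (e - 1)"
  if h: "2 * norm h < norm z" and w: "w \<in> closed_segment z (z + h)" for z h w
 proof -
  have h': "2 * norm (w - z) < norm z" using segment_norm_bounds(1)[OF h w] h by simp
  have "GDERIV G v :> gradient G v" if "v \<in> closed_segment z (z + (w - z))" for v
   using segment_norm_bounds(4)[OF h' that] assms by (intro kernel_GDERIV[of 0 e]) simp_all
  from mvt_segment[OF this] obtain v where v: "v \<in> closed_segment z (z + (w - z))"
   "G (z + (w - z)) - G z = (w - z) \<bullet> gradient G v" by blast
  note vb = segment_norm_bounds[OF h' v(1)]
  have "\<bar>G w - G z\<bar> \<le> norm (w - z) * norm (gradient G v)"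
   using v(2) Cauchy_Schwarz_ineq2[of "w - z" "gradient G v"] by simp
  also have "\<dots> \<le> norm h * (C * norm v powr (e - 1))"
   using segment_norm_bounds(1)[OF h w] C vb(4) by (intro mult_mono) auto
  also have "\<dots> \<le> norm h * (C * (2 powr \<bar>e - 1\<bar> * norm z powr (e - 1)))"
   using vb C h by (intro mult_left_mono powr_comparable) (auto intro: le_less_trans[of 0])
  finally show ?thesis by (simp add: mult_ac)
 qed
 then show ?thesis using C(1) by (intro exI[of _ ?K]) auto
qed

lemma powr_split_le:
 fixes w h \<theta> :: real
 assumes "0 < w" "w \<le> 3 * h" "0 \<le> \<theta>"
 shows "w powr e \<le> 3 powr \<theta> * h powr \<theta> * w powr (e - \<theta>)"
proof -
 have "w powr e = w powr \<theta> * w powr (e - \<theta>)" using assms by (simp add: powr_add[symmetric])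
 also have "\<dots> \<le> (3 * h) powr \<theta> * w powr (e - \<theta>)"
  using assms by (intro mult_right_mono powr_mono2) auto
 finally show ?thesis using assms by (simp add: powr_mult)
qed

text \<open>Where \<open>h\<close> is small compared with \<open>z\<close> this is the mean value theorem; otherwise both values are estimated
 separately.  Only a root of \<open>norm h\<close> is gained, which keeps the singularity on the right-hand side weak.\<close>

lemma kernel_increment:
 fixes G :: "real ^ 'n::finite => real"
 assumes "kernel_class 1 e G"
 shows "\<exists>C\<ge>0. \<forall>z h. z \<noteq> 0 --> z + h \<noteq> 0 --> \<bar>G (z + h) - G z\<bar>
  \<le> C * norm h powr (1/2) * (norm z powr (e - 1/2) + norm (z + h) powr (e - 1/2))"
proof -
 obtain A where A: "\<And>z. z \<noteq> 0 ==> \<bar>G z\<bar> \<le> A * norm z powr e"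
  using kernel_class_bound[OF assms] by blast
 have A': "\<bar>G z\<bar> \<le> \<bar>A\<bar> * norm z powr e" if "z \<noteq> 0" for z
  using A[OF that] by (rule le_abs_mult) simp
 obtain B where B: "B \<ge> 0" "\<And>z h w. 2 * norm h < norm z ==> w \<in> closed_segment z (z + h) ==>
  \<bar>G w - G z\<bar> \<le> B * norm h * norm z powr (e - 1)"
  using kernel_increment_far[OF assms] by blast
 let ?C = "\<bar>A\<bar> * 3 powr (1/2) + B"
 have "\<bar>G (z + h) - G z\<bar> \<le> ?C * norm h powr (1/2) * (norm z powr (e - 1/2) + norm (z + h) powr (e - 1/2))"
  if z: "z \<noteq> 0" "z + h \<noteq> 0" for z h
 proof (cases "2 * norm h < norm z")
  case True
  then have h: "\<bar>G (z + h) - G z\<bar> \<le> B * norm h * norm z powr (e - 1)" by (intro B(2)) auto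
  have "norm h * norm z powr (e - 1) \<le> norm h powr (1/2) * norm z powr (e - 1/2)"
  proof (cases "h = 0")
   case False
   have "norm h * norm z powr (e - 1) = norm h powr (1/2) * (norm h powr (1/2) * norm z powr (e - 1))"
    by (simp add: powr_half_sqrt mult.assoc[symmetric])
   also have "\<dots> \<le> norm h powr (1/2) * (norm z powr (1/2) * norm z powr (e - 1))"
    using True norm_ge_zero[of h] by (intro mult_left_mono mult_right_mono powr_mono2) (linarith | simp)+
   finally show ?thesis using z by (simp add: powr_add[symmetric])
  qed simp
  from mult_left_mono[OF this B(1)] h
  have "\<bar>G (z + h) - G z\<bar> \<le> B * (norm h powr (1/2) * norm z powr (e - 1/2))"
   by (simp add: mult.assoc)
  also have "\<dots> \<le> ?C * (norm h powr (1/2) * (norm z powr (e - 1/2) + norm (z + h) powr (e - 1/2)))"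
   using B(1) by (intro mult_mono mult_left_mono) auto
  finally show ?thesis by (simp add: mult.assoc)
 next
  case False
  have w: "norm (z + h) \<le> 3 * norm h" "norm z \<le> 3 * norm h"
   using False norm_triangle_ineq[of z h] norm_ge_zero[of h] by linarith+
  have "\<bar>G (z + h) - G z\<bar> \<le> \<bar>A\<bar> * norm (z + h) powr e + \<bar>A\<bar> * norm z powr e"
   using A'[OF z(1)] A'[OF z(2)] by linarith
  also have "\<dots> \<le> \<bar>A\<bar> * (3 powr (1/2) * norm h powr (1/2) * norm (z + h) powr (e - 1/2))
    + \<bar>A\<bar> * (3 powr (1/2) * norm h powr (1/2) * norm z powr (e - 1/2))"
   using z w by (intro add_mono mult_left_mono powr_split_le) auto
  also have "\<dots> = (\<bar>A\<bar> * 3 powr (1/2)) * (norm h powr (1/2) * (norm z powr (e - 1/2) + norm (z + h) powr (e - 1/2)))"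
   by (simp add: algebra_simps)
  also have "\<dots> \<le> ?C * (norm h powr (1/2) * (norm z powr (e - 1/2) + norm (z + h) powr (e - 1/2)))"
   using B(1) by (intro mult_right_mono) auto
  finally show ?thesis by (simp add: mult.assoc)
 qed
 then show ?thesis using B(1) by (intro exI[of _ ?C]) auto
qed

text \<open>The exponent three halves, strictly between one and two, leaves a remainder that is
 \<open>o(norm h)\<close> while its singularity is still weaker than that of the second derivatives.\<close>

lemma kernel_increment_second:
 fixes G :: "real ^ 'n::finite => real"
 assumes "kernel_class 2 e G"
 shows "\<exists>C\<ge>0. \<forall>z h. z \<noteq> 0 --> z + h \<noteq> 0 --> \<bar>G (z + h) - G z - h \<bullet> gradient G z\<bar>
  \<le> C * norm h powr (3/2) * (norm z powr (e - 3/2) + norm (z + h) powr (e - 3/2))"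
proof -
 have k2: "kernel_class (Suc (Suc 0)) e G" using assms by (simp only: numeral_2_eq_2)
 have k1: "kernel_class 1 e G" using kernel_class_antimono[OF _ assms, of 1] by simp
 obtain A where A: "\<And>z. z \<noteq> 0 ==> \<bar>G z\<bar> \<le> A * norm z powr e"
  using kernel_class_bound[OF assms] by blast
 have A': "\<bar>G z\<bar> \<le> \<bar>A\<bar> * norm z powr e" if "z \<noteq> 0" for z
  using A[OF that] by (rule le_abs_mult) simp
 obtain D where D: "D \<ge> 0" "\<And>z. z \<noteq> 0 ==> norm (gradient G z) \<le> D * norm z powr (e - 1)"
  using kernel_gradient_bound[OF k1] by blast
 have "\<forall>i. \<exists>C\<ge>0. \<forall>z h. 2 * norm h < norm z --> (\<forall>w\<in>closed_segment z (z + h).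
  \<bar>partial i G w - partial i G z\<bar> \<le> C * norm h * norm z powr (e - 1 - 1))"
  using k2 by (intro allI kernel_increment_far) simp
 then obtain B where B: "\<And>i. B i \<ge> 0" "\<And>i z h w. 2 * norm h < norm z ==> w \<in> closed_segment z (z + h) ==>
  \<bar>partial i G w - partial i G z\<bar> \<le> B i * norm h * norm z powr (e - 1 - 1)"
  by metis
 let ?B = "\<Sum>i\<in>UNIV. B i"
 let ?C = "\<bar>A\<bar> * 3 powr (3/2) + (\<bar>A\<bar> * 3 powr (3/2) + D * 3 powr (1/2)) + ?B"
 have B0: "?B \<ge> 0" using B(1) by (intro sum_nonneg) auto
 have "\<bar>G (z + h) - G z - h \<bullet> gradient G z\<bar>
   \<le> ?C * norm h powr (3/2) * (norm z powr (e - 3/2) + norm (z + h) powr (e - 3/2))"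
  if z: "z \<noteq> 0" "z + h \<noteq> 0" for z h
 proof (cases "2 * norm h < norm z")
  case True
  have "GDERIV G v :> gradient G v" if "v \<in> closed_segment z (z + h)" for v
   using segment_norm_bounds(4)[OF True that] k2 by (intro kernel_GDERIV)
  from mvt_segment[OF this] obtain v where v: "v \<in> closed_segment z (z + h)"
   "G (z + h) - G z = h \<bullet> gradient G v" by blast
  have "\<bar>G (z + h) - G z - h \<bullet> gradient G z\<bar> = \<bar>h \<bullet> (gradient G v - gradient G z)\<bar>"
   using v(2) by (simp add: inner_diff_right)
  also have "\<dots> \<le> norm h * norm (gradient G v - gradient G z)"
   by (rule Cauchy_Schwarz_ineq2)
  also have "\<dots> \<le> norm h * (\<Sum>i\<in>UNIV. \<bar>(gradient G v - gradient G z) $ i\<bar>)"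
   by (intro mult_left_mono norm_le_l1_cart) simp
  also have "\<dots> \<le> norm h * (\<Sum>i\<in>UNIV. B i * norm h * norm z powr (e - 2))"
   using B(2)[OF True v(1)] by (intro mult_left_mono sum_mono) auto
  also have "\<dots> = ?B * (norm h powr 2 * norm z powr (e - 2))"
   by (simp add: sum_distrib_right[symmetric] power2_eq_square mult_ac)
  also have "\<dots> \<le> ?B * (norm h powr (3/2) * norm z powr (e - 3/2))"
  proof (intro mult_left_mono B0)
   have "norm h powr 2 * norm z powr (e - 2) = norm h powr (3/2) * (norm h powr (1/2) * norm z powr (e - 2))"
    by (simp add: powr_add[symmetric] mult.assoc[symmetric])
   also have "\<dots> \<le> norm h powr (3/2) * (norm z powr (1/2) * norm z powr (e - 2))"
    using True norm_ge_zero[of h] by (intro mult_left_mono mult_right_mono powr_mono2) (linarith | simp)+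
   finally show "norm h powr 2 * norm z powr (e - 2) \<le> norm h powr (3/2) * norm z powr (e - 3/2)"
    using z by (simp add: powr_add[symmetric])
  qed
  also have "\<dots> \<le> ?C * (norm h powr (3/2) * (norm z powr (e - 3/2) + norm (z + h) powr (e - 3/2)))"
   using B0 mult_nonneg_nonneg[OF D(1), of "3 powr (1/2)"]
   by (intro mult_mono[of ?B] mult_left_mono) auto
  finally show ?thesis by (simp add: mult.assoc)
 next
  case False
  have w: "norm (z + h) \<le> 3 * norm h" "norm z \<le> 3 * norm h"
   using False norm_triangle_ineq[of z h] norm_ge_zero[of h] by linarith+
  have "\<bar>h \<bullet> gradient G z\<bar> \<le> norm h * norm (gradient G z)" by (rule Cauchy_Schwarz_ineq2)
  also have "\<dots> \<le> norm h * (D * norm z powr (e - 1))"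
   using D z by (intro mult_left_mono) auto
  also have "\<dots> \<le> norm h * (D * (3 powr (1/2) * norm h powr (1/2) * norm z powr (e - 1 - 1/2)))"
   using D z w by (intro mult_left_mono powr_split_le) auto
  also have "\<dots> = D * 3 powr (1/2) * ((norm h powr 1 * norm h powr (1/2)) * norm z powr (e - 3/2))"
   by (simp add: mult_ac)
  also have "norm h powr 1 * norm h powr (1/2) = norm h powr (3/2)"
   by (simp only: powr_add[symmetric]) simp
  finally have 1: "\<bar>h \<bullet> gradient G z\<bar> \<le> D * 3 powr (1/2) * (norm h powr (3/2) * norm z powr (e - 3/2))" .
  have 2: "\<bar>G z\<bar> \<le> \<bar>A\<bar> * (3 powr (3/2) * norm h powr (3/2) * norm z powr (e - 3/2))"
   using z w by (intro order_trans[OF A'] mult_left_mono powr_split_le) auto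
  have 3: "\<bar>G (z + h)\<bar> \<le> \<bar>A\<bar> * (3 powr (3/2) * norm h powr (3/2) * norm (z + h) powr (e - 3/2))"
   using z w by (intro order_trans[OF A'] mult_left_mono powr_split_le) auto
  let ?H = "norm h powr (3/2)" and ?P = "norm z powr (e - 3/2)" and ?Q = "norm (z + h) powr (e - 3/2)"
  have "\<bar>G (z + h) - G z - h \<bullet> gradient G z\<bar> \<le> (\<bar>A\<bar> * 3 powr (3/2) + D * 3 powr (1/2)) * (?H * ?P)
    + (\<bar>A\<bar> * 3 powr (3/2)) * (?H * ?Q)"
  proof -
   have "\<bar>G (z + h) - G z - h \<bullet> gradient G z\<bar> \<le> \<bar>A\<bar> * (3 powr (3/2) * ?H * ?Q)
     + \<bar>A\<bar> * (3 powr (3/2) * ?H * ?P) + D * 3 powr (1/2) * (?H * ?P)"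
    using 1 2 3 by linarith
   then show ?thesis by (simp only: distrib_right mult.assoc)
  qed
  also have "\<dots> \<le> ?C * (?H * ?P) + ?C * (?H * ?Q)"
  proof -
   have "0 \<le> D * 3 powr (1/2)" "0 \<le> \<bar>A\<bar> * 3 powr (3/2)" using D(1) by auto
   then have c: "\<bar>A\<bar> * 3 powr (3/2) + D * 3 powr (1/2) \<le> ?C" "\<bar>A\<bar> * 3 powr (3/2) \<le> ?C"
    using B0 by linarith+
   show ?thesis by (rule add_mono[OF mult_right_mono[OF c(1)] mult_right_mono[OF c(2)]]) simp_all
  qed
  finally show ?thesis by (simp only: distrib_left mult.assoc)
 qed
 then show ?thesis using B0 D(1) by (intro exI[of _ ?C]) auto
qed

section \<open>Potentials\<close>

definition nnpot :: "real => (real ^ 'n::finite => real) => real ^ 'n => ennreal" where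
 "nnpot d f x = (\<integral>\<^sup>+y. ennreal (norm (x - y) powr d * \<bar>f y\<bar>) \<partial>lborel)"

definition pot :: "(real ^ 'n::finite => real) => (real ^ 'n => real) => real ^ 'n => real" where
 "pot G f x = (LINT y|lborel. G (x - y) * f y)"

text \<open>Pointwise finiteness of the potential of \<open>\<bar>f\<bar>\<close> gives no control of its difference quotients; the local
 boundedness does, since increments of kernels are bounded by kernels at both end points.\<close>

definition tame :: "real => (real ^ 'n::finite => real) => (real ^ 'n) set => bool" where
 "tame d f S \<longleftrightarrow> f \<in> borel_measurable borel \<and>
   (\<forall>x\<in>S. \<exists>e>0. \<exists>K\<ge>0. \<forall>y\<in>ball x e. nnpot d f y \<le> ennreal K)"

lemma tameD_measurable: "tame d f S ==> f \<in> borel_measurable borel"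
 by (simp add: tame_def)

lemma tameE:
 assumes "tame d f S" "x \<in> S"
 obtains e K where "e > 0" "K \<ge> 0" "\<And>y. y \<in> ball x e ==> nnpot d f y \<le> ennreal K"
 using assms unfolding tame_def by blast

lemma tame_finite:
 assumes "tame d f S" "x \<in> S"
 shows "nnpot d f x < \<infinity>"
proof -
 obtain e K where e: "e > 0" "\<And>y. y \<in> ball x e ==> nnpot d f y \<le> ennreal K"
  using tameE[OF assms] by blast
 have "nnpot d f x \<le> ennreal K" using e(1) by (intro e(2)) simp
 also have "\<dots> < \<infinity>" by simp
 finally show ?thesis .
qed

lemma kernel_class_measurable: "kernel_class k d G ==> G \<in> borel_measurable borel"
 by (rule borel_measurable_continuous_countable_exceptions[of "{0}"])
  (auto dest: kernel_class_cont)

lemma measurable_reflect: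
 fixes G :: "real ^ 'n::finite => real"
 assumes "G \<in> borel_measurable borel"
 shows "(\<lambda>y. G (x - y)) \<in> borel_measurable borel"
 using measurable_compose[OF _ assms, of "\<lambda>y. x - y" borel] by simp

lemma measurable_pot_integrand:
 fixes G f :: "real ^ 'n::finite => real"
 assumes "G \<in> borel_measurable borel" "f \<in> borel_measurable borel"
 shows "(\<lambda>y. G (x - y) * f y) \<in> borel_measurable borel"
 by (rule borel_measurable_times[OF measurable_reflect[OF assms(1)] assms(2)])

lemma measurable_norm_powr: "(\<lambda>z::real^'n::finite. norm z powr d) \<in> borel_measurable borel"
 by (rule kernel_class_measurable[OF kernel_class_norm_powr[of 0 d]])

lemma measurable_nnpot_integrand:
 fixes f :: "real ^ 'n::finite => real"
 assumes "f \<in> borel_measurable borel"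
 shows "(\<lambda>y. ennreal (norm (x - y) powr d * \<bar>f y\<bar>)) \<in> borel_measurable borel"
 using measurable_pot_integrand[OF measurable_norm_powr[of d] borel_measurable_abs[OF assms], of x]
 by simp

lemma AE_neq: "AE y in lborel. y \<noteq> (x::'a::euclidean_space)"
 by (rule AE_lborel_singleton)

lemma nn_integral_le_nnpot:
 fixes f g :: "real ^ 'n::finite => real"
 assumes f: "f \<in> borel_measurable borel" and "0 \<le> C"
  and le: "\<And>y. y \<noteq> x ==> \<bar>g y\<bar> \<le> C * norm (x - y) powr d * \<bar>f y\<bar>"
 shows "(\<integral>\<^sup>+y. ennreal \<bar>g y\<bar> \<partial>lborel) \<le> ennreal C * nnpot d f x"
proof -
 have "(\<integral>\<^sup>+y. ennreal \<bar>g y\<bar> \<partial>lborel)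
   \<le> (\<integral>\<^sup>+y. ennreal C * ennreal (norm (x - y) powr d * \<bar>f y\<bar>) \<partial>lborel)"
 proof (rule nn_integral_mono_AE, rule AE_mp[OF AE_neq[of x]], rule AE_I2, rule impI)
  fix y assume "y \<noteq> x"
  from le[OF this] show "ennreal \<bar>g y\<bar> \<le> ennreal C * ennreal (norm (x - y) powr d * \<bar>f y\<bar>)"
   using \<open>0 \<le> C\<close> by (simp add: ennreal_mult[symmetric] ennreal_leI mult.assoc)
 qed
 also have "\<dots> = ennreal C * nnpot d f x"
  unfolding nnpot_def by (rule nn_integral_cmult) (simp add: measurable_nnpot_integrand[OF f])
 finally show ?thesis .
qed

lemma abs_integral_le_nn_integral:
 fixes g :: "'a => real"
 shows "ennreal \<bar>LINT y|M. g y\<bar> \<le> (\<integral>\<^sup>+y. ennreal \<bar>g y\<bar> \<partial>M)"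
proof (cases "integrable M g")
 case True
 then show ?thesis using integral_norm_bound_ennreal[OF True] by simp
qed (simp add: not_integrable_integral_eq)

lemma kernel_le:
 fixes G f :: "real ^ 'n::finite => real"
 assumes "\<And>z. z \<noteq> 0 ==> \<bar>G z\<bar> \<le> C * norm z powr d" "y \<noteq> x"
 shows "\<bar>G (x - y) * f y\<bar> \<le> C * norm (x - y) powr d * \<bar>f y\<bar>"
 using assms(1)[of "x - y"] assms(2) by (simp add: abs_mult mult_right_mono)

lemma pot_integrable:
 assumes G: "kernel_class k d G" and f: "f \<in> borel_measurable borel" and fin: "nnpot d f x < \<infinity>"
 shows "integrable lborel (\<lambda>y. G (x - y) * f y)"
proof -
 obtain C where C: "\<And>z. z \<noteq> 0 ==> \<bar>G z\<bar> \<le> C * norm z powr d"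
  using kernel_class_bound[OF G] by blast
 have C': "\<bar>G z\<bar> \<le> \<bar>C\<bar> * norm z powr d" if "z \<noteq> 0" for z
  using C[OF that] by (rule le_abs_mult) simp
 have "(\<integral>\<^sup>+y. ennreal \<bar>G (x - y) * f y\<bar> \<partial>lborel) \<le> ennreal \<bar>C\<bar> * nnpot d f x"
  by (rule nn_integral_le_nnpot[OF f]) (auto intro: kernel_le C')
 also have "\<dots> < \<infinity>" using fin by (simp add: ennreal_mult_less_top)
 finally show ?thesis
  using measurable_pot_integrand[OF kernel_class_measurable[OF G] f, of x]
  by (simp add: integrable_iff_bounded)
qed

lemma pot_le_nnpot:
 assumes f: "f \<in> borel_measurable borel" and "0 \<le> C"
  and le: "\<And>z. z \<noteq> 0 ==> \<bar>G z\<bar> \<le> C * norm z powr d"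
 shows "ennreal \<bar>pot G f x\<bar> \<le> ennreal C * nnpot d f x"
 unfolding pot_def
 by (rule order_trans[OF abs_integral_le_nn_integral nn_integral_le_nnpot[OF f \<open>0 \<le> C\<close>]])
  (rule kernel_le[OF le])

lemma abs_integral_le_two_nnpot:
 fixes f g :: "real ^ 'n::finite => real"
 assumes f: "f \<in> borel_measurable borel" and "0 \<le> c" "0 \<le> K"
  and le: "\<And>y. y \<noteq> x ==> y \<noteq> x' ==>
   \<bar>g y\<bar> \<le> c * (norm (x - y) powr d + norm (x' - y) powr d) * \<bar>f y\<bar>"
  and K: "nnpot d f x \<le> ennreal K" "nnpot d f x' \<le> ennreal K"
 shows "\<bar>LINT y|lborel. g y\<bar> \<le> c * (2 * K)"
proof -
 let ?h = "\<lambda>x y. ennreal (norm (x - y) powr d * \<bar>f y\<bar>)"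
 have "ennreal \<bar>LINT y|lborel. g y\<bar> \<le> (\<integral>\<^sup>+y. ennreal \<bar>g y\<bar> \<partial>lborel)"
  by (rule abs_integral_le_nn_integral)
 also have "\<dots> \<le> (\<integral>\<^sup>+y. ennreal c * (?h x y + ?h x' y) \<partial>lborel)"
 proof (rule nn_integral_mono_AE, rule AE_mp[OF AE_neq[of x]], rule AE_mp[OF AE_neq[of x']],
   rule AE_I2, intro impI)
  fix y assume "y \<noteq> x" "y \<noteq> x'"
  from le[OF this] show "ennreal \<bar>g y\<bar> \<le> ennreal c * (?h x y + ?h x' y)"
   using \<open>0 \<le> c\<close> by (simp add: ennreal_mult[symmetric] ennreal_plus[symmetric] ennreal_leI
     algebra_simps del: ennreal_plus)
 qed
 also have "\<dots> = ennreal c * (nnpot d f x + nnpot d f x')"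
  unfolding nnpot_def using measurable_nnpot_integrand[OF f]
  by (subst nn_integral_cmult) (simp_all add: nn_integral_add)
 also have "\<dots> \<le> ennreal c * (ennreal K + ennreal K)"
  by (intro mult_left_mono add_mono K) simp
 also have "\<dots> = ennreal (c * (2 * K))"
  using \<open>0 \<le> c\<close> \<open>0 \<le> K\<close> by (simp add: ennreal_mult[symmetric] ennreal_plus[symmetric] del: ennreal_plus)
 finally show ?thesis using \<open>0 \<le> c\<close> \<open>0 \<le> K\<close> by simp
qed

subsection \<open>Control of weaker kernels\<close>

lemma nnpot_mono:
 "(\<And>y. \<bar>f y\<bar> \<le> \<bar>g y\<bar>) ==> nnpot d f x \<le> nnpot d g x"
 unfolding nnpot_def by (intro nn_integral_mono ennreal_leI mult_left_mono) auto

lemma tame_mono: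
 assumes "tame d g S" "f \<in> borel_measurable borel" "\<And>y. \<bar>f y\<bar> \<le> \<bar>g y\<bar>"
 shows "tame d f S"
 using assms(1,2) nnpot_mono[of f g d, OF assms(3)] unfolding tame_def
 by (meson order_trans)

lemma tame_subset: "tame d f S ==> T \<subseteq> S ==> tame d f T"
 unfolding tame_def by blast

lemma powr_between:
 assumes "(d1::real) \<le> d" "d \<le> d2" "0 \<le> z"
 shows "z powr d \<le> z powr d1 + z powr d2"
proof (cases "z \<le> 1")
 case True
 then have "z powr d \<le> z powr d1" using assms by (cases "z = 0") (auto intro: powr_mono')
 then show ?thesis by (simp add: add_increasing2)
next
 case False
 then have "z powr d \<le> z powr d2" using assms by (intro powr_mono) auto
 then show ?thesis by (simp add: add_increasing)
qed

lemma nnpot_between: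
 assumes "d1 \<le> d" "d \<le> d2" and f: "f \<in> borel_measurable borel"
 shows "nnpot d f x \<le> nnpot d1 f x + nnpot d2 f x"
proof -
 have "nnpot d f x \<le> (\<integral>\<^sup>+y. ennreal (norm (x - y) powr d1 * \<bar>f y\<bar>)
   + ennreal (norm (x - y) powr d2 * \<bar>f y\<bar>) \<partial>lborel)"
  unfolding nnpot_def
 proof (rule nn_integral_mono)
  fix y
  show "ennreal (norm (x - y) powr d * \<bar>f y\<bar>) \<le> ennreal (norm (x - y) powr d1 * \<bar>f y\<bar>)
   + ennreal (norm (x - y) powr d2 * \<bar>f y\<bar>)"
   using powr_between[OF assms(1,2), of "norm (x - y)"]
   by (simp add: ennreal_plus[symmetric] ennreal_leI mult_right_mono
     distrib_right[symmetric] del: ennreal_plus)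
 qed
 also have "\<dots> = nnpot d1 f x + nnpot d2 f x"
  unfolding nnpot_def using measurable_nnpot_integrand[OF f] by (intro nn_integral_add) simp_all
 finally show ?thesis .
qed

lemma tame_between:
 assumes t: "tame d1 f S" "tame d2 f S" and "d1 \<le> d" "d \<le> d2"
 shows "tame d f S"
 unfolding tame_def
proof (intro conjI ballI)
 show f: "f \<in> borel_measurable borel" using t by (simp add: tame_def)
 fix x assume x: "x \<in> S"
 obtain e1 K1 where 1: "e1 > 0" "K1 \<ge> 0" "\<And>y. y \<in> ball x e1 ==> nnpot d1 f y \<le> ennreal K1"
  using tameE[OF t(1) x] by blast
 obtain e2 K2 where 2: "e2 > 0" "K2 \<ge> 0" "\<And>y. y \<in> ball x e2 ==> nnpot d2 f y \<le> ennreal K2"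
  using tameE[OF t(2) x] by blast
 have "nnpot d f y \<le> ennreal (K1 + K2)" if y: "y \<in> ball x (min e1 e2)" for y
 proof -
  have "nnpot d f y \<le> nnpot d1 f y + nnpot d2 f y" by (rule nnpot_between[OF assms(3,4) f])
  also have "\<dots> \<le> ennreal K1 + ennreal K2" using y by (intro add_mono 1 2) simp_all
  finally show ?thesis using 1(2) 2(2) by (simp add: ennreal_plus)
 qed
 then show "\<exists>e>0. \<exists>K\<ge>0. \<forall>y\<in>ball x e. nnpot d f y \<le> ennreal K"
  using 1 2 by (intro exI[of _ "min e1 e2"] conjI exI[of _ "K1 + K2"]) auto
qed

text \<open>Near \<open>y\<close> the density is bounded and the kernel integrable; at distance at least \<open>\<rho>\<close> the more singular kernel
 is controlled by the less singular one.\<close>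

lemma nnpot_split:
 assumes "d \<le> D" "0 < \<rho>" and f: "f \<in> borel_measurable borel"
  and M: "\<And>w. w \<in> ball y \<rho> ==> \<bar>f w\<bar> \<le> M" "0 \<le> M"
 shows "nnpot d f y \<le> ennreal M * (\<integral>\<^sup>+w. ennreal (norm (y - w) powr d) * indicator (ball y \<rho>) w \<partial>lborel)
  + ennreal (\<rho> powr (d - D)) * nnpot D f y"
proof -
 let ?A = "\<lambda>w. ennreal (norm (y - w) powr d) * indicator (ball y \<rho>) w"
 let ?B = "\<lambda>w. ennreal (norm (y - w) powr D * \<bar>f w\<bar>)"
 have A: "?A \<in> borel_measurable borel"
  using measurable_reflect[OF measurable_norm_powr[of d], of y]
  by (intro borel_measurable_times_ennreal borel_measurable_indicator) simp_all
 have "nnpot d f y \<le> (\<integral>\<^sup>+w. ennreal M * ?A w + ennreal (\<rho> powr (d - D)) * ?B w \<partial>lborel)"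
  unfolding nnpot_def
 proof (rule nn_integral_mono)
  fix w
  show "ennreal (norm (y - w) powr d * \<bar>f w\<bar>) \<le> ennreal M * ?A w + ennreal (\<rho> powr (d - D)) * ?B w"
  proof (cases "w \<in> ball y \<rho>")
   case True
   have "ennreal (norm (y - w) powr d * \<bar>f w\<bar>) \<le> ennreal (M * norm (y - w) powr d)"
    using mult_left_mono[OF M(1)[OF True], of "norm (y - w) powr d"]
    by (intro ennreal_leI) (simp add: mult.commute)
   also have "\<dots> = ennreal M * ?A w" using True M(2) by (simp add: ennreal_mult)
   finally show ?thesis by (simp add: add_increasing2)
  next
   case False
   then have \<rho>: "\<rho> \<le> norm (y - w)" by (simp add: dist_norm)
   have "norm (y - w) powr d = norm (y - w) powr (d - D) * norm (y - w) powr D"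
    using \<rho> assms(2) by (simp add: powr_add[symmetric])
   also have "\<dots> \<le> \<rho> powr (d - D) * norm (y - w) powr D"
    using \<rho> assms(1,2) by (intro mult_right_mono powr_mono2') auto
   finally have "norm (y - w) powr d * \<bar>f w\<bar> \<le> \<rho> powr (d - D) * (norm (y - w) powr D * \<bar>f w\<bar>)"
    using mult_right_mono[of _ _ "\<bar>f w\<bar>"] by (simp only: mult.assoc[symmetric])
   then have "ennreal (norm (y - w) powr d * \<bar>f w\<bar>) \<le> ennreal (\<rho> powr (d - D)) * ?B w"
    by (simp add: ennreal_mult[symmetric] ennreal_leI)
   then show ?thesis by (simp add: add_increasing)
  qed
 qed
 also have "\<dots> = (\<integral>\<^sup>+w. ennreal M * ?A w \<partial>lborel) + (\<integral>\<^sup>+w. ennreal (\<rho> powr (d - D)) * ?B w \<partial>lborel)"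
  using A measurable_nnpot_integrand[OF f]
  by (intro nn_integral_add borel_measurable_times_ennreal) (simp_all add: borel_measurable_indicator)
 also have "\<dots> = ennreal M * (\<integral>\<^sup>+w. ?A w \<partial>lborel) + ennreal (\<rho> powr (d - D)) * (\<integral>\<^sup>+w. ?B w \<partial>lborel)"
  using A measurable_nnpot_integrand[OF f]
  by (intro arg_cong2[where f = "(+)"] nn_integral_cmult) simp_all
 finally show ?thesis by (simp only: nnpot_def)
qed

definition locally_bounded_on :: "'a::metric_space set => ('a => real) => bool" where
 "locally_bounded_on S f \<longleftrightarrow> (\<forall>x\<in>S. \<exists>e>0. \<exists>M. \<forall>y\<in>ball x e. \<bar>f y\<bar> \<le> M)"

lemma continuous_imp_locally_bounded:
 assumes "open S" "continuous_on S f"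
 shows "locally_bounded_on S f"
 unfolding locally_bounded_on_def
proof
 fix x assume "x \<in> S"
 then have "isCont f x" using assms continuous_on_eq_continuous_at by blast
 then obtain d where "d > 0" "\<And>y. dist y x < d ==> dist (f y) (f x) < 1"
  unfolding continuous_at_eps_delta by (meson zero_less_one)
 then have "\<forall>y\<in>ball x d. \<bar>f y\<bar> \<le> \<bar>f x\<bar> + 1"
  by (force simp: dist_commute dist_real_def)
 then show "\<exists>e>0. \<exists>M. \<forall>y\<in>ball x e. \<bar>f y\<bar> \<le> M" using \<open>d > 0\<close> by blast
qed

lemma tame_of_locally_bounded:
 fixes f :: "real ^ 'n::finite => real"
 assumes t: "tame D f S" and b: "locally_bounded_on S f"
  and d: "d \<le> D" "- real CARD('n) < d" "d \<le> 0"
 shows "tame d f S"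
 unfolding tame_def
proof (intro conjI ballI)
 show f: "f \<in> borel_measurable borel" using t by (simp add: tame_def)
 fix x assume x: "x \<in> S"
 obtain e1 K where 1: "e1 > 0" "K \<ge> 0" "\<And>y. y \<in> ball x e1 ==> nnpot D f y \<le> ennreal K"
  using tameE[OF t x] by blast
 obtain e2 M where 2: "e2 > 0" "\<And>y. y \<in> ball x e2 ==> \<bar>f y\<bar> \<le> M"
  using b x unfolding locally_bounded_on_def by blast
 have M: "0 \<le> M" using 2(2)[of x] 2(1) by simp
 define \<rho> where "\<rho> = e2 / 2"
 have \<rho>: "\<rho> > 0" using 2 by (simp add: \<rho>_def)
 obtain C where C: "C > 0" "\<And>(y::real^'n) \<rho>. 0 < \<rho> ==>
  (\<integral>\<^sup>+w. ennreal (norm (y - w) powr d) * indicator (ball y \<rho>) w \<partial>lborel) \<le> ennreal (C * \<rho> powr (d + real CARD('n)))"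
  using nn_integral_near_powr[where 'n = 'n, of "d + real CARD('n)"] d by auto
 let ?K = "M * (C * \<rho> powr (d + real CARD('n))) + \<rho> powr (d - D) * K"
 have "nnpot d f y \<le> ennreal ?K" if y: "y \<in> ball x (min e1 \<rho>)" for y
 proof -
  have sub: "w \<in> ball x e2" if "w \<in> ball y \<rho>" for w
   using that y dist_triangle[of x w y] by (simp add: \<rho>_def dist_commute)
  have "nnpot d f y \<le> ennreal M * (\<integral>\<^sup>+w. ennreal (norm (y - w) powr d) * indicator (ball y \<rho>) w \<partial>lborel)
    + ennreal (\<rho> powr (d - D)) * nnpot D f y"
   by (rule nnpot_split[OF d(1) \<rho> f 2(2)[OF sub] M])
  also have "\<dots> \<le> ennreal M * ennreal (C * \<rho> powr (d + real CARD('n))) + ennreal (\<rho> powr (d - D)) * ennreal K"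
   using y by (intro add_mono mult_left_mono C(2) 1(3) \<rho>) simp_all
  also have "\<dots> = ennreal ?K"
   using M C(1) 1(2) by (simp add: ennreal_mult[symmetric] ennreal_plus[symmetric] del: ennreal_plus)
  finally show ?thesis .
 qed
 moreover have "?K \<ge> 0" using M C(1) 1(2) by simp
 ultimately show "\<exists>e>0. \<exists>K\<ge>0. \<forall>y\<in>ball x e. nnpot d f y \<le> ennreal K"
  using 1(1) \<rho> by (intro exI[of _ "min e1 \<rho>"] conjI exI[of _ ?K]) auto
qed

lemma tame_off_support:
 fixes f :: "real ^ 'n::finite => real"
 assumes t: "tame D f S" and S: "open S" and z: "\<And>y. y \<in> S ==> f y = 0" and d: "d \<le> D"
 shows "tame d f S"
 unfolding tame_def
proof (intro conjI ballI)
 show f: "f \<in> borel_measurable borel" using t by (simp add: tame_def)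
 fix x assume x: "x \<in> S"
 obtain e1 K where 1: "e1 > 0" "K \<ge> 0" "\<And>y. y \<in> ball x e1 ==> nnpot D f y \<le> ennreal K"
  using tameE[OF t x] by blast
 obtain e2 where 2: "e2 > 0" "ball x e2 \<subseteq> S"
  using S x open_contains_ball by blast
 define \<rho> where "\<rho> = e2 / 2"
 have \<rho>: "\<rho> > 0" using 2 by (simp add: \<rho>_def)
 let ?K = "\<rho> powr (d - D) * K"
 have "nnpot d f y \<le> ennreal ?K" if y: "y \<in> ball x (min e1 \<rho>)" for y
 proof -
  have sub: "\<bar>f w\<bar> \<le> 0" if "w \<in> ball y \<rho>" for w
  proof -
   have "w \<in> ball x e2" using that y dist_triangle[of x w y] by (simp add: \<rho>_def dist_commute)
   then show ?thesis using 2(2) z by auto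
  qed
  have "nnpot d f y \<le> ennreal 0 * (\<integral>\<^sup>+w. ennreal (norm (y - w) powr d) * indicator (ball y \<rho>) w \<partial>lborel)
    + ennreal (\<rho> powr (d - D)) * nnpot D f y"
   by (rule nnpot_split[OF d(1) \<rho> f sub]) simp_all
  also have "\<dots> \<le> ennreal (\<rho> powr (d - D)) * ennreal K"
   using y by (simp add: mult_left_mono 1(3))
  also have "\<dots> = ennreal ?K" using 1(2) by (simp add: ennreal_mult)
  finally show ?thesis .
 qed
 then show "\<exists>e>0. \<exists>K\<ge>0. \<forall>y\<in>ball x e. nnpot d f y \<le> ennreal K"
  using 1 \<rho> by (intro exI[of _ "min e1 \<rho>"] conjI exI[of _ ?K]) auto
qed

subsection \<open>Differentiating the kernel\<close>

lemma tendsto_sqrt_dist_0: "((\<lambda>y. c * sqrt (norm (y - x))) \<longlongrightarrow> 0) (at (x::'a::real_normed_vector))"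
proof -
 have "((\<lambda>y. c * sqrt (norm (y - x))) \<longlongrightarrow> c * sqrt (norm (x - x))) (at x)"
  by (intro tendsto_intros)
 then show ?thesis by simp
qed

lemma isCont_pot:
 fixes G f :: "real ^ 'n::finite => real"
 assumes G: "kernel_class 1 d G" and t: "tame d f S" "tame (d - 1/2) f S" and x: "x \<in> S" and "open S"
 shows "isCont (pot G f) x"
proof -
 have f: "f \<in> borel_measurable borel" using t(1) by (rule tameD_measurable)
 obtain C where C: "C \<ge> 0" "\<And>z h. z \<noteq> 0 ==> z + h \<noteq> 0 ==> \<bar>G (z + h) - G z\<bar>
  \<le> C * norm h powr (1/2) * (norm z powr (d - 1/2) + norm (z + h) powr (d - 1/2))"
  using kernel_increment[OF G] by blast
 obtain e1 K where 1: "e1 > 0" "K \<ge> 0" "\<And>y. y \<in> ball x e1 ==> nnpot (d - 1/2) f y \<le> ennreal K"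
  using tameE[OF t(2) x] by blast
 obtain e2 where 2: "e2 > 0" "ball x e2 \<subseteq> S"
  using assms(5) x open_contains_ball by blast
 have int: "integrable lborel (\<lambda>y. G (w - y) * f y)" if "w \<in> S" for w
  by (rule pot_integrable[OF G f tame_finite[OF t(1) that]])
 have "\<bar>pot G f x' - pot G f x\<bar> \<le> (C * (2 * K)) * sqrt (norm (x' - x))"
  if x': "x' \<in> ball x (min e1 e2)" for x'
 proof -
  have "pot G f x' - pot G f x = (LINT y|lborel. G (x' - y) * f y - G (x - y) * f y)"
   unfolding pot_def using x' 2 by (intro Bochner_Integration.integral_diff[symmetric] int x) auto
  moreover have "\<bar>LINT y|lborel. G (x' - y) * f y - G (x - y) * f y\<bar>
    \<le> C * norm (x' - x) powr (1/2) * (2 * K)"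
  proof (rule abs_integral_le_two_nnpot[OF f])
   show "0 \<le> C * norm (x' - x) powr (1/2)" "0 \<le> K" using C 1 by simp_all
   show "nnpot (d - 1/2) f x \<le> ennreal K" "nnpot (d - 1/2) f x' \<le> ennreal K"
    using x' 1 by (auto intro!: 1(3))
   fix y assume "y \<noteq> x" "y \<noteq> x'"
   then have "\<bar>G (x' - y) - G (x - y)\<bar> \<le> C * norm (x' - x) powr (1/2)
     * (norm (x - y) powr (d - 1/2) + norm (x' - y) powr (d - 1/2))"
    using C(2)[of "x - y" "x' - x"] by simp
   from mult_right_mono[OF this, of "\<bar>f y\<bar>"]
   show "\<bar>G (x' - y) * f y - G (x - y) * f y\<bar> \<le> C * norm (x' - x) powr (1/2)
     * (norm (x - y) powr (d - 1/2) + norm (x' - y) powr (d - 1/2)) * \<bar>f y\<bar>"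
    by (simp add: left_diff_distrib[symmetric] abs_mult)
  qed
  ultimately show ?thesis by (simp add: powr_half_sqrt mult_ac)
 qed
 then have "\<forall>\<^sub>F x' in at x. norm (pot G f x' - pot G f x) \<le> (C * (2 * K)) * sqrt (norm (x' - x))"
  using 1(1) 2(1) unfolding eventually_at
  by (intro exI[of _ "min e1 e2"]) (auto simp: dist_commute)
 then have "((\<lambda>x'. pot G f x' - pot G f x) \<longlongrightarrow> 0) (at x)"
  by (rule Lim_null_comparison[OF _ tendsto_sqrt_dist_0])
 then show ?thesis by (simp add: isCont_def LIM_zero_iff)
qed

lemma continuous_on_pot:
 assumes "kernel_class 1 d G" "tame d f S" "tame (d - 1/2) f S" "open S"
 shows "continuous_on S (pot G f)"
 using isCont_pot[OF assms(1-3) _ assms(4)] by (intro continuous_at_imp_continuous_on) blast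

text \<open>The remainder of the linearised kernel is at most \<open>norm h powr (3/2)\<close> times kernels of degree
 \<open>d - 3/2\<close>, whose potentials are locally bounded.\<close>

lemma GDERIV_pot:
 fixes G f :: "real ^ 'n::finite => real"
 assumes G: "kernel_class 2 d G" and t: "tame d f S" "tame (d - 3/2) f S" and x: "x \<in> S" and "open S"
 shows "GDERIV (pot G f) x :> (\<chi> i. pot (partial i G) f x)"
proof -
 let ?V = "\<chi> i. pot (partial i G) f x"
 have G1: "kernel_class 1 (d - 1) (partial i G)" for i using G by (simp add: numeral_2_eq_2)
 have t1: "tame (d - 1) f S" by (rule tame_between[OF t(2,1)]) simp_all
 have f: "f \<in> borel_measurable borel" using t(1) by (rule tameD_measurable)
 obtain C where C: "C \<ge> 0" "\<And>z h. z \<noteq> 0 ==> z + h \<noteq> 0 ==> \<bar>G (z + h) - G z - h \<bullet> gradient G z\<bar>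
  \<le> C * norm h powr (3/2) * (norm z powr (d - 3/2) + norm (z + h) powr (d - 3/2))"
  using kernel_increment_second[OF G] by blast
 obtain e1 K where 1: "e1 > 0" "K \<ge> 0" "\<And>y. y \<in> ball x e1 ==> nnpot (d - 3/2) f y \<le> ennreal K"
  using tameE[OF t(2) x] by blast
 obtain e2 where 2: "e2 > 0" "ball x e2 \<subseteq> S"
  using assms(5) x open_contains_ball by blast
 have int: "integrable lborel (\<lambda>y. G (w - y) * f y)" if "w \<in> S" for w
  by (rule pot_integrable[OF G f tame_finite[OF t(1) that]])
 have int1: "integrable lborel (\<lambda>y. partial i G (x - y) * f y)" for i
  by (rule pot_integrable[OF G1 f tame_finite[OF t1 x]])
 have grad: "(\<lambda>y. h \<bullet> gradient G (x - y) * f y) = (\<lambda>y. \<Sum>i\<in>UNIV. h $ i * (partial i G (x - y) * f y))" for h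
  by (simp add: fun_eq_iff inner_vec_def sum_distrib_right mult.assoc)
 have int2: "integrable lborel (\<lambda>y. h \<bullet> gradient G (x - y) * f y)" for h
  unfolding grad by (intro Bochner_Integration.integrable_sum integrable_mult_right int1)
 have V: "h \<bullet> ?V = (LINT y|lborel. h \<bullet> gradient G (x - y) * f y)" for h
  unfolding grad
  by (subst Bochner_Integration.integral_sum) (simp_all add: int1 inner_vec_def pot_def)
 have est: "norm (pot G f x' - pot G f x - (x' - x) \<bullet> ?V) / norm (x' - x) \<le> (C * (2 * K)) * sqrt (norm (x' - x))"
  if x': "x' \<noteq> x" "dist x' x < min e1 e2" for x'
 proof -
  let ?g = "\<lambda>y. G (x' - y) * f y - G (x - y) * f y - (x' - x) \<bullet> gradient G (x - y) * f y"
  have x'S: "x' \<in> S" using x' 2 by (auto simp: dist_commute)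
  have "pot G f x' - pot G f x - (x' - x) \<bullet> ?V = (LINT y|lborel. ?g y)"
   unfolding pot_def V[unfolded pot_def]
   by (simp add: Bochner_Integration.integral_diff int[OF x] int[OF x'S] int2)
  moreover have "\<bar>LINT y|lborel. ?g y\<bar> \<le> C * norm (x' - x) powr (3/2) * (2 * K)"
  proof (rule abs_integral_le_two_nnpot[OF f])
   show "0 \<le> C * norm (x' - x) powr (3/2)" "0 \<le> K" using C 1 by simp_all
   show "nnpot (d - 3/2) f x \<le> ennreal K" "nnpot (d - 3/2) f x' \<le> ennreal K"
    using x' 1(1) by (auto intro!: 1(3) simp: dist_commute)
   fix y assume "y \<noteq> x" "y \<noteq> x'"
   then have "\<bar>G (x' - y) - G (x - y) - (x' - x) \<bullet> gradient G (x - y)\<bar> \<le> C * norm (x' - x) powr (3/2)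
     * (norm (x - y) powr (d - 3/2) + norm (x' - y) powr (d - 3/2))"
    using C(2)[of "x - y" "x' - x"] by simp
   from mult_right_mono[OF this, of "\<bar>f y\<bar>"]
   show "\<bar>?g y\<bar> \<le> C * norm (x' - x) powr (3/2)
     * (norm (x - y) powr (d - 3/2) + norm (x' - y) powr (d - 3/2)) * \<bar>f y\<bar>"
    by (simp only: left_diff_distrib[symmetric] abs_mult abs_ge_zero)
  qed
  moreover have "norm (x' - x) powr (3/2) = norm (x' - x) * sqrt (norm (x' - x))"
   using powr_add[of "norm (x' - x)" 1 "1/2"] by (simp add: powr_half_sqrt)
  ultimately show ?thesis using x'(1) by (simp add: divide_le_eq mult_ac)
 qed
 have "(pot G f has_derivative (\<lambda>h. h \<bullet> ?V)) (at x)"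
  by (rule has_derivativeI_sandwich[of "min e1 e2" _ _ _ _ "\<lambda>x'. (C * (2 * K)) * sqrt (norm (x' - x))"])
   (use 1(1) 2(1) est bounded_linear_inner_left tendsto_sqrt_dist_0 in auto)
 then show ?thesis by (simp add: gderiv_def)
qed

lemma C_k_on_pot:
 fixes G f :: "real ^ 'n::finite => real"
 assumes "open S" "kernel_class (Suc k) d G" "tame d f S" "tame (d - real k - 1/2) f S"
 shows "C_k_on k (pot G f) S"
 using assms(2-)
proof (induction k arbitrary: d G)
 case 0
 then show ?case using continuous_on_pot[of d G f S] assms(1) by simp
next
 case (Suc k)
 have t: "tame e f S" if "d - real k - 3/2 \<le> e" "e \<le> d" for e
  by (rule tame_between[OF Suc.prems(3,2)]) (use that in simp_all)
 have k2: "kernel_class 2 d G" by (rule kernel_class_antimono[OF _ Suc.prems(1)]) simp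
 show ?case
 proof (rule C_k_on_SucI[OF assms(1)])
  show "GDERIV (pot G f) x :> (\<chi> i. pot (partial i G) f x)" if "x \<in> S" for x
   by (rule GDERIV_pot[OF k2 Suc.prems(2) t that assms(1)]) simp_all
  have "C_k_on k (pot (partial i G) f) S" for i
   by (rule Suc.IH[of "d - 1"]) (use Suc.prems(1) t in auto)
  then show "C_k_on k (\<lambda>x. (\<chi> i. pot (partial i G) f x) $ i) S" for i by simp
 qed
qed

lemma partial_pot:
 fixes G f :: "real ^ 'n::finite => real"
 assumes "kernel_class 2 d G" "tame d f S" "tame (d - 3/2) f S" "x \<in> S" "open S"
 shows "partial i (pot G f) x = pot (partial i G) f x"
 using partial_eq[OF GDERIV_pot[OF assms]] by simp

section \<open>Cutoff functions\<close>

lemma DERIV_pos_part_square: "DERIV (\<lambda>s. (max 0 s)\<^sup>2) x :> 2 * max 0 (x::real)"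
proof -
 consider "x > 0" | "x < 0" | "x = 0" by linarith
 then show ?thesis
 proof cases
  case 1
  have "DERIV (\<lambda>s. s\<^sup>2) x :> 2 * x" by (auto intro!: derivative_eq_intros)
  then have "DERIV (\<lambda>s. (max 0 s)\<^sup>2) x :> 2 * x"
   by (rule has_field_derivative_transform_within_open[of _ _ _ "{0<..}"]) (use 1 in auto)
  then show ?thesis using 1 by simp
 next
  case 2
  have "DERIV (\<lambda>s. 0::real) x :> 0" by simp
  then have "DERIV (\<lambda>s. (max 0 s)\<^sup>2) x :> 0"
   by (rule has_field_derivative_transform_within_open[of _ _ _ "{..<0}"]) (use 2 in auto)
  then show ?thesis using 2 by simp
 next
  case 3
  have "((\<lambda>y::real. max 0 y) \<longlongrightarrow> max 0 0) (at 0)" by (intro tendsto_intros)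
  moreover have "\<forall>\<^sub>F y in at (0::real). max 0 y = ((max 0 y)\<^sup>2 - (max 0 0)\<^sup>2) / (y - 0)"
   by (rule eventually_at_filter[THEN iffD2], rule always_eventually)
    (auto simp: max_def power2_eq_square)
  ultimately have "((\<lambda>y. ((max 0 y)\<^sup>2 - (max 0 0)\<^sup>2) / (y - 0)) \<longlongrightarrow> max 0 0) (at (0::real))"
   by (rule Lim_transform_eventually)
  then show ?thesis using 3 by (simp add: has_field_derivative_iff)
 qed
qed

text \<open>A cutoff of class \<open>C\<^sup>1\<close> is enough, so the step is piecewise quadratic.\<close>

definition smoothstep :: "real => real" where
 "smoothstep s = 2 * (max 0 s)\<^sup>2 - 4 * (max 0 (s - 1/2))\<^sup>2 + 2 * (max 0 (s - 1))\<^sup>2"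

definition dsmoothstep :: "real => real" where
 "dsmoothstep s = 4 * max 0 s - 8 * max 0 (s - 1/2) + 4 * max 0 (s - 1)"

lemma DERIV_smoothstep: "DERIV smoothstep s :> dsmoothstep s"
proof -
 have d: "DERIV (\<lambda>s. (max 0 (s - a))\<^sup>2) s :> 2 * max 0 (s - a)" for a
 proof -
  have "DERIV (\<lambda>s. s - a) s :> 1" by (auto intro!: derivative_eq_intros)
  from DERIV_chain2[OF DERIV_pos_part_square this] show ?thesis by simp
 qed
 have "DERIV (\<lambda>s. 2 * (max 0 (s - 0))\<^sup>2 - 4 * (max 0 (s - 1/2))\<^sup>2 + 2 * (max 0 (s - 1))\<^sup>2) s :>
   2 * (2 * max 0 (s - 0)) - 4 * (2 * max 0 (s - 1/2)) + 2 * (2 * max 0 (s - 1))"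
  by (intro DERIV_add DERIV_diff DERIV_cmult d)
 then show ?thesis by (simp add: smoothstep_def[abs_def] dsmoothstep_def)
qed

lemma smoothstep_0: "s \<le> 0 ==> smoothstep s = 0" "s \<le> 0 ==> dsmoothstep s = 0"
 by (simp_all add: smoothstep_def dsmoothstep_def max_def)

lemma smoothstep_1: "s \<ge> 1 ==> smoothstep s = 1"
 by (simp add: smoothstep_def max_def power2_eq_square algebra_simps)

lemma abs_dsmoothstep: "\<bar>dsmoothstep s\<bar> \<le> 2"
 unfolding dsmoothstep_def max_def by auto

lemma smoothstep_range: "0 \<le> smoothstep s" "smoothstep s \<le> 1"
proof -
 consider "s \<le> 0" | "0 < s" "s \<le> 1/2" | "1/2 < s" "s \<le> 1" | "s > 1" by linarith
 then have "0 \<le> smoothstep s \<and> smoothstep s \<le> 1"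
 proof cases
  case 2
  have "s\<^sup>2 \<le> (1/2)\<^sup>2" using 2 by (intro power_mono) auto
  moreover have "smoothstep s = 2 * s\<^sup>2" using 2 by (simp add: smoothstep_def max_absorb1 max_absorb2)
  ultimately show ?thesis by (simp add: power2_eq_square)
 next
  case 3
  have "(1 - s)\<^sup>2 \<le> (1/2)\<^sup>2" using 3 by (intro power_mono) auto
  moreover have "smoothstep s = 1 - 2 * (1 - s)\<^sup>2"
   using 3 by (simp add: smoothstep_def max_def power2_eq_square algebra_simps)
  ultimately show ?thesis by (simp add: power2_eq_square)
 qed (simp_all add: smoothstep_0 smoothstep_1)
 then show "0 \<le> smoothstep s" "smoothstep s \<le> 1" by auto
qed

lemma continuous_dsmoothstep: "continuous_on UNIV dsmoothstep"
 unfolding dsmoothstep_def[abs_def] by (intro continuous_intros)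

definition bump :: "'a::real_inner => real => 'a => real" where
 "bump z r x = smoothstep ((4 - (norm (x - z))\<^sup>2 / r\<^sup>2) / 3)"

definition dbump :: "'a::real_inner => real => 'a => 'a" where
 "dbump z r x = dsmoothstep ((4 - (norm (x - z))\<^sup>2 / r\<^sup>2) / 3) *\<^sub>R (- (2 / (3 * r\<^sup>2))) *\<^sub>R (x - z)"

lemma GDERIV_translate:
 assumes "GDERIV f (x - z) :> D"
 shows "GDERIV (\<lambda>x. f (x - z)) x :> D"
proof -
 have "((\<lambda>x. x - z) has_derivative (\<lambda>h. h)) (at x)" by (auto intro!: derivative_eq_intros)
 from has_derivative_compose[OF this assms[unfolded gderiv_def]] show ?thesis
  by (simp add: gderiv_def)
qed

lemma GDERIV_bump: "GDERIV (bump z r) x :> dbump z r x"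
proof -
 have "GDERIV (\<lambda>x. 4/3 - (1 / (3 * r\<^sup>2)) * (norm (x - z))\<^sup>2) x :> 0 - (1 / (3 * r\<^sup>2)) *\<^sub>R (2 *\<^sub>R (x - z))"
  by (intro GDERIV_diff GDERIV_const GDERIV_cmult GDERIV_translate[OF GDERIV_norm_square])
 from GDERIV_DERIV_compose[OF this DERIV_smoothstep]
 show ?thesis
  by (simp add: bump_def[abs_def] dbump_def diff_divide_distrib mult.commute)
qed

lemma continuous_dbump: "0 < r ==> continuous_on UNIV (dbump z r)"
 unfolding dbump_def[abs_def]
 by (intro continuous_intros continuous_on_compose2[OF continuous_dsmoothstep]) auto

lemma bump_range: "0 \<le> bump z r x" "bump z r x \<le> 1"
 by (simp_all add: bump_def smoothstep_range)

lemma bump_1: "0 < r ==> norm (x - z) \<le> r ==> bump z r x = 1"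
 unfolding bump_def by (intro smoothstep_1) (simp add: divide_le_eq abs_le_square_iff[symmetric] field_simps power_mono)

lemma bump_arg_nonpos:
 assumes "0 < r" "2 * r \<le> norm (x - z)"
 shows "(4 - (norm (x - z))\<^sup>2 / r\<^sup>2) / 3 \<le> 0"
proof -
 have "(2 * r)\<^sup>2 \<le> (norm (x - z))\<^sup>2" using assms by (intro power_mono) auto
 then show ?thesis using assms(1) by (simp add: le_divide_eq power_mult_distrib)
qed

lemma bump_0: "0 < r ==> 2 * r \<le> norm (x - z) ==> bump z r x = 0"
 unfolding bump_def by (intro smoothstep_0 bump_arg_nonpos)

lemma dbump_0: "0 < r ==> 2 * r \<le> norm (x - z) ==> dbump z r x = 0"
 unfolding dbump_def using smoothstep_0(2)[OF bump_arg_nonpos, of r x z] by simp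

lemma norm_dbump_le:
 assumes "0 < r"
 shows "norm (dbump z r x) \<le> 3 / r"
proof (cases "2 * r \<le> norm (x - z)")
 case False
 have "norm (dbump z r x) \<le> 2 * (2 / (3 * r\<^sup>2) * norm (x - z))"
  unfolding dbump_def norm_scaleR by (intro mult_mono abs_dsmoothstep) auto
 also have "\<dots> \<le> 2 * (2 / (3 * r\<^sup>2) * (2 * r))"
  using False by (intro mult_left_mono) auto
 also have "\<dots> \<le> 3 / r" using assms by (simp add: field_simps power2_eq_square)
 finally show ?thesis .
qed (use assms in \<open>simp add: dbump_0\<close>)

lemma continuous_on_GDERIV:
 "(\<And>x. x \<in> S ==> GDERIV f x :> D x) ==> continuous_on S f"
 by (intro continuous_at_imp_continuous_on ballI differentiable_imp_continuous_within)
  (auto simp: gderiv_def differentiable_def)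

section \<open>Potentials of differentiable densities\<close>

lemma bounded_of_compact_support:
 fixes g :: "'a::euclidean_space => 'b::real_normed_vector"
 assumes "continuous_on UNIV g" "\<And>x. x \<notin> cball 0 R ==> g x = 0"
 shows "\<exists>M\<ge>0. \<forall>x. norm (g x) \<le> M"
proof -
 have "compact (g ` cball 0 R)"
  by (intro compact_continuous_image continuous_on_subset[OF assms(1)]) auto
 then obtain M where M: "\<And>y. y \<in> g ` cball 0 R ==> norm y \<le> M"
  using compact_imp_bounded bounded_iff by metis
 have "norm (g x) \<le> max 0 M" for x
  using M[of "g x"] assms(2)[of x] by (cases "x \<in> cball 0 R") (auto simp: le_max_iff_disj)
 then show ?thesis by (intro exI[of _ "max 0 M"]) auto
qed

lemma uniformly_continuous_of_compact_support:
 fixes g :: "'a::euclidean_space => 'b::real_normed_vector"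
 assumes "continuous_on UNIV g" "\<And>x. x \<notin> cball 0 R ==> g x = 0" "\<eta> > 0"
 shows "\<exists>\<delta>>0. \<delta> \<le> 1 \<and> (\<forall>v w. norm (v - w) < \<delta> --> norm (g v - g w) < \<eta>)"
proof -
 have "uniformly_continuous_on (cball 0 (R + 1)) g"
  by (intro compact_uniformly_continuous continuous_on_subset[OF assms(1)]) auto
 then obtain d where d: "d > 0" "\<And>v w. v \<in> cball 0 (R + 1) ==> w \<in> cball 0 (R + 1) ==>
   dist w v < d ==> dist (g w) (g v) < \<eta>"
  using assms(3) unfolding uniformly_continuous_on_def by blast
 have "norm (g v - g w) < \<eta>" if vw: "norm (v - w) < min d 1" for v w
 proof (cases "norm v \<le> R \<or> norm w \<le> R")
  case True
  then have "norm v \<le> R + 1" "norm w \<le> R + 1"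
   using vw norm_triangle_ineq2[of v w] norm_triangle_ineq2[of w v] by (auto simp: norm_minus_commute)
  then show ?thesis using d(2)[of w v] vw by (simp add: dist_norm)
 next
  case False
  then have "g v = 0" "g w = 0" by (auto intro: assms(2))
  then show ?thesis using assms(3) by simp
 qed
 then show ?thesis using d(1) by (intro exI[of _ "min d 1"]) auto
qed

definition locally_integrable :: "(real ^ 'n::finite => real) => bool" where
 "locally_integrable G \<longleftrightarrow> G \<in> borel_measurable borel \<and>
   (\<forall>r. (\<integral>\<^sup>+z. ennreal \<bar>G z\<bar> * indicator (ball 0 r) z \<partial>lborel) < \<infinity>)"

lemma kernel_class_locally_integrable:
 fixes G :: "real ^ 'n::finite => real"
 assumes G: "kernel_class k d G" and d: "- real CARD('n) < d" "d \<le> 0"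
 shows "locally_integrable G"
 unfolding locally_integrable_def
proof (intro conjI allI)
 show Gm: "G \<in> borel_measurable borel" by (rule kernel_class_measurable[OF G])
 fix r :: real
 obtain A where A: "\<And>z. z \<noteq> 0 ==> \<bar>G z\<bar> \<le> A * norm z powr d"
  using kernel_class_bound[OF G] by blast
 obtain C where C: "C > 0" "\<And>(x::real^'n) \<rho>. 0 < \<rho> ==>
  (\<integral>\<^sup>+w. ennreal (norm (x - w) powr d) * indicator (ball x \<rho>) w \<partial>lborel) \<le> ennreal (C * \<rho> powr (d + real CARD('n)))"
  using nn_integral_near_powr[where 'n = 'n, of "d + real CARD('n)"] d by auto
 define \<rho> :: real where "\<rho> = max r 1"
 have \<rho>: "0 < \<rho>" "ball 0 r \<subseteq> ball 0 \<rho>" by (auto simp: \<rho>_def)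
 have m: "(\<lambda>z. ennreal (norm (0 - z) powr d) * indicator (ball 0 \<rho>) (z :: real^'n)) \<in> borel_measurable lborel"
  using measurable_norm_powr[of d] by (intro borel_measurable_times_ennreal) (simp_all add: borel_measurable_indicator)
 have "(\<integral>\<^sup>+z. ennreal \<bar>G z\<bar> * indicator (ball 0 r) z \<partial>lborel)
   \<le> (\<integral>\<^sup>+z. ennreal \<bar>A\<bar> * (ennreal (norm (0 - z) powr d) * indicator (ball 0 \<rho>) (z::real^'n)) \<partial>lborel)"
 proof (rule nn_integral_mono_AE[OF AE_mp[OF AE_neq[where x = "0 :: real ^ 'n"] AE_I2[OF impI]]])
  fix z :: "real ^ 'n" assume "z \<noteq> 0"
  from le_abs_mult[OF A[OF this]]
  have "ennreal \<bar>G z\<bar> \<le> ennreal \<bar>A\<bar> * ennreal (norm (0 - z) powr d)"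
   by (simp add: ennreal_mult[symmetric] ennreal_leI)
  then show "ennreal \<bar>G z\<bar> * indicator (ball 0 r) z \<le> ennreal \<bar>A\<bar> * (ennreal (norm (0 - z) powr d) * indicator (ball 0 \<rho>) z)"
   by (auto simp: indicator_def \<rho>_def)
 qed
 also have "\<dots> = ennreal \<bar>A\<bar> * (\<integral>\<^sup>+z. ennreal (norm (0 - z) powr d) * indicator (ball 0 \<rho>) (z::real^'n) \<partial>lborel)"
  by (rule nn_integral_cmult[OF m])
 also have "\<dots> \<le> ennreal \<bar>A\<bar> * ennreal (C * \<rho> powr (d + real CARD('n)))"
  by (intro mult_left_mono C(2) \<rho>(1)) simp
 also have "\<dots> < \<infinity>" by (simp add: ennreal_mult_less_top)
 finally show "(\<integral>\<^sup>+z. ennreal \<bar>G z\<bar> * indicator (ball 0 r) z \<partial>lborel) < \<infinity>" .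
qed

lemma pot_flip:
 fixes G g :: "real ^ 'n::finite => real"
 assumes "G \<in> borel_measurable borel" "g \<in> borel_measurable borel"
 shows "pot G g x = (LINT z|lborel. G z * g (x - z))"
 unfolding pot_def
 using integral_lborel_affine[of "-1" "\<lambda>y. G (x - y) * g y" x] measurable_pot_integrand[OF assms, of x]
 by simp

lemma bounded_density_integrable:
 fixes G g :: "real ^ 'n::finite => real"
 assumes G: "locally_integrable G" and g: "g \<in> borel_measurable borel"
  and M: "\<And>y. \<bar>g y\<bar> \<le> M" and z: "\<And>y. y \<notin> cball 0 R ==> g y = 0"
 shows "integrable lborel (\<lambda>z. G z * g (x - z))"
proof -
 have Gm: "G \<in> borel_measurable borel" using G by (simp add: locally_integrable_def)
 have M0: "0 \<le> M" using M[of 0] by simp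
 let ?r = "R + norm x + 1"
 have "(\<integral>\<^sup>+z. ennreal \<bar>G z * g (x - z)\<bar> \<partial>lborel)
   \<le> (\<integral>\<^sup>+z. ennreal M * (ennreal \<bar>G z\<bar> * indicator (ball 0 ?r) z) \<partial>lborel)"
 proof (rule nn_integral_mono)
  fix z
  show "ennreal \<bar>G z * g (x - z)\<bar> \<le> ennreal M * (ennreal \<bar>G z\<bar> * indicator (ball 0 ?r) z)"
  proof (cases "z \<in> ball 0 ?r")
   case True
   have "\<bar>G z * g (x - z)\<bar> \<le> M * \<bar>G z\<bar>"
    using mult_left_mono[OF M[of "x - z"], of "\<bar>G z\<bar>"] by (simp add: abs_mult mult.commute)
   then show ?thesis using True M0 by (simp add: ennreal_mult[symmetric] ennreal_leI)
  next
   case False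
   then have "x - z \<notin> cball 0 R" using norm_triangle_ineq2[of z x] by (simp add: norm_minus_commute)
   then show ?thesis using z by simp
  qed
 qed
 also have "\<dots> = ennreal M * (\<integral>\<^sup>+z. ennreal \<bar>G z\<bar> * indicator (ball 0 ?r) z \<partial>lborel)"
  using Gm by (intro nn_integral_cmult borel_measurable_times_ennreal) (simp_all add: borel_measurable_indicator)
 also have "\<dots> < \<infinity>" using G by (simp add: locally_integrable_def ennreal_mult_less_top)
 finally have fin: "(\<integral>\<^sup>+z. ennreal \<bar>G z * g (x - z)\<bar> \<partial>lborel) < \<infinity>" .
 have "(\<lambda>z. G z * g (x - z)) \<in> borel_measurable borel"
  by (rule borel_measurable_times[OF Gm measurable_reflect[OF g]])
 then show ?thesis using fin by (simp add: integrable_iff_bounded)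
qed

lemma GDERIV_zero_off_support:
 fixes g :: "real ^ 'n::finite => real"
 assumes "\<And>x. GDERIV g x :> D x" "\<And>x. x \<notin> cball 0 R ==> g x = 0" "x \<notin> cball 0 R"
 shows "D x = 0"
proof -
 have "GDERIV g x :> 0"
  by (rule GDERIV_transform_open[OF GDERIV_const[of 0], of "- cball 0 R"]) (use assms in auto)
 then show ?thesis using gradient_eq assms(1) by metis
qed

text \<open>Translating the integration variable puts the derivative on the density, so that nothing but local
 integrability is required of the kernel.\<close>

lemma GDERIV_pot_density:
 fixes G g :: "real ^ 'n::finite => real"
 assumes G: "locally_integrable G"
  and D: "\<And>x. GDERIV g x :> D x" and Dc: "continuous_on UNIV D"
  and z: "\<And>x. x \<notin> cball 0 R ==> g x = 0"
 shows "GDERIV (pot G g) x :> (\<chi> i. pot G (\<lambda>y. D y $ i) x)"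
proof -
 have Gm: "G \<in> borel_measurable borel" using G by (simp add: locally_integrable_def)
 have Dz: "D x = 0" if "x \<notin> cball 0 R" for x
  by (rule GDERIV_zero_off_support[OF D z that])
 have gc: "continuous_on UNIV g" by (rule continuous_on_GDERIV[OF D])
 have gm: "g \<in> borel_measurable borel" by (rule borel_measurable_continuous_onI[OF gc])
 have Dm: "(\<lambda>y. D y $ i) \<in> borel_measurable borel" for i
  by (rule borel_measurable_continuous_onI[OF continuous_on_component[OF Dc]])
 obtain M where M: "\<And>y. norm (g y) \<le> M" using bounded_of_compact_support[OF gc z] by blast
 obtain M' where M': "\<And>y. norm (D y) \<le> M'" using bounded_of_compact_support[OF Dc Dz] by blast
 have Mi: "\<bar>D y $ i\<bar> \<le> M'" for y i
  using order_trans[OF component_le_norm_cart M'] .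
 have int: "integrable lborel (\<lambda>z. G z * g (w - z))" for w
  by (rule bounded_density_integrable[OF G gm M[unfolded real_norm_def] z])
 have inti: "integrable lborel (\<lambda>z. G z * D (w - z) $ i)" for w i
  by (rule bounded_density_integrable[OF G Dm Mi, of R]) (simp add: Dz)
 let ?V = "\<chi> i. pot G (\<lambda>y. D y $ i) x"
 have grad: "(\<lambda>z. G z * (h \<bullet> D (x - z))) = (\<lambda>z. \<Sum>i\<in>UNIV. h $ i * (G z * D (x - z) $ i))" for h
  by (simp add: fun_eq_iff inner_vec_def sum_distrib_left mult_ac)
 have int2: "integrable lborel (\<lambda>z. G z * (h \<bullet> D (x - z)))" for h
  unfolding grad by (intro Bochner_Integration.integrable_sum integrable_mult_right inti)
 have V: "h \<bullet> ?V = (LINT z|lborel. G z * (h \<bullet> D (x - z)))" for h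
  unfolding grad
  by (subst Bochner_Integration.integral_sum) (simp_all add: inti inner_vec_def pot_flip[OF Gm Dm])
 let ?r = "R + norm x + 2"
 define I where "I = enn2real (\<integral>\<^sup>+z. ennreal \<bar>G z\<bar> * indicator (ball 0 ?r) z \<partial>lborel)"
 have I: "(\<integral>\<^sup>+z. ennreal \<bar>G z\<bar> * indicator (ball 0 ?r) z \<partial>lborel) = ennreal I" "0 \<le> I"
  using G by (simp_all add: I_def locally_integrable_def)
 have "(pot G g has_derivative (\<lambda>h. h \<bullet> ?V)) (at x)"
  unfolding has_derivative_at_alt
 proof (intro conjI bounded_linear_inner_left allI impI)
  fix e :: real assume e: "0 < e"
  define \<eta> where "\<eta> = e / (I + 1)"
  have \<eta>: "0 < \<eta>" "\<eta> * I \<le> e" using e I(2) by (auto simp: \<eta>_def field_simps)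
  obtain \<delta> where \<delta>: "0 < \<delta>" "\<delta> \<le> 1" "\<And>v w. norm (v - w) < \<delta> ==> norm (D v - D w) < \<eta>"
   using uniformly_continuous_of_compact_support[OF Dc Dz \<eta>(1)] by blast
  have "norm (pot G g x' - pot G g x - (x' - x) \<bullet> ?V) \<le> e * norm (x' - x)"
   if x': "norm (x' - x) < \<delta>" for x'
  proof -
   let ?h = "x' - x"
   let ?d = "\<lambda>z. g (x' - z) - g (x - z) - ?h \<bullet> D (x - z)"
   have d: "\<bar>?d z\<bar> \<le> \<eta> * norm ?h" for z
   proof -
    obtain v where v: "v \<in> closed_segment (x - z) (x - z + ?h)"
     "g (x - z + ?h) - g (x - z) = ?h \<bullet> D v"
     using mvt_segment[of "x - z" ?h g D] D by blast
    have "norm (v - (x - z)) \<le> norm ?h"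
     using segment_bound(1)[OF v(1)] by simp
    then have "norm (D v - D (x - z)) \<le> \<eta>" using \<delta>(3)[of v "x - z"] x' by simp
    have "?d z = ?h \<bullet> (D v - D (x - z))" using v(2) by (simp add: inner_diff_right)
    also have "\<bar>\<dots>\<bar> \<le> norm ?h * norm (D v - D (x - z))" by (rule Cauchy_Schwarz_ineq2)
    also have "\<dots> \<le> norm ?h * \<eta>" using \<open>norm (D v - D (x - z)) \<le> \<eta>\<close> by (rule mult_left_mono) simp
    finally show ?thesis by (simp add: mult.commute)
   qed
   have "pot G g x' - pot G g x - ?h \<bullet> ?V = (LINT z|lborel. G z * g (x' - z) - G z * g (x - z) - G z * (?h \<bullet> D (x - z)))"
    unfolding V pot_flip[OF Gm gm] using int int2
    by (simp add: Bochner_Integration.integral_diff)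
   then have "ennreal \<bar>pot G g x' - pot G g x - ?h \<bullet> ?V\<bar>
     \<le> (\<integral>\<^sup>+z. ennreal \<bar>G z * g (x' - z) - G z * g (x - z) - G z * (?h \<bullet> D (x - z))\<bar> \<partial>lborel)"
    by (simp only: abs_integral_le_nn_integral)
   also have "\<dots> \<le> (\<integral>\<^sup>+z. ennreal (\<eta> * norm ?h) * (ennreal \<bar>G z\<bar> * indicator (ball 0 ?r) z) \<partial>lborel)"
   proof (rule nn_integral_mono)
    fix z
    have eq: "G z * g (x' - z) - G z * g (x - z) - G z * (?h \<bullet> D (x - z)) = G z * ?d z"
     by (simp add: algebra_simps)
    show "ennreal \<bar>G z * g (x' - z) - G z * g (x - z) - G z * (?h \<bullet> D (x - z))\<bar>
      \<le> ennreal (\<eta> * norm ?h) * (ennreal \<bar>G z\<bar> * indicator (ball 0 ?r) z)"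
    proof (cases "z \<in> ball 0 ?r")
     case True
     have "\<bar>G z * ?d z\<bar> \<le> \<eta> * norm ?h * \<bar>G z\<bar>"
      using mult_left_mono[OF d[of z], of "\<bar>G z\<bar>"] by (simp add: abs_mult mult_ac)
     then show ?thesis unfolding eq using True \<eta>(1) by (simp add: ennreal_mult[symmetric] ennreal_leI)
    next
     case False
     then have 1: "R + 2 \<le> norm (x - z)" using norm_triangle_ineq2[of z x] by (simp add: norm_minus_commute)
     have "norm (x - z) \<le> norm (x' - z) + norm ?h"
      using norm_triangle_ineq[of "x' - z" "x - x'"] by (simp add: norm_minus_commute)
     then have "R < norm (x' - z)" using 1 x' \<delta>(2) by simp
     then have "?d z = 0" using 1 z[of "x' - z"] z[of "x - z"] Dz[of "x - z"] by simp
     then show ?thesis unfolding eq by simp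
    qed
   qed
   also have "\<dots> = ennreal (\<eta> * norm ?h) * ennreal I"
    unfolding I(1)[symmetric] using Gm
    by (intro nn_integral_cmult borel_measurable_times_ennreal) (simp_all add: borel_measurable_indicator)
   also have "\<dots> = ennreal (\<eta> * norm ?h * I)" using \<eta>(1) I(2) by (simp add: ennreal_mult)
   finally have "\<bar>pot G g x' - pot G g x - ?h \<bullet> ?V\<bar> \<le> \<eta> * norm ?h * I"
    using \<eta>(1) I(2) by simp
   also have "\<dots> \<le> e * norm ?h" using mult_right_mono[OF \<eta>(2), of "norm ?h"] by (simp add: mult_ac)
   finally show ?thesis by simp
  qed
  then show "\<exists>d>0. \<forall>y. norm (y - x) < d --> norm (pot G g y - pot G g x - (y - x) \<bullet> ?V) \<le> e * norm (y - x)"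
   using \<delta>(1) by blast
 qed
 then show ?thesis by (simp add: gderiv_def)
qed

section \<open>The Laplacian of a Newtonian potential\<close>

lemma measurable_qpow: "qpow c a \<in> borel_measurable (borel :: (real ^ 'n::finite) measure)"
 unfolding qpow_def by measurable

lemma continuous_on_qpow:
 assumes "0 < c"
 shows "continuous_on UNIV (qpow c a :: 'a::real_inner => real)"
proof -
 have "c + (norm x)\<^sup>2 \<noteq> 0" for x :: 'a using assms zero_le_power2[of "norm x"] by linarith
 then show ?thesis unfolding qpow_def[abs_def] by (intro continuous_intros) auto
qed

lemma qdom_pos: "0 < c ==> 0 < c + (norm x)\<^sup>2"
 using zero_le_power2[of "norm x"] by linarith

lemma qpow_antimono:
 assumes "c \<le> c'" "0 < c + (norm x)\<^sup>2" "a \<le> 0"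
 shows "qpow c' a x \<le> qpow c a x"
 unfolding qpow_def using assms by (intro powr_mono2') auto

lemma qpow_le_norm: "0 \<le> c ==> a \<le> 0 ==> x \<noteq> 0 ==> qpow c a x \<le> norm x powr (2 * a)"
 using qpow_antimono[of 0 c x a] by (simp add: norm_powr_eq_qpow)

lemma qpow_integrable:
 assumes c: "0 < c" and b: "real CARD('n::finite) < 2 * b"
 shows "integrable lborel (qpow c (- b) :: real ^ 'n => real)"
proof -
 obtain C where C: "C > 0" "\<And>(x::real^'n) \<rho>. 0 < \<rho> ==>
  (\<integral>\<^sup>+y. ennreal (norm (x - y) powr (- (2 * b - real CARD('n)) - real CARD('n))) * indicator (- ball x \<rho>) y \<partial>lborel)
   \<le> ennreal (C * \<rho> powr (- (2 * b - real CARD('n))))"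
  using nn_integral_far_powr[where 'n = 'n, of "2 * b - real CARD('n)"] b by auto
 let ?f = "\<lambda>y::real^'n. ennreal (norm (0 - y) powr (- (2 * b - real CARD('n)) - real CARD('n))) * indicator (- ball 0 1) y"
 have m: "?f \<in> borel_measurable lborel"
  using measurable_reflect[OF measurable_norm_powr[of "- (2 * b - real CARD('n)) - real CARD('n)"], of 0]
  by (intro borel_measurable_times_ennreal) (simp_all add: borel_measurable_indicator)
 have "(\<integral>\<^sup>+y. ennreal \<bar>qpow c (- b) (y::real^'n)\<bar> \<partial>lborel)
   \<le> (\<integral>\<^sup>+y. ennreal (c powr (- b)) * indicator (ball 0 1) y + ?f y \<partial>lborel)"
 proof (rule nn_integral_mono)
  fix y :: "real ^ 'n"
  show "ennreal \<bar>qpow c (- b) y\<bar> \<le> ennreal (c powr (- b)) * indicator (ball 0 1) y + ?f y"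
  proof (cases "y \<in> ball 0 1")
   case True
   have "qpow c (- b) y \<le> c powr (- b)"
    unfolding qpow_def using c b by (intro powr_mono2') auto
   then show ?thesis using True by (simp add: ennreal_leI)
  next
   case False
   then have "qpow c (- b) y \<le> norm y powr (2 * - b)"
    using c b by (intro qpow_le_norm) auto
   then show ?thesis using False by (simp add: ennreal_leI)
  qed
 qed
 also have "\<dots> = (\<integral>\<^sup>+y. ennreal (c powr (- b)) * indicator (ball 0 1) (y::real^'n) \<partial>lborel) + (\<integral>\<^sup>+y. ?f y \<partial>lborel)"
  using m by (intro nn_integral_add borel_measurable_times_ennreal) (simp_all add: borel_measurable_indicator)
 also have "\<dots> \<le> ennreal (c powr (- b)) * emeasure lborel (ball (0::real^'n) 1) + ennreal (C * 1 powr (- (2 * b - real CARD('n))))"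
  by (intro add_mono C(2)) (simp_all add: nn_integral_cmult_indicator)
 also have "\<dots> < \<infinity>"
  using emeasure_lborel_ball_finite[of "0::real^'n" 1] by (simp add: ennreal_mult_less_top)
 finally show ?thesis using measurable_qpow[of c "- b"] by (simp add: integrable_iff_bounded)
qed

lemma continuous_locally_integrable:
 assumes c: "continuous_on UNIV (G :: real ^ 'n::finite => real)"
 shows "locally_integrable G"
 unfolding locally_integrable_def
proof (intro conjI allI)
 show "G \<in> borel_measurable borel" by (rule borel_measurable_continuous_onI[OF c])
 fix r :: real
 have "compact (G ` cball 0 r)"
  by (intro compact_continuous_image continuous_on_subset[OF c]) auto
 then obtain M where M: "\<And>y. y \<in> G ` cball 0 r ==> norm y \<le> M"
  using compact_imp_bounded bounded_iff by metis
 have "(\<integral>\<^sup>+z. ennreal \<bar>G z\<bar> * indicator (ball 0 r) z \<partial>lborel)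
   \<le> (\<integral>\<^sup>+z. ennreal M * indicator (ball 0 r) (z::real^'n) \<partial>lborel)"
  using M by (intro nn_integral_mono) (auto simp: indicator_def intro!: ennreal_leI)
 also have "\<dots> = ennreal M * emeasure lborel (ball (0::real^'n) r)"
  by (rule nn_integral_cmult_indicator) simp
 also have "\<dots> < \<infinity>"
  using emeasure_lborel_ball_finite[of "0::real^'n" r] by (simp add: ennreal_mult_less_top)
 finally show "(\<integral>\<^sup>+z. ennreal \<bar>G z\<bar> * indicator (ball 0 r) z \<partial>lborel) < \<infinity>" .
qed

lemma integral_partial_eq_0:
 fixes g :: "real ^ 'n::finite => real"
 assumes "\<And>x. GDERIV g x :> D x" "continuous_on UNIV D" "\<And>x. x \<notin> cball 0 R ==> g x = 0"
 shows "(LINT y|lborel. D y $ i) = 0"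
proof -
 have l: "locally_integrable (\<lambda>z::real^'n. 1)"
  by (rule continuous_locally_integrable) simp
 have "GDERIV (pot (\<lambda>z. 1) g) 0 :> (\<chi> i. pot (\<lambda>z. 1) (\<lambda>y. D y $ i) 0)"
  by (rule GDERIV_pot_density[OF l assms])
 moreover have "pot (\<lambda>z::real^'n. 1) g = (\<lambda>x. LINT y|lborel. g y)" by (simp add: pot_def fun_eq_iff)
 ultimately have "GDERIV (\<lambda>x. LINT y|lborel. g y) (0::real^'n) :> (\<chi> i. pot (\<lambda>z. 1) (\<lambda>y. D y $ i) 0)" by simp
 from partial_eq[OF this, of i] show ?thesis by (simp add: pot_def)
qed

lemma pot_by_parts:
 fixes g H :: "real ^ 'n::finite => real"
 assumes g: "\<And>x. GDERIV g x :> D x" "continuous_on UNIV D" "\<And>x. x \<notin> cball 0 R ==> g x = 0"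
  and H: "\<And>x. GDERIV H x :> E x" "continuous_on UNIV E"
 shows "pot H (\<lambda>y. D y $ i) x = pot (\<lambda>z. E z $ i) g x"
proof -
 have gc: "continuous_on UNIV g" by (rule continuous_on_GDERIV[OF g(1)])
 have Hc: "continuous_on UNIV H" by (rule continuous_on_GDERIV[OF H(1)])
 have Dz: "D x = 0" if "x \<notin> cball 0 R" for x by (rule GDERIV_zero_off_support[OF g(1,3) that])
 obtain M where M: "\<And>y. norm (g y) \<le> M" using bounded_of_compact_support[OF gc g(3)] by blast
 obtain M' where M': "\<And>y. norm (D y) \<le> M'" using bounded_of_compact_support[OF g(2) Dz] by blast
 have Mi: "\<bar>D y $ i\<bar> \<le> M'" for y using order_trans[OF component_le_norm_cart M'] .
 have gm: "g \<in> borel_measurable borel" by (rule borel_measurable_continuous_onI[OF gc])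
 have Hm: "H \<in> borel_measurable borel" by (rule borel_measurable_continuous_onI[OF Hc])
 have Dc: "continuous_on UNIV (\<lambda>y. D y $ i)" by (rule continuous_on_component[OF g(2)])
 have Ec: "continuous_on UNIV (\<lambda>y. E y $ i)" by (rule continuous_on_component[OF H(2)])
 have Dm: "(\<lambda>y. D y $ i) \<in> borel_measurable borel" by (rule borel_measurable_continuous_onI[OF Dc])
 have Em: "(\<lambda>y. E y $ i) \<in> borel_measurable borel" by (rule borel_measurable_continuous_onI[OF Ec])
 have i1: "integrable lborel (\<lambda>z. H z * D (x - z) $ i)"
  by (rule bounded_density_integrable[OF continuous_locally_integrable[OF Hc] Dm Mi, of R]) (simp add: Dz)
 have i2: "integrable lborel (\<lambda>z. E z $ i * g (x - z))"
  by (rule bounded_density_integrable[OF continuous_locally_integrable[OF Ec] gm M[unfolded real_norm_def] g(3)])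
 have refl: "GDERIV (\<lambda>z. g (x - z)) z :> - D (x - z)" for z
 proof -
  have "((\<lambda>z. x - z) has_derivative (\<lambda>h. - h)) (at z)" by (auto intro!: derivative_eq_intros)
  from has_derivative_compose[OF this g(1)[of "x - z", unfolded gderiv_def]] show ?thesis
   by (simp add: gderiv_def)
 qed
 have F: "GDERIV (\<lambda>z. H z * g (x - z)) z :> H z *\<^sub>R (- D (x - z)) + g (x - z) *\<^sub>R E z" for z
  by (intro GDERIV_mult H refl)
 have "(LINT z|lborel. (H z *\<^sub>R (- D (x - z)) + g (x - z) *\<^sub>R E z) $ i) = 0"
 proof (rule integral_partial_eq_0[OF F])
  show "continuous_on UNIV (\<lambda>z. H z *\<^sub>R (- D (x - z)) + g (x - z) *\<^sub>R E z)"
   by (intro continuous_intros Hc H(2) continuous_on_compose2[OF gc] continuous_on_compose2[OF g(2)]) auto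
  show "H z * g (x - z) = 0" if "z \<notin> cball 0 (R + norm x)" for z
  proof -
   have "x - z \<notin> cball 0 R" using that norm_triangle_ineq2[of z x] by (simp add: norm_minus_commute)
   then show ?thesis using g(3) by simp
  qed
 qed
 then have "(LINT z|lborel. E z $ i * g (x - z) - H z * D (x - z) $ i) = 0"
  by (simp add: mult.commute algebra_simps)
 then have "(LINT z|lborel. E z $ i * g (x - z)) = (LINT z|lborel. H z * D (x - z) $ i)"
  using i1 i2 by (simp add: Bochner_Integration.integral_diff)
 then show ?thesis by (simp add: pot_flip[OF Hm Dm] pot_flip[OF Em gm])
qed

text \<open>The total mass of minus the Laplacian of \<open>(1 + |z|^2) powr (1 - n/2)\<close>, which is \<open>n - 2\<close> times the
 area of the unit sphere.\<close>

definition newton_const :: "'n::finite itself => real" where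
 "newton_const _ = (LINT z::real^'n|lborel.
   real CARD('n) * (real CARD('n) - 2) * qpow 1 (- 1 - real CARD('n) / 2) z)"

lemma newton_const_integrable:
 "integrable lborel (\<lambda>z::real^'n::finite. real CARD('n) * (real CARD('n) - 2) * qpow 1 (- 1 - real CARD('n) / 2) z)"
 using qpow_integrable[where 'n = 'n, of 1 "1 + real CARD('n) / 2"]
 by (intro integrable_mult_right) (simp add: algebra_simps)

lemma newton_const_pos:
 assumes n: "CARD('n::finite) \<ge> 3"
 shows "0 < newton_const TYPE('n)"
proof -
 let ?\<rho> = "\<lambda>z::real^'n. real CARD('n) * (real CARD('n) - 2) * qpow 1 (- 1 - real CARD('n) / 2) z"
 have pos: "0 < ?\<rho> z" for z using n by (simp add: qpow_pos qdom_pos)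
 have "newton_const TYPE('n) \<ge> 0"
  unfolding newton_const_def using pos by (intro Bochner_Integration.integral_nonneg) (simp add: less_imp_le)
 moreover have "newton_const TYPE('n) \<noteq> 0"
 proof
  assume "newton_const TYPE('n) = 0"
  then have z: "(LINT z|lborel. ?\<rho> z) = 0" by (simp only: newton_const_def)
  have "AE z in lborel. 0 \<le> ?\<rho> z" using pos by (intro AE_I2) (simp only: less_imp_le)
  from iffD1[OF integral_nonneg_eq_0_iff_AE[OF newton_const_integrable this] z]
  have "AE z in lborel. ?\<rho> z = 0" .
  then have "AE z in (lborel :: (real^'n) measure). False"
   by (rule eventually_mono) (metis pos less_irrefl)
  then show False by (simp add: AE_iff_null null_sets_def)
 qed
 ultimately show ?thesis by simp
qed

lemma GDERIV_partial_qpow_continuous: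
 fixes c a :: real
 assumes "0 < c"
 shows "continuous_on UNIV (\<lambda>x::real^'n::finite. (2 * a * qpow c (a - 1) x) *\<^sub>R axis i 1
   + (4 * a * (a - 1) * x $ i * qpow c (a - 2) x) *\<^sub>R x)"
 by (intro continuous_intros continuous_on_qpow assms)

text \<open>The kernel \<open>(c + |z|^2) powr (1 - n/2)\<close> is smooth and its Laplacian is minus a multiple of
 an approximate identity, so integrating by parts and letting \<open>c\<close> tend to zero avoids any
 surface integral.\<close>

lemma newton_regularised:
 fixes g :: "real ^ 'n::finite => real"
 assumes g: "\<And>x. GDERIV g x :> D x" "continuous_on UNIV D" "\<And>x. x \<notin> cball 0 R ==> g x = 0"
  and \<epsilon>: "0 < \<epsilon>"
 shows "(\<Sum>i\<in>UNIV. pot (partial i (qpow (\<epsilon>\<^sup>2) (1 - real CARD('n) / 2))) (\<lambda>y. D y $ i) x)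
  = - (LINT w|lborel. (real CARD('n) * (real CARD('n) - 2) * qpow 1 (- 1 - real CARD('n) / 2) w) * g (x - \<epsilon> *\<^sub>R w))"
proof -
 let ?n = "real CARD('n)"
 let ?a = "1 - ?n / 2"
 let ?G = "qpow (\<epsilon>\<^sup>2) ?a :: real ^ 'n => real"
 let ?E = "\<lambda>i x::real^'n. (2 * ?a * qpow (\<epsilon>\<^sup>2) (?a - 1) x) *\<^sub>R axis i 1
   + (4 * ?a * (?a - 1) * x $ i * qpow (\<epsilon>\<^sup>2) (?a - 2) x) *\<^sub>R x"
 have \<epsilon>2: "0 < \<epsilon>\<^sup>2" using \<epsilon> by simp
 have gc: "continuous_on UNIV g" by (rule continuous_on_GDERIV[OF g(1)])
 have gm: "g \<in> borel_measurable borel" by (rule borel_measurable_continuous_onI[OF gc])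
 obtain M where M: "\<And>y. norm (g y) \<le> M" using bounded_of_compact_support[OF gc g(3)] by blast
 have dE: "GDERIV (partial i ?G) z :> ?E i z" for i z
  by (rule GDERIV_partial_qpow[OF qdom_pos[OF \<epsilon>2]])
 have cE: "continuous_on UNIV (?E i)" for i by (rule GDERIV_partial_qpow_continuous[OF \<epsilon>2])
 have cEi: "continuous_on UNIV (\<lambda>z. ?E i z $ i)" for i by (rule continuous_on_component[OF cE])
 have Em: "(\<lambda>z. ?E i z $ i) \<in> borel_measurable borel" for i
  by (rule borel_measurable_continuous_onI[OF cEi])
 have int: "integrable lborel (\<lambda>z. ?E i z $ i * g (x - z))" for i
  by (rule bounded_density_integrable[OF continuous_locally_integrable[OF cEi] gm M[unfolded real_norm_def] g(3)])
 have lap: "(\<Sum>i\<in>UNIV. ?E i z $ i) = - (?n * (?n - 2) * \<epsilon>\<^sup>2 * qpow (\<epsilon>\<^sup>2) (- 1 - ?n / 2) z)" for z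
 proof -
  have "(\<Sum>i\<in>UNIV. ?E i z $ i) = laplacian ?G z"
   unfolding laplacian_def by (intro sum.cong refl) (rule partial_eq[OF dE, symmetric])
  also have "\<dots> = 2 * ?a * (?n + 2 * ?a - 2) * qpow (\<epsilon>\<^sup>2) (?a - 1) z
   - 4 * ?a * (?a - 1) * \<epsilon>\<^sup>2 * qpow (\<epsilon>\<^sup>2) (?a - 2) z"
   by (rule laplacian_qpow[OF qdom_pos[OF \<epsilon>2]])
  also have "\<dots> = - (?n * (?n - 2) * \<epsilon>\<^sup>2 * qpow (\<epsilon>\<^sup>2) (- 1 - ?n / 2) z)"
  proof -
   have 1: "?n + 2 * ?a - 2 = 0" by simp
   have 2: "?a - 2 = - 1 - ?n / 2" by simp
   have 3: "4 * ?a * (?a - 1) = ?n * (?n - 2)" by (simp add: field_simps)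
   show ?thesis unfolding 1 2 3 by simp
  qed
  finally show ?thesis .
 qed
 have "(\<Sum>i\<in>UNIV. pot (partial i ?G) (\<lambda>y. D y $ i) x) = (\<Sum>i\<in>UNIV. (LINT z|lborel. ?E i z $ i * g (x - z)))"
  by (intro sum.cong refl) (simp only: pot_by_parts[OF g dE cE] pot_flip[OF Em gm])
 also have "\<dots> = (LINT z|lborel. (\<Sum>i\<in>UNIV. ?E i z $ i * g (x - z)))"
  by (rule Bochner_Integration.integral_sum[symmetric]) (rule int)
 also have "\<dots> = (LINT z|lborel. - (?n * (?n - 2) * \<epsilon>\<^sup>2 * qpow (\<epsilon>\<^sup>2) (- 1 - ?n / 2) z) * g (x - z))"
  by (simp only: sum_distrib_right[symmetric] lap)
 also have "\<dots> = \<bar>\<epsilon>\<bar> ^ DIM(real^'n) * (LINT w|lborel. - (?n * (?n - 2) * \<epsilon>\<^sup>2 * qpow (\<epsilon>\<^sup>2) (- 1 - ?n / 2) (0 + \<epsilon> *\<^sub>R w)) * g (x - (0 + \<epsilon> *\<^sub>R w)))"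
  using \<epsilon> measurable_reflect[OF gm, of x] measurable_qpow[where 'n = 'n]
  by (intro integral_lborel_affine borel_measurable_times borel_measurable_uminus) auto
 also have "\<dots> = (LINT w|lborel. \<epsilon> ^ CARD('n) * (- (?n * (?n - 2) * \<epsilon>\<^sup>2 * qpow (\<epsilon>\<^sup>2) (- 1 - ?n / 2) (\<epsilon> *\<^sub>R w)) * g (x - \<epsilon> *\<^sub>R w)))"
  using \<epsilon> by (subst integral_mult_right_zero) simp
 also have "\<dots> = (LINT w|lborel. - ((?n * (?n - 2) * qpow 1 (- 1 - ?n / 2) w) * g (x - \<epsilon> *\<^sub>R w)))"
 proof (rule Bochner_Integration.integral_cong[OF refl])
  fix w :: "real ^ 'n"
  have "qpow (\<epsilon>\<^sup>2) (- 1 - ?n / 2) (\<epsilon> *\<^sub>R w) = (\<epsilon>\<^sup>2 * (1 + (norm w)\<^sup>2)) powr (- 1 - ?n / 2)"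
   using \<epsilon> by (simp add: qpow_def power_mult_distrib distrib_left)
  also have "\<dots> = (\<epsilon>\<^sup>2) powr (- 1 - ?n / 2) * qpow 1 (- 1 - ?n / 2) w"
   by (simp add: powr_mult qpow_def)
  finally have q: "qpow (\<epsilon>\<^sup>2) (- 1 - ?n / 2) (\<epsilon> *\<^sub>R w) = (\<epsilon>\<^sup>2) powr (- 1 - ?n / 2) * qpow 1 (- 1 - ?n / 2) w" .
  have "\<epsilon> ^ CARD('n) * \<epsilon>\<^sup>2 * (\<epsilon>\<^sup>2) powr (- 1 - ?n / 2) = (\<epsilon>\<^sup>2) powr (?n / 2) * (\<epsilon>\<^sup>2) powr 1 * (\<epsilon>\<^sup>2) powr (- 1 - ?n / 2)"
   using \<epsilon> by (simp add: powr_powr powr_realpow flip: powr_numeral)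
  also have "\<dots> = 1" using \<epsilon> by (simp only: powr_add[symmetric]) simp
  finally have e: "\<epsilon> ^ CARD('n) * \<epsilon>\<^sup>2 * (\<epsilon>\<^sup>2) powr (- 1 - ?n / 2) = 1" .
  have "\<epsilon> ^ CARD('n) * (- (?n * (?n - 2) * \<epsilon>\<^sup>2 * qpow (\<epsilon>\<^sup>2) (- 1 - ?n / 2) (\<epsilon> *\<^sub>R w)) * g (x - \<epsilon> *\<^sub>R w))
    = - ((\<epsilon> ^ CARD('n) * \<epsilon>\<^sup>2 * (\<epsilon>\<^sup>2) powr (- 1 - ?n / 2)) * (?n * (?n - 2) * qpow 1 (- 1 - ?n / 2) w * g (x - \<epsilon> *\<^sub>R w)))"
   unfolding q by (simp only: mult_ac mult_minus_left mult_minus_right)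
  then show "\<epsilon> ^ CARD('n) * (- (?n * (?n - 2) * \<epsilon>\<^sup>2 * qpow (\<epsilon>\<^sup>2) (- 1 - ?n / 2) (\<epsilon> *\<^sub>R w)) * g (x - \<epsilon> *\<^sub>R w))
    = - (?n * (?n - 2) * qpow 1 (- 1 - ?n / 2) w * g (x - \<epsilon> *\<^sub>R w))"
   unfolding e by simp
 qed
 finally show ?thesis by simp
qed

text \<open>The limit of the regularised identity: the mass of the Laplacian of the kernel
 concentrates at the origin.\<close>

lemma newton_representation:
 fixes g :: "real ^ 'n::finite => real"
 assumes g: "\<And>x. GDERIV g x :> D x" "continuous_on UNIV D" "\<And>x. x \<notin> cball 0 R ==> g x = 0"
  and n: "CARD('n) \<ge> 3"
 shows "(\<Sum>i\<in>UNIV. pot (partial i (\<lambda>z. norm z powr (2 - real CARD('n)))) (\<lambda>y. D y $ i) x)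
  = - newton_const TYPE('n) * g x"
proof -
 let ?n = "real CARD('n)"
 let ?a = "1 - ?n / 2"
 let ?\<rho> = "\<lambda>w::real^'n. ?n * (?n - 2) * qpow 1 (- 1 - ?n / 2) w"
 define \<epsilon> :: "nat => real" where "\<epsilon> k = inverse (real (Suc k))" for k
 have \<epsilon>: "\<epsilon> k > 0" "\<epsilon> \<longlonglongrightarrow> 0" for k
  using LIMSEQ_inverse_real_of_nat by (simp_all add: \<epsilon>_def[abs_def])
 have G0: "(\<lambda>z::real^'n. norm z powr (2 - ?n)) = qpow 0 ?a"
  by (simp add: norm_powr_eq_qpow[abs_def] diff_divide_distrib)
 have gc: "continuous_on UNIV g" by (rule continuous_on_GDERIV[OF g(1)])
 have gm: "g \<in> borel_measurable borel" by (rule borel_measurable_continuous_onI[OF gc])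
 have Dz: "D x = 0" if "x \<notin> cball 0 R" for x by (rule GDERIV_zero_off_support[OF g(1,3) that])
 obtain M where M: "\<And>y. norm (g y) \<le> M" using bounded_of_compact_support[OF gc g(3)] by blast
 obtain M' where M': "\<And>y. norm (D y) \<le> M'" using bounded_of_compact_support[OF g(2) Dz] by blast
 have Mi: "\<bar>\<bar>D y $ i\<bar>\<bar> \<le> M'" for y i using order_trans[OF component_le_norm_cart M'] by simp
 have Dm: "(\<lambda>y. D y $ i) \<in> borel_measurable borel" for i
  by (rule borel_measurable_continuous_onI[OF continuous_on_component[OF g(2)]])
 have aDm: "(\<lambda>y. \<bar>D y $ i\<bar>) \<in> borel_measurable borel" for i by (rule borel_measurable_abs[OF Dm])
 have G0m: "partial i (qpow 0 ?a) \<in> borel_measurable (borel :: (real^'n) measure)" for i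
 proof -
  have "kernel_class 0 (2 * ?a - 1) (partial i (qpow 0 ?a :: real^'n => real))"
   using kernel_class_qpow[where 'n = 'n, of "Suc 0" ?a] unfolding kernel_class.simps(2) by blast
  then show ?thesis by (rule kernel_class_measurable)
 qed
 have Gm: "partial i (qpow ((\<epsilon> k)\<^sup>2) ?a) \<in> borel_measurable (borel :: (real^'n) measure)" for i k
  by (rule borel_measurable_continuous_onI[OF continuous_on_GDERIV[OF GDERIV_partial_qpow[OF qdom_pos]]])
   (rule zero_less_power[OF \<epsilon>(1)])
 have lhs: "(\<lambda>k. pot (partial i (qpow ((\<epsilon> k)\<^sup>2) ?a)) (\<lambda>y. D y $ i) x) \<longlonglongrightarrow> pot (partial i (qpow 0 ?a)) (\<lambda>y. D y $ i) x" for i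
  unfolding pot_flip[OF Gm Dm] pot_flip[OF G0m Dm]
 proof (rule integral_dominated_convergence[where w = "\<lambda>z. (?n - 2) * (norm z powr (1 - ?n) * \<bar>D (x - z) $ i\<bar>)"])
  show "(\<lambda>z. partial i (qpow 0 ?a) z * D (x - z) $ i) \<in> borel_measurable lborel"
   using borel_measurable_times[OF G0m measurable_reflect[OF Dm]] by simp
  show "(\<lambda>z. partial i (qpow ((\<epsilon> k)\<^sup>2) ?a) z * D (x - z) $ i) \<in> borel_measurable lborel" for k
   using borel_measurable_times[OF Gm measurable_reflect[OF Dm]] by simp
  have "locally_integrable (\<lambda>z::real^'n. norm z powr (1 - ?n))"
   by (rule kernel_class_locally_integrable[OF kernel_class_norm_powr[of 0]]) (use n in simp_all)
  from bounded_density_integrable[OF this aDm Mi, of R i x]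
  show "integrable lborel (\<lambda>z. (?n - 2) * (norm z powr (1 - ?n) * \<bar>D (x - z) $ i\<bar>))"
   by (intro integrable_mult_right) (simp add: Dz)
  show "AE z in lborel. (\<lambda>k. partial i (qpow ((\<epsilon> k)\<^sup>2) ?a) z * D (x - z) $ i) \<longlonglongrightarrow> partial i (qpow 0 ?a) z * D (x - z) $ i"
  proof (rule AE_mp[OF AE_neq[of "0::real^'n"]], rule AE_I2, rule impI)
   fix z :: "real^'n" assume z: "z \<noteq> 0"
   have "(\<lambda>k. 2 * ?a * z $ i * ((\<epsilon> k)\<^sup>2 + (norm z)\<^sup>2) powr (?a - 1)) \<longlonglongrightarrow> 2 * ?a * z $ i * (0\<^sup>2 + (norm z)\<^sup>2) powr (?a - 1)"
    using z by (intro tendsto_intros \<epsilon>(2)) simp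
   moreover have "partial i (qpow ((\<epsilon> k)\<^sup>2) ?a) z = 2 * ?a * z $ i * ((\<epsilon> k)\<^sup>2 + (norm z)\<^sup>2) powr (?a - 1)" for k
    by (subst partial_qpow[OF qdom_pos[OF zero_less_power[OF \<epsilon>(1)]]]) (simp only: qpow_def)
   moreover have "partial i (qpow 0 ?a) z = 2 * ?a * z $ i * (0\<^sup>2 + (norm z)\<^sup>2) powr (?a - 1)"
    using z by (subst partial_qpow) (simp_all add: qpow_def)
   ultimately have "(\<lambda>k. partial i (qpow ((\<epsilon> k)\<^sup>2) ?a) z) \<longlonglongrightarrow> partial i (qpow 0 ?a) z"
    by (simp only:)
   then show "(\<lambda>k. partial i (qpow ((\<epsilon> k)\<^sup>2) ?a) z * D (x - z) $ i) \<longlonglongrightarrow> partial i (qpow 0 ?a) z * D (x - z) $ i"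
    by (rule tendsto_mult_right)
  qed
  show "AE z in lborel. norm (partial i (qpow ((\<epsilon> k)\<^sup>2) ?a) z * D (x - z) $ i) \<le> (?n - 2) * (norm z powr (1 - ?n) * \<bar>D (x - z) $ i\<bar>)" for k
  proof (rule AE_mp[OF AE_neq[of "0::real^'n"]], rule AE_I2, rule impI)
   fix z :: "real^'n" assume z: "z \<noteq> 0"
   have e: "0 < (\<epsilon> k)\<^sup>2" using \<epsilon>(1)[of k] by simp
   have "\<bar>partial i (qpow ((\<epsilon> k)\<^sup>2) ?a) z\<bar> = (?n - 2) * \<bar>z $ i\<bar> * qpow ((\<epsilon> k)\<^sup>2) (?a - 1) z"
    unfolding partial_qpow[OF qdom_pos[OF e]] abs_mult using n by simp
   also have "\<dots> \<le> (?n - 2) * norm z * norm z powr (2 * (?a - 1))"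
    using n z e by (intro mult_mono mult_left_mono component_le_norm_cart qpow_le_norm) auto
   also have "\<dots> = (?n - 2) * norm z powr (1 - ?n)"
    using z powr_add[of "norm z" 1 "2 * (?a - 1)"] by simp
   finally show "norm (partial i (qpow ((\<epsilon> k)\<^sup>2) ?a) z * D (x - z) $ i) \<le> (?n - 2) * (norm z powr (1 - ?n) * \<bar>D (x - z) $ i\<bar>)"
    using mult_right_mono[of _ _ "\<bar>D (x - z) $ i\<bar>"] by (simp only: real_norm_def abs_mult mult.assoc[symmetric])
  qed
 qed
 have rhs: "(\<lambda>k. LINT w|lborel. ?\<rho> w * g (x - \<epsilon> k *\<^sub>R w)) \<longlonglongrightarrow> (LINT w|lborel. ?\<rho> w * g x)"
 proof (rule integral_dominated_convergence[where w = "\<lambda>w. M * ?\<rho> w"])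
  have \<rho>m: "?\<rho> \<in> borel_measurable borel"
   by (rule borel_measurable_times[OF borel_measurable_const measurable_qpow])
  show "(\<lambda>w. ?\<rho> w * g x) \<in> borel_measurable lborel"
   using borel_measurable_times[OF \<rho>m borel_measurable_const] by simp
  show "(\<lambda>w. ?\<rho> w * g (x - \<epsilon> k *\<^sub>R w)) \<in> borel_measurable lborel" for k
  proof -
   have "(\<lambda>w. g (x - \<epsilon> k *\<^sub>R w)) \<in> borel_measurable borel"
    by (rule measurable_compose[OF _ gm]) simp
   from borel_measurable_times[OF \<rho>m this] show ?thesis by simp
  qed
  show "integrable lborel (\<lambda>w. M * ?\<rho> w)" by (intro integrable_mult_right newton_const_integrable)
  show "AE w in lborel. (\<lambda>k. ?\<rho> w * g (x - \<epsilon> k *\<^sub>R w)) \<longlonglongrightarrow> ?\<rho> w * g x"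
  proof (rule AE_I2)
   fix w
   have "(\<lambda>k. x - \<epsilon> k *\<^sub>R w) \<longlonglongrightarrow> x - 0 *\<^sub>R w" by (intro tendsto_intros \<epsilon>(2))
   moreover have "isCont g x" using gc by (simp add: continuous_on_eq_continuous_at)
   ultimately have "(\<lambda>k. g (x - \<epsilon> k *\<^sub>R w)) \<longlonglongrightarrow> g x"
    by (intro isCont_tendsto_compose[of x g]) simp_all
   then show "(\<lambda>k. ?\<rho> w * g (x - \<epsilon> k *\<^sub>R w)) \<longlonglongrightarrow> ?\<rho> w * g x" by (rule tendsto_mult_left)
  qed
  show "AE w in lborel. norm (?\<rho> w * g (x - \<epsilon> k *\<^sub>R w)) \<le> M * ?\<rho> w" for k
  proof (rule AE_I2)
   fix w
   have p: "0 \<le> ?\<rho> w" using n by simp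
   have "norm (?\<rho> w * g (x - \<epsilon> k *\<^sub>R w)) = ?\<rho> w * \<bar>g (x - \<epsilon> k *\<^sub>R w)\<bar>"
    unfolding real_norm_def abs_mult[of "?\<rho> w"] abs_of_nonneg[OF p] ..
   also have "\<dots> \<le> ?\<rho> w * M" using M[of "x - \<epsilon> k *\<^sub>R w"] p by (intro mult_left_mono) simp_all
   finally show "norm (?\<rho> w * g (x - \<epsilon> k *\<^sub>R w)) \<le> M * ?\<rho> w" by (simp only: mult.commute)
  qed
 qed
 have "(\<lambda>k. \<Sum>i\<in>UNIV. pot (partial i (qpow ((\<epsilon> k)\<^sup>2) ?a)) (\<lambda>y. D y $ i) x)
   \<longlonglongrightarrow> (\<Sum>i\<in>UNIV. pot (partial i (qpow 0 ?a)) (\<lambda>y. D y $ i) x)"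
  by (intro tendsto_sum lhs)
 then have "(\<lambda>k. - (LINT w|lborel. ?\<rho> w * g (x - \<epsilon> k *\<^sub>R w)))
   \<longlonglongrightarrow> (\<Sum>i\<in>UNIV. pot (partial i (qpow 0 ?a)) (\<lambda>y. D y $ i) x)"
  by (simp only: newton_regularised[OF g \<epsilon>(1)])
 moreover have "(\<lambda>k. - (LINT w|lborel. ?\<rho> w * g (x - \<epsilon> k *\<^sub>R w))) \<longlonglongrightarrow> - (LINT w|lborel. ?\<rho> w * g x)"
  by (intro tendsto_minus rhs)
 ultimately have "(\<Sum>i\<in>UNIV. pot (partial i (qpow 0 ?a)) (\<lambda>y. D y $ i) x) = - (LINT w|lborel. ?\<rho> w * g x)"
  by (rule LIMSEQ_unique)
 also have "(LINT w|lborel. ?\<rho> w * g x) = newton_const TYPE('n) * g x"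
  unfolding newton_const_def by (rule integral_mult_left_zero)
 finally show ?thesis by (simp only: G0 mult_minus_left)
qed

section \<open>Regularity of Riesz potentials\<close>

lemma pot_add:
 fixes G f1 f2 :: "real ^ 'n::finite => real"
 assumes "kernel_class k d G" "f1 \<in> borel_measurable borel" "f2 \<in> borel_measurable borel"
  "nnpot d f1 x < \<infinity>" "nnpot d f2 x < \<infinity>"
 shows "pot G (\<lambda>y. f1 y + f2 y) x = pot G f1 x + pot G f2 x"
 unfolding pot_def distrib_left
 by (rule Bochner_Integration.integral_add[OF pot_integrable[OF assms(1,2,4)] pot_integrable[OF assms(1,3,5)]])

lemma pot_cong_off_0:
 fixes G H f :: "real ^ 'n::finite => real"
 assumes "\<And>z. z \<noteq> 0 ==> G z = H z"
  and "G \<in> borel_measurable borel" "H \<in> borel_measurable borel" "f \<in> borel_measurable borel"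
 shows "pot G f x = pot H f x"
 unfolding pot_def
proof (rule integral_cong_AE)
 show "(\<lambda>y. G (x - y) * f y) \<in> borel_measurable lborel" "(\<lambda>y. H (x - y) * f y) \<in> borel_measurable lborel"
  using measurable_pot_integrand[OF assms(2,4)] measurable_pot_integrand[OF assms(3,4)] by simp_all
 show "AE y in lborel. G (x - y) * f y = H (x - y) * f y"
  by (rule AE_mp[OF AE_neq[of x] AE_I2[OF impI]]) (simp add: assms(1))
qed

lemma tame_bounded_compact:
 fixes g :: "real ^ 'n::finite => real"
 assumes g: "g \<in> borel_measurable borel" and M: "\<And>y. \<bar>g y\<bar> \<le> M" and z: "\<And>y. y \<notin> cball 0 R ==> g y = 0"
  and d: "- real CARD('n) < d" "d \<le> 0"
 shows "tame d g UNIV"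
proof (rule tame_of_locally_bounded[OF _ _ d(2) d])
 have M0: "0 \<le> M" using M[of 0] by simp
 show "locally_bounded_on UNIV g" unfolding locally_bounded_on_def using M by (meson zero_less_one)
 have fin: "emeasure lborel (cball (0::real^'n) R) < \<infinity>" by (rule emeasure_bounded_finite) simp
 define K where "K = enn2real (ennreal M * emeasure lborel (cball (0::real^'n) R))"
 have K: "ennreal K = ennreal M * emeasure lborel (cball (0::real^'n) R)"
  using fin by (simp add: K_def ennreal_mult_less_top)
 have "nnpot 0 g x \<le> ennreal K" for x
 proof -
  have "nnpot 0 g x \<le> (\<integral>\<^sup>+y. ennreal M * indicator (cball 0 R) (y::real^'n) \<partial>lborel)"
   unfolding nnpot_def
  proof (rule nn_integral_mono)
   fix y
   have "norm (x - y) powr 0 * \<bar>g y\<bar> \<le> 1 * M"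
    using M[of y] by (intro mult_mono) auto
   then show "ennreal (norm (x - y) powr 0 * \<bar>g y\<bar>) \<le> ennreal M * indicator (cball 0 R) y"
    using z[of y] by (cases "y \<in> cball 0 R") (auto intro: ennreal_leI)
  qed
  also have "\<dots> = ennreal K" unfolding K by (rule nn_integral_cmult_indicator) simp
  finally show ?thesis .
 qed
 moreover have "0 \<le> K" by (simp add: K_def)
 ultimately show "tame 0 g UNIV" unfolding tame_def using g by (meson zero_less_one)
qed

lemma continuous_on_zero_extend:
 fixes f :: "'a::real_normed_vector => 'b::real_normed_vector"
 assumes "continuous_on S f" "open S" "closed C" "C \<subseteq> S" "\<And>x. x \<notin> C ==> f x = 0"
 shows "continuous_on UNIV f"
proof -
 have "continuous_on (- C) f" by (rule continuous_on_eq[of _ "\<lambda>_. 0"]) (use assms(5) in auto)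
 then have "continuous_on (S \<union> - C) f"
  using assms(1-3) by (intro continuous_on_open_Un) auto
 moreover have "S \<union> - C = UNIV" using assms(4) by auto
 ultimately show ?thesis by simp
qed

text \<open>Near a point where the density is differentiable it is the sum of a compactly supported
 differentiable part, through which the potential may be differentiated, and a part vanishing near
 that point, for which the kernel may be differentiated as often as desired.\<close>

lemma density_split:
 fixes f :: "real ^ 'n::finite => real"
 assumes S: "open S" and x0: "x0 \<in> S" and f: "C_k_on 1 f S" "f \<in> borel_measurable borel"
 obtains r R f1 f2 D where "0 < r" "ball x0 r \<subseteq> S" "\<And>y. f y = f1 y + f2 y"
  "\<And>y. GDERIV f1 y :> D y" "continuous_on UNIV D" "\<And>y. y \<notin> cball 0 R ==> f1 y = 0"
  "\<And>y. y \<in> ball x0 r ==> f2 y = 0" "\<And>y. \<bar>f1 y\<bar> \<le> \<bar>f y\<bar>" "\<And>y. \<bar>f2 y\<bar> \<le> \<bar>f y\<bar>"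
  "f1 \<in> borel_measurable borel" "f2 \<in> borel_measurable borel"
proof -
 obtain e where e: "0 < e" "ball x0 e \<subseteq> S" using S x0 open_contains_ball by blast
 define r where "r = e / 3"
 have r: "0 < r" using e by (simp add: r_def)
 have C: "cball x0 (2 * r) \<subseteq> S" using e by (auto simp: r_def subset_iff)
 let ?f1 = "\<lambda>y. bump x0 r y * f y" and ?f2 = "\<lambda>y. (1 - bump x0 r y) * f y"
 let ?D = "\<lambda>y. bump x0 r y *\<^sub>R gradient f y + f y *\<^sub>R dbump x0 r y"
 have b0: "bump x0 r y = 0" "dbump x0 r y = 0" if "y \<notin> cball x0 (2 * r)" for y
  using that bump_0[OF r, of y x0] dbump_0[OF r, of y x0] by (simp_all add: dist_norm norm_minus_commute)
 have bc: "continuous_on UNIV (bump x0 r)" by (rule continuous_on_GDERIV[OF GDERIV_bump])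
 have bm: "bump x0 r \<in> borel_measurable borel" by (rule borel_measurable_continuous_onI[OF bc])
 note fD = C_1_onD[OF S f(1)]
 have G: "GDERIV ?f1 y :> ?D y" for y
 proof (cases "y \<in> S")
  case True
  then show ?thesis by (intro GDERIV_mult GDERIV_bump fD)
 next
  case False
  then have y: "y \<in> - cball x0 (2 * r)" using C by auto
  have "GDERIV ?f1 y :> 0"
   by (rule GDERIV_transform_open[OF GDERIV_const[of 0] _ y]) (auto simp: b0)
  then show ?thesis using y b0[of y] by simp
 qed
 have Dc: "continuous_on UNIV ?D"
 proof (rule continuous_on_zero_extend[OF _ S closed_cball C])
  show "continuous_on S ?D"
   by (intro continuous_intros fD continuous_on_subset[OF bc] continuous_on_subset[OF continuous_dbump[OF r]]) auto
 qed (simp add: b0)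
 have b: "\<bar>bump x0 r y\<bar> \<le> 1" "\<bar>1 - bump x0 r y\<bar> \<le> 1" for y
  using bump_range[of x0 r y] by auto
 show thesis
 proof (rule that[OF r _ _ G Dc])
  show "ball x0 r \<subseteq> S" using e by (auto simp: r_def)
  show "f y = ?f1 y + ?f2 y" for y by (simp add: algebra_simps)
  show "?f1 y = 0" if "y \<notin> cball 0 (norm x0 + 2 * r)" for y
  proof -
   have "y \<notin> cball x0 (2 * r)" using that norm_triangle_ineq[of x0 "y - x0"]
    by (auto simp: dist_norm norm_minus_commute)
   then show ?thesis by (simp add: b0)
  qed
  show "?f2 y = 0" if "y \<in> ball x0 r" for y
   using that bump_1[OF r, of y x0] by (simp add: dist_norm norm_minus_commute)
  show "\<bar>?f1 y\<bar> \<le> \<bar>f y\<bar>" "\<bar>?f2 y\<bar> \<le> \<bar>f y\<bar>" for y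
   using mult_right_mono[OF b(1)[of y], of "\<bar>f y\<bar>"] mult_right_mono[OF b(2)[of y], of "\<bar>f y\<bar>"]
   by (simp_all add: abs_mult)
  show "?f1 \<in> borel_measurable borel" "?f2 \<in> borel_measurable borel"
   using f(2) bm by (simp_all add: borel_measurable_times borel_measurable_diff)
 qed
qed

lemma C_k_on_lincomb:
 fixes f g :: "real ^ 'n::finite => real"
 assumes "open S" "C_k_on k f S" "C_k_on k g S"
 shows "C_k_on k (\<lambda>x. a * f x + b * g x) S"
 using assms(2,3)
proof (induction k arbitrary: f g)
 case 0
 then show ?case by (auto intro!: continuous_intros)
next
 case (Suc k)
 have d: "GDERIV f x :> gradient f x" "GDERIV g x :> gradient g x" if "x \<in> S" for x
  using Suc.prems assms(1) that by (auto simp: differentiable_on_eq_differentiable_at intro!: gradient_GDERIV)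
 show ?case
 proof (rule C_k_on_SucI[OF assms(1)])
  show "GDERIV (\<lambda>x. a * f x + b * g x) x :> a *\<^sub>R gradient f x + b *\<^sub>R gradient g x" if "x \<in> S" for x
   by (intro GDERIV_add GDERIV_cmult d that)
  show "C_k_on k (\<lambda>x. (a *\<^sub>R gradient f x + b *\<^sub>R gradient g x) $ i) S" for i
   using Suc.IH[of "partial i f" "partial i g"] Suc.prems by simp
 qed
qed

lemma laplacian_lincomb:
 fixes f g :: "real ^ 'n::finite => real"
 assumes S: "open S" "x \<in> S" and f: "C_k_on 2 f S" and g: "C_k_on 2 g S"
 shows "laplacian (\<lambda>x. a * f x + b * g x) x = a * laplacian f x + b * laplacian g x"
proof -
 have f1: "GDERIV f y :> gradient f y" "GDERIV g y :> gradient g y" if "y \<in> S" for y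
  using f g S that by (auto simp: numeral_2_eq_2 differentiable_on_eq_differentiable_at intro!: gradient_GDERIV)
 have f2: "GDERIV (partial i f) x :> gradient (partial i f) x" "GDERIV (partial i g) x :> gradient (partial i g) x" for i
  using f g S by (auto simp: numeral_2_eq_2 differentiable_on_eq_differentiable_at intro!: gradient_GDERIV)
 have p: "partial i (\<lambda>x. a * f x + b * g x) y = a * partial i f y + b * partial i g y" if "y \<in> S" for i y
  using partial_eq[OF GDERIV_add[OF GDERIV_cmult[OF f1(1)[OF that]] GDERIV_cmult[OF f1(2)[OF that]]], of i a b]
  by simp
 have "partial i (partial i (\<lambda>x. a * f x + b * g x)) x = a * partial i (partial i f) x + b * partial i (partial i g) x" for i
 proof -
  have "partial i (partial i (\<lambda>x. a * f x + b * g x)) x = partial i (\<lambda>y. a * partial i f y + b * partial i g y) x"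
   by (rule partial_cong_open[OF S p])
  then show ?thesis
   using partial_eq[OF GDERIV_add[OF GDERIV_cmult[OF f2(1)] GDERIV_cmult[OF f2(2)]], of i a i b i] by simp
 qed
 then show ?thesis by (simp add: laplacian_def sum.distrib sum_distrib_left)
qed

lemma C_1_on_pot_density:
 fixes f G :: "real ^ 'n::finite => real"
 assumes S: "open S" and G: "kernel_class 2 (1 - real CARD('n)) G"
  and f: "C_k_on 1 f S" and t: "tame (1 - real CARD('n)) f S"
 shows "C_k_on 1 (pot G f) S"
proof (rule C_k_on_local[OF S])
 fix x0 assume x0: "x0 \<in> S"
 let ?d = "1 - real CARD('n)"
 have fm: "f \<in> borel_measurable borel" by (rule tameD_measurable[OF t])
 obtain r R f1 f2 D where s: "0 < r" "ball x0 r \<subseteq> S" "\<And>y. f y = f1 y + f2 y"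
  "\<And>y. GDERIV f1 y :> D y" "continuous_on UNIV D" "\<And>y. y \<notin> cball 0 R ==> f1 y = 0"
  "\<And>y. y \<in> ball x0 r ==> f2 y = 0" "\<And>y. \<bar>f1 y\<bar> \<le> \<bar>f y\<bar>" "\<And>y. \<bar>f2 y\<bar> \<le> \<bar>f y\<bar>"
  "f1 \<in> borel_measurable borel" "f2 \<in> borel_measurable borel"
  by (rule density_split[OF S x0 f fm]) (rule that, assumption+)
 let ?T = "ball x0 r"
 have n0: "0 < real CARD('n)" by simp
 have n1: "1 \<le> real CARD('n)" using zero_less_card_finite[where 'a = 'n] by linarith
 have G1: "kernel_class 1 ?d G" by (rule kernel_class_antimono[OF _ G]) simp
 have tT: "tame ?d f ?T" by (rule tame_subset[OF t s(2)])
 have t1: "tame ?d f1 ?T" by (rule tame_mono[OF tT s(10,8)])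
 have t2: "tame ?d f2 ?T" by (rule tame_mono[OF tT s(11,9)])
 have t2': "tame (?d - real 1 - 1/2) f2 ?T"
  by (rule tame_off_support[OF t2 open_ball s(7)]) simp_all
 have c2: "C_k_on 1 (pot G f2) ?T"
  by (rule C_k_on_pot[OF open_ball _ t2 t2']) (use G in \<open>simp add: numeral_2_eq_2\<close>)
 have li: "locally_integrable G"
  by (rule kernel_class_locally_integrable[OF G]) (use n1 in simp_all)
 have Dz: "D y = 0" if "y \<notin> cball 0 R" for y by (rule GDERIV_zero_off_support[OF s(4,6) that])
 obtain M where M: "\<And>y. norm (D y) \<le> M" using bounded_of_compact_support[OF s(5) Dz] by blast
 have Mi: "\<bar>D y $ i\<bar> \<le> M" for y i using order_trans[OF component_le_norm_cart M] .
 have Dm: "(\<lambda>y. D y $ i) \<in> borel_measurable borel" for i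
  by (rule borel_measurable_continuous_onI[OF continuous_on_component[OF s(5)]])
 have tD: "tame e (\<lambda>y. D y $ i) UNIV" if "- real CARD('n) < e" "e \<le> 0" for e i
  by (rule tame_bounded_compact[OF Dm Mi, of R]) (use that in \<open>simp_all add: Dz\<close>)
 have c1: "C_k_on 1 (pot G f1) ?T"
 proof (rule C_1_onI[OF open_ball])
  show "GDERIV (pot G f1) x :> (\<chi> i. pot G (\<lambda>y. D y $ i) x)" for x
   by (rule GDERIV_pot_density[OF li s(4,5,6)])
  have "continuous_on UNIV (pot G (\<lambda>y. D y $ i))" for i
   by (rule continuous_on_pot[OF G1 tD tD open_UNIV]) (use n1 in linarith)+
  from continuous_on_vec_lambda[OF continuous_on_subset[OF this subset_UNIV]]
  show "continuous_on ?T (\<lambda>x. \<chi> i. pot G (\<lambda>y. D y $ i) x)" .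
 qed
 have "C_k_on 1 (\<lambda>x. 1 * pot G f1 x + 1 * pot G f2 x) ?T"
  by (rule C_k_on_lincomb[OF open_ball c1 c2])
 then have "C_k_on 1 (pot G f) ?T"
 proof (rule C_k_on_cong[OF open_ball, rotated])
  fix x assume x: "x \<in> ?T"
  have "f = (\<lambda>y. f1 y + f2 y)" using s(3) by auto
  then show "1 * pot G f1 x + 1 * pot G f2 x = pot G f x"
   using pot_add[OF G s(10,11) tame_finite[OF t1 x] tame_finite[OF t2 x]] by simp
 qed
 then show "\<exists>T. open T \<and> x0 \<in> T \<and> C_k_on 1 (pot G f) T"
  using s(1) by (intro exI[of _ ?T]) simp
qed

lemma C_k_on_pot_density:
 fixes f G :: "real ^ 'n::finite => real"
 assumes S: "open S" and G: "kernel_class (k + 2) (real k + 1 - real CARD('n)) G"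
  and f: "C_k_on 1 f S"
  and t: "\<And>e. - real CARD('n) < e ==> e \<le> real k + 1 - real CARD('n) ==> tame e f S"
 shows "C_k_on (k + 1) (pot G f) S"
 using G t
proof (induction k arbitrary: G)
 case 0
 then show ?case using C_1_on_pot_density[OF S _ f, of G] by (simp add: numeral_2_eq_2)
next
 case (Suc k)
 have G2: "kernel_class 2 (real (Suc k) + 1 - real CARD('n)) G"
  by (rule kernel_class_antimono[OF _ Suc.prems(1)]) simp
 have "C_k_on (Suc (k + 1)) (pot G f) S"
 proof (rule C_k_on_SucI[OF S])
  show "GDERIV (pot G f) x :> (\<chi> i. pot (partial i G) f x)" if "x \<in> S" for x
   by (rule GDERIV_pot[OF G2 Suc.prems(2) Suc.prems(2) that S]) simp_all
  have "C_k_on (k + 1) (pot (partial i G) f) S" for i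
  proof (rule Suc.IH)
   have "kernel_class (Suc (k + 2)) (real (Suc k) + 1 - real CARD('n)) G"
    using Suc.prems(1) by (simp only: add_Suc)
   then have "kernel_class (k + 2) (real (Suc k) + 1 - real CARD('n) - 1) (partial i G)"
    unfolding kernel_class.simps(2) by blast
   moreover have "real (Suc k) + 1 - real CARD('n) - 1 = real k + 1 - real CARD('n)" by simp
   ultimately show "kernel_class (k + 2) (real k + 1 - real CARD('n)) (partial i G)" by (simp only:)
   show "tame e f S" if "- real CARD('n) < e" "e \<le> real k + 1 - real CARD('n)" for e
    by (rule Suc.prems(2)) (use that in simp_all)
  qed
  then show "C_k_on (k + 1) (\<lambda>x. (\<chi> i. pot (partial i G) f x) $ i) S" for i by simp
 qed
 then show ?case by simp
qed

text \<open>Of the two derivatives one falls on the kernel and one on the differentiable part of the density; the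
 part vanishing near the point has a harmonic potential there.\<close>

lemma laplacian_newton:
 fixes f :: "real ^ 'n::finite => real"
 assumes S: "open S" and x0: "x0 \<in> S" and f: "C_k_on 1 f S"
  and t: "tame (2 - real CARD('n)) f S" and n: "CARD('n) \<ge> 3"
 shows "laplacian (pot (\<lambda>z. norm z powr (2 - real CARD('n))) f) x0 = - newton_const TYPE('n) * f x0"
proof -
 let ?d = "1 - real CARD('n)"
 let ?G = "\<lambda>z::real^'n. norm z powr (2 - real CARD('n))"
 have lb: "locally_bounded_on S f" by (rule continuous_imp_locally_bounded[OF S C_1_onD(3)[OF S f]])
 have te: "tame e f S" if "- real CARD('n) < e" "e \<le> 2 - real CARD('n)" for e
  by (rule tame_of_locally_bounded[OF t lb that(2,1)]) (use that n in simp)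
 have fm: "f \<in> borel_measurable borel" by (rule tameD_measurable[OF t])
 have G: "kernel_class k (2 - real CARD('n)) ?G" for k by (rule kernel_class_norm_powr)
 have Gi: "kernel_class k ?d (partial i ?G)" for k i using G[of "Suc k"] by simp
 have Gij: "kernel_class k (- real CARD('n)) (partial j (partial i ?G))" for k i j using Gi[of "Suc k"] by simp
 obtain r R f1 f2 D where s: "0 < r" "ball x0 r \<subseteq> S" "\<And>y. f y = f1 y + f2 y"
  "\<And>y. GDERIV f1 y :> D y" "continuous_on UNIV D" "\<And>y. y \<notin> cball 0 R ==> f1 y = 0"
  "\<And>y. y \<in> ball x0 r ==> f2 y = 0" "\<And>y. \<bar>f1 y\<bar> \<le> \<bar>f y\<bar>" "\<And>y. \<bar>f2 y\<bar> \<le> \<bar>f y\<bar>"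
  "f1 \<in> borel_measurable borel" "f2 \<in> borel_measurable borel"
  by (rule density_split[OF S x0 f fm]) (rule that, assumption+)
 let ?T = "ball x0 r"
 have xT: "x0 \<in> ?T" using s(1) by simp
 have tT: "tame ?d f ?T" by (rule tame_subset[OF te s(2)]) (use n in simp_all)
 have t1: "tame ?d f1 ?T" by (rule tame_mono[OF tT s(10,8)])
 have t2: "tame ?d f2 ?T" by (rule tame_mono[OF tT s(11,9)])
 have t2': "tame e f2 ?T" if "e \<le> ?d" for e
  by (rule tame_off_support[OF t2 open_ball s(7) that])
 have p1: "partial i (pot ?G f) y = pot (partial i ?G) f y" if "y \<in> ?T" for i y
 proof (rule partial_pot[OF G t te _ S])
  show "y \<in> S" using that s(2) by blast
 qed simp_all
 have p2: "pot (partial i ?G) f y = pot (partial i ?G) f1 y + pot (partial i ?G) f2 y" if y: "y \<in> ?T" for i y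
 proof -
  have "f = (\<lambda>y. f1 y + f2 y)" using s(3) by auto
  then show ?thesis
   using pot_add[OF Gi s(10,11) tame_finite[OF t1 y] tame_finite[OF t2 y]] by simp
 qed
 have li: "locally_integrable (partial i ?G)" for i
  by (rule kernel_class_locally_integrable[OF Gi]) (use n in simp_all)
 have "partial i (partial i (pot ?G f)) x0 = pot (partial i ?G) (\<lambda>y. D y $ i) x0 + pot (partial i (partial i ?G)) f2 x0" for i
 proof -
  have "partial i (partial i (pot ?G f)) x0 = partial i (\<lambda>y. pot (partial i ?G) f1 y + pot (partial i ?G) f2 y) x0"
   by (rule partial_cong_open[OF open_ball xT]) (simp add: p1 p2)
  also have "GDERIV (\<lambda>y. pot (partial i ?G) f1 y + pot (partial i ?G) f2 y) x0 :>
    (\<chi> j. pot (partial i ?G) (\<lambda>y. D y $ j) x0) + (\<chi> j. pot (partial j (partial i ?G)) f2 x0)"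
   by (intro GDERIV_add GDERIV_pot_density[OF li s(4,5,6)] GDERIV_pot[OF Gi t2 t2' xT open_ball])
    (assumption | linarith)+
  from partial_eq[OF this, of i]
  have "partial i (\<lambda>y. pot (partial i ?G) f1 y + pot (partial i ?G) f2 y) x0
    = pot (partial i ?G) (\<lambda>y. D y $ i) x0 + pot (partial i (partial i ?G)) f2 x0" by simp
  finally show ?thesis .
 qed
 then have "laplacian (pot ?G f) x0 = (\<Sum>i\<in>UNIV. pot (partial i ?G) (\<lambda>y. D y $ i) x0)
   + (\<Sum>i\<in>UNIV. pot (partial i (partial i ?G)) f2 x0)"
  by (simp add: laplacian_def sum.distrib)
 also have "(\<Sum>i\<in>UNIV. pot (partial i ?G) (\<lambda>y. D y $ i) x0) = - newton_const TYPE('n) * f1 x0"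
  by (rule newton_representation[OF s(4,5,6) n])
 also have "f1 x0 = f x0" using s(3)[of x0] s(7)[OF xT] by simp
 also have "(\<Sum>i\<in>UNIV. pot (partial i (partial i ?G)) f2 x0) = 0"
 proof -
  have "(\<Sum>i\<in>UNIV. pot (partial i (partial i ?G)) f2 x0)
    = (LINT y|lborel. (\<Sum>i\<in>UNIV. partial i (partial i ?G) (x0 - y) * f2 y))"
   unfolding pot_def
   by (rule Bochner_Integration.integral_sum[symmetric])
    (rule pot_integrable[OF Gij s(11) tame_finite[OF t2' xT]], simp)
  also have "\<dots> = (LINT y|lborel. laplacian ?G (x0 - y) * f2 y)"
   by (simp only: laplacian_def sum_distrib_right)
  also have "\<dots> = (LINT y::real^'n|lborel. 0)"
  proof (rule Bochner_Integration.integral_cong[OF refl])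
   fix y
   show "laplacian ?G (x0 - y) * f2 y = 0"
   proof (cases "y = x0")
    case True
    then show ?thesis using s(7)[OF xT] by simp
   next
    case False
    have "laplacian ?G (x0 - y) = laplacian (qpow 0 (1 - real CARD('n) / 2)) (x0 - y)"
     by (simp add: norm_powr_eq_qpow[abs_def] diff_divide_distrib)
    also have "\<dots> = 0" using False by (subst laplacian_qpow) simp_all
    finally show ?thesis by simp
   qed
  qed
  finally show ?thesis by simp
 qed
 finally show ?thesis by simp
qed

text \<open>The kernel \<open>|z| powr (2 j - n)\<close> of order \<open>2 j\<close>.\<close>

abbreviation riesz :: "nat => (real ^ 'n::finite => real) => real ^ 'n => real" where
 "riesz j \<equiv> pot (\<lambda>z. norm z powr (2 * real j - real CARD('n)))"

text \<open>Second derivatives of this kernel are still locally integrable, so both derivatives may be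
 taken under the integral.\<close>

lemma laplacian_riesz:
 fixes f :: "real ^ 'n::finite => real"
 assumes S: "open S" and x: "x \<in> S" and j: "1 \<le> j" "2 * j + 2 \<le> CARD('n)"
  and t: "\<And>e. - real CARD('n) < e ==> e \<le> 2 * real j + 2 - real CARD('n) ==> tame e f S"
 shows "laplacian (riesz (Suc j) f) x = (2 * real j + 2 - real CARD('n)) * (2 * real j) * riesz j f x"
proof -
 let ?d = "2 * real (Suc j) - real CARD('n)"
 let ?G = "\<lambda>z::real^'n. norm z powr ?d"
 have G: "kernel_class k ?d ?G" for k by (rule kernel_class_norm_powr)
 have Gi: "kernel_class k (?d - 1) (partial i ?G)" for k i using G[of "Suc k"] by simp
 have Gij: "kernel_class k (?d - 1 - 1) (partial l (partial i ?G))" for k i l using Gi[of "Suc k"] by simp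
 have te: "tame (?d - s) f S" if "0 \<le> s" "s < 4" for s
  by (rule t) (use that j in simp_all)
 have t0: "tame ?d f S" using te[of 0] by simp
 have t2: "tame (?d - 1 - 3/2) f S" "tame (?d - 1 - 1) f S" using te[of "5/2"] te[of 2] by simp_all
 have fm: "f \<in> borel_measurable borel" by (rule tameD_measurable[OF t0])
 have p1: "partial i (pot ?G f) y = pot (partial i ?G) f y" if "y \<in> S" for i y
  by (rule partial_pot[OF G t0 te that S]) simp_all
 have "partial i (partial i (pot ?G f)) x = pot (partial i (partial i ?G)) f x" for i
 proof -
  have "partial i (partial i (pot ?G f)) x = partial i (pot (partial i ?G) f) x"
   by (rule partial_cong_open[OF S x p1])
  also have "\<dots> = pot (partial i (partial i ?G)) f x"
   by (rule partial_pot[OF Gi te t2(1) x S]) simp_all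
  finally show ?thesis .
 qed
 then have "laplacian (pot ?G f) x = (\<Sum>i\<in>UNIV. pot (partial i (partial i ?G)) f x)"
  by (simp add: laplacian_def)
 also have "\<dots> = (LINT y|lborel. (\<Sum>i\<in>UNIV. partial i (partial i ?G) (x - y) * f y))"
  unfolding pot_def
  by (rule Bochner_Integration.integral_sum[symmetric])
   (rule pot_integrable[OF Gij fm tame_finite[OF t2(2) x]])
 also have "\<dots> = pot (laplacian ?G) f x"
  by (simp only: laplacian_def sum_distrib_right pot_def)
 also have "\<dots> = pot (\<lambda>z. (2 * real j + 2 - real CARD('n)) * (2 * real j) * norm z powr (2 * real j - real CARD('n))) f x"
 proof (rule pot_cong_off_0[OF _ _ _ fm])
  show "(\<lambda>z::real^'n. (2 * real j + 2 - real CARD('n)) * (2 * real j) * norm z powr (2 * real j - real CARD('n))) \<in> borel_measurable borel"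
   using measurable_norm_powr[where 'n = 'n] by simp
  have "(\<lambda>z. \<Sum>i\<in>UNIV. partial i (partial i ?G) z) \<in> borel_measurable borel"
   by (intro borel_measurable_sum kernel_class_measurable[OF Gij])
  then show "laplacian ?G \<in> borel_measurable borel"
   by (simp add: laplacian_def[abs_def])
  fix z :: "real ^ 'n" assume z: "z \<noteq> 0"
  have "laplacian ?G z = laplacian (qpow 0 (?d / 2)) z"
   by (simp add: norm_powr_eq_qpow[abs_def])
  also have "\<dots> = 2 * (?d / 2) * (real CARD('n) + 2 * (?d / 2) - 2) * qpow 0 (?d / 2 - 1) z"
   using z by (subst laplacian_qpow) simp_all
  also have "qpow 0 (?d / 2 - 1) z = norm z powr (2 * real j - real CARD('n))"
   unfolding norm_powr_eq_qpow by (simp add: field_simps)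
  also have "2 * (?d / 2) * (real CARD('n) + 2 * (?d / 2) - 2) = (2 * real j + 2 - real CARD('n)) * (2 * real j)"
  proof -
   have "2 * (?d / 2) = 2 * real j + 2 - real CARD('n)" "real CARD('n) + 2 * (?d / 2) - 2 = 2 * real j"
    by (simp_all add: field_simps)
   then show ?thesis by (simp only:)
  qed
  finally show "laplacian ?G z = (2 * real j + 2 - real CARD('n)) * (2 * real j) * norm z powr (2 * real j - real CARD('n))" .
 qed
 also have "\<dots> = (2 * real j + 2 - real CARD('n)) * (2 * real j) * riesz j f x"
  unfolding pot_def mult.assoc by (subst integral_mult_right_zero)+ simp
 finally show ?thesis .
qed

definition riesz_const :: "nat => nat => 'n::finite itself => real" where
 "riesz_const m s _ = (\<Prod>l<s. (real CARD('n) - 2 * real (m - l)) * (2 * real (m - l - 1)))"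

lemma riesz_const_pos: "2 * m < CARD('n::finite) ==> s < m ==> 0 < riesz_const m s TYPE('n)"
 unfolding riesz_const_def by (intro prod_pos) auto

lemma neg_laplacian_pow_Suc: "neg_laplacian_pow (Suc s) f x = - laplacian (neg_laplacian_pow s f) x"
 by (simp add: neg_laplacian_pow_def)

lemma laplacian_cmult_open:
 fixes g :: "real ^ 'n::finite => real"
 assumes S: "open S" and x: "x \<in> S" and h: "\<And>y. y \<in> S ==> h y = c * g y" and g: "C_k_on 2 g S"
 shows "laplacian h x = c * laplacian g x"
proof -
 have "laplacian h x = laplacian (\<lambda>y. c * g y + 0 * g y) x"
  by (rule laplacian_cong_open[OF S x]) (simp add: h)
 then show ?thesis using laplacian_lincomb[OF S x g g, of c 0] by simp
qed

lemma C_k_on_antimono: "j \<le> k ==> open S ==> C_k_on k f S ==> C_k_on j f S"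
proof (induction j arbitrary: k f)
 case 0
 show ?case
 proof (cases k)
  case (Suc l)
  then have "\<And>x. x \<in> S ==> f differentiable (at x)"
   using 0 by (simp add: differentiable_on_eq_differentiable_at)
  then show ?thesis
   by (auto intro!: continuous_at_imp_continuous_on differentiable_imp_continuous_within)
 qed (use 0 in simp)
next
 case (Suc j)
 then obtain l where l: "k = Suc l" "j \<le> l" by (cases k) auto
 then show ?case using Suc.prems Suc.IH[of l] by auto
qed

text \<open>Every Laplacian lowers the order of the Riesz kernel by two, down to the Newtonian kernel; one
 more returns the density.  Below the last step the constants are positive, which is how the
 intermediate powers of the operator inherit the sign of the density.\<close>

theorem neg_laplacian_pow_riesz:
 fixes f :: "real ^ 'n::finite => real"
 assumes S: "open S" and m: "1 \<le> m" "2 * m < CARD('n)"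
  and t: "tame (2 * real m - real CARD('n)) f S" and f: "C_k_on 1 f S"
 shows "C_k_on (2 * m) (riesz m f) S"
  and "s < m ==> x \<in> S ==> neg_laplacian_pow s (riesz m f) x = riesz_const m s TYPE('n) * riesz (m - s) f x"
  and "x \<in> S ==> neg_laplacian_pow m (riesz m f) x = riesz_const m (m - 1) TYPE('n) * newton_const TYPE('n) * f x"
proof -
 have lb: "locally_bounded_on S f" by (rule continuous_imp_locally_bounded[OF S C_1_onD(3)[OF S f]])
 have te: "tame e f S" if "- real CARD('n) < e" "e \<le> 2 * real m - real CARD('n)" for e
  by (rule tame_of_locally_bounded[OF t lb that(2,1)]) (use that m in simp)
 have C: "C_k_on (2 * j) (riesz j f) S" if j: "1 \<le> j" "j \<le> m" for j
 proof -
  have "C_k_on ((2 * j - 1) + 1) (riesz j f) S"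
  proof (rule C_k_on_pot_density[OF S _ f])
   have "real (2 * j - 1) + 1 = 2 * real j" using j by simp
   then show "kernel_class (2 * j - 1 + 2) (real (2 * j - 1) + 1 - real CARD('n)) (\<lambda>z::real^'n. norm z powr (2 * real j - real CARD('n)))"
    by (simp only: kernel_class_norm_powr)
   show "tame e f S" if "- real CARD('n) < e" "e \<le> real (2 * j - 1) + 1 - real CARD('n)" for e
    by (rule te[OF that(1)]) (use that(2) j in linarith)
  qed
  then show ?thesis using j by simp
 qed
 then show "C_k_on (2 * m) (riesz m f) S" using m by simp
 have main: "neg_laplacian_pow s (riesz m f) x = riesz_const m s TYPE('n) * riesz (m - s) f x"
  if "s < m" "x \<in> S" for s x
  using that
 proof (induction s arbitrary: x)
  case 0
  then show ?case by (simp add: neg_laplacian_pow_def riesz_const_def)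
 next
  case (Suc s)
  obtain j where j: "m - s = Suc j" "1 \<le> j" "m - Suc s = j" using Suc.prems(1)
   by (metis Suc_diff_Suc Suc_lessD Suc_leI zero_less_diff One_nat_def)
  have C2: "C_k_on 2 (riesz (m - s) f) S"
   by (rule C_k_on_antimono[OF _ S C]) (use j Suc.prems in linarith)+
  have "laplacian (neg_laplacian_pow s (riesz m f)) x = riesz_const m s TYPE('n) * laplacian (riesz (m - s) f) x"
   by (rule laplacian_cmult_open[OF S Suc.prems(2) Suc.IH C2]) (use Suc.prems in simp_all)
  also have "laplacian (riesz (m - s) f) x = (2 * real j + 2 - real CARD('n)) * (2 * real j) * riesz j f x"
   unfolding j(1)
  proof (rule laplacian_riesz[OF S Suc.prems(2) j(2)])
   show "2 * j + 2 \<le> CARD('n)" using j m by linarith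
   show "tame e f S" if "- real CARD('n) < e" "e \<le> 2 * real j + 2 - real CARD('n)" for e
    by (rule te[OF that(1)]) (use that(2) j(1) in linarith)
  qed
  finally show ?case
   by (simp add: neg_laplacian_pow_Suc riesz_const_def j algebra_simps)
 qed
 then show "s < m ==> x \<in> S ==> neg_laplacian_pow s (riesz m f) x = riesz_const m s TYPE('n) * riesz (m - s) f x" .
 assume x: "x \<in> S"
 obtain l where l: "m = Suc l" using m by (cases m) auto
 have ml: "m - l = 1" "l < m" using l by auto
 have C2: "C_k_on 2 (riesz 1 f) S" using C[of 1] m by simp
 have "laplacian (neg_laplacian_pow l (riesz m f)) x = riesz_const m l TYPE('n) * laplacian (riesz 1 f) x"
  by (rule laplacian_cmult_open[OF S x _ C2]) (use main[of l] ml in simp)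
 also have "laplacian (riesz 1 f) x = - newton_const TYPE('n) * f x"
  using laplacian_newton[OF S x f te] m by simp
 finally show "neg_laplacian_pow m (riesz m f) x = riesz_const m (m - 1) TYPE('n) * newton_const TYPE('n) * f x"
  by (simp add: l neg_laplacian_pow_Suc)
qed

section \<open>A Liouville theorem\<close>

lemma C_2_onI:
 fixes f :: "real ^ 'n::finite => real"
 assumes "open S" "\<And>x. x \<in> S ==> GDERIV f x :> F x"
  and "\<And>i x. x \<in> S ==> GDERIV (\<lambda>x. F x $ i) x :> H i x" "\<And>i. continuous_on S (H i)"
 shows "C_k_on 2 f S"
proof -
 have "C_k_on 1 (\<lambda>x. F x $ i) S" for i by (rule C_1_onI[OF assms(1,3,4)])
 from C_k_on_SucI[OF assms(1,2) this] show ?thesis by (simp only: numeral_2_eq_2 One_nat_def)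
qed

lemma C_2_onD:
 fixes f :: "real ^ 'n::finite => real"
 assumes "open S" "C_k_on 2 f S" "x \<in> S"
 shows "GDERIV f x :> gradient f x" "GDERIV (partial i f) x :> gradient (partial i f) x"
 using assms by (auto simp: numeral_2_eq_2 differentiable_on_eq_differentiable_at intro!: gradient_GDERIV)

lemma C_2_on_norm_square: "C_k_on 2 (\<lambda>x::real^'n::finite. (norm x)\<^sup>2) UNIV"
proof (rule C_2_onI[OF open_UNIV GDERIV_norm_square])
 show "GDERIV (\<lambda>x. (2 *\<^sub>R x) $ i) x :> 2 *\<^sub>R axis i 1" for i and x :: "real^'n"
  using GDERIV_cmult[OF GDERIV_nth, of 2 i x] by simp
qed (rule continuous_on_const)

lemma laplacian_norm_square: "laplacian (\<lambda>x::real^'n::finite. (norm x)\<^sup>2) x = 2 * real CARD('n)"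
proof -
 have 1: "partial i (\<lambda>x::real^'n. (norm x)\<^sup>2) = (\<lambda>x. 2 * x $ i)" for i
  by (rule ext) (simp add: partial_eq[OF GDERIV_norm_square])
 have "partial i (\<lambda>x::real^'n. 2 * x $ i) x = 2" for i
  using partial_eq[OF GDERIV_cmult[OF GDERIV_nth, of 2 i x], of i] by (simp add: axis_def)
 then show ?thesis by (simp add: laplacian_def 1)
qed

lemma second_partial_nonpos_at_max:
 fixes k :: "real ^ 'n::finite => real"
 assumes k: "C_k_on 2 k UNIV" and r: "0 < r" and max: "\<And>y. y \<in> ball x r ==> k y \<le> k x"
 shows "partial i (partial i k) x \<le> 0"
proof (rule ccontr)
 assume "\<not> partial i (partial i k) x \<le> 0"
 then have pos: "0 < partial i (partial i k) x" by simp
 define \<phi> where "\<phi> t = k (x + t *\<^sub>R axis i 1)" for t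
 define \<psi> where "\<psi> t = partial i k (x + t *\<^sub>R axis i 1)" for t
 have line: "((\<lambda>t. x + t *\<^sub>R axis i 1) has_derivative (\<lambda>h. h *\<^sub>R axis i 1)) (at t)" for t :: real
  by (auto intro!: derivative_eq_intros)
 have d1: "DERIV \<phi> t :> \<psi> t" for t
 proof -
  have "GDERIV k y :> gradient k y" for y by (rule C_2_onD(1)[OF open_UNIV k UNIV_I])
  from has_derivative_compose[OF line[of t] this[unfolded gderiv_def]]
  have "((\<lambda>t. k (x + t *\<^sub>R axis i 1)) has_derivative (\<lambda>h. h * partial i k (x + t *\<^sub>R axis i 1))) (at t)"
   by (simp add: inner_axis')
  moreover have "(\<lambda>h. h * partial i k (x + t *\<^sub>R axis i 1)) = (*) (partial i k (x + t *\<^sub>R axis i 1))"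
   by (simp add: fun_eq_iff mult.commute)
  ultimately show ?thesis unfolding has_field_derivative_def \<phi>_def \<psi>_def by (simp only:)
 qed
 have d2: "DERIV \<psi> t :> partial i (partial i k) (x + t *\<^sub>R axis i 1)" for t
 proof -
  have "GDERIV (partial i k) y :> gradient (partial i k) y" for y by (rule C_2_onD(2)[OF open_UNIV k UNIV_I])
  from has_derivative_compose[OF line[of t] this[unfolded gderiv_def]]
  have "((\<lambda>t. partial i k (x + t *\<^sub>R axis i 1)) has_derivative (\<lambda>h. h * partial i (partial i k) (x + t *\<^sub>R axis i 1))) (at t)"
   by (simp add: inner_axis')
  moreover have "(\<lambda>h. h * partial i (partial i k) (x + t *\<^sub>R axis i 1)) = (*) (partial i (partial i k) (x + t *\<^sub>R axis i 1))"
   by (simp add: fun_eq_iff mult.commute)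
  ultimately show ?thesis unfolding has_field_derivative_def \<psi>_def by (simp only:)
 qed
 have in_ball: "x + t *\<^sub>R axis i 1 \<in> ball x r" if "\<bar>t\<bar> < r" for t
  using that by (simp add: dist_norm norm_axis_1)
 have "\<psi> 0 = 0"
  by (rule DERIV_local_max[OF d1 r]) (use in_ball max in \<open>auto simp: \<phi>_def\<close>)
 moreover have "DERIV \<psi> 0 :> partial i (partial i k) x" using d2[of 0] by simp
 ultimately obtain d where d: "0 < d" "\<And>h. 0 < h ==> h < d ==> 0 < \<psi> h"
  using DERIV_pos_inc_right[OF _ pos, of \<psi> 0] by auto
 define s where "s = min d r / 2"
 have s: "0 < s" "s < d" "s < r" using d(1) r by (auto simp: s_def)
 obtain z where z: "0 < z" "z < s" "\<phi> s - \<phi> 0 = (s - 0) * \<psi> z"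
  using MVT2[OF s(1), of \<phi> \<psi>] d1 by auto
 have "0 < \<phi> s - \<phi> 0" using z d(2)[of z] s by simp
 moreover have "\<phi> s \<le> \<phi> 0" unfolding \<phi>_def using max[OF in_ball[of s]] s by simp
 ultimately show False by simp
qed

text \<open>A positive value, together with the decay at infinity, would produce an interior maximum that survives
 adding a small multiple of the strictly subharmonic function \<open>(norm x)\<^sup>2\<close>.\<close>

lemma harmonic_nonpos:
 fixes h :: "real ^ 'n::finite => real"
 assumes h: "C_k_on 2 h UNIV" "\<And>x. laplacian h x = 0" and lim: "(h \<longlongrightarrow> 0) at_infinity"
 shows "h x1 \<le> 0"
proof (rule ccontr)
 assume "\<not> h x1 \<le> 0"
 then have pos: "0 < h x1" by simp
 have "\<forall>\<^sub>F x in at_infinity. h x < h x1 / 2"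
  using order_tendstoD(2)[OF lim, of "h x1 / 2"] pos by simp
 then obtain R0 where R0: "\<And>x. R0 \<le> norm x ==> h x < h x1 / 2"
  unfolding eventually_at_infinity by blast
 define R where "R = max R0 (norm x1 + 1)"
 have R: "R0 \<le> R" "norm x1 < R" by (simp_all add: R_def less_max_iff_disj)
 then have R3: "0 < R" using norm_ge_zero[of x1] by linarith
 define \<epsilon> where "\<epsilon> = h x1 / (4 * R\<^sup>2)"
 have \<epsilon>: "0 < \<epsilon>" "\<epsilon> * R\<^sup>2 = h x1 / 4" using pos R3 by (simp_all add: \<epsilon>_def)
 define k where "k = (\<lambda>x. 1 * h x + \<epsilon> * (norm x)\<^sup>2)"
 have k2: "C_k_on 2 k UNIV" unfolding k_def by (rule C_k_on_lincomb[OF open_UNIV h(1) C_2_on_norm_square])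
 have "continuous_on UNIV k" by (rule continuous_on_GDERIV[OF C_2_onD(1)[OF open_UNIV k2 UNIV_I]])
 then have kc: "continuous_on (cball 0 R) k" by (rule continuous_on_subset) simp
 have "\<exists>x2\<in>cball 0 R. \<forall>y\<in>cball 0 R. k y \<le> k x2"
  by (rule continuous_attains_sup[OF compact_cball _ kc]) (use R3 in simp)
 then obtain x2 where x2: "x2 \<in> cball 0 R" "\<And>y. y \<in> cball 0 R ==> k y \<le> k x2" by blast
 have "h x1 \<le> k x1" using \<epsilon> by (simp add: k_def)
 also have "\<dots> \<le> k x2" using x2 R by simp
 finally have kx2: "h x1 \<le> k x2" .
 have "norm x2 < R"
 proof (rule ccontr)
  assume "\<not> norm x2 < R"
  then have eq: "norm x2 = R" using x2(1) by simp
  then have "k x2 < h x1 / 2 + h x1 / 4" using R0[of x2] R \<epsilon>(2) by (simp add: k_def)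
  then show False using kx2 pos by simp
 qed
 then have r: "0 < R - norm x2" by simp
 have "y \<in> cball 0 R" if "y \<in> ball x2 (R - norm x2)" for y
  using that norm_triangle_ineq2[of y x2] by (simp add: dist_norm norm_minus_commute)
 then have "k y \<le> k x2" if "y \<in> ball x2 (R - norm x2)" for y using that x2(2) by blast
 then have "laplacian k x2 \<le> 0"
  unfolding laplacian_def by (intro sum_nonpos second_partial_nonpos_at_max[OF k2 r]) blast
 moreover have "laplacian k x2 = 1 * laplacian h x2 + \<epsilon> * laplacian (\<lambda>x. (norm x)\<^sup>2) x2"
  unfolding k_def by (rule laplacian_lincomb[OF open_UNIV UNIV_I h(1) C_2_on_norm_square])
 ultimately have "\<epsilon> * (2 * real CARD('n)) \<le> 0" by (simp add: h(2) laplacian_norm_square)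
 then show False using \<epsilon>(1) by (simp add: mult_le_0_iff)
qed

lemma harmonic_vanishing_at_infinity:
 fixes h :: "real ^ 'n::finite => real"
 assumes h: "C_k_on 2 h UNIV" "\<And>x. laplacian h x = 0" and lim: "(h \<longlongrightarrow> 0) at_infinity"
 shows "h x = 0"
proof (rule antisym)
 show "h x \<le> 0" by (rule harmonic_nonpos[OF assms])
 let ?k = "\<lambda>x. (-1) * h x + 0 * h x"
 have "?k x \<le> 0"
 proof (rule harmonic_nonpos)
  show "C_k_on 2 ?k UNIV" by (rule C_k_on_lincomb[OF open_UNIV h(1) h(1)])
  show "laplacian ?k x = 0" for x
   using laplacian_lincomb[OF open_UNIV UNIV_I h(1) h(1), of "-1" 0 x] h(2) by simp
  show "(?k \<longlongrightarrow> 0) at_infinity" using tendsto_minus[OF lim] by simp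
 qed
 then show "0 \<le> h x" by simp
qed

section \<open>Bubbles\<close>

lemma C_2_on_qpow:
 assumes "0 < c"
 shows "C_k_on 2 (qpow c a :: real ^ 'n::finite => real) UNIV"
proof (rule C_2_onI[OF open_UNIV GDERIV_qpow[OF qdom_pos[OF assms]]])
 fix i :: 'n and x :: "real ^ 'n"
 have eq: "(\<lambda>x::real^'n. ((2 * a * qpow c (a - 1) x) *\<^sub>R x) $ i) = partial i (qpow c a)"
  by (rule ext) (simp add: partial_qpow[OF qdom_pos[OF assms]])
 show "GDERIV (\<lambda>x. ((2 * a * qpow c (a - 1) x) *\<^sub>R x) $ i) x :>
  (2 * a * qpow c (a - 1) x) *\<^sub>R axis i 1 + (4 * a * (a - 1) * x $ i * qpow c (a - 2) x) *\<^sub>R x"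
  unfolding eq by (rule GDERIV_partial_qpow[OF qdom_pos[OF assms]])
qed (rule GDERIV_partial_qpow_continuous[OF assms])

lemma C_2_on_sum:
 fixes f :: "'i => real ^ 'n::finite => real"
 assumes "finite I" "\<And>i. C_k_on 2 (f i) UNIV"
 shows "C_k_on 2 (\<lambda>x. \<Sum>i\<in>I. a i * f i x) UNIV
  \<and> laplacian (\<lambda>x. \<Sum>i\<in>I. a i * f i x) x = (\<Sum>i\<in>I. a i * laplacian (f i) x)"
 using assms(1)
proof (induction I)
 case empty
 have "laplacian (\<lambda>x. 0 * (norm x)\<^sup>2 + 0 * (norm x)\<^sup>2) x = 0"
  using laplacian_lincomb[OF open_UNIV UNIV_I C_2_on_norm_square C_2_on_norm_square, of 0 0 x] by simp
 moreover have "C_k_on 2 (\<lambda>x::real^'n. 0 * (norm x)\<^sup>2 + 0 * (norm x)\<^sup>2) UNIV"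
  by (rule C_k_on_lincomb[OF open_UNIV C_2_on_norm_square C_2_on_norm_square])
 ultimately show ?case by simp
next
 case (insert i I)
 have c: "C_k_on 2 (\<lambda>x. \<Sum>i\<in>I. a i * f i x) UNIV" using insert.IH by blast
 show ?case
  using C_k_on_lincomb[OF open_UNIV assms(2)[of i] c, of "a i" 1]
   laplacian_lincomb[OF open_UNIV UNIV_I assms(2)[of i] c, of "a i" 1 x] insert by simp
qed

text \<open>The coefficients of the iterated Laplacians of \<open>(c + |x|^2) powr (-b)\<close>.  Each step either
 raises the exponent by one or raises it by two and produces a factor \<open>c\<close>.  For \<open>b = n/2 - m\<close> the
 last factor makes everything collapse to one term after \<open>m\<close> steps.\<close>

definition bubble_coeff :: "real => real => nat => nat => real" where
 "bubble_coeff m b j i = 4 ^ j * real (j choose i) * pochhammer b (j + i) * (\<Prod>l\<in>{i<..j}. (m - real l))"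

lemma Suc_times_choose: "real (Suc k) * real (j choose Suc k) = real (j - k) * real (j choose k)"
 using binomial_absorption[of k j] binomial_absorb_comp[of j k] by (metis of_nat_mult)

lemma bubble_coeff_0: "bubble_coeff m b (Suc j) 0 = bubble_coeff m b j 0 * (4 * (b + real j) * (m - 1 - real j))"
proof -
 have "{0<..Suc j} = insert (Suc j) {0<..j}" by auto
 then show ?thesis by (simp add: bubble_coeff_def pochhammer_Suc algebra_simps)
qed

lemma bubble_coeff_Suc:
 assumes "k \<le> j"
 shows "bubble_coeff m b (Suc j) (Suc k) =
  bubble_coeff m b j (Suc k) * (4 * (b + real (j + Suc k)) * (m - 1 - real (j + Suc k)))
  + bubble_coeff m b j k * (4 * (b + real (j + k)) * (b + real (j + k) + 1))"
proof (cases "k = j")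
 case True
 then show ?thesis by (simp add: bubble_coeff_def pochhammer_Suc binomial_eq_0 algebra_simps)
next
 case False
 then have k: "k < j" using assms by simp
 let ?P = "\<Prod>l\<in>{Suc k<..j}. (m - real l)"
 have 1: "{k<..j} = insert (Suc k) {Suc k<..j}" using k by auto
 have 2: "{Suc k<..Suc j} = insert (Suc j) {Suc k<..j}" using k by auto
 have P1: "(\<Prod>l\<in>{k<..j}. (m - real l)) = (m - real (Suc k)) * ?P" unfolding 1 by simp
 have P2: "(\<Prod>l\<in>{Suc k<..Suc j}. (m - real l)) = (m - real (Suc j)) * ?P" unfolding 2 by simp
 let ?Q = "4 ^ Suc j * pochhammer b (j + k) * (b + real (j + k)) * (b + real (j + k) + 1) * ?P"
 have q: "pochhammer b (Suc j + Suc k) = pochhammer b (j + k) * (b + real (j + k)) * (b + real (j + k) + 1)"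
  "pochhammer b (j + Suc k) = pochhammer b (j + k) * (b + real (j + k))"
  by (simp_all add: pochhammer_Suc algebra_simps)
 have c: "real (j choose Suc k) * (real k + 1) = (real j - real k) * real (j choose k)"
  using Suc_times_choose[of k j] k by (simp add: of_nat_diff mult.commute add.commute)
 have "real (Suc j choose Suc k) * (m - real (Suc j))
   = real (j choose Suc k) * (m - 1 - real (j + Suc k)) + real (j choose k) * (m - real (Suc k))"
  using c by (simp add: algebra_simps)
 then have "?Q * (real (Suc j choose Suc k) * (m - real (Suc j)))
   = ?Q * (real (j choose Suc k) * (m - 1 - real (j + Suc k))) + ?Q * (real (j choose k) * (m - real (Suc k)))"
  by (simp only: distrib_left)
 moreover have "bubble_coeff m b (Suc j) (Suc k) = ?Q * (real (Suc j choose Suc k) * (m - real (Suc j)))"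
  unfolding bubble_coeff_def P2 q by (simp only: mult_ac)
 moreover have "bubble_coeff m b j (Suc k) * (4 * (b + real (j + Suc k)) * (m - 1 - real (j + Suc k)))
   = ?Q * (real (j choose Suc k) * (m - 1 - real (j + Suc k)))"
 proof -
  have "b + real (j + Suc k) = b + real (j + k) + 1" by simp
  then show ?thesis unfolding bubble_coeff_def q by (simp only: power_Suc mult_ac)
 qed
 moreover have "bubble_coeff m b j k * (4 * (b + real (j + k)) * (b + real (j + k) + 1))
   = ?Q * (real (j choose k) * (m - real (Suc k)))"
  unfolding bubble_coeff_def P1 by (simp only: power_Suc mult_ac)
 ultimately show ?thesis by (simp only:)
qed

lemma bubble_coeff_zero: "j < i ==> bubble_coeff m b j i = 0"
 by (simp add: bubble_coeff_def binomial_eq_0)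

lemma neg_laplacian_pow_qpow:
 fixes x :: "real ^ 'n::finite"
 assumes c: "0 < c" and b: "b = real CARD('n) / 2 - real m"
 shows "neg_laplacian_pow j (qpow c (- b) :: real^'n => real) x =
  (\<Sum>i\<le>j. bubble_coeff (real m) b j i * c ^ i * qpow c (- (b + real (j + i))) x)"
proof (induction j arbitrary: x)
 case 0
 show ?case by (simp add: neg_laplacian_pow_def bubble_coeff_def)
next
 case (Suc j)
 let ?\<beta> = "bubble_coeff (real m) b"
 let ?q = "\<lambda>i x. qpow c (- (b + real i)) (x :: real^'n)"
 have lap: "- laplacian (?q i) x = 4 * (b + real i) * (real m - 1 - real i) * ?q (i + 1) x
   + 4 * (b + real i) * (b + real i + 1) * c * ?q (i + 2) x" for i
 proof -
  have 1: "real CARD('n) + 2 * (- (b + real i)) - 2 = 2 * (real m - 1 - real i)"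
   using b by (simp add: field_simps)
  have 2: "- (b + real i) - 1 = - (b + real (i + 1))" "- (b + real i) - 2 = - (b + real (i + 2))" by simp_all
  let ?y = "qpow c (- (b + real (i + 1))) x" and ?z = "qpow c (- (b + real (i + 2))) x"
  have "- (2 * - (b + real i) * (2 * (real m - 1 - real i)) * ?y - 4 * - (b + real i) * - (b + real (i + 1)) * c * ?z)
    = 4 * (b + real i) * (real m - 1 - real i) * ?y + 4 * (b + real i) * (b + real i + 1) * c * ?z"
  proof -
   define y z where "y = ?y" and "z = ?z"
   show ?thesis unfolding y_def[symmetric] z_def[symmetric] by (simp add: algebra_simps)
  qed
  then show ?thesis
   unfolding laplacian_qpow[OF qdom_pos[OF c]] 1 2 .
 qed
 have eq: "neg_laplacian_pow j (qpow c (- b)) = (\<lambda>x. \<Sum>i\<in>{..j}. (?\<beta> j i * c ^ i) * ?q (j + i) x)"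
  using Suc.IH by (simp add: fun_eq_iff)
 have "neg_laplacian_pow (Suc j) (qpow c (- b)) x = - (\<Sum>i\<in>{..j}. (?\<beta> j i * c ^ i) * laplacian (?q (j + i)) x)"
  unfolding neg_laplacian_pow_Suc eq
  by (rule arg_cong[where f = uminus]) (rule conjunct2[OF C_2_on_sum[OF finite_atMost C_2_on_qpow[OF c]]])
 also have "\<dots> = (\<Sum>i\<le>j. (?\<beta> j i * c ^ i) * (- laplacian (?q (j + i)) x))"
  by (simp add: sum_negf)
 also have "\<dots> = (\<Sum>i\<le>j. ?\<beta> j i * (4 * (b + real (j + i)) * (real m - 1 - real (j + i))) * c ^ i * ?q (Suc j + i) x)
   + (\<Sum>i\<le>j. ?\<beta> j i * (4 * (b + real (j + i)) * (b + real (j + i) + 1)) * c ^ Suc i * ?q (Suc j + Suc i) x)"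
  unfolding sum.distrib[symmetric] lap
  by (intro sum.cong refl) (simp add: algebra_simps)
 also have "(\<Sum>i\<le>j. ?\<beta> j i * (4 * (b + real (j + i)) * (real m - 1 - real (j + i))) * c ^ i * ?q (Suc j + i) x)
   = (\<Sum>i\<le>Suc j. ?\<beta> j i * (4 * (b + real (j + i)) * (real m - 1 - real (j + i))) * c ^ i * ?q (Suc j + i) x)"
  by (simp add: bubble_coeff_zero)
 also have "\<dots> = ?\<beta> j 0 * (4 * (b + real j) * (real m - 1 - real j)) * ?q (Suc j) x
   + (\<Sum>i\<le>j. ?\<beta> j (Suc i) * (4 * (b + real (j + Suc i)) * (real m - 1 - real (j + Suc i))) * c ^ Suc i * ?q (Suc j + Suc i) x)"
  unfolding sum.atMost_Suc_shift by simp
 also have "\<dots> + (\<Sum>i\<le>j. ?\<beta> j i * (4 * (b + real (j + i)) * (b + real (j + i) + 1)) * c ^ Suc i * ?q (Suc j + Suc i) x)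
   = ?\<beta> (Suc j) 0 * ?q (Suc j) x + (\<Sum>i\<le>j. ?\<beta> (Suc j) (Suc i) * c ^ Suc i * ?q (Suc j + Suc i) x)"
  unfolding bubble_coeff_0
  by (subst add.assoc, subst sum.distrib[symmetric], intro arg_cong2[where f = "(+)"] refl sum.cong)
   (simp only: bubble_coeff_Suc atMost_iff distrib_right)
 also have "\<dots> = (\<Sum>i\<le>Suc j. ?\<beta> (Suc j) i * c ^ i * ?q (Suc j + i) x)"
  unfolding sum.atMost_Suc_shift by simp
 finally show ?case .
qed

text \<open>For \<open>j = m\<close> all coefficients but that of \<open>i = m\<close> contain the factor \<open>m - m\<close>.\<close>

lemma neg_laplacian_pow_bubble:
 fixes x :: "real ^ 'n::finite"
 assumes c: "0 < c"
 shows "neg_laplacian_pow m (qpow c (- (real CARD('n) / 2 - real m)) :: real^'n => real) x =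
  4 ^ m * pochhammer (real CARD('n) / 2 - real m) (2 * m) * c ^ m * qpow c (- (real CARD('n) / 2 + real m)) x"
proof -
 let ?b = "real CARD('n) / 2 - real m"
 have z: "bubble_coeff (real m) ?b m i = 0" if "i < m" for i
  using that unfolding bubble_coeff_def by (simp add: prod_zero_iff)
 have "neg_laplacian_pow m (qpow c (- ?b) :: real^'n => real) x
   = (\<Sum>i\<le>m. bubble_coeff (real m) ?b m i * c ^ i * qpow c (- (?b + real (m + i))) x)"
  by (rule neg_laplacian_pow_qpow[OF c refl])
 also have "\<dots> = (\<Sum>i\<in>{m}. bubble_coeff (real m) ?b m i * c ^ i * qpow c (- (?b + real (m + i))) x)"
  by (rule sum.mono_neutral_right) (auto simp: z)
 also have "\<dots> = 4 ^ m * pochhammer ?b (m + m) * c ^ m * qpow c (- (?b + real (m + m))) x"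
  by (simp add: bubble_coeff_def)
 also have "m + m = 2 * m" by simp
 also have "?b + real (2 * m) = real CARD('n) / 2 + real m" by simp
 finally show ?thesis .
qed

lemma neg_laplacian_pow_qpow_C2:
 assumes c: "0 < c" and b: "b = real CARD('n::finite) / 2 - real m"
 shows "C_k_on 2 (neg_laplacian_pow j (qpow c (- b)) :: real^'n => real) UNIV"
proof -
 have "neg_laplacian_pow j (qpow c (- b)) = (\<lambda>x::real^'n. \<Sum>i\<in>{..j}. (bubble_coeff (real m) b j i * c ^ i) * qpow c (- (b + real (j + i))) x)"
  using neg_laplacian_pow_qpow[OF c b] by (simp add: fun_eq_iff)
 moreover have "C_k_on 2 (\<lambda>x::real^'n. \<Sum>i\<in>{..j}. (bubble_coeff (real m) b j i * c ^ i) * qpow c (- (b + real (j + i))) x) UNIV"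
  by (rule conjunct1[OF C_2_on_sum[OF finite_atMost C_2_on_qpow[OF c]]])
 ultimately show ?thesis by (simp only:)
qed

lemma tendsto_norm_powr_at_infinity:
 assumes "s < 0"
 shows "((\<lambda>x::'a::real_normed_vector. norm x powr s) \<longlongrightarrow> 0) at_infinity"
 by (rule tendsto_neg_powr[OF assms filterlim_norm_at_top])

lemma tendsto_qpow_at_infinity:
 assumes "0 < c" "a < 0"
 shows "((qpow c a :: 'a::real_inner => real) \<longlongrightarrow> 0) at_infinity"
proof (rule Lim_null_comparison)
 show "((\<lambda>x::'a. norm x powr (2 * a)) \<longlongrightarrow> 0) at_infinity"
  by (rule tendsto_norm_powr_at_infinity) (use assms in simp)
 show "\<forall>\<^sub>F x::'a in at_infinity. norm (qpow c a x) \<le> norm x powr (2 * a)"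
  unfolding eventually_at_infinity
  using assms by (intro exI[of _ 1] allI impI) (auto intro!: qpow_le_norm)
qed

lemma nnpot_0_qpow:
 assumes c: "0 < c" and b: "real CARD('n::finite) < 2 * b"
 shows "\<exists>I\<ge>0. \<forall>x::real^'n. nnpot 0 (qpow c (- b)) x \<le> ennreal I"
proof -
 let ?f = "qpow c (- b) :: real^'n => real"
 have int: "integrable lborel ?f" by (rule qpow_integrable[OF c b])
 have "nnpot 0 ?f x \<le> ennreal (LINT y|lborel. ?f y)" for x
 proof -
  have "nnpot 0 ?f x \<le> (\<integral>\<^sup>+y. ennreal (?f y) \<partial>lborel)"
   unfolding nnpot_def
  proof (rule nn_integral_mono, rule ennreal_leI)
   fix y
   have "norm (x - y) powr 0 * \<bar>?f y\<bar> \<le> 1 * ?f y" by (intro mult_mono) auto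
   then show "norm (x - y) powr 0 * \<bar>?f y\<bar> \<le> ?f y" by simp
  qed
  also have "\<dots> = ennreal (LINT y|lborel. ?f y)"
   by (rule nn_integral_eq_integral[OF int]) simp
  finally show ?thesis .
 qed
 moreover have "0 \<le> (LINT y|lborel. ?f y)" by (rule Bochner_Integration.integral_nonneg) simp
 ultimately show ?thesis by blast
qed

lemma tame_qpow:
 assumes c: "0 < c" and b: "real CARD('n::finite) < 2 * b" and d: "- real CARD('n) < d" "d \<le> 0"
 shows "tame d (qpow c (- b) :: real^'n => real) UNIV"
proof (rule tame_of_locally_bounded[OF _ _ d(2,1,2)])
 obtain I where I: "0 \<le> I" "\<And>x::real^'n. nnpot 0 (qpow c (- b)) x \<le> ennreal I"
  using nnpot_0_qpow[OF c b] by blast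
 show "tame 0 (qpow c (- b) :: real^'n => real) UNIV"
  unfolding tame_def using I measurable_qpow[of c "- b"] by (meson zero_less_one)
 show "locally_bounded_on UNIV (qpow c (- b) :: real^'n => real)"
  by (rule continuous_imp_locally_bounded[OF open_UNIV continuous_on_qpow[OF c]])
qed

lemma riesz_qpow_tendsto_0:
 assumes c: "0 < c" and b: "real CARD('n::finite) < 2 * b" and j: "1 \<le> j" "2 * j < CARD('n)"
 shows "(riesz j (qpow c (- b) :: real^'n => real) \<longlongrightarrow> 0) at_infinity"
proof -
 let ?n = "real CARD('n)"
 let ?d = "2 * real j - ?n"
 let ?f = "qpow c (- b) :: real^'n => real"
 have fm: "?f \<in> borel_measurable borel" by (rule measurable_qpow)
 obtain I where I: "0 \<le> I" "\<And>x::real^'n. nnpot 0 ?f x \<le> ennreal I"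
  using nnpot_0_qpow[OF c b] by blast
 obtain C where C: "C > 0" "\<And>(y::real^'n) \<rho>. 0 < \<rho> ==>
  (\<integral>\<^sup>+w. ennreal (norm (y - w) powr ?d) * indicator (ball y \<rho>) w \<partial>lborel) \<le> ennreal (C * \<rho> powr (2 * real j))"
  using nn_integral_near_powr[where 'n = 'n, of "2 * real j"] j by auto
 define h where "h x = C * (norm x / 2) powr (2 * real j - 2 * b) + I * (norm x / 2) powr ?d" for x :: "real^'n"
 have "\<bar>riesz j ?f x\<bar> \<le> h x" if x: "1 \<le> norm x" for x :: "real^'n"
 proof -
  let ?\<rho> = "norm x / 2"
  have "0 < norm x" using x by linarith
  then have \<rho>: "0 < ?\<rho>" by simp
  have M: "\<bar>?f w\<bar> \<le> ?\<rho> powr (- 2 * b)" if "w \<in> ball x ?\<rho>" for w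
  proof -
   have w: "?\<rho> \<le> norm w" using that norm_triangle_ineq2[of x "x - w"] by (simp add: dist_norm)
   have "?f w \<le> norm w powr (2 * - b)"
    using w \<rho> c b by (intro qpow_le_norm) auto
   also have "\<dots> \<le> ?\<rho> powr (2 * - b)" using w \<rho> b by (intro powr_mono2') auto
   finally show ?thesis by simp
  qed
  have "ennreal \<bar>riesz j ?f x\<bar> \<le> ennreal 1 * nnpot ?d ?f x"
   by (rule pot_le_nnpot[OF fm]) simp_all
  also have "\<dots> = nnpot ?d ?f x" by simp
  also have "\<dots> \<le> ennreal (?\<rho> powr (- 2 * b)) * (\<integral>\<^sup>+w. ennreal (norm (x - w) powr ?d) * indicator (ball x ?\<rho>) w \<partial>lborel)
    + ennreal (?\<rho> powr (?d - 0)) * nnpot 0 ?f x"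
   by (rule nnpot_split[OF _ \<rho> fm M]) (use j in simp_all)
  also have "\<dots> \<le> ennreal (?\<rho> powr (- 2 * b)) * ennreal (C * ?\<rho> powr (2 * real j)) + ennreal (?\<rho> powr (?d - 0)) * ennreal I"
   by (intro add_mono mult_left_mono C(2) I(2) \<rho>) simp_all
  also have "\<dots> = ennreal (?\<rho> powr (- 2 * b) * (C * ?\<rho> powr (2 * real j)) + ?\<rho> powr (?d - 0) * I)"
   using C(1) I(1) by (simp add: ennreal_mult[symmetric] ennreal_plus[symmetric] del: ennreal_plus)
  also have "?\<rho> powr (- 2 * b) * (C * ?\<rho> powr (2 * real j)) + ?\<rho> powr (?d - 0) * I = h x"
  proof -
   have "?\<rho> powr (- 2 * b) * ?\<rho> powr (2 * real j) = ?\<rho> powr (2 * real j - 2 * b)"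
    by (simp add: powr_add[symmetric] add.commute)
   note 2 = this
   have 1: "?\<rho> powr (- 2 * b) * (C * ?\<rho> powr (2 * real j)) = C * (?\<rho> powr (- 2 * b) * ?\<rho> powr (2 * real j))"
    by (rule mult.left_commute)
   show ?thesis unfolding h_def 1 2 diff_0_right by (simp only: mult.commute[of I])
  qed
  finally have "ennreal \<bar>riesz j ?f x\<bar> \<le> ennreal (h x)" .
  moreover have "0 \<le> h x" using C(1) I(1) unfolding h_def by (intro add_nonneg_nonneg mult_nonneg_nonneg) simp_all
  ultimately show ?thesis by (simp only: ennreal_le_iff)
 qed
 then have "\<forall>\<^sub>F x in at_infinity. norm (riesz j ?f x) \<le> h x"
  unfolding eventually_at_infinity by (intro exI[of _ 1]) simp
 moreover have "(h \<longlongrightarrow> 0) at_infinity"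
 proof -
  have t: "((\<lambda>x::real^'n. (norm x / 2) powr s) \<longlongrightarrow> 0) at_infinity" if "s < 0" for s
   using tendsto_mult_right[OF tendsto_norm_powr_at_infinity[OF that], of "(1/2) powr s"]
   by (simp add: powr_divide)
  have "(h \<longlongrightarrow> C * 0 + I * 0) at_infinity"
   unfolding h_def by (intro tendsto_intros t) (use j b in simp_all)
  then show ?thesis by simp
 qed
 ultimately show ?thesis by (rule Lim_null_comparison)
qed

text \<open>Both sides have the same iterated Laplacian of order \<open>m\<close> and all the lower iterated Laplacians
 tend to zero at infinity, so Liouville's theorem applies \<open>m\<close> times.\<close>

theorem riesz_bubble:
 fixes x :: "real ^ 'n::finite"
 assumes c: "0 < c" and m: "1 \<le> m" "2 * m < CARD('n)"
 shows "4 ^ m * pochhammer (real CARD('n) / 2 - real m) (2 * m) * c ^ m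
   * riesz m (qpow c (- (real CARD('n) / 2 + real m))) x
  = riesz_const m (m - 1) TYPE('n) * newton_const TYPE('n) * qpow c (- (real CARD('n) / 2 - real m)) x"
proof -
 let ?n = "real CARD('n)"
 let ?b = "?n / 2 - real m"
 let ?f = "qpow c (- (?n / 2 + real m)) :: real^'n => real"
 define A where "A = 4 ^ m * pochhammer ?b (2 * m) * c ^ m"
 define \<gamma> where "\<gamma> = riesz_const m (m - 1) TYPE('n) * newton_const TYPE('n)"
 have te: "tame d ?f UNIV" if "- ?n < d" "d \<le> 0" for d
  by (rule tame_qpow[OF c _ that]) (use m in simp)
 have f1: "C_k_on 1 ?f UNIV"
  by (rule C_k_on_antimono[OF _ open_UNIV C_2_on_qpow[OF c]]) simp
 have tm: "tame (2 * real m - ?n) ?f UNIV" by (rule te) (use m in simp_all)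
 have C2: "C_k_on 2 (riesz j ?f) UNIV" if "1 \<le> j" "j \<le> m" for j
 proof -
  have "C_k_on (2 * j) (riesz j ?f) UNIV"
   by (rule neg_laplacian_pow_riesz(1)[OF open_UNIV that(1) _ te f1]) (use that m in simp_all)
  then show ?thesis by (rule C_k_on_antimono[OF _ open_UNIV, rotated]) (use that in simp)
 qed
 let ?v = "\<lambda>s. neg_laplacian_pow s (qpow c (- ?b) :: real^'n => real)"
 let ?w = "\<lambda>s. neg_laplacian_pow s (riesz m ?f)"
 have w: "?w s = (\<lambda>x. riesz_const m s TYPE('n) * riesz (m - s) ?f x)" if "s < m" for s
  by (rule ext) (rule neg_laplacian_pow_riesz(2)[OF open_UNIV m tm f1 that UNIV_I])
 have wm: "?w m x = \<gamma> * ?f x" for x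
  unfolding \<gamma>_def by (rule neg_laplacian_pow_riesz(3)[OF open_UNIV m tm f1 UNIV_I])
 have vm: "?v m x = A * ?f x" for x
  unfolding A_def by (rule neg_laplacian_pow_bubble[OF c])
 have wC: "C_k_on 2 (?w s) UNIV" if "s < m" for s
 proof -
  have "C_k_on 2 (\<lambda>x. riesz_const m s TYPE('n) * riesz (m - s) ?f x + 0 * riesz (m - s) ?f x) UNIV"
   by (rule C_k_on_lincomb[OF open_UNIV C2 C2]) (use that in simp_all)
  then show ?thesis unfolding w[OF that] by simp
 qed
 have vC: "C_k_on 2 (?v s) UNIV" for s by (rule neg_laplacian_pow_qpow_C2[OF c refl])
 have vlim: "(?v s \<longlongrightarrow> 0) at_infinity" for s
 proof -
  have "((\<lambda>x::real^'n. \<Sum>i\<le>s. bubble_coeff (real m) ?b s i * c ^ i * qpow c (- (?b + real (s + i))) x)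
    \<longlongrightarrow> (\<Sum>i\<le>s. bubble_coeff (real m) ?b s i * c ^ i * 0)) at_infinity"
   by (intro tendsto_intros tendsto_qpow_at_infinity[OF c]) (use m in \<open>simp add: field_simps\<close>)
  moreover have "?v s = (\<lambda>x. \<Sum>i\<le>s. bubble_coeff (real m) ?b s i * c ^ i * qpow c (- (?b + real (s + i))) x)"
   by (rule ext) (rule neg_laplacian_pow_qpow[OF c refl])
  ultimately show ?thesis by simp
 qed
 have wlim: "(?w s \<longlongrightarrow> 0) at_infinity" if "s < m" for s
 proof -
  have "((\<lambda>x. riesz_const m s TYPE('n) * riesz (m - s) ?f x) \<longlongrightarrow> riesz_const m s TYPE('n) * 0) at_infinity"
   by (intro tendsto_intros riesz_qpow_tendsto_0[OF c]) (use m that in simp_all)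
  then show ?thesis unfolding w[OF that] by simp
 qed
 have zero: "\<forall>x. \<gamma> * ?v (m - s) x + (- A) * ?w (m - s) x = 0" if "s \<le> m" for s
  using that
 proof (induction s)
  case 0
  show ?case unfolding minus_nat.diff_0 vm wm by simp
 next
  case (Suc s)
  define t where "t = m - Suc s"
  have t: "t < m" "m - s = Suc t" using Suc.prems by (auto simp: t_def)
  have "\<gamma> * ?v t x + (- A) * ?w t x = 0" for x
  proof (rule harmonic_vanishing_at_infinity)
   show "C_k_on 2 (\<lambda>x. \<gamma> * ?v t x + (- A) * ?w t x) UNIV"
    by (rule C_k_on_lincomb[OF open_UNIV vC wC[OF t(1)]])
   show "laplacian (\<lambda>x. \<gamma> * ?v t x + (- A) * ?w t x) x = 0" for x
   proof -
    have "laplacian (\<lambda>x. \<gamma> * ?v t x + (- A) * ?w t x) x = \<gamma> * laplacian (?v t) x + (- A) * laplacian (?w t) x"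
     by (rule laplacian_lincomb[OF open_UNIV UNIV_I vC wC[OF t(1)]])
    also have "\<dots> = - (\<gamma> * ?v (Suc t) x + (- A) * ?w (Suc t) x)"
     by (simp add: neg_laplacian_pow_Suc)
    also have "\<dots> = 0" using Suc.IH Suc.prems unfolding t(2) by simp
    finally show ?thesis .
   qed
   have "((\<lambda>x. \<gamma> * ?v t x + (- A) * ?w t x) \<longlongrightarrow> \<gamma> * 0 + (- A) * 0) at_infinity"
    by (intro tendsto_intros vlim wlim[OF t(1)])
   then show "((\<lambda>x. \<gamma> * ?v t x + (- A) * ?w t x) \<longlongrightarrow> 0) at_infinity" by simp
  qed
  then show ?case unfolding t_def by simp
 qed
 from zero[of m] have "\<gamma> * ?v 0 x = A * ?w 0 x" by simp
 then show ?thesis unfolding A_def \<gamma>_def by (simp add: neg_laplacian_pow_def)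
qed

section \<open>The normalised inverse of the polyharmonic operator\<close>

lemma measurable_nnpot_integrand_lborel:
 fixes f :: "real ^ 'n::finite => real"
 assumes "f \<in> borel_measurable borel"
 shows "(\<lambda>y. ennreal (norm (x - y) powr d * \<bar>f y\<bar>)) \<in> borel_measurable lborel"
 using measurable_nnpot_integrand[OF assms, of x d] by simp

lemma solve_for_factor: "Z * M * R = g * Q ==> Z \<noteq> 0 ==> M \<noteq> 0 ==> g \<noteq> 0 ==> R / g = 1 / Z * (1 / M) * Q"
 for Z M R g Q :: real
 by (simp add: field_simps)

lemma nnpot_cmult:
 assumes "f \<in> borel_measurable borel" "0 \<le> c"
 shows "nnpot d (\<lambda>y. c * f y) x = ennreal c * nnpot d f x"
proof -
 have "nnpot d (\<lambda>y. c * f y) x = (\<integral>\<^sup>+y. ennreal c * ennreal (norm (x - y) powr d * \<bar>f y\<bar>) \<partial>lborel)"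
  unfolding nnpot_def
  by (rule nn_integral_cong) (use assms(2) in \<open>simp add: abs_mult ennreal_mult[symmetric] mult.left_commute\<close>)
 also have "\<dots> = ennreal c * nnpot d f x"
  unfolding nnpot_def by (rule nn_integral_cmult) (simp add: measurable_nnpot_integrand[OF assms(1)])
 finally show ?thesis .
qed

lemma nnpot_add:
 assumes "f \<in> borel_measurable borel" "g \<in> borel_measurable borel" "\<And>y. 0 \<le> f y" "\<And>y. 0 \<le> g y"
 shows "nnpot d (\<lambda>y. f y + g y) x = nnpot d f x + nnpot d g x"
proof -
 have "nnpot d (\<lambda>y. f y + g y) x = (\<integral>\<^sup>+y. ennreal (norm (x - y) powr d * \<bar>f y\<bar>) + ennreal (norm (x - y) powr d * \<bar>g y\<bar>) \<partial>lborel)"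
  unfolding nnpot_def
 proof (rule nn_integral_cong)
  fix y
  show "ennreal (norm (x - y) powr d * \<bar>f y + g y\<bar>) = ennreal (norm (x - y) powr d * \<bar>f y\<bar>) + ennreal (norm (x - y) powr d * \<bar>g y\<bar>)"
   using assms(3,4)[of y] by (simp add: ennreal_plus[symmetric] distrib_left del: ennreal_plus)
 qed
 also have "\<dots> = nnpot d f x + nnpot d g x"
  unfolding nnpot_def
  by (rule nn_integral_add[OF measurable_nnpot_integrand_lborel[OF assms(1)] measurable_nnpot_integrand_lborel[OF assms(2)]])
 finally show ?thesis .
qed

lemma nnpot_suminf:
 fixes f :: "nat => real ^ 'n::finite => real"
 assumes f: "\<And>i. f i \<in> borel_measurable borel" "\<And>i y. 0 \<le> f i y" "\<And>y. summable (\<lambda>i. f i y)"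
 shows "nnpot d (\<lambda>y. \<Sum>i. f i y) x = (\<Sum>i. nnpot d (f i) x)"
proof -
 have "nnpot d (\<lambda>y. \<Sum>i. f i y) x = (\<integral>\<^sup>+y. (\<Sum>i. ennreal (norm (x - y) powr d * \<bar>f i y\<bar>)) \<partial>lborel)"
  unfolding nnpot_def
 proof (rule nn_integral_cong)
  fix y
  have "(\<Sum>i. ennreal (norm (x - y) powr d * \<bar>f i y\<bar>)) = ennreal (\<Sum>i. norm (x - y) powr d * f i y)"
   using f(2) by (subst suminf_ennreal2) (auto intro!: summable_mult f(3))
  also have "(\<Sum>i. norm (x - y) powr d * f i y) = norm (x - y) powr d * (\<Sum>i. f i y)"
   by (rule suminf_mult[OF f(3)])
  finally show "ennreal (norm (x - y) powr d * \<bar>\<Sum>i. f i y\<bar>) = (\<Sum>i. ennreal (norm (x - y) powr d * \<bar>f i y\<bar>))"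
   using suminf_nonneg[OF f(3) f(2), of y] by simp
 qed
 also have "\<dots> = (\<Sum>i. nnpot d (f i) x)"
  unfolding nnpot_def by (rule nn_integral_suminf[OF measurable_nnpot_integrand_lborel[OF f(1)]])
 finally show ?thesis .
qed

lemma nnpot_translate:
 fixes f :: "real ^ 'n::finite => real"
 assumes f: "f \<in> borel_measurable borel"
 shows "nnpot d (\<lambda>y. f (y - z)) x = nnpot d f (x - z)"
proof -
 have m: "(\<lambda>y. f (y - z)) \<in> borel_measurable borel"
  by (rule measurable_compose[OF _ f]) simp
 have "nnpot d (\<lambda>y. f (y - z)) x = ennreal (\<bar>1\<bar> ^ DIM(real^'n)) *
   (\<integral>\<^sup>+y. ennreal (norm (x - (z + 1 *\<^sub>R y)) powr d * \<bar>f (z + 1 *\<^sub>R y - z)\<bar>) \<partial>lborel)"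
  unfolding nnpot_def by (rule nn_integral_lborel_affine[OF _ measurable_nnpot_integrand[OF m]]) simp
 then show ?thesis by (simp add: nnpot_def diff_diff_eq)
qed

lemma ennreal_pot_eq_nnpot:
 fixes f :: "real ^ 'n::finite => real"
 assumes f: "f \<in> borel_measurable borel" "\<And>y. 0 \<le> f y" and fin: "nnpot d f x < \<infinity>"
 shows "ennreal (pot (\<lambda>z. norm z powr d) f x) = nnpot d f x" "0 \<le> pot (\<lambda>z. norm z powr d) f x"
proof -
 have int: "integrable lborel (\<lambda>y. norm (x - y) powr d * f y)"
  by (rule pot_integrable[OF kernel_class_norm_powr[of 0] f(1) fin])
 show "ennreal (pot (\<lambda>z. norm z powr d) f x) = nnpot d f x"
  using nn_integral_eq_integral[OF int] f(2) by (simp add: pot_def nnpot_def)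
 show "0 \<le> pot (\<lambda>z. norm z powr d) f x"
  unfolding pot_def using f(2) by (intro Bochner_Integration.integral_nonneg) simp
qed

lemma pot_nonneg_pos:
 fixes f :: "real ^ 'n::finite => real"
 assumes f: "f \<in> borel_measurable borel" "\<And>y. 0 \<le> f y" and fin: "nnpot d f x < \<infinity>"
  and pos: "0 < r" "\<And>y. y \<in> ball z r ==> 0 < f y"
 shows "0 < pot (\<lambda>z. norm z powr d) f x"
proof -
 have int: "integrable lborel (\<lambda>y. norm (x - y) powr d * f y)"
  by (rule pot_integrable[OF kernel_class_norm_powr[of 0] f(1) fin])
 have "pot (\<lambda>z. norm z powr d) f x \<noteq> 0"
 proof
  assume "pot (\<lambda>z. norm z powr d) f x = 0"
  then have "AE y in lborel. norm (x - y) powr d * f y = 0"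
   using integral_nonneg_eq_0_iff_AE[OF int] f(2) by (simp add: pot_def)
  with AE_neq[of x] have "AE y in lborel. y \<notin> ball z r"
  proof eventually_elim
   case (elim y)
   then show ?case using pos(2)[of y] by auto
  qed
  then have "emeasure lborel (ball z r) = 0"
   by (subst (asm) AE_iff_measurable[of "ball z r"]) auto
  moreover have "emeasure lborel (ball z r) \<noteq> 0"
   unfolding emeasure_ball[OF less_imp_le[OF pos(1)]]
   using pos(1) unit_ball_vol_pos[of "real DIM(real^'n)"] by (simp add: ennreal_eq_0_iff not_le)
  ultimately show False by blast
 qed
 then show ?thesis using ennreal_pot_eq_nnpot(2)[OF f fin] by simp
qed

text \<open>The argument \<open>dim\<close> carries the dimension to those constants whose types do not mention it.\<close>

locale riesz_setting =
 fixes m :: nat and N :: real and dim :: "'n::finite itself"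
 assumes m1: "1 \<le> m" and dim4: "2 * m + 4 \<le> CARD('n)" and N_def: "N = real CARD('n) - 2 * real m"
begin

definition p :: real where "p = (N + 4 * real m) / N"

definition \<gamma> :: real where "\<gamma> = riesz_const m (m - 1) dim * newton_const dim"

lemma \<gamma>_eq: "\<gamma> = riesz_const m (m - 1) TYPE('n) * newton_const TYPE('n)"
 by (simp add: \<gamma>_def riesz_const_def newton_const_def)

text \<open>Values in \<open>ennreal\<close> allow for monotone arguments without discussing integrability first.\<close>

definition T :: "(real ^ 'n => real) => real ^ 'n => ennreal" where
 "T f x = ennreal (1 / \<gamma>) * nnpot (- N) f x"

definition c1 :: real where "c1 = 1 / (4 ^ m * pochhammer (N / 2) (2 * m))"

definition q :: "real => real ^ 'n => real ^ 'n => real" where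
 "q \<mu> z x = qpow (\<mu>\<^sup>2) (- (N / 2)) (x - z)"

lemma N4: "4 \<le> N" using dim4 by (simp add: N_def)

lemma n_eq: "real CARD('n) = N + 2 * real m" by (simp add: N_def)

lemma m1r: "1 \<le> real m" using m1 by simp

lemma \<gamma>_pos: "0 < \<gamma>"
 unfolding \<gamma>_eq using m1 dim4
 by (intro mult_pos_pos riesz_const_pos newton_const_pos) simp_all

lemma c1_pos: "0 < c1"
 unfolding c1_def using N4 by (simp add: pochhammer_pos)

lemma p_minus_1: "(p - 1) * N = 4 * real m" "p * N = N + 4 * real m" "p - 1 = 4 * real m / N"
 using N4 by (simp_all add: p_def field_simps)

lemma p_gt_1: "1 < p"
proof -
 have "0 < 4 * real m / N" using N4 m1r by (intro divide_pos_pos) simp_all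
 then show ?thesis using p_minus_1(3) by linarith
qed

lemma q_pos: "0 < \<mu> ==> 0 < q \<mu> z x"
 unfolding q_def by (intro qpow_pos qdom_pos) simp

lemma q_powr_p: "q \<mu> z x powr p = qpow (\<mu>\<^sup>2) (- (real CARD('n) / 2 + real m)) (x - z)"
proof -
 have "- (N / 2) * p = - (real CARD('n) / 2 + real m)" using p_minus_1(2) n_eq by (simp add: field_simps)
 then show ?thesis by (simp add: q_def qpow_def powr_powr)
qed

lemma T_mono: "(\<And>y. \<bar>f y\<bar> \<le> \<bar>g y\<bar>) ==> T f x \<le> T g x"
 unfolding T_def by (intro mult_left_mono nnpot_mono) auto

lemma T_cmult: "f \<in> borel_measurable borel ==> 0 \<le> c ==> T (\<lambda>y. c * f y) x = ennreal c * T f x"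
 unfolding T_def by (simp add: nnpot_cmult mult.left_commute)

lemma T_add: "f \<in> borel_measurable borel ==> g \<in> borel_measurable borel ==>
  (\<And>y. 0 \<le> f y) ==> (\<And>y. 0 \<le> g y) ==> T (\<lambda>y. f y + g y) x = T f x + T g x"
 unfolding T_def by (simp add: nnpot_add distrib_left)

lemma T_suminf:
 assumes "\<And>i. f i \<in> borel_measurable borel" "\<And>i y. 0 \<le> f i y" "\<And>y. summable (\<lambda>i. f i y)"
 shows "T (\<lambda>y. \<Sum>i. f i y) x = (\<Sum>i. T (f i) x)"
 unfolding T_def by (simp add: nnpot_suminf[OF assms])

lemma T_finite_iff: "T f x < \<infinity> \<longleftrightarrow> nnpot (- N) f x < \<infinity>"
 unfolding T_def using \<gamma>_pos by (auto simp: ennreal_mult_less_top)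

lemma riesz_kernel: "riesz m = pot (\<lambda>z::real^'n. norm z powr (- N))"
 by (simp add: N_def)

lemma T_eq_riesz:
 assumes f: "f \<in> borel_measurable borel" "\<And>y. 0 \<le> f y" and fin: "T f x < \<infinity>"
 shows "enn2real (T f x) = riesz m f x / \<gamma>" "0 \<le> riesz m f x"
proof -
 have fin': "nnpot (- N) f x < \<infinity>" using fin by (simp only: T_finite_iff)
 note e = ennreal_pot_eq_nnpot[OF f fin']
 show "0 \<le> riesz m f x" using e(2) by (simp only: riesz_kernel)
 show "enn2real (T f x) = riesz m f x / \<gamma>"
  unfolding T_def e(1)[symmetric] riesz_kernel using e(2) \<gamma>_pos
  by (simp add: ennreal_mult[symmetric])
qed

lemma abs_riesz_le_T:
 assumes f: "f \<in> borel_measurable borel"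
 shows "ennreal \<bar>riesz m f x / \<gamma>\<bar> \<le> T f x"
proof -
 have "ennreal \<bar>riesz m f x\<bar> \<le> ennreal 1 * nnpot (- N) f x"
  unfolding riesz_kernel by (rule pot_le_nnpot[OF f]) simp_all
 then have "ennreal (1 / \<gamma>) * ennreal \<bar>riesz m f x\<bar> \<le> T f x"
  unfolding T_def by (intro mult_left_mono) simp_all
 then show ?thesis using \<gamma>_pos by (simp add: ennreal_mult[symmetric])
qed

lemma measurable_q: "q \<mu> z \<in> borel_measurable borel"
 unfolding q_def by (rule measurable_compose[OF _ measurable_qpow]) simp

lemma measurable_q_powr: "(\<lambda>x. q \<mu> z x powr s) \<in> borel_measurable borel"
 using measurable_q[of \<mu> z] by simp

lemma T_q_powr_p:
 assumes \<mu>: "0 < \<mu>"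
 shows "T (\<lambda>y. q \<mu> z y powr p) x = ennreal (c1 * \<mu> powr (- 2 * real m) * q \<mu> z x)"
proof -
 let ?f = "qpow (\<mu>\<^sup>2) (- (real CARD('n) / 2 + real m)) :: real^'n => real"
 have \<mu>2: "0 < \<mu>\<^sup>2" using \<mu> by simp
 have fm: "?f \<in> borel_measurable borel" by (rule measurable_qpow)
 have t: "tame (- N) ?f UNIV"
  by (rule tame_qpow[OF \<mu>2]) (use m1r N4 n_eq in simp_all)
 have fin: "nnpot (- N) ?f w < \<infinity>" for w by (rule tame_finite[OF t UNIV_I])
 have A: "0 < 4 ^ m * pochhammer (N / 2) (2 * m)" using N4 by (simp add: pochhammer_pos)
 have "(4 ^ m * pochhammer (real CARD('n) / 2 - real m) (2 * m)) * (\<mu>\<^sup>2) ^ m * riesz m ?f (x - z)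
   = \<gamma> * qpow (\<mu>\<^sup>2) (- (real CARD('n) / 2 - real m)) (x - z)"
  unfolding \<gamma>_eq using m1 dim4 by (intro riesz_bubble[OF \<mu>2]) simp_all
 moreover have "real CARD('n) / 2 - real m = N / 2" by (simp add: N_def)
 ultimately have "(4 ^ m * pochhammer (N / 2) (2 * m)) * (\<mu>\<^sup>2) ^ m * riesz m ?f (x - z) = \<gamma> * q \<mu> z x"
  unfolding q_def by (simp only:)
 then have "riesz m ?f (x - z) / \<gamma> = c1 * (1 / (\<mu>\<^sup>2) ^ m) * q \<mu> z x"
  unfolding c1_def by (rule solve_for_factor) (use A \<mu>2 \<gamma>_pos in auto)
 moreover have "1 / (\<mu>\<^sup>2) ^ m = \<mu> powr (- 2 * real m)"
  using \<mu> powr_realpow[OF \<mu>, of "2 * m"] by (simp add: powr_minus_divide power_mult)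
 ultimately have eq: "riesz m ?f (x - z) / \<gamma> = c1 * \<mu> powr (- 2 * real m) * q \<mu> z x" by (simp only:)
 have "T (\<lambda>y. q \<mu> z y powr p) x = ennreal (1 / \<gamma>) * nnpot (- N) (\<lambda>y. ?f (y - z)) x"
  unfolding T_def q_powr_p ..
 also have "\<dots> = ennreal (1 / \<gamma>) * ennreal (riesz m ?f (x - z))"
  unfolding nnpot_translate[OF fm] riesz_kernel
  by (rule arg_cong[where f = "(*) (ennreal (1 / \<gamma>))"])
   (rule ennreal_pot_eq_nnpot(1)[OF fm qpow_nonneg fin, symmetric])
 also have "\<dots> = ennreal (riesz m ?f (x - z) / \<gamma>)"
  using \<gamma>_pos ennreal_pot_eq_nnpot(2)[OF fm _ fin] unfolding riesz_kernel
  by (simp add: ennreal_mult[symmetric])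
 finally show ?thesis by (simp only: eq)
qed

lemma T_outer_power:
 "\<exists>C>0. \<forall>z x r. 0 < r --> T (\<lambda>y. norm (y - z) powr (- 4 * real m) * indicator (- ball z r) y) x
   \<le> ennreal (C * r powr (- 2 * real m))"
proof -
 obtain A where A: "A > 0" "\<And>(x::real^'n) \<rho>. 0 < \<rho> ==>
  (\<integral>\<^sup>+y. ennreal (norm (x - y) powr (2 * real m - real CARD('n))) * indicator (ball x \<rho>) y \<partial>lborel) \<le> ennreal (A * \<rho> powr (2 * real m))"
  using nn_integral_near_powr[where 'n = 'n, of "2 * real m"] m1r dim4 by auto
 obtain B where B: "B > 0" "\<And>(x::real^'n) \<rho>. 0 < \<rho> ==>
  (\<integral>\<^sup>+y. ennreal (norm (x - y) powr (- (2 * real m) - real CARD('n))) * indicator (- ball x \<rho>) y \<partial>lborel) \<le> ennreal (B * \<rho> powr (- (2 * real m)))"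
  using nn_integral_far_powr[where 'n = 'n, of "2 * real m"] m1r by auto
 have mI: "(\<lambda>y. ennreal (norm (x - y) powr d) * indicator S y) \<in> borel_measurable lborel"
  if "S \<in> sets borel" for x d and S :: "(real^'n) set"
  using measurable_reflect[OF measurable_norm_powr[of d], of x] that
  by (intro borel_measurable_times_ennreal) (simp_all add: borel_measurable_indicator)
 have "T (\<lambda>y. norm (y - z) powr (- 4 * real m) * indicator (- ball z r) y) x \<le> ennreal (((A + 2 * B) / \<gamma>) * r powr (- 2 * real m))"
  if r: "0 < r" for z x r
 proof -
  let ?a = "\<lambda>y. ennreal (r powr (- 4 * real m)) * (ennreal (norm (x - y) powr (2 * real m - real CARD('n))) * indicator (ball x r) y)"
  let ?b = "\<lambda>(x::real^'n) y. ennreal (norm (x - y) powr (- (2 * real m) - real CARD('n))) * indicator (- ball x r) y"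
  have N2: "- N = 2 * real m - real CARD('n)" by (simp add: N_def)
  have "nnpot (- N) (\<lambda>y. norm (y - z) powr (- 4 * real m) * indicator (- ball z r) y) x
    \<le> (\<integral>\<^sup>+y. ?a y + (?b x y + ?b z y) \<partial>lborel)"
   unfolding nnpot_def
  proof (rule nn_integral_mono)
   fix y
   let ?l = "norm (x - y) powr (- N) * \<bar>norm (y - z) powr (- 4 * real m) * indicator (- ball z r) y\<bar>"
   show "ennreal ?l \<le> ?a y + (?b x y + ?b z y)"
   proof (cases "y \<in> ball z r")
    case False
    then have yz: "r \<le> norm (y - z)" by (simp add: dist_norm norm_minus_commute)
    have l: "?l = norm (x - y) powr (- N) * norm (y - z) powr (- 4 * real m)" using False by simp
    consider "norm (y - z) \<le> norm (x - y)" | "norm (x - y) < norm (y - z)" "norm (x - y) < r"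
     | "norm (x - y) < norm (y - z)" "r \<le> norm (x - y)" by linarith
    then show ?thesis
    proof cases
     case 1
     have "?l \<le> norm (y - z) powr (- N) * norm (y - z) powr (- 4 * real m)"
      unfolding l using 1 yz r N4 by (intro mult_right_mono powr_mono2') auto
     also have "\<dots> = norm (z - y) powr (- (2 * real m) - real CARD('n))"
      by (simp add: powr_add[symmetric] N_def norm_minus_commute)
     finally have "ennreal ?l \<le> ?b z y" using False by (simp add: ennreal_leI)
     then show ?thesis by (simp add: add_increasing)
    next
     case 2
     have "?l \<le> r powr (- 4 * real m) * norm (x - y) powr (2 * real m - real CARD('n))"
      unfolding l unfolding N2 using 2 yz r by (subst mult.commute, intro mult_right_mono powr_mono2') auto
     then have "ennreal ?l \<le> ?a y" using 2(2) by (simp add: dist_norm ennreal_mult[symmetric] ennreal_leI)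
     then show ?thesis by (simp add: add_increasing2)
    next
     case 3
     have "?l \<le> norm (x - y) powr (- N) * norm (x - y) powr (- 4 * real m)"
      unfolding l using 3 yz r by (intro mult_left_mono powr_mono2') auto
     also have "\<dots> = norm (x - y) powr (- (2 * real m) - real CARD('n))"
      by (simp add: powr_add[symmetric] N_def)
     finally have "ennreal ?l \<le> ?b x y" using 3(2) by (simp add: dist_norm ennreal_leI)
     then show ?thesis by (simp add: add_increasing add_increasing2)
    qed
   qed simp
  qed
  also have "\<dots> = ennreal (r powr (- 4 * real m)) * (\<integral>\<^sup>+y. ennreal (norm (x - y) powr (2 * real m - real CARD('n))) * indicator (ball x r) y \<partial>lborel)
    + ((\<integral>\<^sup>+y. ?b x y \<partial>lborel) + (\<integral>\<^sup>+y. ?b z y \<partial>lborel))"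
  proof -
   have ma: "(\<lambda>y. ennreal (norm (x - y) powr (2 * real m - real CARD('n))) * indicator (ball x r) y) \<in> borel_measurable lborel"
    by (rule mI) simp
   have mb: "?b w \<in> borel_measurable lborel" for w by (rule mI) simp
   show ?thesis
    unfolding nn_integral_add[OF borel_measurable_times_ennreal[OF borel_measurable_const ma] borel_measurable_add[OF mb mb]]
     nn_integral_cmult[OF ma] nn_integral_add[OF mb mb] ..
  qed
  also have "\<dots> \<le> ennreal (r powr (- 4 * real m)) * ennreal (A * r powr (2 * real m))
    + (ennreal (B * r powr (- (2 * real m))) + ennreal (B * r powr (- (2 * real m))))"
   by (intro add_mono mult_left_mono A(2) B(2) r) simp
  also have "\<dots> = ennreal (r powr (- 4 * real m) * (A * r powr (2 * real m)) + (B * r powr (- (2 * real m)) + B * r powr (- (2 * real m))))"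
   using A(1) B(1) by (simp add: ennreal_mult[symmetric] ennreal_plus[symmetric] del: ennreal_plus)
  also have "r powr (- 4 * real m) * (A * r powr (2 * real m)) = A * (r powr (- 4 * real m) * r powr (2 * real m))"
   by (rule mult.left_commute)
  also have "r powr (- 4 * real m) * r powr (2 * real m) = r powr (- 2 * real m)"
   by (simp add: powr_add[symmetric])
  finally have "nnpot (- N) (\<lambda>y. norm (y - z) powr (- 4 * real m) * indicator (- ball z r) y) x
    \<le> ennreal ((A + 2 * B) * r powr (- 2 * real m))" by (simp add: algebra_simps)
  then have "T (\<lambda>y. norm (y - z) powr (- 4 * real m) * indicator (- ball z r) y) x
    \<le> ennreal (1 / \<gamma>) * ennreal ((A + 2 * B) * r powr (- 2 * real m))"
   unfolding T_def by (intro mult_left_mono) simp_all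
  also have "\<dots> = ennreal (((A + 2 * B) / \<gamma>) * r powr (- 2 * real m))"
   using A(1) B(1) \<gamma>_pos by (simp add: ennreal_mult[symmetric])
  finally show ?thesis .
 qed
 moreover have "0 < (A + 2 * B) / \<gamma>" using A(1) B(1) \<gamma>_pos by simp
 ultimately show ?thesis by blast
qed

lemma T_ball:
 "\<exists>C>0. \<forall>z x \<rho>. 0 < \<rho> --> x \<in> ball z \<rho> --> T (indicator (ball z \<rho>)) x \<le> ennreal (C * \<rho> powr (2 * real m))"
proof -
 obtain A where A: "A > 0" "\<And>(x::real^'n) \<rho>. 0 < \<rho> ==>
  (\<integral>\<^sup>+y. ennreal (norm (x - y) powr (2 * real m - real CARD('n))) * indicator (ball x \<rho>) y \<partial>lborel) \<le> ennreal (A * \<rho> powr (2 * real m))"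
  using nn_integral_near_powr[where 'n = 'n, of "2 * real m"] m1r dim4 by auto
 have "T (indicator (ball z \<rho>)) x \<le> ennreal ((A * 2 powr (2 * real m) / \<gamma>) * \<rho> powr (2 * real m))"
  if \<rho>: "0 < \<rho>" and x: "x \<in> ball z \<rho>" for z x \<rho>
 proof -
  have "nnpot (- N) (indicator (ball z \<rho>)) x \<le> (\<integral>\<^sup>+y. ennreal (norm (x - y) powr (2 * real m - real CARD('n))) * indicator (ball x (2 * \<rho>)) y \<partial>lborel)"
   unfolding nnpot_def
  proof (rule nn_integral_mono)
   fix y
   have "y \<in> ball x (2 * \<rho>)" if "y \<in> ball z \<rho>"
    using that x dist_triangle[of x y z] by (simp add: dist_commute)
   then show "ennreal (norm (x - y) powr (- N) * \<bar>indicator (ball z \<rho>) y\<bar>)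
     \<le> ennreal (norm (x - y) powr (2 * real m - real CARD('n))) * indicator (ball x (2 * \<rho>)) y"
    by (auto simp: indicator_def N_def)
  qed
  also have "\<dots> \<le> ennreal (A * (2 * \<rho>) powr (2 * real m))" using \<rho> by (intro A(2)) simp
  finally have "T (indicator (ball z \<rho>)) x \<le> ennreal (1 / \<gamma>) * ennreal (A * (2 * \<rho>) powr (2 * real m))"
   unfolding T_def by (intro mult_left_mono) simp_all
  also have "\<dots> = ennreal ((A * 2 powr (2 * real m) / \<gamma>) * \<rho> powr (2 * real m))"
   using A(1) \<gamma>_pos \<rho> by (simp add: ennreal_mult[symmetric] powr_mult)
  finally show ?thesis .
 qed
 moreover have "0 < A * 2 powr (2 * real m) / \<gamma>" using A(1) \<gamma>_pos by simp
 ultimately show ?thesis by blast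
qed

definition dpot :: "(real ^ 'n => real) => real ^ 'n => real ^ 'n" where
 "dpot f x = (\<chi> i. pot (partial i (\<lambda>z::real^'n. norm z powr (- N))) f x)"

text \<open>At distance at least \<open>r\<close> the gradient of the kernel is bounded by the kernel over \<open>r\<close>; the
 rest is the integral of the gradient of the kernel over a ball, where the density is bounded by \<open>E\<close>.\<close>

lemma gradient_riesz_bound:
 "\<exists>C>0. \<forall>F x r E Q. F \<in> borel_measurable borel --> 0 < r --> 0 \<le> E --> 0 \<le> Q -->
   (\<forall>y\<in>ball x r. \<bar>F y\<bar> \<le> E) --> T F x \<le> ennreal Q -->
   norm (dpot F x) \<le> C * (Q / r + E * r powr (2 * real m - 1))"
proof -
 let ?G = "\<lambda>z::real^'n. norm z powr (- N)"
 obtain A where A: "A > 0" "\<And>(x::real^'n) \<rho>. 0 < \<rho> ==>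
  (\<integral>\<^sup>+y. ennreal (norm (x - y) powr (2 * real m - 1 - real CARD('n))) * indicator (ball x \<rho>) y \<partial>lborel) \<le> ennreal (A * \<rho> powr (2 * real m - 1))"
  using nn_integral_near_powr[where 'n = 'n, of "2 * real m - 1"] m1r dim4 by auto
 obtain B where B: "B \<ge> 0" "\<And>z. z \<noteq> 0 ==> norm (gradient ?G z) \<le> B * norm z powr (- N - 1)"
  using kernel_gradient_bound[OF kernel_class_norm_powr[of 1 "- N"]] by blast
 have Bi: "\<bar>partial i ?G z\<bar> \<le> B * norm z powr (- N - 1)" if "z \<noteq> 0" for i z
  using order_trans[OF component_le_norm_cart B(2)[OF that], of i] by simp
 let ?C = "real CARD('n) * ((B + 1) * (A + \<gamma>))"
 have "norm (\<chi> i. pot (partial i ?G) F x) \<le> ?C * (Q / r + E * r powr (2 * real m - 1))"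
  if F: "F \<in> borel_measurable borel" and r: "0 < r" and E: "0 \<le> E" and Q: "0 \<le> Q"
   and FE: "\<forall>y\<in>ball x r. \<bar>F y\<bar> \<le> E" and TQ: "T F x \<le> ennreal Q" for F x r E Q
 proof -
  have nQ: "nnpot (- N) F x \<le> ennreal (\<gamma> * Q)"
  proof -
   have "nnpot (- N) F x = ennreal \<gamma> * T F x"
    unfolding T_def mult.assoc[symmetric] using \<gamma>_pos by (simp add: ennreal_mult[symmetric])
   also have "\<dots> \<le> ennreal \<gamma> * ennreal Q" by (intro mult_left_mono TQ) simp
   finally show ?thesis using \<gamma>_pos Q by (simp add: ennreal_mult)
  qed
  have d: "- N - 1 = 2 * real m - 1 - real CARD('n)" by (simp add: N_def)
  have "nnpot (- N - 1) F x \<le> ennreal E * (\<integral>\<^sup>+y. ennreal (norm (x - y) powr (- N - 1)) * indicator (ball x r) y \<partial>lborel)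
    + ennreal (r powr (- N - 1 - (- N))) * nnpot (- N) F x"
   by (rule nnpot_split[OF _ r F]) (use FE E in auto)
  also have "\<dots> \<le> ennreal E * ennreal (A * r powr (2 * real m - 1)) + ennreal (r powr (- N - 1 - (- N))) * ennreal (\<gamma> * Q)"
   unfolding d by (intro add_mono mult_left_mono A(2) r nQ) simp_all
  also have "r powr (- N - 1 - (- N)) = 1 / r" using r by (simp add: powr_minus_divide)
  also have "ennreal E * ennreal (A * r powr (2 * real m - 1)) + ennreal (1 / r) * ennreal (\<gamma> * Q)
    = ennreal (E * (A * r powr (2 * real m - 1)) + 1 / r * (\<gamma> * Q))"
   using E A(1) \<gamma>_pos Q r by (simp add: ennreal_mult[symmetric] ennreal_plus[symmetric] del: ennreal_plus)
  also have "\<dots> \<le> ennreal ((A + \<gamma>) * (Q / r + E * r powr (2 * real m - 1)))"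
  proof (rule ennreal_leI)
   have "0 \<le> A * (Q / r)" "0 \<le> \<gamma> * (E * r powr (2 * real m - 1))" using A(1) \<gamma>_pos E Q r by auto
   then show "E * (A * r powr (2 * real m - 1)) + 1 / r * (\<gamma> * Q) \<le> (A + \<gamma>) * (Q / r + E * r powr (2 * real m - 1))"
    by (simp add: algebra_simps)
  qed
  finally have nn: "nnpot (- N - 1) F x \<le> ennreal ((A + \<gamma>) * (Q / r + E * r powr (2 * real m - 1)))" .
  let ?V = "Q / r + E * r powr (2 * real m - 1)"
  have V: "0 \<le> ?V" using E Q r by simp
  have "\<bar>pot (partial i ?G) F x\<bar> \<le> (B + 1) * ((A + \<gamma>) * ?V)" for i
  proof -
   have "ennreal \<bar>pot (partial i ?G) F x\<bar> \<le> ennreal B * nnpot (- N - 1) F x"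
    by (rule pot_le_nnpot[OF F B(1) Bi])
   also have "\<dots> \<le> ennreal B * ennreal ((A + \<gamma>) * ?V)" by (intro mult_left_mono nn) simp
   also have "\<dots> = ennreal (B * ((A + \<gamma>) * ?V))" using B(1) A(1) \<gamma>_pos V by (simp add: ennreal_mult)
   finally have "\<bar>pot (partial i ?G) F x\<bar> \<le> B * ((A + \<gamma>) * ?V)"
    using B(1) A(1) \<gamma>_pos V by (subst (asm) ennreal_le_iff) simp_all
   also have "\<dots> \<le> (B + 1) * ((A + \<gamma>) * ?V)" using A(1) \<gamma>_pos V by (intro mult_right_mono) simp_all
   finally show ?thesis .
  qed
  then have "(\<Sum>i\<in>UNIV. \<bar>(\<chi> i. pot (partial i ?G) F x) $ i\<bar>) \<le> (\<Sum>i\<in>(UNIV::'n set). (B + 1) * ((A + \<gamma>) * ?V))"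
   by (intro sum_mono) simp
  then have "norm (\<chi> i. pot (partial i ?G) F x) \<le> (\<Sum>i\<in>(UNIV::'n set). (B + 1) * ((A + \<gamma>) * ?V))"
   using norm_le_l1_cart order_trans by blast
  then show ?thesis by (simp add: mult.assoc)
 qed
 moreover have "0 < ?C" using A(1) B(1) \<gamma>_pos by simp
 ultimately show ?thesis unfolding dpot_def by blast
qed

subsection \<open>Monotone iteration\<close>

lemma measurable_T:
 assumes f[measurable]: "f \<in> borel_measurable borel"
 shows "T f \<in> borel_measurable borel"
proof -
 have "(\<lambda>(x, y). ennreal (norm (x - y) powr (- N) * \<bar>f y\<bar>)) \<in> borel_measurable (borel \<Otimes>\<^sub>M (lborel :: (real^'n) measure))"
  by measurable
 from lborel.borel_measurable_nn_integral[OF this]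
 have "nnpot (- N) f \<in> borel_measurable borel" unfolding nnpot_def[abs_def] by simp
 then show ?thesis unfolding T_def[abs_def] by simp
qed

text \<open>The right-hand side is monotone in the density.  Iterating it from zero gives an increasing sequence
 that stays below \<open>fb\<close>, and monotone convergence shows that the limit is a fixed point.\<close>

lemma fixed_point_below_supersolution:
 assumes E: "E \<in> borel_measurable borel" "\<And>x. 0 \<le> E x"
  and H: "H \<in> borel_measurable borel" "\<And>x. 0 \<le> H x"
  and fb: "\<And>x. T fb x < \<infinity>"
  and sup: "\<And>x. E x + H x * enn2real (T fb x) powr p \<le> fb x"
 shows "\<exists>f. f \<in> borel_measurable borel \<and> (\<forall>x. 0 \<le> f x \<and> f x \<le> fb x \<and> f x = E x + H x * enn2real (T f x) powr p)"
proof -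
 define \<Phi> where "\<Phi> f x = E x + H x * enn2real (T f x) powr p" for f x
 define F where "F i = (\<Phi> ^^ i) (\<lambda>x. 0)" for i
 have FS: "F (Suc i) = \<Phi> (F i)" for i by (simp add: F_def)
 have F0: "F 0 = (\<lambda>x. 0)" by (simp add: F_def)
 have mono: "\<Phi> f x \<le> \<Phi> g x" if "\<And>y. 0 \<le> f y" "\<And>y. f y \<le> g y" "T g x < \<infinity>" for f g x
 proof -
  have "\<bar>f y\<bar> \<le> \<bar>g y\<bar>" for y using that(1)[of y] that(2)[of y] by linarith
  then have "T f x \<le> T g x" by (rule T_mono)
  then have "enn2real (T f x) \<le> enn2real (T g x)" using that(3) by (intro enn2real_mono) simp_all
  then have "enn2real (T f x) powr p \<le> enn2real (T g x) powr p" using p_gt_1 by (intro powr_mono2) simp_all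
  then show ?thesis unfolding \<Phi>_def using H(2)[of x] by (intro add_left_mono mult_left_mono)
 qed
 have nn: "0 \<le> F i x" for i x
  by (cases i) (simp_all add: F0 FS \<Phi>_def E H)
 have fb0: "0 \<le> fb x" for x using sup[of x] E(2)[of x] H(2)[of x] by (smt (verit) mult_nonneg_nonneg powr_ge_zero)
 have le: "F i x \<le> fb x" for i x
 proof (induction i arbitrary: x)
  case 0
  show ?case by (simp add: F0 fb0)
 next
  case (Suc i)
  have "F (Suc i) x \<le> \<Phi> fb x" unfolding FS by (rule mono[OF nn Suc.IH fb])
  also have "\<dots> \<le> fb x" unfolding \<Phi>_def by (rule sup)
  finally show ?case .
 qed
 have Tle: "T (F i) x \<le> T fb x" for i x
  by (rule T_mono) (use nn le fb0 in simp)
 have Tfin: "T (F i) x < \<infinity>" for i x using Tle fb le_less_trans by blast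
 have step: "F i x \<le> F (Suc i) x" for i x
 proof (induction i arbitrary: x)
  case 0
  show ?case unfolding F0 by (rule nn)
 next
  case (Suc i)
  show ?case unfolding FS[of "Suc i"] by (subst FS) (rule mono[OF nn Suc.IH Tfin])
 qed
 have inc: "incseq (\<lambda>i. F i x)" for x by (rule incseq_SucI) (rule step)
 have meas: "F i \<in> borel_measurable borel" for i
 proof (induction i)
  case 0
  show ?case by (simp add: F0)
 next
  case (Suc i)
  have "(\<lambda>x. enn2real (T (F i) x)) \<in> borel_measurable borel"
   using measurable_T[OF Suc.IH] by simp
  then show ?case unfolding FS \<Phi>_def using E(1) H(1) by simp
 qed
 define f where "f x = (SUP i. F i x)" for x
 have lim: "(\<lambda>i. F i x) \<longlonglongrightarrow> f x" for x
  unfolding f_def by (rule LIMSEQ_incseq_SUP[OF _ inc]) (rule bdd_aboveI2[OF le])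
 have fm: "f \<in> borel_measurable borel"
  by (rule borel_measurable_LIMSEQ_real[OF lim meas])
 have f0: "0 \<le> f x" for x by (rule LIMSEQ_le_const[OF lim]) (use nn in blast)
 have fle: "f x \<le> fb x" for x by (rule LIMSEQ_le_const2[OF lim]) (use le in blast)
 have Tf: "T f x < \<infinity>" for x
 proof -
  have "T f x \<le> T fb x" by (rule T_mono) (use f0 fle fb0 in simp)
  then show ?thesis using fb le_less_trans by blast
 qed
 have Tlim: "(\<lambda>i. T (F i) x) \<longlonglongrightarrow> T f x" for x
 proof -
  have "(\<lambda>i. nnpot (- N) (F i) x) \<longlonglongrightarrow> nnpot (- N) f x"
   unfolding nnpot_def
  proof (rule nn_integral_LIMSEQ)
   show "incseq (\<lambda>i y. ennreal (norm (x - y) powr (- N) * \<bar>F i y\<bar>))"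
    using step nn by (intro incseq_SucI le_funI ennreal_leI mult_left_mono) simp_all
   show "(\<lambda>y. ennreal (norm (x - y) powr (- N) * \<bar>F i y\<bar>)) \<in> borel_measurable lborel" for i
    using measurable_nnpot_integrand[OF meas] by simp
   show "(\<lambda>i. ennreal (norm (x - y) powr (- N) * \<bar>F i y\<bar>)) \<longlonglongrightarrow> ennreal (norm (x - y) powr (- N) * \<bar>f y\<bar>)" for y
    by (intro tendsto_ennrealI tendsto_mult_left tendsto_rabs lim)
  qed
  then show ?thesis unfolding T_def by (intro ennreal_tendsto_cmult) simp_all
 qed
 have "f x = E x + H x * enn2real (T f x) powr p" for x
 proof (rule LIMSEQ_unique)
  show "(\<lambda>i. F (Suc i) x) \<longlonglongrightarrow> f x" by (rule LIMSEQ_Suc[OF lim])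
  have "(\<lambda>i. T (F i) x) \<longlonglongrightarrow> ennreal (enn2real (T f x))"
   using Tlim[of x] Tf[of x] by simp
  then have "(\<lambda>i. enn2real (T (F i) x)) \<longlonglongrightarrow> enn2real (T f x)"
   by (rule tendsto_enn2real) simp
  then have "(\<lambda>i. enn2real (T (F i) x) powr p) \<longlonglongrightarrow> enn2real (T f x) powr p"
   by (rule tendsto_powr'[OF _ tendsto_const]) (use p_gt_1 in simp)
  then show "(\<lambda>i. F (Suc i) x) \<longlonglongrightarrow> E x + H x * enn2real (T f x) powr p"
   unfolding FS \<Phi>_def by (intro tendsto_add tendsto_mult_left tendsto_const)
 qed
 then show ?thesis using fm f0 fle by blast
qed

end

section \<open>Bubbles with prescribed curvature\<close>

lemma abs_powr_diff_le:
 fixes u v s :: real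
 assumes "0 \<le> u" "0 \<le> v" "1 \<le> s" "u \<le> c" "v \<le> c"
 shows "\<bar>u powr s - v powr s\<bar> \<le> s * c powr (s - 1) * \<bar>u - v\<bar>"
proof -
 have main: "v powr s - u powr s \<le> s * c powr (s - 1) * (v - u)" if uv: "0 \<le> u" "u < v" "v \<le> c" for u v
 proof -
  have "continuous_on {u..v} (\<lambda>x. x powr s)"
   using assms(3) by (intro continuous_on_powr' continuous_intros) (use uv in auto)
  moreover have "DERIV (\<lambda>x. x powr s) x :> s * x powr (s - 1)" if "u < x" "x < v" for x
   using uv that by (intro has_real_derivative_powr) auto
  ultimately obtain x where x: "u < x" "x < v" "v powr s - u powr s = (v - u) * (s * x powr (s - 1))"
   using MVT[of u v "\<lambda>x. x powr s"] uv
   by (metis (no_types, lifting) DERIV_unique real_differentiable_def)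
  have "(v - u) * (s * x powr (s - 1)) \<le> (v - u) * (s * c powr (s - 1))"
   using uv x assms(3) by (intro mult_left_mono powr_mono2) auto
  then show ?thesis using x(3) by (simp add: mult_ac)
 qed
 have ab: "\<bar>u powr s - v powr s\<bar> = v powr s - u powr s" if "0 \<le> u" "u < v" for u v
  using powr_mono2[of s u v] that assms(3) by simp
 consider "u = v" | "u < v" | "v < u" by linarith
 then show ?thesis
 proof cases
  case 2
  then show ?thesis using main[of u v] ab[of u v] assms by simp
 next
  case 3
  then show ?thesis using main[of v u] ab[of v u] assms by (simp add: abs_minus_commute)
 qed simp
qed

lemma powr_ratio:
 fixes \<mu> r k :: real
 assumes "0 < \<mu>" "0 < r"
 shows "\<mu> powr (2 * k) * r powr (- 2 * k) = (\<mu> / r) powr (2 * k)"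
 using assms by (simp add: powr_divide powr_minus_divide)

lemma powr_add_le:
 fixes s x y :: real
 assumes "0 \<le> x" "0 \<le> y" "0 \<le> s"
 shows "(x + y) powr s \<le> 2 powr s * (x powr s + y powr s)"
proof -
 have "(x + y) powr s \<le> (2 * max x y) powr s" using assms by (intro powr_mono2) auto
 also have "\<dots> = 2 powr s * max x y powr s" using assms by (simp add: powr_mult)
 also have "\<dots> \<le> 2 powr s * (x powr s + y powr s)"
  by (intro mult_left_mono) (auto simp: max_def)
 finally show ?thesis .
qed

locale curvature_bounds = riesz_setting m N dim
 for m :: nat and N :: real and dim :: "'n::finite itself" +
 fixes a b :: real
 assumes a0: "0 < a" and ab: "a \<le> b"
begin

text \<open>The factor for which the bubble is the potential of \<open>\<kappa> * psi powr p\<close>; see \<open>alpha_eq\<close>.\<close>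

definition alpha :: "real => real" where "alpha \<kappa> = (c1 * \<kappa>) powr (- 1 / (p - 1))"

definition psi :: "real => real => real ^ 'n => real ^ 'n => real" where
 "psi \<kappa> \<mu> z x = alpha \<kappa> * \<mu> powr (N / 2) * q \<mu> z x"

definition dpsi :: "real => real => real ^ 'n => real ^ 'n => real ^ 'n" where
 "dpsi \<kappa> \<mu> z x = (- N * alpha \<kappa> * \<mu> powr (N / 2) * qpow (\<mu>\<^sup>2) (- (N / 2) - 1) (x - z)) *\<^sub>R (x - z)"

lemma b0: "0 < b" using a0 ab by simp

lemma alpha_pos: "0 < \<kappa> ==> 0 < alpha \<kappa>"
 using c1_pos by (simp add: alpha_def)

lemma alpha_eq:
 assumes "0 < \<kappa>"
 shows "c1 * \<kappa> * alpha \<kappa> powr (p - 1) = 1"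
proof -
 have "alpha \<kappa> powr (p - 1) = (c1 * \<kappa>) powr (- 1)"
  using p_gt_1 by (simp add: alpha_def powr_powr)
 then show ?thesis using assms c1_pos by (simp add: powr_minus_divide)
qed

lemma alpha_range:
 assumes "a \<le> \<kappa>" "\<kappa> \<le> b"
 shows "alpha b \<le> alpha \<kappa>" "alpha \<kappa> \<le> alpha a"
 unfolding alpha_def using assms a0 c1_pos p_gt_1
 by (auto intro!: powr_mono2' mult_left_mono divide_nonpos_pos)

lemma psi_pos: "0 < \<kappa> ==> 0 < \<mu> ==> 0 < psi \<kappa> \<mu> z x"
 unfolding psi_def by (intro mult_pos_pos alpha_pos q_pos) simp_all

lemma measurable_psi: "psi \<kappa> \<mu> z \<in> borel_measurable borel"
 unfolding psi_def[abs_def] using measurable_q[of \<mu> z] by simp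

lemma GDERIV_psi:
 assumes "0 < \<mu>"
 shows "GDERIV (psi \<kappa> \<mu> z) x :> dpsi \<kappa> \<mu> z x"
proof -
 have "0 < \<mu>\<^sup>2" using assms by simp
 from GDERIV_cmult[OF GDERIV_translate[OF GDERIV_qpow[OF qdom_pos[OF this]]], of "alpha \<kappa> * \<mu> powr (N / 2)" "- (N / 2)" z x]
 show ?thesis unfolding psi_def[abs_def] dpsi_def q_def by (simp add: mult_ac)
qed

lemma continuous_dpsi: "0 < \<mu> ==> continuous_on UNIV (dpsi \<kappa> \<mu> z)"
 unfolding dpsi_def[abs_def]
 by (intro continuous_intros continuous_on_compose2[OF continuous_on_qpow]) auto

lemma continuous_psi: "0 < \<mu> ==> continuous_on UNIV (psi \<kappa> \<mu> z)"
 by (rule continuous_on_GDERIV[OF GDERIV_psi])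

lemma q_le: "x \<noteq> z ==> q \<mu> z x \<le> norm (x - z) powr (- N)"
 using qpow_le_norm[of "\<mu>\<^sup>2" "- (N / 2)" "x - z"] N4 by (simp add: q_def)

lemma q_le_max: "0 < \<mu> ==> q \<mu> z x \<le> \<mu> powr (- N)"
proof -
 assume \<mu>: "0 < \<mu>"
 have "q \<mu> z x \<le> (\<mu>\<^sup>2) powr (- (N / 2))"
  unfolding q_def qpow_def using \<mu> N4 by (intro powr_mono2') auto
 also have "\<dots> = \<mu> powr (- N)" using \<mu> by (simp add: powr_powr flip: powr_numeral)
 finally show ?thesis .
qed

lemma psi_le:
 assumes "a \<le> \<kappa>" "\<kappa> \<le> b" "x \<noteq> z"
 shows "psi \<kappa> \<mu> z x \<le> alpha a * \<mu> powr (N / 2) * norm (x - z) powr (- N)"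
 unfolding psi_def using assms alpha_range[OF assms(1,2)] q_le[OF assms(3), of \<mu>] alpha_pos[of \<kappa>] alpha_pos[of a] a0
 by (intro mult_mono) (auto simp: q_def)

lemma psi_le_max:
 assumes "a \<le> \<kappa>" "\<kappa> \<le> b" "0 < \<mu>"
 shows "psi \<kappa> \<mu> z x \<le> alpha a * \<mu> powr (- (N / 2))"
proof -
 have "psi \<kappa> \<mu> z x \<le> alpha a * \<mu> powr (N / 2) * \<mu> powr (- N)"
  unfolding psi_def using assms alpha_range[OF assms(1,2)] q_le_max[OF assms(3)] alpha_pos[of \<kappa>] alpha_pos[of a] a0
  by (intro mult_mono) (auto simp: q_def)
 also have "\<dots> = alpha a * \<mu> powr (- (N / 2))" by (simp add: mult.assoc powr_add[symmetric])
 finally show ?thesis .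
qed

lemma psi_center: "0 < \<mu> ==> psi \<kappa> \<mu> z z = alpha \<kappa> * \<mu> powr (- (N / 2))"
proof -
 assume \<mu>: "0 < \<mu>"
 have "q \<mu> z z = \<mu> powr (- N)"
  unfolding q_def qpow_def using \<mu> by (simp add: powr_powr flip: powr_numeral)
 then show ?thesis unfolding psi_def by (simp add: mult.assoc powr_add[symmetric])
qed

lemma T_psi:
 assumes "0 < \<kappa>" "0 < \<mu>"
 shows "T (\<lambda>y. \<kappa> * psi \<kappa> \<mu> z y powr p) x = ennreal (psi \<kappa> \<mu> z x)"
proof -
 let ?s = "alpha \<kappa> * \<mu> powr (N / 2)"
 have s: "0 < ?s" using alpha_pos[OF assms(1)] assms(2) by simp
 have qp: "0 \<le> q \<mu> z y" for y using q_pos[OF assms(2)] less_imp_le by blast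
 have "(\<lambda>y. \<kappa> * psi \<kappa> \<mu> z y powr p) = (\<lambda>y. (\<kappa> * ?s powr p) * q \<mu> z y powr p)"
  unfolding psi_def using s qp by (simp add: powr_mult fun_eq_iff)
 then have "T (\<lambda>y. \<kappa> * psi \<kappa> \<mu> z y powr p) x = ennreal (\<kappa> * ?s powr p) * ennreal (c1 * \<mu> powr (- 2 * real m) * q \<mu> z x)"
  using T_cmult[OF measurable_q_powr[of \<mu> z p], of "\<kappa> * ?s powr p" x] assms by (simp add: T_q_powr_p)
 also have "\<dots> = ennreal ((\<kappa> * ?s powr p) * (c1 * \<mu> powr (- 2 * real m) * q \<mu> z x))"
  using assms c1_pos qp by (simp add: ennreal_mult[symmetric])
 also have "(\<kappa> * ?s powr p) * (c1 * \<mu> powr (- 2 * real m) * q \<mu> z x) = psi \<kappa> \<mu> z x"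
 proof -
  have "?s powr p = ?s powr (1 + (p - 1))" by simp
  also have "\<dots> = ?s * ?s powr (p - 1)" using s by (subst powr_add) simp
  also have "?s powr (p - 1) = alpha \<kappa> powr (p - 1) * \<mu> powr (2 * real m)"
   using alpha_pos[OF assms(1)] assms(2) p_minus_1(1) by (simp add: powr_mult powr_powr mult.commute)
  finally have "(\<kappa> * ?s powr p) * (c1 * \<mu> powr (- 2 * real m) * q \<mu> z x)
    = (c1 * \<kappa> * alpha \<kappa> powr (p - 1)) * (\<mu> powr (2 * real m) * \<mu> powr (- 2 * real m)) * (?s * q \<mu> z x)"
   by (simp only: mult_ac)
  also have "\<mu> powr (2 * real m) * \<mu> powr (- 2 * real m) = 1"
   using assms(2) by (simp add: powr_add[symmetric])
  finally show ?thesis unfolding alpha_eq[OF assms(1)] psi_def by simp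
 qed
 finally show ?thesis .
qed

lemma q_outer_le:
 assumes "0 < \<mu>" "\<mu> \<le> r" "y \<notin> ball z r"
 shows "q \<mu> z y \<le> 2 powr (N / 2) * q r z y"
proof -
 have r: "0 < r" "r \<le> norm (y - z)" using assms by (simp_all add: dist_norm norm_minus_commute)
 have "r\<^sup>2 \<le> (norm (y - z))\<^sup>2" using r by (intro power_mono) auto
 then have le: "(r\<^sup>2 + (norm (y - z))\<^sup>2) / 2 \<le> \<mu>\<^sup>2 + (norm (y - z))\<^sup>2"
 proof -
  have "r\<^sup>2 + (norm (y - z))\<^sup>2 \<le> 2 * \<mu>\<^sup>2 + 2 * (norm (y - z))\<^sup>2"
   using \<open>r\<^sup>2 \<le> (norm (y - z))\<^sup>2\<close> zero_le_power2[of \<mu>] by linarith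
  then show ?thesis by simp
 qed
 have pos: "0 < (r\<^sup>2 + (norm (y - z))\<^sup>2) / 2" using r zero_le_power2[of "norm (y - z)"] by (simp add: add_pos_nonneg)
 have "q \<mu> z y \<le> ((r\<^sup>2 + (norm (y - z))\<^sup>2) / 2) powr (- (N / 2))"
  unfolding q_def qpow_def using N4 le pos by (intro powr_mono2') auto
 also have "\<dots> = 2 powr (N / 2) * q r z y"
  unfolding q_def qpow_def using pos by (simp add: powr_divide powr_minus field_simps)
 finally show ?thesis .
qed

lemma q_antimono:
 assumes "0 < \<mu>" "\<mu> \<le> r"
 shows "q r z x \<le> q \<mu> z x"
proof -
 have "\<mu>\<^sup>2 \<le> r\<^sup>2" using assms by (intro power_mono) auto
 moreover have "0 < \<mu>\<^sup>2 + (norm (x - z))\<^sup>2" using assms(1) by (intro qdom_pos) simp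
 ultimately show ?thesis unfolding q_def using N4 by (intro qpow_antimono) auto
qed

text \<open>Outside \<open>ball z r\<close> the density of a bubble of width \<open>\<mu>\<close> is at most a multiple of the density of a
 bubble of width \<open>r\<close>, whose potential is explicit.\<close>

lemma T_psi_outer:
 "\<exists>A>0. \<forall>\<kappa> \<mu> r z x. a \<le> \<kappa> --> \<kappa> \<le> b --> 0 < \<mu> --> \<mu> \<le> r -->
   T (\<lambda>y. psi \<kappa> \<mu> z y powr p * indicator (- ball z r) y) x \<le> ennreal (A * (\<mu> / r) powr (2 * real m) * psi \<kappa> \<mu> z x) \<and>
   T (\<lambda>y. psi \<kappa> \<mu> z y powr p * indicator (- ball z r) y) x \<le> ennreal (A * \<mu> powr (N / 2 + 2 * real m) * r powr (- (N + 2 * real m)))"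
proof -
 let ?P = "2 powr (N / 2 * p) * c1"
 let ?A = "?P * alpha a powr p + ?P * alpha a powr (p - 1)"
 have aa: "0 < alpha a" by (rule alpha_pos[OF a0])
 have "T (\<lambda>y. psi \<kappa> \<mu> z y powr p * indicator (- ball z r) y) x \<le> ennreal (?A * (\<mu> / r) powr (2 * real m) * psi \<kappa> \<mu> z x) \<and>
   T (\<lambda>y. psi \<kappa> \<mu> z y powr p * indicator (- ball z r) y) x \<le> ennreal (?A * \<mu> powr (N / 2 + 2 * real m) * r powr (- (N + 2 * real m)))"
  if \<kappa>: "a \<le> \<kappa>" "\<kappa> \<le> b" and \<mu>: "0 < \<mu>" "\<mu> \<le> r" for \<kappa> \<mu> r z x
 proof -
  have r: "0 < r" using \<mu> by simp
  have \<alpha>: "0 < alpha \<kappa>" "alpha \<kappa> \<le> alpha a" using alpha_pos[of \<kappa>] alpha_range[OF \<kappa>] \<kappa> a0 by auto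
  have q0: "0 \<le> q w z y" for w y by (simp add: q_def)
  define s where "s = alpha \<kappa> * \<mu> powr (N / 2)"
  have s: "0 < s" using \<alpha> \<mu> by (simp add: s_def)
  have pN: "N / 2 * p = N / 2 + 2 * real m" "N * p / 2 = N / 2 + 2 * real m"
   using p_minus_1(2) by (simp_all add: algebra_simps)
  have sp: "s powr p = alpha \<kappa> powr p * \<mu> powr (N / 2 + 2 * real m)"
   unfolding s_def using \<alpha> \<mu> by (simp add: powr_mult powr_powr pN)
  let ?K = "s powr p * 2 powr (N / 2 * p)"
  have "T (\<lambda>y. psi \<kappa> \<mu> z y powr p * indicator (- ball z r) y) x \<le> T (\<lambda>y. ?K * q r z y powr p) x"
  proof (rule T_mono)
   fix y
   show "\<bar>psi \<kappa> \<mu> z y powr p * indicator (- ball z r) y\<bar> \<le> \<bar>?K * q r z y powr p\<bar>"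
   proof (cases "y \<in> ball z r")
    case False
    have "psi \<kappa> \<mu> z y \<le> s * (2 powr (N / 2) * q r z y)"
     unfolding psi_def s_def[symmetric] using s q_outer_le[OF \<mu> False] by (intro mult_left_mono) auto
    then have "psi \<kappa> \<mu> z y powr p \<le> (s * (2 powr (N / 2) * q r z y)) powr p"
     using psi_pos[of \<kappa> \<mu> z y] \<kappa> a0 \<mu> p_gt_1 by (intro powr_mono2) auto
    also have "\<dots> = ?K * q r z y powr p"
     using s q0[of r y] by (simp add: powr_mult powr_powr)
    finally show ?thesis using False by simp
   qed simp
  qed
  also have "\<dots> = ennreal ?K * ennreal (c1 * r powr (- 2 * real m) * q r z x)"
   using T_cmult[OF measurable_q_powr[of r z p], of ?K x] r by (simp add: T_q_powr_p)
  also have "\<dots> = ennreal (?K * (c1 * r powr (- 2 * real m) * q r z x))"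
   using c1_pos q0 by (simp add: ennreal_mult[symmetric])
  finally have le: "T (\<lambda>y. psi \<kappa> \<mu> z y powr p * indicator (- ball z r) y) x \<le> ennreal (?K * (c1 * r powr (- 2 * real m) * q r z x))" .
  have e1: "?K * (c1 * r powr (- 2 * real m) * q r z x) \<le> ?A * (\<mu> / r) powr (2 * real m) * psi \<kappa> \<mu> z x"
  proof -
   have "s powr p = s powr (1 + (p - 1))" by simp
   also have "\<dots> = s * s powr (p - 1)" using s by (subst powr_add) simp
   also have "s powr (p - 1) = alpha \<kappa> powr (p - 1) * \<mu> powr (2 * real m)"
    unfolding s_def using \<alpha> \<mu> p_minus_1(1) by (simp add: powr_mult powr_powr mult.commute)
   finally have "?K * (c1 * r powr (- 2 * real m) * q r z x)
     = (?P * alpha \<kappa> powr (p - 1)) * (\<mu> powr (2 * real m) * r powr (- 2 * real m)) * (s * q r z x)"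
    by (simp only: mult_ac)
   also have "\<mu> powr (2 * real m) * r powr (- 2 * real m) = (\<mu> / r) powr (2 * real m)"
    using \<mu> r by (intro powr_ratio)
   also have "(?P * alpha \<kappa> powr (p - 1)) * (\<mu> / r) powr (2 * real m) * (s * q r z x)
     \<le> ?A * (\<mu> / r) powr (2 * real m) * psi \<kappa> \<mu> z x"
    unfolding psi_def s_def[symmetric]
   proof (intro mult_mono)
    have "alpha \<kappa> powr (p - 1) \<le> alpha a powr (p - 1)" using \<alpha> p_gt_1 by (intro powr_mono2) auto
    then have "?P * alpha \<kappa> powr (p - 1) \<le> ?P * alpha a powr (p - 1)" using c1_pos by (intro mult_left_mono) auto
    then show "?P * alpha \<kappa> powr (p - 1) \<le> ?A" using c1_pos by (simp add: add_increasing)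
   qed (use s q0 c1_pos q_antimono[OF \<mu>] in auto)
   finally show ?thesis .
  qed
  have e2: "?K * (c1 * r powr (- 2 * real m) * q r z x) \<le> ?A * \<mu> powr (N / 2 + 2 * real m) * r powr (- (N + 2 * real m))"
  proof -
   have "?K * (c1 * r powr (- 2 * real m) * q r z x) = (?P * alpha \<kappa> powr p) * \<mu> powr (N / 2 + 2 * real m) * (r powr (- 2 * real m) * q r z x)"
    unfolding sp by (simp only: mult_ac)
   also have "\<dots> \<le> ?A * \<mu> powr (N / 2 + 2 * real m) * (r powr (- 2 * real m) * r powr (- N))"
   proof (intro mult_mono)
    have "alpha \<kappa> powr p \<le> alpha a powr p" using \<alpha> p_gt_1 by (intro powr_mono2) auto
    then have "?P * alpha \<kappa> powr p \<le> ?P * alpha a powr p" using c1_pos by (intro mult_left_mono) auto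
    then show "?P * alpha \<kappa> powr p \<le> ?A" using c1_pos by (simp add: add_increasing2)
   qed (use q0 c1_pos q_le_max[OF r] in auto)
   also have "r powr (- 2 * real m) * r powr (- N) = r powr (- (N + 2 * real m))"
    by (simp add: powr_add[symmetric] algebra_simps)
   finally show ?thesis .
  qed
  show ?thesis using order_trans[OF le ennreal_leI[OF e1]] order_trans[OF le ennreal_leI[OF e2]] by blast
 qed
 moreover have "0 < ?A" using c1_pos aa by (intro add_pos_pos mult_pos_pos) simp_all
 ultimately show ?thesis by blast
qed

lemma psi_powr_outer_le:
 assumes "a \<le> \<kappa>" "\<kappa> \<le> b" "0 < \<mu>" "x \<noteq> z" "0 \<le> s"
 shows "psi \<kappa> \<mu> z x powr s \<le> alpha a powr s * \<mu> powr (N / 2 * s) * norm (x - z) powr (- N * s)"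
proof -
 have "psi \<kappa> \<mu> z x powr s \<le> (alpha a * \<mu> powr (N / 2) * norm (x - z) powr (- N)) powr s"
  using psi_le[OF assms(1,2,4), of \<mu>] psi_pos[of \<kappa> \<mu> z x] assms a0 by (intro powr_mono2) auto
 also have "\<dots> = alpha a powr s * \<mu> powr (N / 2 * s) * norm (x - z) powr (- N * s)"
  using alpha_pos[OF a0] assms by (simp add: powr_mult powr_powr)
 finally show ?thesis .
qed

lemma T_psi_outer_linear:
 "\<exists>A>0. \<forall>\<kappa> \<mu> r z x. a \<le> \<kappa> --> \<kappa> \<le> b --> 0 < \<mu> --> 0 < r -->
   T (\<lambda>y. psi \<kappa> \<mu> z y powr (p - 1) * indicator (- ball z r) y) x \<le> ennreal (A * (\<mu> / r) powr (2 * real m))"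
proof -
 obtain C where C: "C > 0" "\<And>z x r. 0 < r ==> T (\<lambda>y. norm (y - z) powr (- 4 * real m) * indicator (- ball z r) y) x
   \<le> ennreal (C * r powr (- 2 * real m))"
  using T_outer_power by blast
 have "T (\<lambda>y. psi \<kappa> \<mu> z y powr (p - 1) * indicator (- ball z r) y) x \<le> ennreal ((alpha a powr (p - 1) * C) * (\<mu> / r) powr (2 * real m))"
  if \<kappa>: "a \<le> \<kappa>" "\<kappa> \<le> b" and \<mu>: "0 < \<mu>" and r: "0 < r" for \<kappa> \<mu> r z x
 proof -
  let ?K = "alpha a powr (p - 1) * \<mu> powr (2 * real m)"
  let ?h = "\<lambda>y. norm (y - z) powr (- 4 * real m) * indicator (- ball z r) y"
  have e: "N / 2 * (p - 1) = 2 * real m" "- N * (p - 1) = - 4 * real m"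
   using p_minus_1(1) by (simp_all add: algebra_simps)
  have hm: "?h \<in> borel_measurable borel"
  proof -
   have "(\<lambda>y::real^'n. norm (y - z) powr (- 4 * real m)) \<in> borel_measurable borel"
    by (rule measurable_compose[OF _ measurable_norm_powr]) simp
   then show ?thesis by (intro borel_measurable_times borel_measurable_indicator) simp_all
  qed
  have "T (\<lambda>y. psi \<kappa> \<mu> z y powr (p - 1) * indicator (- ball z r) y) x \<le> T (\<lambda>y. ?K * ?h y) x"
  proof (rule T_mono)
   fix y
   show "\<bar>psi \<kappa> \<mu> z y powr (p - 1) * indicator (- ball z r) y\<bar> \<le> \<bar>?K * ?h y\<bar>"
   proof (cases "y \<in> ball z r")
    case False
    then have "y \<noteq> z" using r by auto
    from psi_powr_outer_le[OF \<kappa> \<mu> this, of "p - 1"] show ?thesis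
     using False p_gt_1 unfolding e by simp
   qed simp
  qed
  also have "\<dots> = ennreal ?K * T ?h x" by (rule T_cmult[OF hm]) simp
  also have "\<dots> \<le> ennreal ?K * ennreal (C * r powr (- 2 * real m))" by (intro mult_left_mono C(2) r) simp
  also have "\<dots> = ennreal (?K * (C * r powr (- 2 * real m)))"
   using C(1) by (simp add: ennreal_mult[symmetric])
  also have "?K * (C * r powr (- 2 * real m)) = (alpha a powr (p - 1) * C) * (\<mu> powr (2 * real m) * r powr (- 2 * real m))"
   by (simp only: mult_ac)
  also have "\<mu> powr (2 * real m) * r powr (- 2 * real m) = (\<mu> / r) powr (2 * real m)"
   using \<mu> r by (intro powr_ratio)
  finally show ?thesis .
 qed
 moreover have "0 < alpha a powr (p - 1) * C" using C(1) alpha_pos[OF a0] by simp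
 ultimately show ?thesis by blast
qed

lemma inverse_psi_bounds:
 "\<exists>A>0. \<forall>\<kappa> \<mu> r z x. a \<le> \<kappa> --> \<kappa> \<le> b --> 0 < \<mu> --> \<mu> \<le> r --> norm (x - z) \<le> 2 * r -->
   1 / psi \<kappa> \<mu> z x \<le> A * \<mu> powr (- (N / 2)) * r powr N \<and>
   norm (dpsi \<kappa> \<mu> z x) / (psi \<kappa> \<mu> z x)\<^sup>2 \<le> A * \<mu> powr (- (N / 2)) * r powr (N - 1)"
proof -
 let ?A1 = "5 powr (N / 2) / alpha b" and ?A2 = "N * (2 * 5 powr (N / 2 - 1)) / alpha b"
 have ab: "0 < alpha b" by (rule alpha_pos[OF b0])
 have "1 / psi \<kappa> \<mu> z x \<le> (?A1 + ?A2) * \<mu> powr (- (N / 2)) * r powr N \<and>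
   norm (dpsi \<kappa> \<mu> z x) / (psi \<kappa> \<mu> z x)\<^sup>2 \<le> (?A1 + ?A2) * \<mu> powr (- (N / 2)) * r powr (N - 1)"
  if \<kappa>: "a \<le> \<kappa>" "\<kappa> \<le> b" and \<mu>: "0 < \<mu>" "\<mu> \<le> r" and x: "norm (x - z) \<le> 2 * r" for \<kappa> \<mu> r z x
 proof -
  have r: "0 < r" using \<mu> by simp
  have \<alpha>: "0 < alpha \<kappa>" "alpha b \<le> alpha \<kappa>" using alpha_pos[of \<kappa>] alpha_range[OF \<kappa>] \<kappa> a0 by auto
  define w where "w = \<mu>\<^sup>2 + (norm (x - z))\<^sup>2"
  have w: "0 < w" unfolding w_def using \<mu> by (intro qdom_pos) simp
  have w5: "w \<le> 5 * r\<^sup>2"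
  proof -
   have "\<mu>\<^sup>2 \<le> r\<^sup>2" using \<mu> by (intro power_mono) auto
   moreover have "(norm (x - z))\<^sup>2 \<le> (2 * r)\<^sup>2" using x by (intro power_mono) auto
   ultimately show ?thesis by (simp add: w_def power_mult_distrib)
  qed
  have wp: "w powr s \<le> 5 powr s * r powr (2 * s)" if "0 \<le> s" for s
  proof -
   have "w powr s \<le> (5 * r\<^sup>2) powr s" using w w5 that by (intro powr_mono2) auto
   also have "\<dots> = 5 powr s * r powr (2 * s)" using r by (simp add: powr_mult powr_powr flip: powr_numeral)
   finally show ?thesis .
  qed
  have psi: "psi \<kappa> \<mu> z x = alpha \<kappa> * \<mu> powr (N / 2) * w powr (- (N / 2))"
   by (simp add: psi_def q_def qpow_def w_def)
  have dpsi: "dpsi \<kappa> \<mu> z x = (- N * alpha \<kappa> * \<mu> powr (N / 2) * w powr (- (N / 2) - 1)) *\<^sub>R (x - z)"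
   by (simp add: dpsi_def qpow_def w_def)
  have 1: "1 / psi \<kappa> \<mu> z x = 1 / alpha \<kappa> * \<mu> powr (- (N / 2)) * w powr (N / 2)"
   unfolding psi powr_minus_divide by simp
  also have "\<dots> \<le> 1 / alpha b * \<mu> powr (- (N / 2)) * (5 powr (N / 2) * r powr (2 * (N / 2)))"
   using \<alpha> ab N4 by (intro mult_mono wp divide_left_mono) auto
  also have "\<dots> = ?A1 * \<mu> powr (- (N / 2)) * r powr N" by simp
  also have "\<dots> \<le> (?A1 + ?A2) * \<mu> powr (- (N / 2)) * r powr N"
   using ab N4 by (intro mult_right_mono) auto
  finally have g1: "1 / psi \<kappa> \<mu> z x \<le> (?A1 + ?A2) * \<mu> powr (- (N / 2)) * r powr N" .
  have "norm (dpsi \<kappa> \<mu> z x) / (psi \<kappa> \<mu> z x)\<^sup>2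
    = (N * alpha \<kappa> * \<mu> powr (N / 2) * w powr (- (N / 2) - 1) * norm (x - z)) * (1 / psi \<kappa> \<mu> z x) * (1 / psi \<kappa> \<mu> z x)"
   unfolding dpsi using N4 \<alpha> by (simp add: power2_eq_square abs_mult)
  also have "\<dots> = (alpha \<kappa> * (1 / alpha \<kappa>)) * (N * (1 / alpha \<kappa>) * (\<mu> powr (N / 2) * \<mu> powr (- (N / 2)) * \<mu> powr (- (N / 2))) * (w powr (- (N / 2) - 1) * w powr (N / 2) * w powr (N / 2)) * norm (x - z))"
   unfolding 1 by (simp only: mult_ac)
  also have "\<dots> = N * (1 / alpha \<kappa>) * (\<mu> powr (N / 2) * \<mu> powr (- (N / 2)) * \<mu> powr (- (N / 2))) * (w powr (- (N / 2) - 1) * w powr (N / 2) * w powr (N / 2)) * norm (x - z)"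
   using \<alpha>(1) by simp
  also have "\<mu> powr (N / 2) * \<mu> powr (- (N / 2)) * \<mu> powr (- (N / 2)) = \<mu> powr (- (N / 2))"
   using \<mu> by (simp add: powr_add[symmetric])
  also have "w powr (- (N / 2) - 1) * w powr (N / 2) * w powr (N / 2) = w powr (N / 2 - 1)"
   by (simp only: powr_add[symmetric]) (simp add: algebra_simps)
  also have "N * (1 / alpha \<kappa>) * \<mu> powr (- (N / 2)) * w powr (N / 2 - 1) * norm (x - z)
    \<le> N * (1 / alpha b) * \<mu> powr (- (N / 2)) * (5 powr (N / 2 - 1) * r powr (2 * (N / 2 - 1))) * (2 * r)"
   using \<alpha> ab N4 x by (intro mult_mono wp divide_left_mono mult_nonneg_nonneg) auto
  also have "\<dots> = ?A2 * \<mu> powr (- (N / 2)) * (r powr (N - 2) * r)"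
   by (simp add: algebra_simps)
  also have "r powr (N - 2) * r = r powr (N - 1)" using r powr_add[of r "N - 2" 1] by simp
  also have "?A2 * \<mu> powr (- (N / 2)) * r powr (N - 1) \<le> (?A1 + ?A2) * \<mu> powr (- (N / 2)) * r powr (N - 1)"
   using ab N4 by (intro mult_right_mono) auto
  finally show ?thesis using g1 by blast
 qed
 moreover have "0 < ?A1 + ?A2" using ab N4 by (intro add_pos_pos) auto
 ultimately show ?thesis by blast
qed

end

section \<open>The solution near a bubble\<close>

context curvature_bounds
begin

lemma abs_diff_bound_aux:
 fixes k \<kappa> u v \<eta> :: real
 assumes "0 \<le> \<eta>" "\<eta> \<le> 1" "0 \<le> k" "k \<le> b" "\<bar>k - \<kappa>\<bar> \<le> l" "0 \<le> u" "0 \<le> v" "u \<le> 2 * v + 1"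
 shows "\<bar>\<eta> * (\<kappa> * v powr p) + (1 - \<eta>) * (k * u powr p) - \<kappa> * v powr p\<bar>
  \<le> l * v powr p + (b * p * 3 powr (p - 1)) * (v powr (p - 1) + 1) * \<bar>u - v\<bar>"
proof -
 have p1: "0 \<le> p - 1" "1 \<le> p" "0 < p" using p_gt_1 by auto
 have "(2 * v + 1) powr (p - 1) \<le> 3 powr (p - 1) * (v powr (p - 1) + 1)"
 proof (cases "v \<le> 1")
  case True
  then have "(2 * v + 1) powr (p - 1) \<le> 3 powr (p - 1)" using assms p1 by (intro powr_mono2) auto
  also have "\<dots> \<le> 3 powr (p - 1) * (v powr (p - 1) + 1)" by simp
  finally show ?thesis .
 next
  case False
  then have "(2 * v + 1) powr (p - 1) \<le> (3 * v) powr (p - 1)" using assms p1 by (intro powr_mono2) auto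
  also have "\<dots> = 3 powr (p - 1) * v powr (p - 1)" using assms by (simp add: powr_mult)
  also have "\<dots> \<le> 3 powr (p - 1) * (v powr (p - 1) + 1)" by simp
  finally show ?thesis .
 qed
 then have c: "p * (2 * v + 1) powr (p - 1) * \<bar>u - v\<bar> \<le> p * (3 powr (p - 1) * (v powr (p - 1) + 1)) * \<bar>u - v\<bar>"
  using p1 by (intro mult_right_mono mult_left_mono) auto
 have d: "\<bar>u powr p - v powr p\<bar> \<le> p * (3 powr (p - 1) * (v powr (p - 1) + 1)) * \<bar>u - v\<bar>"
  using abs_powr_diff_le[of u v p "2 * v + 1"] assms p1 c by linarith
 have "\<eta> * (\<kappa> * v powr p) + (1 - \<eta>) * (k * u powr p) - \<kappa> * v powr p
   = (1 - \<eta>) * ((k - \<kappa>) * v powr p + k * (u powr p - v powr p))"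
  by (simp add: algebra_simps)
 also have "\<bar>\<dots>\<bar> \<le> 1 * (\<bar>k - \<kappa>\<bar> * v powr p + k * \<bar>u powr p - v powr p\<bar>)"
  unfolding abs_mult using assms by (intro mult_mono order_trans[OF abs_triangle_ineq]) (auto simp: abs_mult)
 also have "\<dots> \<le> l * v powr p + b * (p * (3 powr (p - 1) * (v powr (p - 1) + 1)) * \<bar>u - v\<bar>)"
  unfolding mult_1 using assms d by (intro add_mono mult_right_mono mult_mono) auto
 finally show ?thesis by (simp only: mult.assoc)
qed

text \<open>The density \<open>f\<close> agrees with that of the bubble on the core \<open>ball z r\<close>, and \<open>W\<close> bounds the influence
 of everything outside \<open>ball z (t / 2)\<close>.  The two constants must not depend on any of the parameters
 of the bubble.\<close>

definition deviation_constants :: "real => real => bool" where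
 "deviation_constants C h \<longleftrightarrow> 0 < C \<and> 0 < h \<and> (\<forall>\<kappa> \<mu> r t z k l W f \<eta>.
  a \<le> \<kappa> --> \<kappa> \<le> b --> 0 < \<mu> --> \<mu> \<le> r --> 8 * r \<le> t --> t \<le> 1 -->
  (\<mu> / r) powr (2 * real m) \<le> h --> t powr (2 * real m) \<le> h -->
  f \<in> borel_measurable borel --> (\<forall>y. 0 \<le> f y) --> (\<forall>y. T f y < \<infinity>) --> 0 \<le> l -->
  (\<forall>y\<in>ball z (t / 2). 0 \<le> k y \<and> k y \<le> b \<and> \<bar>k y - \<kappa>\<bar> \<le> l) -->
  (\<forall>y. 0 \<le> \<eta> y \<and> \<eta> y \<le> 1) --> (\<forall>y\<in>ball z r. \<eta> y = 1) -->
  (\<forall>y\<in>ball z (t / 2). f y = \<eta> y * (\<kappa> * psi \<kappa> \<mu> z y powr p) + (1 - \<eta> y) * (k y * enn2real (T f y) powr p)) -->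
  (\<forall>y\<in>ball z (t / 2). enn2real (T f y) \<le> 2 * psi \<kappa> \<mu> z y + 1) --> 0 \<le> W -->
  (\<forall>x\<in>ball z (t / 2). T (\<lambda>y. f y * indicator (- ball z (t / 2)) y) x \<le> ennreal W) -->
  (\<forall>x\<in>ball z (t / 2). T (\<lambda>y. \<kappa> * (psi \<kappa> \<mu> z y powr p * indicator (- ball z (t / 2)) y)) x \<le> ennreal W) -->
  (\<forall>x\<in>ball z (t / 2). \<bar>enn2real (T f x) - psi \<kappa> \<mu> z x\<bar> \<le> C * (l * \<mu> powr (N / 2 + 2 * real m) * r powr (- (N + 2 * real m)) + W)) \<and>
  (\<forall>x. norm (x - z) \<le> 2 * r -->
   norm (dpot (\<lambda>y. f y - \<kappa> * psi \<kappa> \<mu> z y powr p) x)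
    \<le> C * (l * \<mu> powr (N / 2 + 2 * real m) * r powr (- (N + 2 * real m)) + W) / r))"

text \<open>The difference \<open>w\<close> of the solution and a bubble is the potential of a density which is bounded,
 on the ring where the curvature is not adjusted, by the oscillation of the curvature and by a
 multiple of \<open>|w|\<close>.  The second contribution is absorbed because the potential of
 \<open>psi powr (p - 1)\<close> over the exterior of the core is small.\<close>

lemma deviation: "\<exists>C h. deviation_constants C h"
proof -
 obtain A3 where A3: "A3 > 0" "\<And>\<kappa> \<mu> r z x. a \<le> \<kappa> ==> \<kappa> \<le> b ==> 0 < \<mu> ==> \<mu> \<le> r ==>
   T (\<lambda>y. psi \<kappa> \<mu> z y powr p * indicator (- ball z r) y) x \<le> ennreal (A3 * \<mu> powr (N / 2 + 2 * real m) * r powr (- (N + 2 * real m)))"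
  using T_psi_outer by blast
 obtain A4 where A4: "A4 > 0" "\<And>\<kappa> \<mu> r z x. a \<le> \<kappa> ==> \<kappa> \<le> b ==> 0 < \<mu> ==> 0 < r ==>
   T (\<lambda>y. psi \<kappa> \<mu> z y powr (p - 1) * indicator (- ball z r) y) x \<le> ennreal (A4 * (\<mu> / r) powr (2 * real m))"
  using T_psi_outer_linear by blast
 obtain A5 where A5: "A5 > 0" "\<And>z x \<rho>. 0 < \<rho> ==> x \<in> ball z \<rho> ==> T (indicator (ball z \<rho>)) x \<le> ennreal (A5 * \<rho> powr (2 * real m))"
  using T_ball by blast
 obtain C6 where C6: "C6 > 0" "\<And>F x r E Q. F \<in> borel_measurable borel ==> 0 < r ==> 0 \<le> E ==> 0 \<le> Q ==>
   (\<forall>y\<in>ball x r. \<bar>F y\<bar> \<le> E) ==> T F x \<le> ennreal Q ==>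
   norm (dpot F x) \<le> C6 * (Q / r + E * r powr (2 * real m - 1))"
  using gradient_riesz_bound by blast
 define M where "M = b * p * 3 powr (p - 1)"
 have M: "0 < M" using b0 p_gt_1 by (simp add: M_def)
 define h where "h = min 1 (1 / (4 * M * (A4 + A5)))"
 have h: "0 < h" "h \<le> 1" "M * (A4 + A5) * h \<le> 1 / 2"
 proof -
  show "0 < h" "h \<le> 1" using M A4(1) A5(1) by (simp_all add: h_def)
  have "M * (A4 + A5) * h \<le> M * (A4 + A5) * (1 / (4 * M * (A4 + A5)))"
   using M A4(1) A5(1) by (intro mult_left_mono) (simp_all add: h_def)
  also have "\<dots> = 1 / 4"
  proof -
   have "M * (A4 + A5) \<noteq> 0" using M A4(1) A5(1) by simp
   then have "(M * (A4 + A5)) / (4 * (M * (A4 + A5))) = 1 / 4" by simp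
   then show ?thesis by (simp only: mult.assoc times_divide_eq_right mult_1_right)
  qed
  finally show "M * (A4 + A5) * h \<le> 1 / 2" by simp
 qed
 define Ap where "Ap = alpha a powr p"
 define Aq where "Aq = alpha a powr (p - 1)"
 define C0 where "C0 = 2 * A3 + 4"
 define C where "C = C0 + C6 * (1 + Ap + M * (Aq + 1)) * C0"
 have ApAq: "0 \<le> Ap" "0 \<le> Aq" by (simp_all add: Ap_def Aq_def)
 have C0: "4 \<le> C0" "0 < C0" using A3(1) by (simp_all add: C0_def)
 have C7: "0 \<le> C6 * (1 + Ap + M * (Aq + 1))" using C6(1) M ApAq by simp
 have C: "0 < C" "C0 \<le> C" "C6 * (1 + Ap + M * (Aq + 1)) * C0 \<le> C"
  using C0 mult_nonneg_nonneg[OF C7, of C0] by (simp_all add: C_def)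
 have concl: "(\<forall>x\<in>ball z (t / 2). \<bar>enn2real (T f x) - psi \<kappa> \<mu> z x\<bar> \<le> C * (l * \<mu> powr (N / 2 + 2 * real m) * r powr (- (N + 2 * real m)) + W)) \<and>
  (\<forall>x. norm (x - z) \<le> 2 * r -->
   norm (dpot (\<lambda>y. f y - \<kappa> * psi \<kappa> \<mu> z y powr p) x)
    \<le> C * (l * \<mu> powr (N / 2 + 2 * real m) * r powr (- (N + 2 * real m)) + W) / r)"
  if \<kappa>: "a \<le> \<kappa>" "\<kappa> \<le> b" and \<mu>: "0 < \<mu>" "\<mu> \<le> r" and rt: "8 * r \<le> t" "t \<le> 1"
   and hh: "(\<mu> / r) powr (2 * real m) \<le> h" "t powr (2 * real m) \<le> h"
   and fm: "f \<in> borel_measurable borel" and f0: "\<And>y. 0 \<le> f y" and Tf: "\<And>y. T f y < \<infinity>" and l: "0 \<le> l"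
   and k: "\<And>y. y \<in> ball z (t / 2) ==> 0 \<le> k y \<and> k y \<le> b \<and> \<bar>k y - \<kappa>\<bar> \<le> l"
   and \<eta>: "\<And>y. 0 \<le> \<eta> y \<and> \<eta> y \<le> 1" "\<And>y. y \<in> ball z r ==> \<eta> y = 1"
   and feq: "\<And>y. y \<in> ball z (t / 2) ==> f y = \<eta> y * (\<kappa> * psi \<kappa> \<mu> z y powr p) + (1 - \<eta> y) * (k y * enn2real (T f y) powr p)"
   and ule: "\<And>y. y \<in> ball z (t / 2) ==> enn2real (T f y) \<le> 2 * psi \<kappa> \<mu> z y + 1" and W: "0 \<le> W"
   and W1: "\<And>x. x \<in> ball z (t / 2) ==> T (\<lambda>y. f y * indicator (- ball z (t / 2)) y) x \<le> ennreal W"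
   and W2: "\<And>x. x \<in> ball z (t / 2) ==> T (\<lambda>y. \<kappa> * (psi \<kappa> \<mu> z y powr p * indicator (- ball z (t / 2)) y)) x \<le> ennreal W"
  for \<kappa> \<mu> r t z k l W f \<eta>
 proof -
  define \<psi> where "\<psi> = psi \<kappa> \<mu> z"
  define u where "u y = enn2real (T f y)" for y
  define B where "B = ball z (t / 2)"
  define F where "F y = f y - \<kappa> * \<psi> y powr p" for y
  define X where "X = \<mu> powr (N / 2 + 2 * real m) * r powr (- (N + 2 * real m))"
  have r: "0 < r" "0 < t" using \<mu> rt by linarith+
  have \<kappa>0: "0 < \<kappa>" using \<kappa> a0 by simp
  have \<psi>0: "0 < \<psi> y" for y unfolding \<psi>_def by (rule psi_pos[OF \<kappa>0 \<mu>(1)])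
  have \<psi>m: "\<psi> \<in> borel_measurable borel" unfolding \<psi>_def by (rule measurable_psi)
  have \<psi>sm: "(\<lambda>y. \<psi> y powr s) \<in> borel_measurable borel" for s using \<psi>m by simp
  have Im: "(indicator S :: real^'n => real) \<in> borel_measurable borel" if "S \<in> sets borel" for S
   using that by (rule borel_measurable_indicator)
  have Fm: "F \<in> borel_measurable borel" unfolding F_def using fm \<psi>sm[of p] by simp
  have rB: "ball z r \<subseteq> B" using r rt by (auto simp: B_def)
  have u0: "0 \<le> u y" for y by (simp add: u_def)
  have X0: "0 \<le> X" by (simp add: X_def)
  have F0: "F y = 0" if "y \<in> ball z r" for y
   using feq[of y] \<eta>(2)[OF that] rB that by (auto simp: F_def B_def \<psi>_def)
  have FB: "\<bar>F y\<bar> \<le> l * \<psi> y powr p + M * (\<psi> y powr (p - 1) + 1) * \<bar>u y - \<psi> y\<bar>" if y: "y \<in> B" for y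
  proof -
   have "\<bar>\<eta> y * (\<kappa> * \<psi> y powr p) + (1 - \<eta> y) * (k y * u y powr p) - \<kappa> * \<psi> y powr p\<bar>
     \<le> l * \<psi> y powr p + (b * p * 3 powr (p - 1)) * (\<psi> y powr (p - 1) + 1) * \<bar>u y - \<psi> y\<bar>"
    using \<eta>(1)[of y] k[of y] ule[of y] y u0[of y] \<psi>0[of y]
    by (intro abs_diff_bound_aux) (auto simp: B_def u_def \<psi>_def)
   then show ?thesis using feq[of y] y by (simp add: F_def B_def u_def \<psi>_def M_def)
  qed
  define E0 where "E0 = l * (A3 * X) + 2 * W"
  have E00: "0 \<le> E0" using l A3(1) X0 W by (simp add: E0_def)
  have TF: "T F x \<le> ennreal (E0 + D0 / 2)" if D0: "0 \<le> D0" "\<And>y. y \<in> B ==> \<bar>u y - \<psi> y\<bar> \<le> D0" and x: "x \<in> B" for D0 x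
  proof -
   define I where "I = (indicator (- ball z r) :: real^'n => real)"
   define J where "J = (indicator (- B) :: real^'n => real)"
   have IJ: "0 \<le> I y" "0 \<le> J y" for y by (simp_all add: I_def J_def)
   have mI: "(\<lambda>y. \<psi> y powr s * I y) \<in> borel_measurable borel" "(\<lambda>y. \<psi> y powr s * J y) \<in> borel_measurable borel" for s
    unfolding I_def J_def B_def by (intro borel_measurable_times \<psi>sm Im; simp)+
   have mJ: "(\<lambda>y. f y * J y) \<in> borel_measurable borel"
    unfolding J_def B_def by (intro borel_measurable_times fm Im) simp
   have mB: "(indicator B :: real^'n => real) \<in> borel_measurable borel" unfolding B_def by (intro Im) simp
   have MD: "0 \<le> M * D0" using M D0 by simp
   let ?g1 = "\<lambda>y. l * (\<psi> y powr p * I y)" and ?g2 = "\<lambda>y. (M * D0) * (\<psi> y powr (p - 1) * I y)"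
    and ?g3 = "\<lambda>y. (M * D0) * indicator B y" and ?g4 = "\<lambda>y. f y * J y" and ?g5 = "\<lambda>y. \<kappa> * (\<psi> y powr p * J y)"
   have m1: "?g1 \<in> borel_measurable borel" "?g2 \<in> borel_measurable borel" "?g3 \<in> borel_measurable borel" "?g5 \<in> borel_measurable borel"
    using mI mB by (auto intro!: borel_measurable_times)
   have nn: "0 \<le> ?g1 y" "0 \<le> ?g2 y" "0 \<le> ?g3 y" "0 \<le> ?g4 y" "0 \<le> ?g5 y" for y
    using l MD IJ f0 \<kappa>0 by simp_all
   have "T F x \<le> T (\<lambda>y. (((?g1 y + ?g2 y) + ?g3 y) + ?g4 y) + ?g5 y) x"
   proof (rule T_mono)
    fix y
    have pw: "\<bar>F y\<bar> \<le> (((?g1 y + ?g2 y) + ?g3 y) + ?g4 y) + ?g5 y"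
    proof (cases "y \<in> ball z r")
     case True
     then show ?thesis using F0[OF True] nn[of y] by (simp only: abs_zero add_nonneg_nonneg)
    next
     case r': False
     show ?thesis
     proof (cases "y \<in> B")
      case True
      have "M * (\<psi> y powr (p - 1) + 1) * \<bar>u y - \<psi> y\<bar> \<le> M * (\<psi> y powr (p - 1) + 1) * D0"
       using M D0(2)[OF True] by (intro mult_left_mono) auto
      also have "\<dots> = (M * D0) * \<psi> y powr (p - 1) + M * D0" by (simp only: distrib_left distrib_right mult_1_right mult_ac)
      finally have "\<bar>F y\<bar> \<le> l * \<psi> y powr p + ((M * D0) * \<psi> y powr (p - 1) + M * D0)"
       using FB[OF True] by linarith
      then show ?thesis using True r' by (simp add: I_def J_def)
     next
      case False
      have "\<bar>F y\<bar> \<le> f y + \<kappa> * \<psi> y powr p" unfolding F_def using f0[of y] \<kappa>0 by (simp add: abs_le_iff)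
      then have "\<bar>F y\<bar> \<le> ?g4 y + ?g5 y" using False by (simp add: J_def)
      then show ?thesis using nn(1-3)[of y] by linarith
     qed
    qed
    then show "\<bar>F y\<bar> \<le> \<bar>(((?g1 y + ?g2 y) + ?g3 y) + ?g4 y) + ?g5 y\<bar>" by linarith
   qed
   also have "\<dots> = (((T ?g1 x + T ?g2 x) + T ?g3 x) + T ?g4 x) + T ?g5 x"
    using m1 mJ nn by (simp add: T_add borel_measurable_add add_nonneg_nonneg)
   also have "\<dots> \<le> (((ennreal (l * (A3 * X)) + ennreal ((M * D0) * (A4 * h))) + ennreal ((M * D0) * (A5 * h))) + ennreal W) + ennreal W"
   proof (intro add_mono)
    have "T ?g1 x = ennreal l * T (\<lambda>y. \<psi> y powr p * I y) x" by (rule T_cmult[OF mI(1) l])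
    also have "\<dots> \<le> ennreal l * ennreal (A3 * X)"
     unfolding \<psi>_def I_def X_def mult.assoc[symmetric] by (intro mult_left_mono A3(2) \<kappa> \<mu>) simp
    finally show "T ?g1 x \<le> ennreal (l * (A3 * X))" using l A3(1) X0 by (simp add: ennreal_mult)
    have "T ?g2 x = ennreal (M * D0) * T (\<lambda>y. \<psi> y powr (p - 1) * I y) x" by (rule T_cmult[OF mI(1) MD])
    also have "\<dots> \<le> ennreal (M * D0) * ennreal (A4 * (\<mu> / r) powr (2 * real m))"
     unfolding \<psi>_def I_def by (intro mult_left_mono A4(2) \<kappa> \<mu> r) simp
    also have "\<dots> \<le> ennreal (M * D0) * ennreal (A4 * h)"
     using A4(1) hh(1) by (intro mult_left_mono ennreal_leI) auto
    finally show "T ?g2 x \<le> ennreal ((M * D0) * (A4 * h))" using MD A4(1) h by (simp add: ennreal_mult)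
    have "T ?g3 x = ennreal (M * D0) * T (indicator B) x" by (rule T_cmult[OF mB MD])
    also have "\<dots> \<le> ennreal (M * D0) * ennreal (A5 * (t / 2) powr (2 * real m))"
     using x r unfolding B_def by (intro mult_left_mono A5(2)) auto
    also have "\<dots> \<le> ennreal (M * D0) * ennreal (A5 * h)"
    proof (intro mult_left_mono ennreal_leI)
     have "(t / 2) powr (2 * real m) \<le> t powr (2 * real m)" using r by (intro powr_mono2) auto
     then show "(t / 2) powr (2 * real m) \<le> h" using hh(2) by linarith
    qed (use A5(1) in auto)
    finally show "T ?g3 x \<le> ennreal ((M * D0) * (A5 * h))" using MD A5(1) h by (simp add: ennreal_mult)
    show "T ?g4 x \<le> ennreal W" using W1 x unfolding J_def B_def by blast
    show "T ?g5 x \<le> ennreal W" using W2 x unfolding J_def B_def \<psi>_def by blast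
   qed
   also have "\<dots> = ennreal (l * (A3 * X) + (M * D0) * (A4 * h) + (M * D0) * (A5 * h) + W + W)"
    using l A3(1) X0 MD A4(1) A5(1) h W by (simp add: ennreal_plus[symmetric] del: ennreal_plus)
   also have "\<dots> \<le> ennreal (E0 + D0 / 2)"
   proof (rule ennreal_leI)
    have "(M * D0) * (A4 * h) + (M * D0) * (A5 * h) = D0 * (M * (A4 + A5) * h)" by (simp add: algebra_simps)
    also have "\<dots> \<le> D0 * (1 / 2)" using D0(1) h(3) by (intro mult_left_mono)
    finally show "l * (A3 * X) + (M * D0) * (A4 * h) + (M * D0) * (A5 * h) + W + W \<le> E0 + D0 / 2"
     by (simp add: E0_def)
   qed
   finally show ?thesis .
  qed
  have uF: "u x - \<psi> x = riesz m F x / \<gamma>" for x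
  proof -
   let ?g = "\<lambda>y. \<kappa> * \<psi> y powr p"
   have gm: "?g \<in> borel_measurable borel" using \<psi>sm[of p] by simp
   have g0: "0 \<le> ?g y" for y using \<kappa>0 by simp
   have Tg: "T ?g x = ennreal (\<psi> x)" unfolding \<psi>_def by (rule T_psi[OF \<kappa>0 \<mu>(1)])
   have Tg': "T ?g x < \<infinity>" unfolding Tg by simp
   have "u x = riesz m f x / \<gamma>" unfolding u_def by (rule T_eq_riesz(1)[OF fm f0 Tf])
   moreover have "\<psi> x = riesz m ?g x / \<gamma>"
    using T_eq_riesz(1)[OF gm g0 Tg'] \<psi>0[of x] unfolding Tg by simp
   moreover have "riesz m F x = riesz m f x - riesz m ?g x"
    unfolding riesz_kernel pot_def F_def right_diff_distrib
    by (rule Bochner_Integration.integral_diff[OF pot_integrable[OF kernel_class_norm_powr[of 0] fm] pot_integrable[OF kernel_class_norm_powr[of 0] gm]])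
     (use Tf[of x] Tg' in \<open>simp_all only: T_finite_iff\<close>)
   ultimately show ?thesis by (simp add: diff_divide_distrib)
  qed
  have uT: "\<bar>u x - \<psi> x\<bar> \<le> Q" if "T F x \<le> ennreal Q" "0 \<le> Q" for x Q
  proof -
   have "ennreal \<bar>u x - \<psi> x\<bar> \<le> ennreal Q"
    unfolding uF using order_trans[OF abs_riesz_le_T[OF Fm] that(1)] .
   then show ?thesis using that(2) by (simp only: ennreal_le_iff)
  qed
  have bdd: "\<bar>u y - \<psi> y\<bar> \<le> 3 * (alpha a * \<mu> powr (- (N / 2))) + 1" if "y \<in> B" for y
   using ule[of y] that psi_le_max[OF \<kappa> \<mu>(1), of z y] u0[of y] \<psi>0[of y] unfolding B_def u_def \<psi>_def by linarith
  define D0 where "D0 = (SUP y\<in>B. \<bar>u y - \<psi> y\<bar>)"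
  have zB: "z \<in> B" using r by (simp add: B_def)
  have bd: "bdd_above ((\<lambda>y. \<bar>u y - \<psi> y\<bar>) ` B)" by (rule bdd_aboveI2[OF bdd])
  have le0: "\<bar>u y - \<psi> y\<bar> \<le> D0" if "y \<in> B" for y
   unfolding D0_def by (rule cSUP_upper[OF that bd])
  have D00: "0 \<le> D0" using le0[OF zB] by linarith
  have "D0 \<le> E0 + D0 / 2"
   unfolding D0_def
  proof (rule cSUP_least)
   show "B \<noteq> {}" using zB by blast
   show "\<bar>u y - \<psi> y\<bar> \<le> E0 + (SUP y\<in>B. \<bar>u y - \<psi> y\<bar>) / 2" if "y \<in> B" for y
    using uT[OF TF[OF D00 le0 that]] E00 D00 unfolding D0_def by simp
  qed
  then have D0E: "D0 \<le> 2 * E0" by simp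
  define D where "D = C0 * (l * X + W)"
  have lX: "0 \<le> l * X" using l X0 by simp
  have ED: "2 * E0 \<le> D"
  proof -
   have "2 * E0 = (2 * A3) * (l * X) + 4 * W" by (simp add: E0_def)
   also have "\<dots> \<le> C0 * (l * X) + C0 * W"
    using lX W A3(1) by (intro add_mono mult_right_mono) (simp_all add: C0_def)
   finally show ?thesis by (simp add: D_def distrib_left)
  qed
  have lXD: "l * X \<le> D"
  proof -
   have "1 * (l * X) \<le> C0 * (l * X + W)" using lX W C0 by (intro mult_mono) auto
   then show ?thesis by (simp add: D_def)
  qed
  have D: "0 \<le> D" using lX lXD by linarith
  have uD: "\<bar>u x - \<psi> x\<bar> \<le> D" if "x \<in> B" for x using le0[OF that] D0E ED by linarith
  have TFD: "T F x \<le> ennreal D" if "x \<in> B" for x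
  proof -
   have "E0 + D0 / 2 \<le> D" using D0E ED by linarith
   from order_trans[OF TF[OF D00 le0 that] ennreal_leI[OF this]] show ?thesis .
  qed
  have grad: "norm (dpot F x) \<le> C6 * (1 + Ap + M * (Aq + 1)) * D / r"
   if x: "norm (x - z) \<le> 2 * r" for x
  proof -
   have xB: "x \<in> B" using x r rt by (simp add: B_def dist_norm norm_minus_commute)
   define V where "V = l * (Ap * \<mu> powr (N / 2 * p) * r powr (- N * p)) + M * (Aq * \<mu> powr (N / 2 * (p - 1)) * r powr (- N * (p - 1)) + 1) * D"
   have V0: "0 \<le> V" unfolding V_def using l ApAq M D by simp
   have FV: "\<bar>F y\<bar> \<le> V" if y: "y \<in> ball x r" for y
   proof (cases "y \<in> ball z r")
    case True
    then show ?thesis using F0 V0 by simp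
   next
    case False
    then have yz: "r \<le> norm (y - z)" "y \<noteq> z" using r by (auto simp: dist_norm norm_minus_commute)
    have "norm (y - z) < 3 * r" using y x norm_triangle_ineq[of "y - x" "x - z"] by (simp add: dist_norm norm_minus_commute)
    then have yB: "y \<in> B" using rt r by (simp add: B_def dist_norm norm_minus_commute)
    have ps: "\<psi> y powr s \<le> alpha a powr s * \<mu> powr (N / 2 * s) * r powr (- N * s)" if s: "0 \<le> s" for s
    proof -
     have "norm (y - z) powr (- N * s) \<le> r powr (- N * s)"
      using yz(1) r N4 s by (intro powr_mono2') auto
     then have "alpha a powr s * \<mu> powr (N / 2 * s) * norm (y - z) powr (- N * s)
       \<le> alpha a powr s * \<mu> powr (N / 2 * s) * r powr (- N * s)"
      by (intro mult_left_mono) auto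
     then show ?thesis using psi_powr_outer_le[OF \<kappa> \<mu>(1) yz(2) s] unfolding \<psi>_def by linarith
    qed
    have "M * (\<psi> y powr (p - 1) + 1) * \<bar>u y - \<psi> y\<bar> \<le> M * (Aq * \<mu> powr (N / 2 * (p - 1)) * r powr (- N * (p - 1)) + 1) * D"
     unfolding Aq_def using M p_gt_1 D uD[OF yB] by (intro mult_mono mult_left_mono add_mono ps) auto
    moreover have "l * \<psi> y powr p \<le> l * (Ap * \<mu> powr (N / 2 * p) * r powr (- N * p))"
     unfolding Ap_def using l p_gt_1 by (intro mult_left_mono ps) auto
    ultimately show ?thesis using FB[OF yB] unfolding V_def by linarith
   qed
   have "V * r powr (2 * real m - 1) \<le> (Ap + M * (Aq + 1)) * D / r"
   proof -
    have e1: "N / 2 * p = N / 2 + 2 * real m" "- N * p + (2 * real m - 1) = - (N + 2 * real m) - 1"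
     using p_minus_1(2) by (simp_all add: algebra_simps)
    have e2: "N / 2 * (p - 1) = 2 * real m" "- N * (p - 1) + (2 * real m - 1) = - 2 * real m - 1"
     using p_minus_1(1) by (simp_all add: algebra_simps)
    have r1: "r powr (s - 1) = r powr s / r" for s using r powr_diff[of r s 1] by simp
    have R1: "r powr (- N * p) * r powr (2 * real m - 1) = r powr (- (N + 2 * real m)) / r"
     unfolding powr_add[symmetric, of r "- N * p"] e1(2) by (rule r1)
    have R2: "r powr (- N * (p - 1)) * r powr (2 * real m - 1) = r powr (- 2 * real m) / r"
     unfolding powr_add[symmetric, of r "- N * (p - 1)"] e2(2) by (rule r1)
    have R3: "V * r powr (2 * real m - 1) = l * (Ap * \<mu> powr (N / 2 * p) * (r powr (- N * p) * r powr (2 * real m - 1)))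
      + M * (Aq * \<mu> powr (N / 2 * (p - 1)) * (r powr (- N * (p - 1)) * r powr (2 * real m - 1)) + r powr (2 * real m - 1)) * D"
     unfolding V_def by (simp only: distrib_left distrib_right mult_1_left mult_1_right mult_ac)
    have "V * r powr (2 * real m - 1) = Ap * (l * X) / r + M * (Aq * (\<mu> powr (2 * real m) * r powr (- 2 * real m)) + r powr (2 * real m)) * D / r"
     unfolding R3 R1 R2 e1(1) e2(1) unfolding X_def r1[of "2 * real m"]
     by (simp only: times_divide_eq_right times_divide_eq_left add_divide_distrib[symmetric] mult_ac)
    also have "\<mu> powr (2 * real m) * r powr (- 2 * real m) = (\<mu> / r) powr (2 * real m)" by (rule powr_ratio[OF \<mu>(1) r(1)])
    also have "Ap * (l * X) / r + M * (Aq * (\<mu> / r) powr (2 * real m) + r powr (2 * real m)) * D / r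
      \<le> Ap * D / r + M * (Aq * 1 + 1) * D / r"
    proof (intro add_mono divide_right_mono mult_mono mult_left_mono add_mono)
     have "r powr (2 * real m) \<le> 1 powr (2 * real m)" using r rt by (intro powr_mono2) auto
     then show "r powr (2 * real m) \<le> 1" by simp
     show "(\<mu> / r) powr (2 * real m) \<le> 1" using hh(1) h(2) by linarith
    qed (use ApAq M D r lXD lX in auto)
    also have "\<dots> = (Ap + M * (Aq + 1)) * D / r" by (simp add: add_divide_distrib distrib_right)
    finally show ?thesis .
   qed
   then have "D / r + V * r powr (2 * real m - 1) \<le> (1 + Ap + M * (Aq + 1)) * D / r"
    by (simp add: add_divide_distrib distrib_right)
   then have "C6 * (D / r + V * r powr (2 * real m - 1)) \<le> C6 * ((1 + Ap + M * (Aq + 1)) * D / r)"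
    using C6(1) by (intro mult_left_mono) auto
   moreover have "norm (dpot F x) \<le> C6 * (D / r + V * r powr (2 * real m - 1))"
    by (rule C6(2)[OF Fm r(1) V0 D _ TFD[OF xB]]) (use FV in blast)
   ultimately show ?thesis by (simp add: mult.assoc)
  qed
  have CD: "D \<le> C * (l * X + W)" "C6 * (1 + Ap + M * (Aq + 1)) * D \<le> C * (l * X + W)"
  proof -
   have n: "0 \<le> l * X + W" using lX W by simp
   show "D \<le> C * (l * X + W)" unfolding D_def by (rule mult_right_mono[OF C(2) n])
   show "C6 * (1 + Ap + M * (Aq + 1)) * D \<le> C * (l * X + W)"
    unfolding D_def mult.assoc[symmetric] using mult_right_mono[OF C(3) n] by (simp only: mult.assoc)
  qed
  have eqX: "l * \<mu> powr (N / 2 + 2 * real m) * r powr (- (N + 2 * real m)) = l * X" by (simp only: X_def mult.assoc)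
  show ?thesis
   unfolding eqX
  proof (intro conjI ballI allI impI)
   fix x assume "x \<in> ball z (t / 2)"
   then show "\<bar>enn2real (T f x) - psi \<kappa> \<mu> z x\<bar> \<le> C * (l * X + W)"
    using uD[of x] CD(1) unfolding B_def u_def \<psi>_def by linarith
  next
   fix x assume x: "norm (x - z) \<le> 2 * r"
   have "C6 * (1 + Ap + M * (Aq + 1)) * D / r \<le> C * (l * X + W) / r"
    using CD(2) r by (intro divide_right_mono) auto
   then show "norm (dpot (\<lambda>y. f y - \<kappa> * psi \<kappa> \<mu> z y powr p) x) \<le> C * (l * X + W) / r"
    using grad[OF x] unfolding F_def \<psi>_def by linarith
  qed
 qed
 show ?thesis
  unfolding deviation_constants_def
  apply (rule exI[of _ C], rule exI[of _ h], rule conjI[OF C(1)], rule conjI[OF h(1)], (rule allI | rule impI)+)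
  subgoal for \<kappa> \<mu> r t z k l W f \<eta>
   by (rule concl[where k = k and \<eta> = \<eta> and t = t and r = r and z = z]) (assumption | blast)+
  done
qed

end

section \<open>The corrected curvature function\<close>

context curvature_bounds
begin

text \<open>Where the density of the solution is \<open>\<kappa> * psi powr p\<close> the curvature is \<open>\<kappa> * (u / psi) powr (- p)\<close>.  The values of
 \<open>u\<close> and \<open>k\<close> and of their gradients at \<open>x\<close> enter as numbers and vectors, so that bounds can
 be stated pointwise.\<close>

definition corr :: "real => real => real ^ 'n => real => real => real => real ^ 'n => real" where
 "corr \<kappa> \<mu> z r u k x = bump z r x * (\<kappa> * (u / psi \<kappa> \<mu> z x) powr (- p) - k)"

definition dcorr :: "real => real => real ^ 'n => real => real => real => real ^ 'n => real ^ 'n => real ^ 'n => real ^ 'n" where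
 "dcorr \<kappa> \<mu> z r u k Du Dk x =
   bump z r x *\<^sub>R ((\<kappa> * (- p * (u / psi \<kappa> \<mu> z x) powr (- p - 1))) *\<^sub>R
    ((1 / psi \<kappa> \<mu> z x) *\<^sub>R Du - (u / (psi \<kappa> \<mu> z x)\<^sup>2) *\<^sub>R dpsi \<kappa> \<mu> z x) - Dk)
   + (\<kappa> * (u / psi \<kappa> \<mu> z x) powr (- p) - k) *\<^sub>R dbump z r x"

lemma GDERIV_corr:
 assumes \<kappa>: "0 < \<kappa>" and \<mu>: "0 < \<mu>" and u: "GDERIV u x :> Du" "0 < u x" and k: "GDERIV k x :> Dk"
 shows "GDERIV (\<lambda>x. corr \<kappa> \<mu> z r (u x) (k x) x) x :> dcorr \<kappa> \<mu> z r (u x) (k x) Du Dk x"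
proof -
 let ?\<psi> = "psi \<kappa> \<mu> z"
 have \<psi>0: "0 < ?\<psi> x" by (rule psi_pos[OF \<kappa> \<mu>])
 have "GDERIV (\<lambda>x. u x * inverse (?\<psi> x)) x :> u x *\<^sub>R (- (inverse (?\<psi> x))\<^sup>2 *\<^sub>R dpsi \<kappa> \<mu> z x) + inverse (?\<psi> x) *\<^sub>R Du"
  using \<psi>0 by (intro GDERIV_mult GDERIV_inverse GDERIV_psi u \<mu>) simp
 then have v: "GDERIV (\<lambda>x. u x / ?\<psi> x) x :> (1 / ?\<psi> x) *\<^sub>R Du - (u x / (?\<psi> x)\<^sup>2) *\<^sub>R dpsi \<kappa> \<mu> z x"
  by (simp add: divide_inverse power_inverse)
 have "DERIV (\<lambda>s. s powr (- p)) (u x / ?\<psi> x) :> - p * (u x / ?\<psi> x) powr (- p - 1)"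
  using u(2) \<psi>0 by (intro has_real_derivative_powr) simp
 from GDERIV_DERIV_compose[OF v this]
 have w: "GDERIV (\<lambda>x. \<kappa> * (u x / ?\<psi> x) powr (- p) - k x) x :>
   \<kappa> *\<^sub>R ((- p * (u x / ?\<psi> x) powr (- p - 1)) *\<^sub>R ((1 / ?\<psi> x) *\<^sub>R Du - (u x / (?\<psi> x)\<^sup>2) *\<^sub>R dpsi \<kappa> \<mu> z x)) - Dk"
  by (intro GDERIV_diff GDERIV_cmult k)
 from GDERIV_mult[OF GDERIV_bump w, of z r] show ?thesis
  unfolding corr_def[abs_def] dcorr_def by (simp only: scaleR_scaleR)
qed

lemma continuous_on_dcorr:
 assumes \<kappa>: "0 < \<kappa>" and \<mu>: "0 < \<mu>" and r: "0 < r" and c: "continuous_on S u" "continuous_on S k" "continuous_on S Du" "continuous_on S Dk"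
  and u: "\<And>x. x \<in> S ==> 0 < u x"
 shows "continuous_on S (\<lambda>x. dcorr \<kappa> \<mu> z r (u x) (k x) (Du x) (Dk x) x)"
proof -
 have \<psi>: "psi \<kappa> \<mu> z x \<noteq> 0" for x using psi_pos[OF \<kappa> \<mu>, of z x] by simp
 have nz: "u x / psi \<kappa> \<mu> z x \<noteq> 0" if "x \<in> S" for x using u[OF that] \<psi>[of x] by simp
 show ?thesis
  unfolding dcorr_def
  by (intro continuous_intros c continuous_on_subset[OF continuous_psi[OF \<mu>] subset_UNIV]
    continuous_on_subset[OF continuous_dpsi[OF \<mu>] subset_UNIV]
    continuous_on_subset[OF continuous_dbump[OF r] subset_UNIV]
    continuous_on_subset[OF continuous_on_GDERIV[OF GDERIV_bump] subset_UNIV])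
   (use \<psi> nz in auto)
qed

text \<open>On the doubled core the bubble is at least a multiple of \<open>\<mu> powr (N / 2) * r powr (- N)\<close>, so that \<open>\<sigma> * r\<close> is
 the relative size of a deviation \<open>D\<close>; the factor \<open>r\<close> makes up for the gradient of the cutoff.\<close>

definition ratio_constants :: "real => real => bool" where
 "ratio_constants C s0 \<longleftrightarrow> 0 < C \<and> 0 < s0 \<and> (\<forall>\<kappa> \<mu> r z k u Du Dk D \<sigma> \<omega> x.
   a \<le> \<kappa> --> \<kappa> \<le> b --> 0 < \<mu> --> \<mu> \<le> r --> r \<le> 1 --> norm (x - z) \<le> 2 * r --> 0 \<le> D -->
   \<bar>u - psi \<kappa> \<mu> z x\<bar> \<le> D --> norm (Du - dpsi \<kappa> \<mu> z x) \<le> D / r -->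
   D * \<mu> powr (- (N / 2)) * r powr (N - 1) \<le> \<sigma> --> \<sigma> \<le> s0 --> 0 \<le> \<omega> --> \<bar>k - \<kappa>\<bar> \<le> 2 * \<omega> * r --> norm Dk \<le> \<omega> -->
   psi \<kappa> \<mu> z x / 2 \<le> u \<and>
   \<bar>corr \<kappa> \<mu> z r u k x\<bar> \<le> C * (\<sigma> + \<omega>) * r \<and> norm (dcorr \<kappa> \<mu> z r u k Du Dk x) \<le> C * (\<sigma> + \<omega>))"

lemma ratio_bounds: "\<exists>C s0. ratio_constants C s0"
proof -
 obtain A where A: "A > 0" "\<And>\<kappa> \<mu> r z x. a \<le> \<kappa> ==> \<kappa> \<le> b ==> 0 < \<mu> ==> \<mu> \<le> r ==> norm (x - z) \<le> 2 * r ==>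
   1 / psi \<kappa> \<mu> z x \<le> A * \<mu> powr (- (N / 2)) * r powr N \<and>
   norm (dpsi \<kappa> \<mu> z x) / (psi \<kappa> \<mu> z x)\<^sup>2 \<le> A * \<mu> powr (- (N / 2)) * r powr (N - 1)"
  using inverse_psi_bounds by blast
 define s0 where "s0 = 1 / (2 * A)"
 define G where "G = b * (p * 2 powr (p - 1) * 2 powr p) * A"
 define H where "H = b * (p * 2 powr (p + 1)) * (2 * A)"
 define C where "C = 3 * (G + 2) + H + 1"
 have p0: "0 < p" using p_gt_1 by simp
 have GH: "0 \<le> G" "0 \<le> H" using b0 p0 A(1) by (simp_all add: G_def H_def)
 have s0: "0 < s0" using A(1) by (simp add: s0_def)
 have C: "0 < C" using GH by (simp add: C_def)
 have main: "psi \<kappa> \<mu> z x / 2 \<le> u \<and> \<bar>corr \<kappa> \<mu> z r u k x\<bar> \<le> C * (\<sigma> + \<omega>) * r \<and> norm (dcorr \<kappa> \<mu> z r u k Du Dk x) \<le> C * (\<sigma> + \<omega>)"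
  if \<kappa>: "a \<le> \<kappa>" "\<kappa> \<le> b" and \<mu>: "0 < \<mu>" "\<mu> \<le> r" "r \<le> 1" and x: "norm (x - z) \<le> 2 * r" and D: "0 \<le> D"
   and u: "\<bar>u - psi \<kappa> \<mu> z x\<bar> \<le> D" and Du: "norm (Du - dpsi \<kappa> \<mu> z x) \<le> D / r"
   and \<sigma>: "D * \<mu> powr (- (N / 2)) * r powr (N - 1) \<le> \<sigma>" "\<sigma> \<le> s0" and \<omega>: "0 \<le> \<omega>" and k: "\<bar>k - \<kappa>\<bar> \<le> 2 * \<omega> * r"
   and Dk: "norm Dk \<le> \<omega>"
  for \<kappa> \<mu> r z k u Du Dk D \<sigma> \<omega> x
 proof -
  define \<psi> where "\<psi> = psi \<kappa> \<mu> z x"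
  define d where "d = dpsi \<kappa> \<mu> z x"
  define v where "v = u / \<psi>"
  have r: "0 < r" using \<mu> by simp
  have \<psi>0: "0 < \<psi>" unfolding \<psi>_def using \<kappa> a0 \<mu> by (intro psi_pos) auto
  have i1: "1 / \<psi> \<le> A * \<mu> powr (- (N / 2)) * r powr N" and i2: "norm d / \<psi>\<^sup>2 \<le> A * \<mu> powr (- (N / 2)) * r powr (N - 1)"
   using A(2)[OF \<kappa> \<mu>(1,2) x] by (simp_all add: \<psi>_def d_def)
  have rN: "r powr N = r powr (N - 1) * r" using r powr_add[of r "N - 1" 1] by simp
  define Y where "Y = D * \<mu> powr (- (N / 2)) * r powr (N - 1)"
  have Y: "0 \<le> Y" "Y \<le> \<sigma>" using D \<sigma> by (simp_all add: Y_def)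
  have \<sigma>0: "0 \<le> \<sigma>" using Y by simp
  have D\<psi>: "D * (1 / \<psi>) \<le> A * \<sigma> * r"
  proof -
   have "D * (1 / \<psi>) \<le> D * (A * \<mu> powr (- (N / 2)) * r powr N)" using i1 D by (rule mult_left_mono)
   also have "\<dots> = A * Y * r" unfolding rN Y_def by (simp only: mult_ac)
   also have "\<dots> \<le> A * \<sigma> * r" using A(1) Y r by (intro mult_right_mono mult_left_mono) auto
   finally show ?thesis .
  qed
  have v1: "\<bar>v - 1\<bar> \<le> A * \<sigma> * r"
  proof -
   have "v - 1 = (u - \<psi>) * (1 / \<psi>)" using \<psi>0 by (simp add: v_def field_simps)
   then have "\<bar>v - 1\<bar> = \<bar>u - \<psi>\<bar> * (1 / \<psi>)" using \<psi>0 by (simp add: abs_mult)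
   also have "\<dots> \<le> D * (1 / \<psi>)" using u \<psi>0 by (intro mult_right_mono) (auto simp: \<psi>_def)
   finally show ?thesis using D\<psi> by linarith
  qed
  have "A * \<sigma> * r \<le> A * s0 * 1" using A(1) \<sigma>(2) \<sigma>0 \<mu>(3) r by (intro mult_mono) auto
  also have "\<dots> = 1 / 2" using A(1) by (simp add: s0_def)
  finally have v2: "1 / 2 \<le> v" "v \<le> 2" using v1 by auto
  have vp: "v powr (- s) \<le> 2 powr s" if "0 \<le> s" for s
  proof -
   have "v powr (- s) \<le> (1 / 2) powr (- s)" using v2 that by (intro powr_mono2') auto
   then show ?thesis by (simp add: powr_divide powr_minus)
  qed
  have e1: "\<bar>v powr (- p) - 1\<bar> \<le> p * 2 powr (p - 1) * 2 powr p * (A * \<sigma> * r)"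
  proof -
   have "v powr (- p) - 1 = v powr (- p) * (1 powr p - v powr p)"
    using v2 by (simp add: right_diff_distrib powr_add[symmetric])
   then have "\<bar>v powr (- p) - 1\<bar> = v powr (- p) * \<bar>1 powr p - v powr p\<bar>" by (simp add: abs_mult)
   also have "\<dots> \<le> 2 powr p * (p * 2 powr (p - 1) * \<bar>1 - v\<bar>)"
    using p_gt_1 v2 by (intro mult_mono vp abs_powr_diff_le) auto
   also have "\<dots> \<le> 2 powr p * (p * 2 powr (p - 1) * (A * \<sigma> * r))"
    using p0 v1 by (intro mult_left_mono) (auto simp: abs_minus_commute)
   finally show ?thesis by (simp only: mult_ac)
  qed
  have e2: "\<bar>\<kappa> * v powr (- p) - k\<bar> \<le> (G + 2) * (\<sigma> + \<omega>) * r"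
  proof -
   have "\<kappa> * v powr (- p) - k = \<kappa> * (v powr (- p) - 1) - (k - \<kappa>)" by (simp add: algebra_simps)
   then have "\<bar>\<kappa> * v powr (- p) - k\<bar> \<le> \<kappa> * \<bar>v powr (- p) - 1\<bar> + \<bar>k - \<kappa>\<bar>"
    using \<kappa> a0 abs_triangle_ineq4[of "\<kappa> * (v powr (- p) - 1)" "k - \<kappa>"] by (simp add: abs_mult)
   also have "\<dots> \<le> b * (p * 2 powr (p - 1) * 2 powr p * (A * \<sigma> * r)) + 2 * \<omega> * r"
    using \<kappa> a0 e1 k by (intro add_mono mult_mono) auto
   also have "\<dots> = (G * \<sigma> + 2 * \<omega>) * r" by (simp add: G_def algebra_simps)
   also have "\<dots> \<le> ((G + 2) * (\<sigma> + \<omega>)) * r"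
   proof (intro mult_right_mono)
    have "0 \<le> G * \<omega>" using GH(1) \<omega> by simp
    then show "G * \<sigma> + 2 * \<omega> \<le> (G + 2) * (\<sigma> + \<omega>)" using \<sigma>0 by (simp add: algebra_simps)
   qed (use r in simp)
   finally show ?thesis .
  qed
  have Dv: "norm ((1 / \<psi>) *\<^sub>R Du - (u / \<psi>\<^sup>2) *\<^sub>R d) \<le> 2 * A * \<sigma>"
  proof -
   have "(u / \<psi>\<^sup>2) *\<^sub>R d = (1 / \<psi>) *\<^sub>R d + ((u - \<psi>) / \<psi>\<^sup>2) *\<^sub>R d"
    using \<psi>0 by (simp add: scaleR_add_left[symmetric] power2_eq_square field_simps)
   then have "(1 / \<psi>) *\<^sub>R Du - (u / \<psi>\<^sup>2) *\<^sub>R d = (1 / \<psi>) *\<^sub>R (Du - d) - ((u - \<psi>) / \<psi>\<^sup>2) *\<^sub>R d"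
    by (simp add: scaleR_diff_right)
   then have "norm ((1 / \<psi>) *\<^sub>R Du - (u / \<psi>\<^sup>2) *\<^sub>R d) \<le> norm ((1 / \<psi>) *\<^sub>R (Du - d)) + norm (((u - \<psi>) / \<psi>\<^sup>2) *\<^sub>R d)"
    using norm_triangle_ineq4 by metis
   also have "\<dots> = (1 / \<psi>) * norm (Du - d) + \<bar>u - \<psi>\<bar> * (norm d / \<psi>\<^sup>2)" using \<psi>0 by simp
   also have "\<dots> \<le> (1 / \<psi>) * (D / r) + D * (A * \<mu> powr (- (N / 2)) * r powr (N - 1))"
    using Du u i2 \<psi>0 D by (intro add_mono mult_mono) (auto simp: d_def \<psi>_def)
   also have "(1 / \<psi>) * (D / r) = (D * (1 / \<psi>)) / r" by simp
   also have "\<dots> \<le> (A * \<sigma> * r) / r" using D\<psi> r by (intro divide_right_mono) auto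
   also have "\<dots> = A * \<sigma>" using r by simp
   also have "D * (A * \<mu> powr (- (N / 2)) * r powr (N - 1)) = A * Y" by (simp only: Y_def mult_ac)
   also have "A * \<sigma> + A * Y \<le> A * \<sigma> + A * \<sigma>" using A(1) Y by simp
   finally show ?thesis by simp
  qed
  have bb: "0 \<le> bump z r x" "bump z r x \<le> 1" by (rule bump_range)+
  have f1: "\<bar>corr \<kappa> \<mu> z r u k x\<bar> \<le> C * (\<sigma> + \<omega>) * r"
  proof -
   have "\<bar>corr \<kappa> \<mu> z r u k x\<bar> = bump z r x * \<bar>\<kappa> * v powr (- p) - k\<bar>"
    using bb by (simp add: corr_def abs_mult v_def \<psi>_def)
   also have "\<dots> \<le> 1 * ((G + 2) * (\<sigma> + \<omega>) * r)" using bb e2 by (intro mult_mono) auto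
   also have "\<dots> \<le> C * (\<sigma> + \<omega>) * r"
    unfolding mult_1 using GH \<sigma>0 \<omega> r by (intro mult_right_mono) (auto simp: C_def)
   finally show ?thesis .
  qed
  have f2: "norm (dcorr \<kappa> \<mu> z r u k Du Dk x) \<le> C * (\<sigma> + \<omega>)"
  proof -
   let ?V = "(1 / \<psi>) *\<^sub>R Du - (u / \<psi>\<^sup>2) *\<^sub>R d"
   let ?c = "\<kappa> * (- p * v powr (- p - 1))"
   have c: "\<bar>?c\<bar> \<le> b * (p * 2 powr (p + 1))"
   proof -
    have "\<bar>?c\<bar> = \<kappa> * (p * v powr (- (p + 1)))" using \<kappa> a0 p0 by (simp add: abs_mult)
    also have "\<dots> \<le> b * (p * 2 powr (p + 1))" using \<kappa> a0 p0 by (intro mult_mono vp) auto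
    finally show ?thesis .
   qed
   have "norm (?c *\<^sub>R ?V - Dk) \<le> \<bar>?c\<bar> * norm ?V + norm Dk"
    using norm_triangle_ineq4[of "?c *\<^sub>R ?V" Dk] by simp
   also have "\<dots> \<le> b * (p * 2 powr (p + 1)) * (2 * A * \<sigma>) + \<omega>"
    using c Dv Dk b0 p0 by (intro add_mono mult_mono) auto
   also have "\<dots> = H * \<sigma> + \<omega>" by (simp add: H_def)
   finally have g1: "norm (?c *\<^sub>R ?V - Dk) \<le> H * \<sigma> + \<omega>" .
   have "norm (dcorr \<kappa> \<mu> z r u k Du Dk x) \<le> bump z r x * norm (?c *\<^sub>R ?V - Dk) + \<bar>\<kappa> * v powr (- p) - k\<bar> * norm (dbump z r x)"
    unfolding dcorr_def v_def \<psi>_def d_def using bb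
    by (intro order_trans[OF norm_triangle_ineq]) simp
   also have "\<dots> \<le> 1 * (H * \<sigma> + \<omega>) + ((G + 2) * (\<sigma> + \<omega>) * r) * (3 / r)"
    using bb g1 e2 norm_dbump_le[OF r] \<sigma>0 \<omega> GH r by (intro add_mono mult_mono) auto
   also have "((G + 2) * (\<sigma> + \<omega>) * r) * (3 / r) = 3 * (G + 2) * (\<sigma> + \<omega>)" using r by (simp add: field_simps)
   also have "1 * (H * \<sigma> + \<omega>) + 3 * (G + 2) * (\<sigma> + \<omega>) \<le> C * (\<sigma> + \<omega>)"
   proof -
    have "0 \<le> H * \<omega>" using GH \<omega> by simp
    then show ?thesis using \<sigma>0 by (simp add: C_def algebra_simps)
   qed
   finally show ?thesis .
  qed
  have "\<psi> / 2 \<le> u" using v2(1) \<psi>0 by (simp add: v_def field_simps)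
  then show ?thesis using f1 f2 by (simp add: \<psi>_def)
 qed
 show ?thesis
  unfolding ratio_constants_def
  by (rule exI[of _ C], rule exI[of _ s0], intro conjI C s0 allI impI main; assumption)
qed

text \<open>The relation \<open>\<mu> = t powr (-1/4) * r powr (3/2)\<close> balances the two ways in which the curvature may
 fail to stay close to the given one: the interaction with the rest of the solution needs \<open>\<mu>\<close> large
 compared with a power of \<open>r\<close>, and the tail of the bubble beyond its core needs \<open>\<mu>\<close> small.  When
 \<open>N = 4\<close> and \<open>m = 1\<close> both leave only the factor \<open>t powr (1/2)\<close>.\<close>

lemma bubble_parameters:
 assumes t: "0 < t" "t \<le> 1" and h: "0 < h" and M: "0 \<le> M1" "0 \<le> M2" and d: "0 < d1" "0 < d2"
 shows "\<exists>r \<mu>. 0 < \<mu> \<and> \<mu> \<le> r \<and> 8 * r \<le> t \<and> (\<mu> / r) powr (2 * real m) \<le> h \<and> M1 * \<mu> powr (N / 2) \<le> d1 \<and>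
  M2 * \<mu> powr (N / 2 + 2 * real m) \<le> d2 \<and>
  t * \<mu> powr (2 * real m) * r powr (- (2 * real m) - 1) \<le> t powr (1 / 2) \<and>
  \<mu> powr (- (N / 2)) * r powr (N - 1) \<le> t powr (1 / 2)"
proof -
 define g where "g = min (min 1 h) (min (d1 / (M1 + 1)) (d2 / (M2 + 1)))"
 have g: "0 < g" "g \<le> 1" "g \<le> h" "g \<le> d1 / (M1 + 1)" "g \<le> d2 / (M2 + 1)"
  using h M d by (auto simp: g_def)
 have gM: "M1 * g \<le> d1" "M2 * g \<le> d2"
 proof -
  have "(M1 + 1) * g \<le> d1" using g(4) M(1) by (simp add: le_divide_eq mult.commute)
  then show "M1 * g \<le> d1" using g(1) by (simp add: distrib_right)
  have "(M2 + 1) * g \<le> d2" using g(5) M(2) by (simp add: le_divide_eq mult.commute)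
  then show "M2 * g \<le> d2" using g(1) by (simp add: distrib_right)
 qed
 have small: "x powr s \<le> g" if "0 < x" "x \<le> g" "1 \<le> s" for x s
 proof -
  have "x powr s \<le> x powr 1" using that g(2) by (intro powr_mono') auto
  then show ?thesis using that by simp
 qed
 define r where "r = min (t / 8) (g\<^sup>2 * t powr (1 / 2))"
 define \<mu> where "\<mu> = t powr (- 1 / 4) * r powr (3 / 2)"
 have r: "0 < r" "r \<le> t / 8" "r \<le> g\<^sup>2 * t powr (1 / 2)" using t g(1) by (auto simp: r_def)
 have r1: "r \<le> 1" using r t by linarith
 have \<mu>0: "0 < \<mu>" using t r by (simp add: \<mu>_def)
 have ratio: "\<mu> / r = t powr (- 1 / 4) * r powr (1 / 2)"
  using powr_diff[of r "3 / 2" 1] r by (simp add: \<mu>_def)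
 have "r powr (1 / 2) \<le> (g\<^sup>2 * t powr (1 / 2)) powr (1 / 2)" using r by (intro powr_mono2) auto
 also have "\<dots> = g * t powr (1 / 4)" using g(1) t by (simp add: powr_mult powr_powr flip: powr_numeral)
 finally have "t powr (- 1 / 4) * r powr (1 / 2) \<le> t powr (- 1 / 4) * (g * t powr (1 / 4))"
  by (intro mult_left_mono) auto
 also have "\<dots> = g * (t powr (- 1 / 4) * t powr (1 / 4))" by (rule mult.left_commute)
 also have "t powr (- 1 / 4) * t powr (1 / 4) = 1" using t by (simp add: powr_add[symmetric])
 finally have rg: "\<mu> / r \<le> g" unfolding ratio by simp
 have \<mu>r: "\<mu> \<le> g * r" using rg r(1) by (simp add: divide_le_eq)
 have \<mu>r': "\<mu> \<le> r" "\<mu> \<le> g"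
 proof -
  have "g * r \<le> 1 * r" by (rule mult_right_mono[OF g(2)]) (use r(1) in simp)
  then show "\<mu> \<le> r" using \<mu>r by linarith
  have "g * r \<le> g * 1" by (rule mult_left_mono[OF r1]) (use g(1) in simp)
  then show "\<mu> \<le> g" using \<mu>r by linarith
 qed
 have c1: "(\<mu> / r) powr (2 * real m) \<le> h"
  using small[of "\<mu> / r" "2 * real m"] rg \<mu>0 r(1) m1r g(3) by simp
 have c2: "M1 * \<mu> powr (N / 2) \<le> d1"
  using mult_left_mono[OF small[OF \<mu>0 \<mu>r'(2), of "N / 2"] M(1)] N4 gM(1) by simp
 have c3: "M2 * \<mu> powr (N / 2 + 2 * real m) \<le> d2"
  using mult_left_mono[OF small[OF \<mu>0 \<mu>r'(2), of "N / 2 + 2 * real m"] M(2)] N4 gM(2) by simp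
 have \<mu>s: "\<mu> powr s = t powr (- 1 / 4 * s) * r powr (3 / 2 * s)" for s
  unfolding \<mu>_def using t r(1) by (simp add: powr_mult powr_powr)
 have rt: "r \<le> t powr (1 / 2)"
 proof -
  have "t powr 1 \<le> t powr (1 / 2)" using t by (intro powr_mono') auto
  then show ?thesis using r t by simp
 qed
 have c4: "t * \<mu> powr (2 * real m) * r powr (- (2 * real m) - 1) \<le> t powr (1 / 2)"
 proof -
  have "t * \<mu> powr (2 * real m) * r powr (- (2 * real m) - 1)
    = (t powr 1 * t powr (- 1 / 4 * (2 * real m))) * (r powr (3 / 2 * (2 * real m)) * r powr (- (2 * real m) - 1))"
   unfolding \<mu>s using t by (simp add: mult_ac)
  also have "t powr 1 * t powr (- 1 / 4 * (2 * real m)) = t powr (1 / 2) * t powr (1 / 2 * - (real m - 1))"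
   unfolding powr_add[symmetric] by (rule arg_cong[where f = "\<lambda>s. t powr s"]) (simp add: field_simps)
  also have "r powr (3 / 2 * (2 * real m)) * r powr (- (2 * real m) - 1) = r powr (real m - 1)"
   unfolding powr_add[symmetric] by (rule arg_cong[where f = "\<lambda>s. r powr s"]) (simp add: field_simps)
  also have "t powr (1 / 2) * t powr (1 / 2 * - (real m - 1)) * r powr (real m - 1)
    \<le> t powr (1 / 2) * t powr (1 / 2 * - (real m - 1)) * (t powr (1 / 2)) powr (real m - 1)"
   using rt r(1) m1r by (intro mult_left_mono powr_mono2) auto
  also have "\<dots> = t powr (1 / 2) * (t powr (1 / 2 * - (real m - 1)) * t powr (1 / 2 * (real m - 1)))"
   by (simp only: powr_powr mult.assoc)
  also have "t powr (1 / 2 * - (real m - 1)) * t powr (1 / 2 * (real m - 1)) = 1"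
   unfolding powr_add[symmetric] using t by (simp only: distrib_left[symmetric]) simp
  finally show ?thesis by simp
 qed
 have c5: "\<mu> powr (- (N / 2)) * r powr (N - 1) \<le> t powr (1 / 2)"
 proof -
  have "\<mu> powr (- (N / 2)) * r powr (N - 1) = t powr (- 1 / 4 * - (N / 2)) * (r powr (3 / 2 * - (N / 2)) * r powr (N - 1))"
   unfolding \<mu>s by (simp only: mult.assoc)
  also have "r powr (3 / 2 * - (N / 2)) * r powr (N - 1) = r powr (N / 4 - 1)"
   unfolding powr_add[symmetric] by (rule arg_cong[where f = "\<lambda>s. r powr s"]) (simp add: field_simps)
  also have "t powr (- 1 / 4 * - (N / 2)) * r powr (N / 4 - 1) \<le> t powr (1 / 2) * 1"
  proof (intro mult_mono)
   show "t powr (- 1 / 4 * - (N / 2)) \<le> t powr (1 / 2)" using t N4 by (intro powr_mono') auto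
   have "r powr (N / 4 - 1) \<le> 1 powr (N / 4 - 1)" using r r1 N4 by (intro powr_mono2) auto
   then show "r powr (N / 4 - 1) \<le> 1" by simp
  qed auto
  finally show ?thesis by simp
 qed
 have "8 * r \<le> t" using r(2) by simp
 then show ?thesis using \<mu>0 \<mu>r'(1) c1 c2 c3 c4 c5 by blast
qed

end

section \<open>Gluing functions supported near a sequence of points\<close>

text \<open>The points \<open>(\<tau> / 4 ^ i) *\<^sub>R e\<close> converge to the origin and the balls around them of half
 their distance to the origin are disjoint.\<close>

definition tball :: "real => 'a::real_normed_vector => nat => 'a set" where
 "tball \<tau> e i = ball ((\<tau> / 4 ^ i) *\<^sub>R e) ((\<tau> / 4 ^ i) / 2)"

lemma tball_norm:
 assumes "norm e = 1" "0 < \<tau>" "x \<in> tball \<tau> e i"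
 shows "(\<tau> / 4 ^ i) / 2 < norm x" "norm x < 3 / 2 * (\<tau> / 4 ^ i)"
proof -
 have n: "norm ((\<tau> / 4 ^ i) *\<^sub>R e) = \<tau> / 4 ^ i" using assms(1,2) by simp
 have d: "norm ((\<tau> / 4 ^ i) *\<^sub>R e - x) < (\<tau> / 4 ^ i) / 2" using assms(3) by (simp add: tball_def dist_norm)
 show "(\<tau> / 4 ^ i) / 2 < norm x"
  using d n norm_triangle_ineq2[of "(\<tau> / 4 ^ i) *\<^sub>R e" x] by linarith
 show "norm x < 3 / 2 * (\<tau> / 4 ^ i)"
  using d n norm_triangle_ineq2[of x "(\<tau> / 4 ^ i) *\<^sub>R e"] by (simp add: norm_minus_commute)
qed

lemma zero_notin_tball:
 assumes "norm e = 1" "0 < \<tau>"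
 shows "0 \<notin> tball \<tau> e i"
proof
 assume "0 \<in> tball \<tau> e i"
 from tball_norm(1)[OF assms this] have "(\<tau> / 4 ^ i) / 2 < 0" by simp
 moreover have "0 < (\<tau> / 4 ^ i) / 2" using assms(2) by simp
 ultimately show False by linarith
qed

lemma tball_disjoint:
 assumes "norm e = 1" "0 < \<tau>" "x \<in> tball \<tau> e i" "x \<in> tball \<tau> e j"
 shows "i = j"
proof -
 have *: "False" if "i < j" "x \<in> tball \<tau> e i" "x \<in> tball \<tau> e j" for i j
 proof -
  have "(4::real) ^ Suc i \<le> 4 ^ j" using that(1) by (intro power_increasing) auto
  then have "\<tau> / 4 ^ j \<le> \<tau> / 4 ^ Suc i" using assms(2) by (intro divide_left_mono) auto
  then show False using tball_norm[OF assms(1,2) that(2)] tball_norm[OF assms(1,2) that(3)] assms(2) by simp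
 qed
 show ?thesis using *[of i j] *[of j i] assms(3,4) by (metis linorder_neqE_nat)
qed

lemma tball_eventually_small:
 fixes \<tau> d :: real
 assumes "0 < \<tau>" "0 < d"
 shows "\<exists>i0. \<forall>i\<ge>i0. \<tau> / 4 ^ i < d"
proof -
 obtain i0 where i0: "\<tau> / d < 4 ^ i0" using real_arch_pow[of 4 "\<tau> / d"] by auto
 have "\<tau> / 4 ^ i < d" if "i0 \<le> i" for i
 proof -
  have "(4::real) ^ i0 \<le> 4 ^ i" using that by (intro power_increasing) auto
  then have "\<tau> / d < 4 ^ i" using i0 by linarith
  then show ?thesis using assms by (simp add: field_simps)
 qed
 then show ?thesis by blast
qed

lemma tball_locally_finite:
 assumes "norm e = 1" "0 < \<tau>" "x \<noteq> 0"
 shows "\<exists>d>0. \<exists>i0. 0 \<notin> ball x d \<and> (\<forall>y\<in>ball x d. \<forall>i\<ge>i0. y \<notin> tball \<tau> e i)"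
proof -
 have x: "0 < norm x / 4" using assms(3) by simp
 obtain i0 where i0: "\<And>i. i0 \<le> i ==> \<tau> / 4 ^ i < norm x / 4"
  using tball_eventually_small[OF assms(2) x] by blast
 have "y \<notin> tball \<tau> e i" if "y \<in> ball x (norm x / 2)" "i0 \<le> i" for y i
 proof
  assume "y \<in> tball \<tau> e i"
  from tball_norm(2)[OF assms(1,2) this] i0[OF that(2)]
  have "norm y < 3 / 2 * (norm x / 4)" by linarith
  then show False using that(1) norm_triangle_ineq2[of x y] x by (simp add: dist_norm)
 qed
 then show ?thesis using assms(3) by (intro exI[of _ "norm x / 2"] conjI exI[of _ i0]) auto
qed

lemma suminf_tball:
 fixes F :: "nat => 'a::real_normed_vector => 'b::{t2_space,comm_monoid_add}"
 assumes "norm e = 1" "0 < \<tau>" "\<And>i. x \<notin> tball \<tau> e i ==> F i x = 0"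
 shows "x \<in> tball \<tau> e i ==> (\<Sum>j. F j x) = F i x"
  and "(\<And>i. x \<notin> tball \<tau> e i) ==> (\<Sum>j. F j x) = 0"
proof -
 assume i: "x \<in> tball \<tau> e i"
 have "F j x = 0" if "j \<noteq> i" for j
  using assms(3)[of j] tball_disjoint[OF assms(1,2) i, of j] that by blast
 then show "(\<Sum>j. F j x) = F i x" using suminf_finite[of "{i}" "\<lambda>j. F j x"] by simp
next
 assume "\<And>i. x \<notin> tball \<tau> e i"
 then show "(\<Sum>j. F j x) = 0" using assms(3) by simp
qed

text \<open>Away from the origin the sums are locally finite.  At the origin the bounds by \<open>S i\<close> with
 \<open>S\<close> tending to zero make the sum \<open>o(norm x)\<close> and its derivative continuous.\<close>

lemma gluing:
 fixes P :: "nat => real ^ 'n::finite => real" and DP :: "nat => real ^ 'n => real ^ 'n"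
 assumes e: "norm e = 1" "0 < \<tau>"
  and z: "\<And>i x. x \<notin> tball \<tau> e i ==> P i x = 0" "\<And>i x. x \<notin> tball \<tau> e i ==> DP i x = 0"
  and G: "\<And>i x. x \<noteq> 0 ==> GDERIV (P i) x :> DP i x" "\<And>i. continuous_on (- {0}) (DP i)"
  and S: "\<And>i x. \<bar>P i x\<bar> \<le> S i * norm x" "\<And>i x. norm (DP i x) \<le> S i" "S \<longlonglongrightarrow> 0"
 shows "GDERIV (\<lambda>x. \<Sum>i. P i x) x :> (\<Sum>i. DP i x)" "continuous_on UNIV (\<lambda>x. \<Sum>i. DP i x)"
proof -
 let ?P = "\<lambda>x. \<Sum>i. P i x" and ?D = "\<lambda>x. \<Sum>i. DP i x"
 have loc: "\<exists>d>0. \<exists>i0. 0 \<notin> ball x d \<and> (\<forall>y\<in>ball x d. ?P y = (\<Sum>i<i0. P i y) \<and> ?D y = (\<Sum>i<i0. DP i y))"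
  if x0: "x \<noteq> 0" for x
 proof -
  obtain d i0 where d: "d > 0" "0 \<notin> ball x d" "\<And>y i. y \<in> ball x d ==> i0 \<le> i ==> y \<notin> tball \<tau> e i"
   using tball_locally_finite[OF e x0] by blast
  have "?P y = (\<Sum>i<i0. P i y) \<and> ?D y = (\<Sum>i<i0. DP i y)" if "y \<in> ball x d" for y
   using z[of y] d(3)[OF that] by (intro conjI suminf_finite) (auto simp: not_less)
  then show ?thesis using d(1,2) by blast
 qed
 have G1: "GDERIV ?P x :> ?D x" if x: "x \<noteq> 0" for x
 proof -
  obtain d i0 where d: "d > 0" "\<And>y. y \<in> ball x d ==> ?P y = (\<Sum>i<i0. P i y) \<and> ?D y = (\<Sum>i<i0. DP i y)"
   using loc[OF x] by blast
  have "GDERIV (\<lambda>y. \<Sum>i<i0. P i y) x :> (\<Sum>i<i0. DP i x)" by (intro GDERIV_sum G x)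
  then have "GDERIV ?P x :> (\<Sum>i<i0. DP i x)"
   by (rule GDERIV_transform_open[of _ _ _ "ball x d"]) (use d in auto)
  then show ?thesis using d by simp
 qed
 have C1: "isCont ?D x" if x: "x \<noteq> 0" for x
 proof -
  obtain d i0 where d: "d > 0" "0 \<notin> ball x d" "\<And>y. y \<in> ball x d ==> ?P y = (\<Sum>i<i0. P i y) \<and> ?D y = (\<Sum>i<i0. DP i y)"
   using loc[OF x] by blast
  have "continuous_on (ball x d) (\<lambda>y. \<Sum>i<i0. DP i y)"
   using d(2) by (intro continuous_on_sum continuous_on_subset[OF G(2)]) blast
  then have "continuous_on (ball x d) ?D"
   by (rule continuous_on_eq) (use d(3) in simp)
  then show ?thesis using d(1) by (simp add: continuous_on_eq_continuous_at)
 qed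
 have zero: "?P 0 = 0" "?D 0 = 0" using z zero_notin_tball[OF e] by simp_all
 have small: "\<exists>d>0. \<forall>y. norm y < d --> \<bar>?P y\<bar> \<le> \<eta> * norm y \<and> norm (?D y) \<le> \<eta>" if \<eta>: "0 < \<eta>" for \<eta>
 proof -
  obtain i0 where i0: "\<And>i. i0 \<le> i ==> S i < \<eta>"
   using order_tendstoD(2)[OF S(3) \<eta>] unfolding eventually_sequentially by blast
  define d where "d = (\<tau> / 4 ^ i0) / 2"
  have "\<bar>?P y\<bar> \<le> \<eta> * norm y \<and> norm (?D y) \<le> \<eta>" if y: "norm y < d" for y
  proof (cases "\<exists>i. y \<in> tball \<tau> e i")
   case True
   then obtain i where i: "y \<in> tball \<tau> e i" by blast
   have "i0 \<le> i"
   proof (rule ccontr)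
    assume "\<not> i0 \<le> i"
    then have "(4::real) ^ i \<le> 4 ^ i0" by (intro power_increasing) auto
    then have "\<tau> / 4 ^ i0 \<le> \<tau> / 4 ^ i" using e(2) by (intro divide_left_mono) auto
    then show False using tball_norm(1)[OF e i] y by (simp add: d_def)
   qed
   then have "S i \<le> \<eta>" using i0 by (simp add: less_imp_le)
   have "?P y = P i y" by (rule suminf_tball(1)[OF e z(1) i])
   moreover have "?D y = DP i y" by (rule suminf_tball(1)[OF e z(2) i])
   moreover have "S i * norm y \<le> \<eta> * norm y" using \<open>S i \<le> \<eta>\<close> by (rule mult_right_mono) simp
   ultimately show ?thesis using S(1)[of i y] S(2)[of i y] \<open>S i \<le> \<eta>\<close> by simp
  next
   case False
   then have "?P y = 0" "?D y = 0" using z by simp_all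
   then show ?thesis using \<eta> by simp
  qed
  moreover have "d > 0" using e(2) by (simp add: d_def)
  ultimately show ?thesis by blast
 qed
 have G0: "GDERIV ?P 0 :> ?D 0"
  unfolding zero gderiv_def has_derivative_at_alt
 proof (intro conjI bounded_linear_inner_left allI impI)
  fix \<eta> :: real assume "0 < \<eta>"
  from small[OF this] obtain d where d: "d > 0" "\<And>y. norm y < d ==> \<bar>?P y\<bar> \<le> \<eta> * norm y" by blast
  have "norm (?P y - 0 - (y - 0) \<bullet> 0) \<le> \<eta> * norm (y - 0)" if "norm (y - 0) < d" for y
   using d(2)[of y] that by simp
  then show "\<exists>d>0. \<forall>y. norm (y - 0) < d --> norm (?P y - 0 - (y - 0) \<bullet> 0) \<le> \<eta> * norm (y - 0)"
   using d(1) by blast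
 qed
 show "GDERIV ?P x :> ?D x" using G0 G1 by (cases "x = 0") auto
 have "isCont ?D 0"
  unfolding continuous_at_eps_delta
 proof (intro allI impI)
  fix \<eta> :: real assume \<eta>: "0 < \<eta>"
  then have "0 < \<eta> / 2" by simp
  from small[OF this] obtain d where d: "d > 0" "\<And>y. norm y < d ==> norm (?D y) \<le> \<eta> / 2" by blast
  have "dist (?D y) (?D 0) < \<eta>" if "dist y 0 < d" for y
  proof -
   have "norm y < d" using that by (simp only: dist_norm diff_zero)
   from d(2)[OF this] show ?thesis using \<eta> unfolding zero by (simp add: dist_norm)
  qed
  then show "\<exists>d>0. \<forall>y. dist y 0 < d --> dist (?D y) (?D 0) < \<eta>" using d(1) by blast
 qed
 then have "isCont ?D x" for x using C1 by (cases "x = 0") auto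
 then show "continuous_on UNIV ?D" by (simp add: continuous_on_eq_continuous_at)
qed

section \<open>Solutions as potentials of their own densities\<close>

context riesz_setting
begin

text \<open>The normalised potentials have the same local bounds up to the factor \<open>\<gamma>\<close>.\<close>

lemma tame_of_T_bounded:
 fixes f :: "real ^ 'n => real"
 assumes f: "f \<in> borel_measurable borel"
  and b: "\<And>x. x \<noteq> 0 ==> \<exists>d>0. \<exists>M\<ge>0. \<forall>y\<in>ball x d. T f y \<le> ennreal M"
 shows "tame (- N) f (- {0})"
 unfolding tame_def
proof (intro conjI f ballI)
 fix x :: "real ^ 'n" assume "x \<in> - {0}"
 then have "x \<noteq> 0" by simp
 from b[OF this] obtain d M where dM: "d > 0" "0 \<le> M" "\<And>y. y \<in> ball x d ==> T f y \<le> ennreal M" by blast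
 have "nnpot (- N) f y \<le> ennreal (\<gamma> * M)" if "y \<in> ball x d" for y
 proof -
  have "nnpot (- N) f y = (ennreal \<gamma> * ennreal (1 / \<gamma>)) * nnpot (- N) f y"
   using \<gamma>_pos by (simp add: ennreal_mult[symmetric])
  also have "\<dots> = ennreal \<gamma> * T f y" by (simp only: T_def mult.assoc)
  also have "\<dots> \<le> ennreal \<gamma> * ennreal M" using dM(3)[OF that] by (rule mult_left_mono) simp
  also have "\<dots> = ennreal (\<gamma> * M)" using \<gamma>_pos dM(2) by (intro ennreal_mult[symmetric]) auto
  finally show ?thesis .
 qed
 then show "\<exists>e>0. \<exists>K\<ge>0. \<forall>y\<in>ball x e. nnpot (- N) f y \<le> ennreal K"
  using dM(1,2) \<gamma>_pos by (intro exI[of _ d] conjI exI[of _ "\<gamma> * M"]) auto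
qed

text \<open>A solution is given as the normalised potential of a density which is only locally bounded away
 from the origin.  This already makes the solution continuously differentiable, which is what the
 regularity of the density, and then the full regularity of the solution, are derived from.\<close>

lemma potential_C1:
 fixes f :: "real ^ 'n => real"
 assumes f: "\<And>y. 0 \<le> f y" "tame (- N) f (- {0})" "locally_bounded_on (- {0}) f"
  and pos: "0 < r" "\<And>y. y \<in> ball z r ==> 0 < f y" and x: "x \<noteq> 0"
 shows "0 < enn2real (T f x)"
  and "GDERIV (\<lambda>x. enn2real (T f x)) x :> (1 / \<gamma>) *\<^sub>R dpot f x"
proof -
 have fm: "f \<in> borel_measurable borel" by (rule tameD_measurable[OF f(2)])
 have u: "enn2real (T f y) = (1 / \<gamma>) * pot (\<lambda>z. norm z powr (- N)) f y" if "y \<in> - {0}" for y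
  using T_eq_riesz(1)[OF fm f(1), of y] tame_finite[OF f(2) that] unfolding T_finite_iff riesz_kernel by simp
 have "0 < pot (\<lambda>z. norm z powr (- N)) f x"
  by (rule pot_nonneg_pos[OF fm f(1) tame_finite[OF f(2)] pos(1)]) (use pos(2) x in auto)
 then show "0 < enn2real (T f x)" using u[of x] x \<gamma>_pos by simp
 have "tame (- N - 3 / 2) f (- {0})"
  using m1r n_eq N4 by (intro tame_of_locally_bounded[OF f(2,3)]) auto
 then have "GDERIV (pot (\<lambda>z. norm z powr (- N)) f) x :> dpot f x"
  unfolding dpot_def by (rule GDERIV_pot[OF kernel_class_norm_powr f(2)]) (use x in auto)
 from GDERIV_cmult[OF this, of "1 / \<gamma>"]
 show "GDERIV (\<lambda>x. enn2real (T f x)) x :> (1 / \<gamma>) *\<^sub>R dpot f x"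
  by (rule GDERIV_transform_open[of _ _ _ "- {0}"]) (use u x in auto)
qed

lemma potential_solves:
 fixes f :: "real ^ 'n => real"
 assumes f: "\<And>y. 0 \<le> f y" "tame (- N) f (- {0})" "C_k_on 1 f (- {0})" and fin: "\<And>x. T f x < \<infinity>"
  and pos: "0 < r" "\<And>y. y \<in> ball z r ==> 0 < f y"
 defines "u \<equiv> \<lambda>x. enn2real (T f x)"
 shows "C_k_on (2 * m) u (- {0})"
  and "x \<noteq> 0 ==> neg_laplacian_pow m u x = f x"
  and "s \<in> {1..m - 1} ==> x \<noteq> 0 ==> 0 < neg_laplacian_pow s u x"
proof -
 have fm: "f \<in> borel_measurable borel" by (rule tameD_measurable[OF f(2)])
 let ?g = "\<lambda>y. (1 / \<gamma>) * f y"
 have g0: "0 \<le> ?g y" for y using f(1)[of y] \<gamma>_pos by simp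
 have gm: "?g \<in> borel_measurable borel" using fm by simp
 have "u x = riesz m ?g x" for x
  using T_eq_riesz(1)[OF fm f(1) fin, of x] unfolding u_def pot_def by (simp add: mult.left_commute[of _ "1 / \<gamma>"])
 then have u: "u = riesz m ?g" by (rule ext)
 have tg: "tame (2 * real m - real CARD('n)) ?g (- {0})"
  unfolding tame_def
 proof (intro conjI gm ballI)
  fix x :: "real ^ 'n" assume x: "x \<in> - {0}"
  obtain e K where e: "e > 0" "K \<ge> 0" "\<And>y. y \<in> ball x e ==> nnpot (- N) f y \<le> ennreal K"
   by (rule tameE[OF f(2) x]) (rule that, assumption+)
  have "nnpot (2 * real m - real CARD('n)) ?g y \<le> ennreal (1 / \<gamma> * K)" if "y \<in> ball x e" for y
  proof -
   have "nnpot (- N) ?g y = ennreal (1 / \<gamma>) * nnpot (- N) f y"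
    using \<gamma>_pos by (subst nnpot_cmult[OF fm]) simp_all
   also have "\<dots> \<le> ennreal (1 / \<gamma>) * ennreal K" using e(3)[OF that] by (rule mult_left_mono) simp
   also have "\<dots> = ennreal (1 / \<gamma> * K)" using e(2) \<gamma>_pos by (intro ennreal_mult[symmetric]) simp_all
   finally show ?thesis by (simp add: N_def)
  qed
  then show "\<exists>e>0. \<exists>K\<ge>0. \<forall>y\<in>ball x e. nnpot (2 * real m - real CARD('n)) ?g y \<le> ennreal K"
   using e(1,2) \<gamma>_pos by (intro exI[of _ e] conjI exI[of _ "1 / \<gamma> * K"]) auto
 qed
 have op: "open (- {0 :: real ^ 'n})" by (rule open_Compl[OF closed_singleton])
 have gC: "C_k_on 1 ?g (- {0})"
  using C_k_on_lincomb[OF op f(3) f(3), of "1 / \<gamma>" 0] by simp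
 have m2: "2 * m < CARD('n)" using dim4 by simp
 note main = neg_laplacian_pow_riesz[OF op m1 m2 tg gC]
 show "C_k_on (2 * m) u (- {0})" unfolding u by (rule main(1))
 show "neg_laplacian_pow m u x = f x" if "x \<noteq> 0"
  using main(3)[of x] that \<gamma>_pos unfolding u \<gamma>_eq[symmetric] by simp
 show "0 < neg_laplacian_pow s u x" if s: "s \<in> {1..m - 1}" and x: "x \<noteq> 0"
 proof -
  have sm: "s < m" "1 \<le> m - s" using s m1 by auto
  have "locally_bounded_on (- {0}) ?g"
   by (rule continuous_imp_locally_bounded[OF op C_1_onD(3)[OF op gC]])
  then have "tame (2 * real (m - s) - real CARD('n)) ?g (- {0})"
   by (rule tame_of_locally_bounded[OF tg]) (use sm m2 in auto)
  from tame_finite[OF this, of x] have fin: "nnpot (2 * real (m - s) - real CARD('n)) ?g x < \<infinity>" using x by simp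
  have "0 < ?g y" if "y \<in> ball z r" for y using pos(2)[OF that] \<gamma>_pos by simp
  then have "0 < riesz (m - s) ?g x" by (rule pot_nonneg_pos[OF gm g0 fin pos(1)])
  then show ?thesis
   unfolding u using main(2)[OF sm(1), of x] x riesz_const_pos[OF m2 sm(1)] by simp
 qed
qed

end

section \<open>Superposition of infinitely many bubbles\<close>

text \<open>The bubbles are centred at the points \<open>z i\<close> on a ray.  The first smallness hypothesis \<open>core\<close> makes
 the correction of the supersolution on the ring around the core of a bubble harmless, the second one,
 \<open>far\<close>, makes the sum of all other bubbles negligible on \<open>tball \<tau> e i\<close>.\<close>

locale bubble_sequence = curvature_bounds m N dim a b
 for m :: nat and N :: real and dim :: "'n::finite itself" and a b :: real +
 fixes k :: "real ^ 'n => real" and e :: "real ^ 'n" and \<tau> :: real and \<kappa> \<mu> r :: "nat => real" and \<delta> :: real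
 assumes e1: "norm e = 1" and \<tau>0: "0 < \<tau>"
  and km: "k \<in> borel_measurable borel" and kab: "\<And>x. a \<le> k x \<and> k x \<le> b"
  and \<kappa>ab: "\<And>i. a \<le> \<kappa> i" "\<And>i. \<kappa> i \<le> b"
  and \<mu>r: "\<And>i. 0 < \<mu> i" "\<And>i. \<mu> i \<le> r i" "\<And>i. 8 * r i \<le> \<tau> / 4 ^ i"
  and \<delta>: "0 < \<delta>" "b * 2 powr p * (\<delta> * (c1 + 1)) powr p \<le> \<delta>"
  and core: "\<And>i x. T (\<lambda>y. psi (\<kappa> i) (\<mu> i) ((\<tau> / 4 ^ i) *\<^sub>R e) y powr p * indicator (- ball ((\<tau> / 4 ^ i) *\<^sub>R e) (r i)) y) x
    \<le> ennreal (1 / (b * 4 powr p) * psi (\<kappa> i) (\<mu> i) ((\<tau> / 4 ^ i) *\<^sub>R e) x)"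
  and far: "\<And>i x. x \<notin> tball \<tau> e i ==>
    2 * psi (\<kappa> i) (\<mu> i) ((\<tau> / 4 ^ i) *\<^sub>R e) x \<le> \<delta> * (1 / 2) ^ Suc i * q 1 0 x"
begin

definition zc :: "nat => real ^ 'n" where "zc i = (\<tau> / 4 ^ i) *\<^sub>R e"

definition \<psi> :: "nat => real ^ 'n => real" where "\<psi> i = psi (\<kappa> i) (\<mu> i) (zc i)"

definition bubble_density :: "nat => real ^ 'n => real" where
 "bubble_density i y = indicator (tball \<tau> e i) y *
   (\<kappa> i * \<psi> i y powr p + (b * 4 powr p) * (\<psi> i y powr p * indicator (- ball (zc i) (r i)) y))"

text \<open>The background \<open>\<delta> * q 1 0 y powr p\<close> compensates for the nonlinearity between the bubbles.  Leaving out some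
 of the bubbles measures the influence of the others at a given one.\<close>

definition super_density :: "nat set => real ^ 'n => real" where
 "super_density J y = \<delta> * q 1 0 y powr p + (\<Sum>i. indicator J i * bubble_density i y)"

definition cut :: "real ^ 'n => real" where "cut x = (\<Sum>i. bump (zc i) (r i) x)"

lemma r0: "0 < r i" using \<mu>r(1,2)[of i] by linarith

lemma \<kappa>0: "0 < \<kappa> i" using \<kappa>ab(1)[of i] a0 by linarith

lemma t0: "0 < \<tau> / 4 ^ i" using \<tau>0 by simp

lemma \<psi>_pos: "0 < \<psi> i x" unfolding \<psi>_def by (rule psi_pos[OF \<kappa>0 \<mu>r(1)])

lemma \<psi>_measurable: "(\<lambda>x. \<psi> i x powr s) \<in> borel_measurable borel"
 unfolding \<psi>_def using measurable_psi[of "\<kappa> i" "\<mu> i" "zc i"] by simp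

lemma tball_zc: "tball \<tau> e i = ball (zc i) ((\<tau> / 4 ^ i) / 2)"
 by (simp add: tball_def zc_def)

lemma bump_off_tball: "x \<notin> tball \<tau> e i ==> bump (zc i) (r i) x = 0"
 using \<mu>r(3)[of i] r0[of i]
 by (intro bump_0) (auto simp: tball_zc dist_norm norm_minus_commute)

lemma dbump_off_tball: "x \<notin> tball \<tau> e i ==> dbump (zc i) (r i) x = 0"
 using \<mu>r(3)[of i] r0[of i]
 by (intro dbump_0) (auto simp: tball_zc dist_norm norm_minus_commute)

lemma cut_tball: "x \<in> tball \<tau> e i ==> cut x = bump (zc i) (r i) x"
 unfolding cut_def
 by (rule suminf_tball(1)[where F = "\<lambda>i x. bump (zc i) (r i) x", OF e1 \<tau>0 bump_off_tball])

lemma cut_off: "(\<And>i. x \<notin> tball \<tau> e i) ==> cut x = 0"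
 unfolding cut_def
 by (rule suminf_tball(2)[where F = "\<lambda>i x. bump (zc i) (r i) x", OF e1 \<tau>0 bump_off_tball])

lemma cut_range: "0 \<le> cut x" "cut x \<le> 1"
proof -
 have "0 \<le> cut x \<and> cut x \<le> 1"
 proof (cases "\<exists>i. x \<in> tball \<tau> e i")
  case True
  then show ?thesis using cut_tball bump_range by metis
 next
  case False
  then show ?thesis using cut_off[of x] by simp
 qed
 then show "0 \<le> cut x" "cut x \<le> 1" by auto
qed

lemma measurable_cut: "cut \<in> borel_measurable borel"
proof -
 have "bump (zc i) (r i) \<in> borel_measurable borel" for i
  by (intro borel_measurable_continuous_onI continuous_on_GDERIV[OF GDERIV_bump])
 then show ?thesis unfolding cut_def[abs_def] by (intro borel_measurable_suminf) simp
qed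

lemma b4: "0 < b * 4 powr p" using b0 by simp

lemma bubble_density_nonneg: "0 \<le> bubble_density i y"
 unfolding bubble_density_def using \<kappa>0[of i] b0 by (intro mult_nonneg_nonneg add_nonneg_nonneg) simp_all

lemma bubble_density_off: "y \<notin> tball \<tau> e i ==> bubble_density i y = 0"
 by (simp add: bubble_density_def)

lemma measurable_bubble_density: "bubble_density i \<in> borel_measurable borel"
proof -
 have "(indicator (ball x d) :: real^'n => real) \<in> borel_measurable borel"
  "(indicator (- ball x d) :: real^'n => real) \<in> borel_measurable borel" for x d
  by (rule borel_measurable_indicator; auto)+
 then show ?thesis unfolding bubble_density_def[abs_def] tball_zc
  by (intro borel_measurable_times borel_measurable_add \<psi>_measurable borel_measurable_const)
qed

lemma T_bubble_density: "T (bubble_density i) x \<le> ennreal (2 * \<psi> i x)"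
proof -
 let ?I = "indicator (- ball (zc i) (r i)) :: real ^ 'n => real"
 let ?g1 = "\<lambda>y. \<kappa> i * \<psi> i y powr p" and ?g0 = "\<lambda>y. \<psi> i y powr p * ?I y"
 let ?g2 = "\<lambda>y. (b * 4 powr p) * ?g0 y"
 have Im: "?I \<in> borel_measurable borel" by (rule borel_measurable_indicator) auto
 have m0: "?g0 \<in> borel_measurable borel" by (rule borel_measurable_times[OF \<psi>_measurable Im])
 have m: "?g1 \<in> borel_measurable borel" "?g2 \<in> borel_measurable borel"
  by (rule borel_measurable_times[OF borel_measurable_const \<psi>_measurable])
   (rule borel_measurable_times[OF borel_measurable_const m0])
 have nn: "0 \<le> ?g1 y" "0 \<le> ?g2 y" for y using \<kappa>0[of i] b4 by (auto intro!: mult_nonneg_nonneg)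
 have "T (bubble_density i) x \<le> T (\<lambda>y. ?g1 y + ?g2 y) x"
 proof (rule T_mono)
  fix y
  have "bubble_density i y \<le> 1 * (?g1 y + ?g2 y)"
   unfolding bubble_density_def using nn[of y] by (intro mult_right_mono add_nonneg_nonneg) (auto simp: indicator_def)
  then show "\<bar>bubble_density i y\<bar> \<le> \<bar>?g1 y + ?g2 y\<bar>"
   unfolding abs_of_nonneg[OF bubble_density_nonneg] using abs_ge_self[of "?g1 y + ?g2 y"] by (simp only: mult_1)
 qed
 also have "\<dots> = T ?g1 x + T ?g2 x" by (rule T_add[OF m nn])
 also have "T ?g1 x = ennreal (\<psi> i x)" unfolding \<psi>_def by (rule T_psi[OF \<kappa>0 \<mu>r(1)])
 also have "T ?g2 x = ennreal (b * 4 powr p) * T ?g0 x" using b4 by (intro T_cmult[OF m0]) simp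
 also have "ennreal (\<psi> i x) + \<dots> \<le> ennreal (\<psi> i x) + ennreal (b * 4 powr p) * ennreal (1 / (b * 4 powr p) * \<psi> i x)"
  using core[of i x] unfolding \<psi>_def zc_def by (intro add_left_mono mult_left_mono) simp_all
 also have "ennreal (b * 4 powr p) * ennreal (1 / (b * 4 powr p) * \<psi> i x) = ennreal (b * 4 powr p * (1 / (b * 4 powr p) * \<psi> i x))"
  using b4 \<psi>_pos[of i x] by (intro ennreal_mult[symmetric]) auto
 also have "b * 4 powr p * (1 / (b * 4 powr p) * \<psi> i x) = \<psi> i x" using b0 by simp
 also have "ennreal (\<psi> i x) + ennreal (\<psi> i x) = ennreal (2 * \<psi> i x)"
  using \<psi>_pos[of i x] by (simp add: ennreal_plus[symmetric] del: ennreal_plus)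
 finally show ?thesis .
qed

lemma summable_bubble_density: "summable (\<lambda>i. indicator J i * bubble_density i y)"
proof (cases "\<exists>i. y \<in> tball \<tau> e i")
 case True
 then obtain i where i: "y \<in> tball \<tau> e i" by blast
 show ?thesis
 proof (rule summable_finite[of "{i}"])
  fix n assume "n \<notin> {i}"
  then have "y \<notin> tball \<tau> e n" using tball_disjoint[OF e1 \<tau>0 i, of n] by auto
  then show "indicator J n * bubble_density n y = 0" by (simp add: bubble_density_off)
 qed simp
next
 case False
 then show ?thesis using bubble_density_off[of y] by simp
qed

lemma super_density_eq:
 assumes "y \<in> tball \<tau> e i"
 shows "super_density J y = \<delta> * q 1 0 y powr p + indicator J i * bubble_density i y"
 unfolding super_density_def using suminf_tball(1)[OF e1 \<tau>0 _ assms, of "\<lambda>i y. indicator J i * bubble_density i y"] bubble_density_off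
 by simp

lemma super_density_off:
 assumes "\<And>i. y \<notin> tball \<tau> e i"
 shows "super_density J y = \<delta> * q 1 0 y powr p"
 using suminf_tball(2)[OF e1 \<tau>0 _ assms, of "\<lambda>i y. indicator J i * bubble_density i y"] bubble_density_off
 unfolding super_density_def by simp

lemma super_density_nonneg: "0 \<le> super_density J y"
 unfolding super_density_def using \<delta>(1) bubble_density_nonneg
 by (intro add_nonneg_nonneg suminf_nonneg[OF summable_bubble_density]) simp_all

lemma measurable_super_density: "super_density J \<in> borel_measurable borel"
 unfolding super_density_def[abs_def]
 by (intro borel_measurable_add borel_measurable_times borel_measurable_const measurable_q_powr
   borel_measurable_suminf measurable_bubble_density)

text \<open>By \<open>far\<close>, the bubbles seen from outside their balls form a geometric series dominated by the
 potential of the background.\<close>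

lemma T_super_density:
 assumes x: "\<And>j. j \<in> J ==> x \<notin> tball \<tau> e j"
 shows "T (super_density J) x \<le> ennreal (\<delta> * (c1 + 1) * q 1 0 x)"
proof -
 let ?g = "\<lambda>i y. indicator J i * bubble_density i y"
 let ?B = "\<lambda>y. \<delta> * q 1 0 y powr p"
 have q0: "0 < q 1 0 x" by (rule q_pos) simp
 have gm: "?g i \<in> borel_measurable borel" for i using measurable_bubble_density[of i] by simp
 have g0: "0 \<le> ?g i y" for i y using bubble_density_nonneg by simp
 have Bm: "?B \<in> borel_measurable borel" using measurable_q_powr[of 1 0 p] by simp
 have B0: "0 \<le> ?B y" for y using \<delta>(1) by simp
 have Sm: "(\<lambda>y. \<Sum>i. ?g i y) \<in> borel_measurable borel" by (intro borel_measurable_suminf gm)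
 have S0: "0 \<le> (\<Sum>i. ?g i y)" for y by (rule suminf_nonneg[OF summable_bubble_density g0])
 have "T (super_density J) x = T ?B x + T (\<lambda>y. \<Sum>i. ?g i y) x"
  unfolding super_density_def[abs_def] by (rule T_add[OF Bm Sm B0 S0])
 also have "T ?B x = ennreal \<delta> * T (\<lambda>y. q 1 0 y powr p) x"
  using \<delta>(1) by (intro T_cmult measurable_q_powr) simp
 also have "T (\<lambda>y. q 1 0 y powr p) x = ennreal (c1 * q 1 0 x)" using T_q_powr_p[of 1 0 x] by simp
 also have "ennreal \<delta> * ennreal (c1 * q 1 0 x) = ennreal (\<delta> * c1 * q 1 0 x)"
  using \<delta>(1) c1_pos q0 by (simp add: ennreal_mult[symmetric] mult.assoc)
 also have "T (\<lambda>y. \<Sum>i. ?g i y) x = (\<Sum>i. T (?g i) x)"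
  by (rule T_suminf[OF gm g0 summable_bubble_density])
 also have "(\<Sum>i. T (?g i) x) \<le> (\<Sum>i. ennreal (\<delta> * q 1 0 x * (1 / 2) ^ Suc i))"
 proof (rule suminf_le)
  fix i
  show "T (?g i) x \<le> ennreal (\<delta> * q 1 0 x * (1 / 2) ^ Suc i)"
  proof (cases "i \<in> J")
   case True
   then have "T (?g i) x = T (bubble_density i) x" by simp
   also have "\<dots> \<le> ennreal (2 * \<psi> i x)" by (rule T_bubble_density)
   also have "\<dots> \<le> ennreal (\<delta> * q 1 0 x * (1 / 2) ^ Suc i)"
    using far[OF x[OF True]] unfolding \<psi>_def zc_def by (intro ennreal_leI) (simp only: mult_ac)
   finally show ?thesis .
  next
   case False
   then have "T (?g i) x = T (\<lambda>y. 0 * bubble_density i y) x" by simp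
   also have "\<dots> = 0" by (subst T_cmult[OF measurable_bubble_density]) simp_all
   finally show ?thesis by simp
  qed
 qed simp_all
 also have "(\<Sum>i. ennreal (\<delta> * q 1 0 x * (1 / 2) ^ Suc i)) = ennreal (\<delta> * q 1 0 x)"
 proof -
  define c where "c = \<delta> * q 1 0 x"
  have "(\<Sum>i. ennreal (c / 2 * (1 / 2) ^ i)) = ennreal ((c / 2) / (1 - 1 / 2))"
   by (rule suminf_geometric_ennreal) (use \<delta>(1) q0 in \<open>simp_all add: c_def\<close>)
  moreover have "c / 2 * (1 / 2) ^ i = c * (1 / 2) ^ Suc i" for i by simp
  moreover have "(c / 2) / (1 - 1 / 2) = c" by simp
  ultimately show ?thesis unfolding c_def[symmetric] by (simp only:)
 qed
 also have "ennreal (\<delta> * c1 * q 1 0 x) + ennreal (\<delta> * q 1 0 x) = ennreal (\<delta> * (c1 + 1) * q 1 0 x)"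
  using \<delta>(1) q0 c1_pos by (simp add: ennreal_plus[symmetric] algebra_simps del: ennreal_plus)
 finally show ?thesis by (simp add: add_left_mono)
qed

lemma T_super_density_tball:
 assumes x: "x \<in> tball \<tau> e i"
 shows "T (super_density UNIV) x \<le> ennreal (2 * \<psi> i x + \<delta> * (c1 + 1) * q 1 0 x)"
proof -
 have split: "super_density UNIV y = bubble_density i y + super_density (- {i}) y" for y
 proof (cases "\<exists>j. y \<in> tball \<tau> e j")
  case True
  then obtain j where j: "y \<in> tball \<tau> e j" by blast
  have "bubble_density i y = 0" if "i \<noteq> j" using tball_disjoint[OF e1 \<tau>0 j] that bubble_density_off by blast
  then show ?thesis unfolding super_density_eq[OF j] by (cases "i = j") auto
 next
  case False
  then show ?thesis using super_density_off[of y] bubble_density_off[of y i] by simp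
 qed
 have q0: "0 < q 1 0 x" by (rule q_pos) simp
 have "T (super_density UNIV) x = T (bubble_density i) x + T (super_density (- {i})) x"
  unfolding split by (rule T_add[OF measurable_bubble_density measurable_super_density bubble_density_nonneg super_density_nonneg])
 also have "\<dots> \<le> ennreal (2 * \<psi> i x) + ennreal (\<delta> * (c1 + 1) * q 1 0 x)"
  by (intro add_mono T_bubble_density T_super_density) (use tball_disjoint[OF e1 \<tau>0 x] in blast)
 also have "\<dots> = ennreal (2 * \<psi> i x + \<delta> * (c1 + 1) * q 1 0 x)"
  using \<delta>(1) c1_pos q0 \<psi>_pos[of i x] by (intro ennreal_plus[symmetric]) simp_all
 finally show ?thesis .
qed

text \<open>In \<open>tball \<tau> e i\<close> the potential is at most \<open>2 * \<psi> i\<close> plus the background, and the two resulting powers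
 are covered by the ring term of \<open>bubble_density\<close> and by the background.  On the core, where \<open>\<psi> i\<close> is too large for
 that, the factor \<open>1 - cut x\<close> vanishes.\<close>

lemma supersolution:
 "(\<Sum>i. bump (zc i) (r i) x * (\<kappa> i * \<psi> i x powr p)) + (1 - cut x) * k x * enn2real (T (super_density UNIV) x) powr p
  \<le> super_density UNIV x"
proof -
 define Q where "Q = \<delta> * (c1 + 1) * q 1 0 x"
 define U where "U = enn2real (T (super_density UNIV) x)"
 have q0: "0 < q 1 0 x" by (rule q_pos) simp
 have Q0: "0 \<le> Q" using \<delta>(1) c1_pos q0 by (simp add: Q_def)
 have U0: "0 \<le> U" by (simp add: U_def)
 have Qp: "b * (2 powr p * Q powr p) \<le> \<delta> * q 1 0 x powr p"
 proof -
  have "b * (2 powr p * Q powr p) = (b * 2 powr p * (\<delta> * (c1 + 1)) powr p) * q 1 0 x powr p"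
   using \<delta>(1) c1_pos q0 by (simp add: Q_def powr_mult)
  also have "\<dots> \<le> \<delta> * q 1 0 x powr p" using \<delta>(2) by (rule mult_right_mono) simp
  finally show ?thesis .
 qed
 have k: "0 \<le> k x" "k x \<le> b" using kab[of x] a0 by auto
 have off: "bump (zc i) (r i) x * (\<kappa> i * \<psi> i x powr p) = 0" if "x \<notin> tball \<tau> e i" for i
  using bump_off_tball[OF that] by simp
 show ?thesis
 proof (cases "\<exists>i. x \<in> tball \<tau> e i")
  case True
  then obtain i where i: "x \<in> tball \<tau> e i" by blast
  define \<eta> where "\<eta> = bump (zc i) (r i) x"
  have \<eta>: "0 \<le> \<eta>" "\<eta> \<le> 1" unfolding \<eta>_def by (rule bump_range)+
  have E: "(\<Sum>i. bump (zc i) (r i) x * (\<kappa> i * \<psi> i x powr p)) = \<eta> * (\<kappa> i * \<psi> i x powr p)"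
   unfolding \<eta>_def by (rule suminf_tball(1)[where F = "\<lambda>i x. bump (zc i) (r i) x * (\<kappa> i * \<psi> i x powr p)", OF e1 \<tau>0 off i])
  have P: "0 \<le> \<psi> i x powr p" "0 \<le> \<kappa> i * \<psi> i x powr p" "0 \<le> (b * 4 powr p) * \<psi> i x powr p" "0 \<le> \<delta> * q 1 0 x powr p"
   using \<kappa>0[of i] b4 \<delta>(1) by (auto intro!: mult_nonneg_nonneg)
  have S: "super_density UNIV x = \<delta> * q 1 0 x powr p + (\<kappa> i * \<psi> i x powr p +
    (b * 4 powr p) * (\<psi> i x powr p * indicator (- ball (zc i) (r i)) x))"
   unfolding super_density_eq[OF i] bubble_density_def using i by simp
  have c: "cut x = \<eta>" unfolding \<eta>_def by (rule cut_tball[OF i])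
  show ?thesis
  proof (cases "x \<in> ball (zc i) (r i)")
   case True
   then have "\<eta> = 1" unfolding \<eta>_def using r0[of i] by (intro bump_1) (auto simp: dist_norm norm_minus_commute)
   then show ?thesis unfolding E c S using P True by (simp add: indicator_def)
  next
   case False
   have "U \<le> 2 * \<psi> i x + Q"
    unfolding U_def using T_super_density_tball[OF i] Q0 \<psi>_pos[of i x]
    by (intro enn2real_leI) (auto simp: Q_def)
   then have "U powr p \<le> (2 * \<psi> i x + Q) powr p" using U0 p_gt_1 by (intro powr_mono2) auto
   also have "\<dots> \<le> 2 powr p * ((2 * \<psi> i x) powr p + Q powr p)"
    using \<psi>_pos[of i x] Q0 p_gt_1 by (intro powr_add_le) auto
   also have "\<dots> = 4 powr p * \<psi> i x powr p + 2 powr p * Q powr p"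
   proof -
    have "(4::real) powr p = 2 powr p * 2 powr p" using powr_mult[of 2 2 p] by simp
    then show ?thesis using \<psi>_pos[of i x] by (simp add: powr_mult distrib_left)
   qed
   finally have "k x * U powr p \<le> b * (4 powr p * \<psi> i x powr p + 2 powr p * Q powr p)"
    using k b0 by (intro mult_mono) auto
   also have "\<dots> \<le> (b * 4 powr p) * \<psi> i x powr p + \<delta> * q 1 0 x powr p"
    using Qp by (simp add: distrib_left mult.assoc)
   finally have kU: "k x * U powr p \<le> (b * 4 powr p) * \<psi> i x powr p + \<delta> * q 1 0 x powr p" .
   have kU0: "0 \<le> k x * U powr p" using k by simp
   have "\<eta> * (\<kappa> i * \<psi> i x powr p) \<le> 1 * (\<kappa> i * \<psi> i x powr p)" using \<eta> P by (intro mult_right_mono)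
   moreover have "(1 - \<eta>) * (k x * U powr p) \<le> 1 * (k x * U powr p)" using \<eta> kU0 by (intro mult_right_mono) auto
   ultimately have "\<eta> * (\<kappa> i * \<psi> i x powr p) + (1 - \<eta>) * (k x * U powr p)
     \<le> \<kappa> i * \<psi> i x powr p + ((b * 4 powr p) * \<psi> i x powr p + \<delta> * q 1 0 x powr p)" using kU by linarith
   then show ?thesis unfolding E c S U_def[symmetric] using False by (simp add: mult.assoc)
  qed
 next
  case False
  then have x: "x \<notin> tball \<tau> e i" for i by blast
  have E: "(\<Sum>i. bump (zc i) (r i) x * (\<kappa> i * \<psi> i x powr p)) = 0"
   by (rule suminf_tball(2)[where F = "\<lambda>i x. bump (zc i) (r i) x * (\<kappa> i * \<psi> i x powr p)", OF e1 \<tau>0 off x])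
  have "U \<le> Q" unfolding U_def using T_super_density[OF x] Q0 by (intro enn2real_leI) (auto simp: Q_def)
  then have "U powr p \<le> 1 * Q powr p" using U0 p_gt_1 by (simp add: powr_mono2)
  also have "\<dots> \<le> 2 powr p * Q powr p" using p_gt_1 by (intro mult_right_mono ge_one_powr_ge_zero) auto
  finally have "k x * U powr p \<le> b * (2 powr p * Q powr p)" using k b0 by (intro mult_mono) auto
  then show ?thesis unfolding E cut_off[OF x] super_density_off[OF x] U_def[symmetric] using Qp by simp
 qed
qed

lemma bubble_solution:
 obtains f where "tame (- N) f (- {0})" "locally_bounded_on (- {0}) f" "\<And>y. 0 \<le> f y" "\<And>y. T f y < \<infinity>"
  "\<And>i y. y \<in> tball \<tau> e i ==> f y = bump (zc i) (r i) y * (\<kappa> i * \<psi> i y powr p)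
    + (1 - bump (zc i) (r i) y) * (k y * enn2real (T f y) powr p)"
  "\<And>y. (\<And>i. y \<notin> tball \<tau> e i) ==> f y = k y * enn2real (T f y) powr p"
  "\<And>i y. y \<in> tball \<tau> e i ==> enn2real (T f y) \<le> 2 * \<psi> i y + \<delta> * (c1 + 1) * q 1 0 y"
  "\<And>y. (\<And>i. y \<notin> tball \<tau> e i) ==> enn2real (T f y) \<le> \<delta> * (c1 + 1) * q 1 0 y"
  "\<And>i y. y \<in> tball \<tau> e i ==> T (\<lambda>w. f w * indicator (- tball \<tau> e i) w) y \<le> ennreal (\<delta> * (c1 + 1) * q 1 0 y)"
proof -
 let ?E = "\<lambda>x. \<Sum>i. bump (zc i) (r i) x * (\<kappa> i * \<psi> i x powr p)"
 let ?H = "\<lambda>x. (1 - cut x) * k x"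
 let ?F = "super_density UNIV"
 have q0: "0 < q 1 0 x" for x by (rule q_pos) simp
 have off: "bump (zc i) (r i) x * (\<kappa> i * \<psi> i x powr p) = 0" if "x \<notin> tball \<tau> e i" for i x
  using bump_off_tball[OF that] by simp
 have Eb: "?E x = bump (zc i) (r i) x * (\<kappa> i * \<psi> i x powr p)" if "x \<in> tball \<tau> e i" for i x
  by (rule suminf_tball(1)[where F = "\<lambda>i x. bump (zc i) (r i) x * (\<kappa> i * \<psi> i x powr p)", OF e1 \<tau>0 off that])
 have Eo: "?E x = 0" if "\<And>i. x \<notin> tball \<tau> e i" for x
  by (rule suminf_tball(2)[where F = "\<lambda>i x. bump (zc i) (r i) x * (\<kappa> i * \<psi> i x powr p)", OF e1 \<tau>0 off that])
 have E0: "0 \<le> ?E x" for x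
 proof (cases "\<exists>i. x \<in> tball \<tau> e i")
  case True
  then obtain i where i: "x \<in> tball \<tau> e i" by blast
  show ?thesis unfolding Eb[OF i] using bump_range(1)[of "zc i" "r i" x] \<kappa>0[of i] by simp
 next
  case False
  then show ?thesis using Eo[of x] by simp
 qed
 have bm: "bump (zc i) (r i) \<in> borel_measurable borel" for i
  by (intro borel_measurable_continuous_onI continuous_on_GDERIV[OF GDERIV_bump])
 have Em: "?E \<in> borel_measurable borel"
  by (intro borel_measurable_suminf borel_measurable_times bm borel_measurable_const \<psi>_measurable)
 have Hm: "?H \<in> borel_measurable borel"
  by (intro borel_measurable_times borel_measurable_diff measurable_cut km borel_measurable_const)
 have H0: "0 \<le> ?H x" for x using cut_range(2)[of x] kab[of x] a0 by simp
 have TF: "T ?F x < \<infinity>" for x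
 proof (cases "\<exists>i. x \<in> tball \<tau> e i")
  case True
  then obtain i where i: "x \<in> tball \<tau> e i" by blast
  show ?thesis using le_less_trans[OF T_super_density_tball[OF i]] by simp
 next
  case False
  then show ?thesis using le_less_trans[OF T_super_density[of UNIV x]] by simp
 qed
 obtain f where fm: "f \<in> borel_measurable borel" and f: "\<And>x. 0 \<le> f x" "\<And>x. f x \<le> ?F x" "\<And>x. f x = ?E x + ?H x * enn2real (T f x) powr p"
  using fixed_point_below_supersolution[OF Em E0 Hm H0 TF supersolution] by blast
 have TfF: "T f x \<le> T ?F x" for x
 proof (rule T_mono)
  show "\<bar>f y\<bar> \<le> \<bar>?F y\<bar>" for y using f(1,2)[of y] by linarith
 qed
 show thesis
 proof (rule that[of f])
  show "0 \<le> f y" for y by (rule f(1))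
  show "T f y < \<infinity>" for y using le_less_trans[OF TfF TF] .
  show "f y = bump (zc i) (r i) y * (\<kappa> i * \<psi> i y powr p) + (1 - bump (zc i) (r i) y) * (k y * enn2real (T f y) powr p)"
   if "y \<in> tball \<tau> e i" for i y
   using f(3)[of y] unfolding Eb[OF that] cut_tball[OF that] by (simp only: mult.assoc)
  show "f y = k y * enn2real (T f y) powr p" if "\<And>i. y \<notin> tball \<tau> e i" for y
   using f(3)[of y] unfolding Eo[OF that] cut_off[OF that] by simp
  show "enn2real (T f y) \<le> 2 * \<psi> i y + \<delta> * (c1 + 1) * q 1 0 y" if "y \<in> tball \<tau> e i" for i y
   using order_trans[OF TfF T_super_density_tball[OF that]] \<delta>(1) c1_pos q0[of y] \<psi>_pos[of i y]
   by (intro enn2real_leI) auto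
  show "enn2real (T f y) \<le> \<delta> * (c1 + 1) * q 1 0 y" if "\<And>i. y \<notin> tball \<tau> e i" for y
   using order_trans[OF TfF T_super_density[of UNIV y]] that \<delta>(1) c1_pos q0[of y]
   by (intro enn2real_leI) auto
  show "T (\<lambda>w. f w * indicator (- tball \<tau> e i) w) y \<le> ennreal (\<delta> * (c1 + 1) * q 1 0 y)" if y: "y \<in> tball \<tau> e i" for i y
  proof -
   have "T (\<lambda>w. f w * indicator (- tball \<tau> e i) w) y \<le> T (super_density (- {i})) y"
   proof (rule T_mono)
    fix w
    have "f w * indicator (- tball \<tau> e i) w \<le> super_density (- {i}) w"
    proof (cases "w \<in> tball \<tau> e i")
     case True
     then show ?thesis using super_density_nonneg by simp
    next
     case w: False
     have "super_density UNIV w = super_density (- {i}) w"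
     proof (cases "\<exists>j. w \<in> tball \<tau> e j")
      case True
      then obtain j where j: "w \<in> tball \<tau> e j" by blast
      then have "j \<noteq> i" using w by blast
      then show ?thesis unfolding super_density_eq[OF j] by simp
     next
      case False
      then show ?thesis using super_density_off[of w] by simp
     qed
     then show ?thesis using f(2)[of w] w by simp
    qed
    moreover have "0 \<le> f w * indicator (- tball \<tau> e i) w" using f(1)[of w] by simp
    ultimately show "\<bar>f w * indicator (- tball \<tau> e i) w\<bar> \<le> \<bar>super_density (- {i}) w\<bar>" by linarith
   qed
   also have "\<dots> \<le> ennreal (\<delta> * (c1 + 1) * q 1 0 y)"
    by (rule T_super_density) (use tball_disjoint[OF e1 \<tau>0 y] in blast)
   finally show ?thesis .
  qed
  (* Only finitely many of the balls meet a neighbourhood of a point other than the origin. *)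
  have q1: "q 1 0 x \<le> 1" for x using q_le_max[of 1 0 x] by simp
  have loc: "\<exists>d>0. \<exists>M\<ge>0. \<forall>y\<in>ball x d. f y \<le> M \<and> T f y \<le> ennreal M" if x: "x \<noteq> 0" for x
  proof -
   obtain d i0 where d: "d > 0" "\<And>y i. y \<in> ball x d ==> i0 \<le> i ==> y \<notin> tball \<tau> e i"
    using tball_locally_finite[OF e1 \<tau>0 x] by blast
   define s where "s i = alpha a * \<mu> i powr (- (N / 2))" for i
   define M1 where "M1 = \<delta> * (c1 + 1) + 2 * (\<Sum>i<i0. s i)"
   define M2 where "M2 = \<delta> + (\<Sum>i<i0. (b + b * 4 powr p) * s i powr p)"
   have s0: "0 \<le> s i" for i unfolding s_def using alpha_pos[OF a0] by simp
   have \<psi>s: "\<psi> i y \<le> s i" for i y unfolding \<psi>_def s_def by (rule psi_le_max[OF \<kappa>ab \<mu>r(1)])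
   have S0: "0 \<le> (\<Sum>i<i0. s i)" "0 \<le> (\<Sum>i<i0. (b + b * 4 powr p) * s i powr p)"
    using s0 b0 by (auto intro!: sum_nonneg mult_nonneg_nonneg)
   have M0: "0 \<le> M1" "0 \<le> M2" using S0 \<delta>(1) c1_pos by (auto simp: M1_def M2_def)
   have Q1: "\<delta> * (c1 + 1) * q 1 0 y \<le> \<delta> * (c1 + 1)" for y
    using mult_left_mono[OF q1[of y], of "\<delta> * (c1 + 1)"] \<delta>(1) c1_pos by simp
   have Q2: "\<delta> * q 1 0 y powr p \<le> \<delta>" for y
   proof -
    have "q 1 0 y powr p \<le> 1 powr p" using q1[of y] q0[of y] p_gt_1 by (intro powr_mono2) auto
    then show ?thesis using mult_left_mono[of "q 1 0 y powr p" 1 \<delta>] \<delta>(1) by simp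
   qed
   have "f y \<le> max M1 M2 \<and> T f y \<le> ennreal (max M1 M2)" if y: "y \<in> ball x d" for y
   proof (cases "\<exists>i. y \<in> tball \<tau> e i")
    case True
    then obtain i where i: "y \<in> tball \<tau> e i" by blast
    then have ii: "i \<in> {..<i0}" using d(2)[OF y] by (force simp: not_le[symmetric])
    have "s i \<le> (\<Sum>i<i0. s i)" by (rule member_le_sum[OF ii]) (use s0 in auto)
    then have t1: "2 * \<psi> i y + \<delta> * (c1 + 1) * q 1 0 y \<le> M1" using \<psi>s[of i y] Q1[of y] by (simp add: M1_def)
    have "T f y \<le> ennreal M1" using order_trans[OF order_trans[OF TfF T_super_density_tball[OF i]] ennreal_leI[OF t1]] .
    moreover have "f y \<le> M2"
    proof -
     have pw: "\<psi> i y powr p \<le> s i powr p" using \<psi>s[of i y] \<psi>_pos[of i y] p_gt_1 by (intro powr_mono2) auto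
     have "bubble_density i y \<le> 1 * (b * s i powr p + (b * 4 powr p) * (s i powr p * 1))"
      unfolding bubble_density_def
      by (intro mult_mono add_mono pw \<kappa>ab mult_nonneg_nonneg add_nonneg_nonneg)
       (use \<kappa>0[of i] b0 in \<open>auto simp: indicator_def\<close>)
     also have "\<dots> = (b + b * 4 powr p) * s i powr p" by (simp add: algebra_simps)
     also have "\<dots> \<le> (\<Sum>i<i0. (b + b * 4 powr p) * s i powr p)"
      by (rule member_le_sum[OF ii]) (use s0 b0 in \<open>auto intro!: mult_nonneg_nonneg\<close>)
     finally have "super_density UNIV y \<le> M2" unfolding super_density_eq[OF i] M2_def using Q2[of y] by simp
     then show ?thesis using f(2)[of y] by linarith
    qed
    ultimately show ?thesis
     using order_trans[OF _ ennreal_leI[OF max.cobounded1[of M1 M2]]] by (auto simp: le_max_iff_disj)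
   next
    case False
    then have no: "y \<notin> tball \<tau> e i" for i by blast
    have "\<delta> * (c1 + 1) * q 1 0 y \<le> M1" using Q1[of y] S0 by (simp add: M1_def)
    from order_trans[OF order_trans[OF TfF T_super_density[OF no]] ennreal_leI[OF this]]
    have "T f y \<le> ennreal M1" .
    moreover have "f y \<le> M2" using f(2)[of y] Q2[of y] S0 unfolding super_density_off[OF no] M2_def by linarith
    ultimately show ?thesis
     using order_trans[OF _ ennreal_leI[OF max.cobounded1[of M1 M2]]] by (auto simp: le_max_iff_disj)
   qed
   then show ?thesis using d(1) M0 by (intro exI[of _ d] conjI exI[of _ "max M1 M2"]) auto
  qed
  show "locally_bounded_on (- {0}) f"
   unfolding locally_bounded_on_def
  proof
   fix x :: "real ^ 'n" assume "x \<in> - {0}"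
   then have "x \<noteq> 0" by simp
   from loc[OF this] obtain d M where d: "d > 0" "\<forall>y\<in>ball x d. f y \<le> M \<and> T f y \<le> ennreal M" by blast
   have "\<forall>y\<in>ball x d. \<bar>f y\<bar> \<le> M" using d(2) f(1) by simp
   then show "\<exists>e>0. \<exists>M. \<forall>y\<in>ball x e. \<bar>f y\<bar> \<le> M" using d(1) by blast
  qed
  show "tame (- N) f (- {0})"
  proof (rule tame_of_T_bounded[OF fm])
   fix x :: "real ^ 'n" assume "x \<noteq> 0"
   from loc[OF this] obtain d M where dM: "d > 0" "0 \<le> M" "\<forall>y\<in>ball x d. f y \<le> M \<and> T f y \<le> ennreal M" by blast
   have "\<forall>y\<in>ball x d. T f y \<le> ennreal M" using dM(3) by simp
   with dM(1,2) show "\<exists>d>0. \<exists>M\<ge>0. \<forall>y\<in>ball x d. T f y \<le> ennreal M" by blast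
  qed
 qed
qed

end

context riesz_setting
begin

lemma tame_lower:
 fixes f :: "real ^ 'n => real"
 assumes "tame (- N) f (- {0})" "locally_bounded_on (- {0}) f" "0 \<le> s" "s < 2"
 shows "tame (- N - s) f (- {0})"
 using m1r n_eq N4 assms(3,4) by (intro tame_of_locally_bounded[OF assms(1,2)]) auto

lemma dpot_diff:
 assumes f: "tame (- N) f (- {0})" "locally_bounded_on (- {0}) f"
  and g: "tame (- N) g (- {0})" "locally_bounded_on (- {0}) g" and x: "x \<noteq> 0"
 shows "dpot (\<lambda>y. f y - g y) x = dpot f x - dpot g x"
proof -
 let ?G = "\<lambda>i. partial i (\<lambda>z::real^'n. norm z powr (- N))"
 have "kernel_class (Suc 1) (- N) (\<lambda>z::real^'n. norm z powr (- N))" by (rule kernel_class_norm_powr)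
 then have K: "kernel_class 1 (- N - 1) (?G i)" for i by (simp only: kernel_class.simps(2)) 
 have fin: "nnpot (- N - 1) h x < \<infinity>" if "tame (- N) h (- {0})" "locally_bounded_on (- {0}) h" for h
  using tame_finite[OF tame_lower[OF that, of 1], of x] x by simp
 have "pot (?G i) (\<lambda>y. f y - g y) x = pot (?G i) f x - pot (?G i) g x" for i
  unfolding pot_def right_diff_distrib
  by (rule Bochner_Integration.integral_diff[OF pot_integrable[OF K tameD_measurable[OF f(1)] fin[OF f]]
    pot_integrable[OF K tameD_measurable[OF g(1)] fin[OF g]]])
 then show ?thesis unfolding dpot_def by (simp add: vec_eq_iff)
qed

lemma continuous_dpot:
 assumes f: "tame (- N) f (- {0})" "locally_bounded_on (- {0}) f"
 shows "continuous_on (- {0}) (dpot f)"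
proof -
 let ?G = "\<lambda>z::real^'n. norm z powr (- N)"
 have op: "open (- {0 :: real ^ 'n})" by (rule open_Compl[OF closed_singleton])
 have "tame (- N - real 1 - 1 / 2) f (- {0})" using tame_lower[OF f, of "3 / 2"] by (simp add: diff_diff_eq)
 then have "C_k_on 1 (pot ?G f) (- {0})"
  by (intro C_k_on_pot[OF op kernel_class_norm_powr f(1)])
 from C_1_onD(2)[OF op this] have "continuous_on (- {0}) (gradient (pot ?G f))" .
 moreover have "gradient (pot ?G f) x = dpot f x" if "x \<in> - {0}" for x
  unfolding dpot_def
  by (rule gradient_eq[OF GDERIV_pot[OF kernel_class_norm_powr f(1) tame_lower[OF f] that op]]) simp_all
 ultimately show ?thesis by (rule continuous_on_eq)
qed

end

context curvature_bounds
begin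

lemma bubble_density_tame:
 assumes \<kappa>: "a \<le> \<kappa>" "\<kappa> \<le> b" and \<mu>: "0 < \<mu>"
 shows "tame (- N) (\<lambda>y. \<kappa> * psi \<kappa> \<mu> z y powr p) (- {0})"
  and "locally_bounded_on (- {0}) (\<lambda>y. \<kappa> * psi \<kappa> \<mu> z y powr p)"
proof -
 let ?g = "\<lambda>y. \<kappa> * psi \<kappa> \<mu> z y powr p"
 have \<kappa>0: "0 < \<kappa>" using \<kappa> a0 by simp
 have gm: "?g \<in> borel_measurable borel" using measurable_psi[of \<kappa> \<mu> z] by simp
 show "tame (- N) ?g (- {0})"
 proof (rule tame_of_T_bounded[OF gm])
  fix x :: "real ^ 'n"
  have "T ?g y \<le> ennreal (alpha a * \<mu> powr (- (N / 2)))" for y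
   unfolding T_psi[OF \<kappa>0 \<mu>] by (intro ennreal_leI psi_le_max \<kappa> \<mu>)
  moreover have "0 \<le> alpha a * \<mu> powr (- (N / 2))" using alpha_pos[OF a0] by simp
  ultimately show "\<exists>d>0. \<exists>M\<ge>0. \<forall>y\<in>ball x d. T ?g y \<le> ennreal M" using zero_less_one by blast
 qed
 have "psi \<kappa> \<mu> z y \<noteq> 0" for y using psi_pos[OF \<kappa>0 \<mu>, of z y] by simp
 then have "continuous_on (- {0}) ?g"
  by (intro continuous_intros continuous_on_subset[OF continuous_psi[OF \<mu>] subset_UNIV]) auto
 then show "locally_bounded_on (- {0}) ?g"
  by (rule continuous_imp_locally_bounded[OF open_Compl[OF closed_singleton]])
qed

lemma dpsi_eq_dpot:
 assumes \<kappa>: "a \<le> \<kappa>" "\<kappa> \<le> b" and \<mu>: "0 < \<mu>" and x: "x \<noteq> 0"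
 shows "dpsi \<kappa> \<mu> z x = (1 / \<gamma>) *\<^sub>R dpot (\<lambda>y. \<kappa> * psi \<kappa> \<mu> z y powr p) x"
proof -
 let ?g = "\<lambda>y. \<kappa> * psi \<kappa> \<mu> z y powr p"
 have \<kappa>0: "0 < \<kappa>" using \<kappa> a0 by simp
 have g0: "0 < ?g y" for y using psi_pos[OF \<kappa>0 \<mu>, of z y] \<kappa>0 by simp
 have gn: "0 \<le> ?g y" for y using g0[of y] by (rule less_imp_le)
 have "psi \<kappa> \<mu> z = (\<lambda>x. enn2real (T ?g x))"
  unfolding T_psi[OF \<kappa>0 \<mu>] using psi_pos[OF \<kappa>0 \<mu>, of z] by (simp add: less_imp_le fun_eq_iff)
 then have "GDERIV (psi \<kappa> \<mu> z) x :> (1 / \<gamma>) *\<^sub>R dpot ?g x"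
  using potential_C1(2)[OF gn bubble_density_tame[OF \<kappa> \<mu>, of z] zero_less_one g0 x] by simp
 from gradient_eq[OF this] gradient_eq[OF GDERIV_psi[OF \<mu>, of \<kappa> z x]] show ?thesis by simp
qed

end

section \<open>The equation with the corrected curvature\<close>

context bubble_sequence
begin

lemma core_in_tball:
 assumes "norm (x - zc i) \<le> 2 * r i"
 shows "x \<in> tball \<tau> e i" "r i \<le> norm x"
proof -
 define t where "t = \<tau> / 4 ^ i"
 have t: "8 * r i \<le> t" "0 < t" using \<mu>r(3)[of i] t0[of i] by (simp_all only: t_def)
 have "norm (x - zc i) < t / 2" using assms t by linarith
 then show *: "x \<in> tball \<tau> e i" by (simp add: tball_zc t_def[symmetric] dist_norm norm_minus_commute)
 have "t / 2 < norm x" using tball_norm(1)[OF e1 \<tau>0 *] by (simp only: t_def)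
 then show "r i \<le> norm x" using t r0[of i] by linarith
qed

text \<open>Regularity is gained in three steps: \<open>u\<close> is \<open>C\<^sup>1\<close> as the potential of a locally bounded
 density, therefore \<open>K\<close> is \<open>C\<^sup>1\<close>, therefore the density \<open>K * u powr p\<close> is \<open>C\<^sup>1\<close>, which suffices for the
 full regularity of \<open>u\<close>.\<close>

lemma glued_curvature:
 fixes f :: "real ^ 'n => real" and S :: "nat => real"
 defines "u \<equiv> \<lambda>x. enn2real (T f x)"
 assumes kC: "C_k_on 1 k UNIV" and g0: "gradient k 0 = 0" and \<tau>1: "\<tau> \<le> 1"
  and f: "tame (- N) f (- {0})" "locally_bounded_on (- {0}) f" "\<And>y. 0 \<le> f y" "\<And>y. T f y < \<infinity>"
  and feq: "\<And>i y. y \<in> tball \<tau> e i ==> f y = bump (zc i) (r i) y * (\<kappa> i * \<psi> i y powr p)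
    + (1 - bump (zc i) (r i) y) * (k y * u y powr p)"
  and foff: "\<And>y. (\<And>i. y \<notin> tball \<tau> e i) ==> f y = k y * u y powr p"
  and S: "\<And>i x. norm (x - zc i) \<le> 2 * r i ==>
    \<bar>corr (\<kappa> i) (\<mu> i) (zc i) (r i) (u x) (k x) x\<bar> \<le> S i * r i \<and>
    norm (dcorr (\<kappa> i) (\<mu> i) (zc i) (r i) (u x) (k x) ((1 / \<gamma>) *\<^sub>R dpot f x) (gradient k x) x) \<le> S i"
   "S \<longlonglongrightarrow> 0" "\<And>i. S i \<le> c"
 shows "\<exists>K. C_k_on 1 K UNIV \<and> (\<forall>x. K x > 0) \<and> gradient K 0 = 0 \<and> K 0 = k 0 \<and>
   (\<forall>x. norm x \<ge> 2 * \<tau> --> K x = k x) \<and> C1_norm (\<lambda>x. K x - k x) \<le> ereal (2 * c) \<and>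
   C_k_on (2 * m) u (- {0}) \<and> (\<forall>x. x \<noteq> 0 --> u x > 0) \<and>
   (\<forall>x. x \<noteq> 0 --> neg_laplacian_pow m u x = K x * u x powr p) \<and>
   (\<forall>s\<in>{1..m - 1}. \<forall>x. x \<noteq> 0 --> neg_laplacian_pow s u x > 0)"
proof -
 define Du where "Du x = (1 / \<gamma>) *\<^sub>R dpot f x" for x
 define P where "P i x = corr (\<kappa> i) (\<mu> i) (zc i) (r i) (u x) (k x) x" for i x
 define DP where "DP i x = dcorr (\<kappa> i) (\<mu> i) (zc i) (r i) (u x) (k x) (Du x) (gradient k x) x" for i x
 define K where "K x = k x + (\<Sum>i. P i x)" for x
 define DK where "DK x = gradient k x + (\<Sum>i. DP i x)" for x
 have op: "open (- {0 :: real ^ 'n})" by (rule open_Compl[OF closed_singleton])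
 have kp: "0 < k x" for x using kab[of x] a0 by simp
 note kG = C_1_onD(1)[OF open_UNIV kC UNIV_I] and kgc = C_1_onD(2)[OF open_UNIV kC] and kc = C_1_onD(3)[OF open_UNIV kC]
 have fpos: "0 < f y" if y: "y \<in> ball (zc 0) (r 0)" for y
 proof -
  have n: "norm (y - zc 0) \<le> r 0" using y by (simp add: dist_norm norm_minus_commute)
  then have "y \<in> tball \<tau> e 0" using r0[of 0] by (intro core_in_tball) linarith
  from feq[OF this] have "f y = \<kappa> 0 * \<psi> 0 y powr p" by (simp only: bump_1[OF r0 n]) simp
  then show ?thesis using \<kappa>0[of 0] \<psi>_pos[of 0 y] by simp
 qed
 have u0: "0 < u x" if "x \<noteq> 0" for x
  unfolding u_def by (rule potential_C1(1)[OF f(3,1,2) r0 fpos that])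
 have uG: "GDERIV u x :> Du x" if "x \<noteq> 0" for x
  unfolding u_def Du_def by (rule potential_C1(2)[OF f(3,1,2) r0 fpos that])
 have uc: "continuous_on (- {0}) u" by (rule continuous_on_GDERIV[of _ _ Du]) (use uG in simp)
 have Duc: "continuous_on (- {0}) Du"
  unfolding Du_def by (intro continuous_intros continuous_dpot f)
 have Poff: "P i x = 0" "DP i x = 0" if "x \<notin> tball \<tau> e i" for i x
  unfolding P_def DP_def corr_def dcorr_def by (simp_all add: bump_off_tball[OF that] dbump_off_tball[OF that])
 have PG: "GDERIV (P i) x :> DP i x" if "x \<noteq> 0" for i x
  unfolding P_def[abs_def] DP_def by (rule GDERIV_corr[OF \<kappa>0 \<mu>r(1) uG[OF that] u0[OF that] kG])
 have DPc: "continuous_on (- {0}) (DP i)" for i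
  unfolding DP_def[abs_def]
  by (rule continuous_on_dcorr[OF \<kappa>0 \<mu>r(1) r0 uc continuous_on_subset[OF kc subset_UNIV] Duc continuous_on_subset[OF kgc subset_UNIV]])
   (use u0 in simp)
 have PS: "\<bar>P i x\<bar> \<le> S i * r i" "norm (DP i x) \<le> S i" if "norm (x - zc i) \<le> 2 * r i" for i x
  using S(1)[OF that] unfolding P_def DP_def Du_def by simp_all
 have Soff: "P i x = 0" "DP i x = 0" if "\<not> norm (x - zc i) \<le> 2 * r i" for i x
  unfolding P_def DP_def corr_def dcorr_def using that by (simp_all add: bump_0[OF r0] dbump_0[OF r0])
 have S0: "0 \<le> S i" for i
 proof -
  have "norm (DP i (zc i)) \<le> S i" using r0[of i] by (intro PS(2)) simp
  then show ?thesis using norm_ge_zero order_trans by blast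
 qed
 have c0: "0 \<le> c" using S0[of 0] S(3)[of 0] by linarith
 have Px: "\<bar>P i x\<bar> \<le> S i * norm x" for i x
 proof (cases "norm (x - zc i) \<le> 2 * r i")
  case True
  have "S i * r i \<le> S i * norm x" using core_in_tball(2)[OF True] S0[of i] by (rule mult_left_mono)
  then show ?thesis using PS(1)[OF True] by linarith
 next
  case False
  then show ?thesis using Soff(1)[OF False] S0[of i] by simp
 qed
 have DPx: "norm (DP i x) \<le> S i" for i x
  using PS(2)[of x i] Soff(2)[of x i] S0[of i] by (cases "norm (x - zc i) \<le> 2 * r i") auto
 have Pc: "\<bar>P i x\<bar> \<le> c" for i x
 proof (cases "norm (x - zc i) \<le> 2 * r i")
  case True
  have "\<tau> / 4 ^ i \<le> 1"
  proof -
   have "(1::real) \<le> 4 ^ i" by simp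
   then have "\<tau> \<le> 4 ^ i" using \<tau>1 by linarith
   then show ?thesis by (simp add: divide_le_eq)
  qed
  then have "r i \<le> 1" using \<mu>r(3)[of i] r0[of i] by linarith
  then have "S i * r i \<le> S i * 1" using S0[of i] by (rule mult_left_mono)
  then show ?thesis using PS(1)[OF True] S(3)[of i] by linarith
 next
  case False
  then show ?thesis using Soff(1)[OF False] c0 by simp
 qed
 have gl: "GDERIV (\<lambda>x. \<Sum>i. P i x) x :> (\<Sum>i. DP i x)" "continuous_on UNIV (\<lambda>x. \<Sum>i. DP i x)" for x
  by (rule gluing[of e \<tau> P DP S, OF e1 \<tau>0 Poff PG DPc Px DPx S(2)]; assumption)+
 have Kb: "K x = k x + P i x" "(\<Sum>i. P i x) = P i x" "(\<Sum>i. DP i x) = DP i x" if "x \<in> tball \<tau> e i" for x i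
  unfolding K_def using suminf_tball(1)[of e \<tau> x P, OF e1 \<tau>0 Poff(1) that]
   suminf_tball(1)[of e \<tau> x DP, OF e1 \<tau>0 Poff(2) that] by simp_all
 have Ko: "K x = k x" "(\<Sum>i. P i x) = 0" "(\<Sum>i. DP i x) = 0" if "\<And>i. x \<notin> tball \<tau> e i" for x
  unfolding K_def using suminf_tball(2)[of e \<tau> x P, OF e1 \<tau>0 Poff(1) that]
   suminf_tball(2)[of e \<tau> x DP, OF e1 \<tau>0 Poff(2) that] by simp_all
 have zo: "0 \<notin> tball \<tau> e i" for i by (rule zero_notin_tball[OF e1 \<tau>0])
 have KG: "GDERIV K x :> DK x" for x
  unfolding K_def[abs_def] DK_def by (rule GDERIV_add[OF kG gl(1)])
 have DKc: "continuous_on UNIV DK"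
  unfolding DK_def[abs_def] by (rule continuous_on_add[OF kgc gl(2)])
 have Kform: "K x = (1 - bump (zc i) (r i) x) * k x + bump (zc i) (r i) x * (\<kappa> i * (u x / \<psi> i x) powr (- p))"
  if "x \<in> tball \<tau> e i" for i x
  unfolding Kb(1)[OF that] P_def corr_def \<psi>_def by (simp add: algebra_simps)
 have Kpos: "0 < K x" for x
 proof (cases "\<exists>i. x \<in> tball \<tau> e i")
  case True
  then obtain i where i: "x \<in> tball \<tau> e i" by blast
  have x0: "x \<noteq> 0" using i zo[of i] by blast
  let ?\<eta> = "bump (zc i) (r i) x"
  have q: "0 < \<kappa> i * (u x / \<psi> i x) powr (- p)" using \<kappa>0[of i] u0[OF x0] \<psi>_pos[of i x] by simp
  have \<eta>: "0 \<le> ?\<eta>" "?\<eta> \<le> 1" by (rule bump_range)+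
  show ?thesis
  proof (cases "?\<eta> = 1")
   case True
   then show ?thesis unfolding Kform[OF i] using q by simp
  next
   case False
   then have "0 < (1 - ?\<eta>) * k x" using \<eta> kp[of x] by simp
   moreover have "0 \<le> ?\<eta> * (\<kappa> i * (u x / \<psi> i x) powr (- p))" using \<eta> q by simp
   ultimately show ?thesis unfolding Kform[OF i] by linarith
  qed
 next
  case False
  then show ?thesis using Ko(1)[of x] kp[of x] by simp
 qed
 have fK: "f x = K x * u x powr p" if x: "x \<noteq> 0" for x
 proof (cases "\<exists>i. x \<in> tball \<tau> e i")
  case True
  then obtain i where i: "x \<in> tball \<tau> e i" by blast
  have "(u x / \<psi> i x) powr (- p) * u x powr p = \<psi> i x powr p"
   using u0[OF x] \<psi>_pos[of i x] by (simp add: powr_divide powr_minus_divide)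
  then have "\<kappa> i * (u x / \<psi> i x) powr (- p) * u x powr p = \<kappa> i * \<psi> i x powr p" by (simp only: mult.assoc)
  then show ?thesis unfolding Kform[OF i] feq[OF i] by (simp only: distrib_right mult.assoc)
 next
  case False
  then show ?thesis using Ko(1)[of x] foff[of x] by simp
 qed
 have fC: "C_k_on 1 f (- {0})"
 proof -
  have "C_k_on 1 (\<lambda>x. K x * u x powr p) (- {0})"
  proof (rule C_1_onI[OF op])
   fix x :: "real ^ 'n" assume "x \<in> - {0}"
   then have x: "x \<noteq> 0" by simp
   have "DERIV (\<lambda>s. s powr p) (u x) :> p * u x powr (p - 1)"
    by (rule has_real_derivative_powr[OF u0[OF x]])
   from GDERIV_DERIV_compose[OF uG[OF x] this]
   have "GDERIV (\<lambda>x. u x powr p) x :> (p * u x powr (p - 1)) *\<^sub>R Du x" .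
   from GDERIV_mult[OF KG this]
   show "GDERIV (\<lambda>x. K x * u x powr p) x :> K x *\<^sub>R ((p * u x powr (p - 1)) *\<^sub>R Du x) + (u x powr p) *\<^sub>R DK x" .
  next
   have "u x \<noteq> 0" if "x \<in> - {0}" for x using u0[of x] that by simp
   then show "continuous_on (- {0}) (\<lambda>x. K x *\<^sub>R ((p * u x powr (p - 1)) *\<^sub>R Du x) + (u x powr p) *\<^sub>R DK x)"
    by (intro continuous_on_add continuous_on_scaleR continuous_on_mult continuous_on_powr uc Duc continuous_on_const
      continuous_on_subset[OF DKc subset_UNIV] continuous_on_subset[OF continuous_on_GDERIV[OF KG] subset_UNIV]) auto
  qed
  then show ?thesis by (rule C_k_on_cong[OF op, rotated]) (use fK in simp)
 qed
 have sol1: "C_k_on (2 * m) u (- {0})"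
  unfolding u_def by (rule potential_solves(1)[OF f(3,1) fC f(4) r0 fpos])
 have sol2: "neg_laplacian_pow m u x = f x" if "x \<noteq> 0" for x
  unfolding u_def by (rule potential_solves(2)[OF f(3,1) fC f(4) r0 fpos that])
 have sol3: "0 < neg_laplacian_pow s u x" if "s \<in> {1..m - 1}" "x \<noteq> 0" for s x
  unfolding u_def by (rule potential_solves(3)[OF f(3,1) fC f(4) r0 fpos that])
 have nrm: "C1_norm (\<lambda>x. K x - k x) \<le> ereal (2 * c)"
 proof -
  have eq: "(\<lambda>x. K x - k x) = (\<lambda>x. \<Sum>i. P i x)" by (simp add: K_def)
  have "\<bar>\<Sum>i. P i x\<bar> \<le> c \<and> norm (\<Sum>i. DP i x) \<le> c" for x
  proof (cases "\<exists>i. x \<in> tball \<tau> e i")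
   case True
   then obtain i where i: "x \<in> tball \<tau> e i" by blast
   show ?thesis unfolding Kb(2,3)[OF i] using Pc[of i x] DPx[of i x] S(3)[of i] by linarith
  next
   case False
   then show ?thesis using Ko(2,3)[of x] c0 by simp
  qed
  then have "(SUP x. ereal \<bar>\<Sum>i. P i x\<bar>) + (SUP x. ereal (norm (gradient (\<lambda>x. \<Sum>i. P i x) x))) \<le> ereal c + ereal c"
   unfolding gradient_eq[OF gl(1)] by (intro add_mono SUP_least) simp_all
  then show ?thesis unfolding C1_norm_def eq by simp
 qed
 have far: "K x = k x" if "2 * \<tau> \<le> norm x" for x
 proof (rule Ko(1))
  fix i
  have "\<tau> / 4 ^ i \<le> \<tau> / 1" using \<tau>0 by (intro divide_left_mono) auto
  then show "x \<notin> tball \<tau> e i" using tball_norm(2)[OF e1 \<tau>0, of x i] that \<tau>0 by auto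
 qed
 have "DK 0 = 0" unfolding DK_def g0 Ko(3)[OF zo] by simp
 then have "gradient K 0 = 0" using gradient_eq[OF KG[of 0]] by simp
 moreover have "C_k_on 1 K UNIV" by (rule C_1_onI[OF open_UNIV KG DKc])
 moreover have "neg_laplacian_pow m u x = K x * u x powr p" if "x \<noteq> 0" for x
  using sol2[OF that] fK[OF that] by simp
 ultimately show ?thesis using Kpos Ko(1)[OF zo] far nrm sol1 sol3 u0 by (intro exI[of _ K] conjI) auto
qed

end

section \<open>Choice of the parameters\<close>

lemma lipschitz_from_gradient:
 fixes k :: "real ^ 'n::finite => real"
 assumes k: "\<And>x. GDERIV k x :> D x" and C: "convex C" "y \<in> C" "z \<in> C" and D: "\<And>x. x \<in> C ==> norm (D x) \<le> \<omega>"
 shows "\<bar>k y - k z\<bar> \<le> \<omega> * norm (y - z)"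
proof -
 have "\<exists>w\<in>closed_segment z (z + (y - z)). k (z + (y - z)) - k z = (y - z) \<bullet> D w"
  by (rule mvt_segment) (rule k)
 then obtain w where w: "w \<in> closed_segment z y" "k y - k z = (y - z) \<bullet> D w" by auto
 have "w \<in> C" using w(1) closed_segment_subset[OF C(3,2,1)] by blast
 have "\<bar>k y - k z\<bar> \<le> norm (y - z) * norm (D w)" unfolding w(2) by (rule Cauchy_Schwarz_ineq2)
 also have "\<dots> \<le> norm (y - z) * \<omega>" using D[OF \<open>w \<in> C\<close>] by (rule mult_left_mono) simp
 finally show ?thesis by (simp add: mult.commute)
qed

context curvature_bounds
begin

lemma psi_le_off_ball:
 assumes \<kappa>: "a \<le> \<kappa>" "\<kappa> \<le> b" and e: "norm e = 1" and t: "0 < t" and x: "x \<notin> ball (t *\<^sub>R e) (t / 2)"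
 shows "psi \<kappa> \<mu> (t *\<^sub>R e) x \<le> (alpha a * (4 / t\<^sup>2 + 9) powr (N / 2)) * \<mu> powr (N / 2) * q 1 0 x"
proof -
 define d where "d = norm (x - t *\<^sub>R e)"
 define c where "c = 4 / t\<^sup>2 + 9"
 have d: "t / 2 \<le> d" using x by (simp add: d_def dist_norm norm_minus_commute)
 then have d0: "0 < d" using t by linarith
 then have xz: "x \<noteq> t *\<^sub>R e" by (auto simp: d_def)
 have c0: "0 < c" using t by (simp add: c_def add_pos_pos)
 have "norm x \<le> d + norm (t *\<^sub>R e)" unfolding d_def using norm_triangle_ineq[of "x - t *\<^sub>R e" "t *\<^sub>R e"] by simp
 then have "norm x \<le> 3 * d" using d e t by simp
 then have "(norm x)\<^sup>2 \<le> (3 * d)\<^sup>2" by (intro power_mono) auto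
 then have n: "(norm x)\<^sup>2 \<le> 9 * d\<^sup>2" by (simp add: power_mult_distrib)
 have "(t / 2)\<^sup>2 \<le> d\<^sup>2" using d t by (intro power_mono) auto
 then have "1 \<le> 4 / t\<^sup>2 * d\<^sup>2" using t by (simp add: power_divide field_simps)
 then have le: "1 + (norm x)\<^sup>2 \<le> c * d\<^sup>2" using n unfolding c_def distrib_right by linarith
 have "(c * d\<^sup>2) powr (- (N / 2)) \<le> (1 + (norm x)\<^sup>2) powr (- (N / 2))"
  using le N4 by (intro powr_mono2') (auto simp: add_pos_nonneg)
 also have "\<dots> = q 1 0 x" by (simp add: q_def qpow_def)
 also have "(c * d\<^sup>2) powr (- (N / 2)) = c powr (- (N / 2)) * d powr (- N)"
  using c0 d0 by (simp add: powr_mult powr_powr flip: powr_numeral)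
 finally have "c powr (N / 2) * (c powr (- (N / 2)) * d powr (- N)) \<le> c powr (N / 2) * q 1 0 x"
  by (rule mult_left_mono) simp
 moreover have "c powr (N / 2) * (c powr (- (N / 2)) * d powr (- N)) = d powr (- N)"
  using c0 by (simp add: mult.assoc[symmetric] powr_add[symmetric])
 ultimately have dq: "d powr (- N) \<le> c powr (N / 2) * q 1 0 x" by simp
 have "psi \<kappa> \<mu> (t *\<^sub>R e) x \<le> alpha a * \<mu> powr (N / 2) * d powr (- N)"
  unfolding d_def by (rule psi_le[OF \<kappa> xz])
 also have "\<dots> \<le> alpha a * \<mu> powr (N / 2) * (c powr (N / 2) * q 1 0 x)"
  using dq alpha_pos[OF a0] by (intro mult_left_mono) auto
 finally show ?thesis by (simp only: c_def mult_ac)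
qed

text \<open>Possible because \<open>p > 1\<close>.\<close>

lemma background_size:
 "\<exists>\<delta>>0. \<delta> * (c1 + 1) \<le> 1 \<and> b * 2 powr p * (\<delta> * (c1 + 1)) powr p \<le> \<delta>"
proof -
 define B where "B = b * 2 powr p * (c1 + 1)"
 define d where "d = min 1 (B powr (- 1 / (p - 1)))"
 have B: "0 < B" using b0 c1_pos by (simp add: B_def)
 have d: "0 < d" "d \<le> 1" using B by (simp_all add: d_def)
 have "d powr (p - 1) \<le> (B powr (- 1 / (p - 1))) powr (p - 1)"
  using d p_gt_1 by (intro powr_mono2) (auto simp: d_def)
 also have "\<dots> = 1 / B"
 proof -
  have e: "- 1 / (p - 1) * (p - 1) = - 1" using p_gt_1 by simp
  show ?thesis unfolding powr_powr e using B by (simp add: powr_minus_divide)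
 qed
 finally have "B * d powr (p - 1) \<le> 1" using B by (simp add: field_simps)
 then have "B * d powr (p - 1) * d \<le> 1 * d" using d by (intro mult_right_mono) auto
 moreover have "d powr p = d powr (p - 1) * d" using d powr_add[of d "p - 1" 1] by simp
 ultimately have "B * d powr p \<le> d" by (simp add: mult.assoc)
 then have "b * 2 powr p * d powr p \<le> d / (c1 + 1)"
  using c1_pos by (simp add: B_def pos_le_divide_eq mult_ac)
 moreover have "d / (c1 + 1) * (c1 + 1) = d" using c1_pos by simp
 ultimately show ?thesis using d c1_pos by (intro exI[of _ "d / (c1 + 1)"]) simp
qed

text \<open>The constants of \<open>deviation\<close> and \<open>ratio_bounds\<close> come first, then \<open>\<tau>\<close> small enough that the oscillation
 of \<open>k\<close> and the square root of \<open>\<tau>\<close> are small compared with them, and finally for each \<open>i\<close> a bubble so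
 narrow that all its tails are negligible and its height exceeds \<open>real i + 1\<close> times the prescribed size.\<close>

theorem singular_solution:
 fixes k :: "real ^ 'n => real"
 assumes kC: "C_k_on 1 k UNIV" and kab: "\<And>x. a \<le> k x \<and> k x \<le> b" and g0: "gradient k 0 = 0"
  and \<epsilon>: "0 < \<epsilon>" and \<phi>0: "\<forall>t\<in>{0<..<1}. \<phi> t > 0"
 shows "\<exists>K u. C_k_on 1 K UNIV \<and> (\<forall>x. K x > 0) \<and> gradient K 0 = 0 \<and> K 0 = k 0 \<and>
   (\<forall>x. norm x \<ge> \<epsilon> --> K x = k x) \<and> C1_norm (\<lambda>x. K x - k x) < ereal \<epsilon> \<and>
   C_k_on (2 * m) u (- {0}) \<and> (\<forall>x. x \<noteq> 0 --> u x > 0) \<and>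
   (\<forall>x. x \<noteq> 0 --> neg_laplacian_pow m u x = K x * u x powr p) \<and>
   (\<forall>s\<in>{1..m - 1}. \<forall>x. x \<noteq> 0 --> neg_laplacian_pow s u x > 0) \<and>
   (\<forall>d>0. \<forall>M. \<exists>x. x \<noteq> 0 \<and> norm x < d \<and> norm x < 1 \<and> M * \<phi> (norm x) < u x) \<and>
   (\<forall>x. 2 \<le> norm x --> u x \<le> norm x powr (- N))"
proof -
 have \<phi>: "0 < \<phi> t" if "0 < t" "t < 1" for t using \<phi>0 that by simp
 obtain Cd hd where "deviation_constants Cd hd"
  using deviation by blast
 note dev0 = this[unfolded deviation_constants_def]
 have Cd: "0 < Cd" "0 < hd" using dev0 by (rule conjunct1, rule conjunct1[OF conjunct2])
 note dev = dev0[THEN conjunct2, THEN conjunct2]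
 obtain Cr s0 where "ratio_constants Cr s0"
  using ratio_bounds by blast
 note rat0 = this[unfolded ratio_constants_def]
 have Cr: "0 < Cr" "0 < s0" using rat0 by (rule conjunct1, rule conjunct1[OF conjunct2])
 note rat = rat0[THEN conjunct2, THEN conjunct2]
 obtain A3 where A3: "A3 > 0"
  "\<And>\<kappa> \<mu> r z x. a \<le> \<kappa> ==> \<kappa> \<le> b ==> 0 < \<mu> ==> \<mu> \<le> r ==>
   T (\<lambda>y. psi \<kappa> \<mu> z y powr p * indicator (- ball z r) y) x \<le> ennreal (A3 * (\<mu> / r) powr (2 * real m) * psi \<kappa> \<mu> z x)"
  "\<And>\<kappa> \<mu> r z x. a \<le> \<kappa> ==> \<kappa> \<le> b ==> 0 < \<mu> ==> \<mu> \<le> r ==>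
   T (\<lambda>y. psi \<kappa> \<mu> z y powr p * indicator (- ball z r) y) x \<le> ennreal (A3 * \<mu> powr (N / 2 + 2 * real m) * r powr (- (N + 2 * real m)))"
  using T_psi_outer by blast
 obtain \<delta> where \<delta>: "0 < \<delta>" "\<delta> * (c1 + 1) \<le> 1" "b * 2 powr p * (\<delta> * (c1 + 1)) powr p \<le> \<delta>"
  using background_size by blast
 have b4: "0 < b * 4 powr p" using b0 by simp
 define C' where "C' = Cd * (1 + 1 / \<gamma>)"
 have C': "0 < C'" "Cd \<le> C'" "1 / \<gamma> * Cd \<le> C'"
  using Cd \<gamma>_pos by (simp_all add: C'_def distrib_left add_pos_pos)
 define \<eta>1 where "\<eta>1 = min s0 (\<epsilon> / (6 * Cr))"
 define \<eta>0 where "\<eta>0 = min 1 (\<epsilon> / (6 * Cr))"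
 have \<eta>: "0 < \<eta>1" "\<eta>1 \<le> s0" "\<eta>1 \<le> \<epsilon> / (6 * Cr)" "0 < \<eta>0" "\<eta>0 \<le> 1" "\<eta>0 \<le> \<epsilon> / (6 * Cr)"
  using Cr \<epsilon> by (simp_all add: \<eta>1_def \<eta>0_def)
 note kG = C_1_onD(1)[OF open_UNIV kC UNIV_I] and kgc = C_1_onD(2)[OF open_UNIV kC] and kc = C_1_onD(3)[OF open_UNIV kC]
 have gsmall: "\<exists>\<rho>>0. \<forall>x. norm x < \<rho> --> norm (gradient k x) \<le> \<eta>" if "0 < \<eta>" for \<eta>
 proof -
  have "isCont (gradient k) 0" using kgc by (simp add: continuous_on_eq_continuous_at)
  then obtain \<rho> where "0 < \<rho>" "\<And>x. dist x 0 < \<rho> ==> dist (gradient k x) (gradient k 0) < \<eta>"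
   using \<open>0 < \<eta>\<close> unfolding continuous_at_eps_delta by blast
  then show ?thesis unfolding g0 by (intro exI[of _ \<rho>]) (auto simp: dist_norm less_imp_le)
 qed
 obtain \<rho> where \<rho>: "0 < \<rho>" "\<And>x. norm x < \<rho> ==> norm (gradient k x) \<le> \<eta>0" using gsmall[OF \<eta>(4)] by blast
 define g where "g = \<eta>1 / (2 * C')"
 have g: "0 < g" using \<eta> C' by (simp add: g_def)
 define \<tau> where "\<tau> = min (min (1 / 2) (\<rho> / 3)) (min (\<epsilon> / 2) (min (g\<^sup>2) hd))"
 have \<tau>: "0 < \<tau>" "\<tau> \<le> 1 / 2" "3 * \<tau> \<le> \<rho>" "2 * \<tau> \<le> \<epsilon>" "\<tau> \<le> g\<^sup>2" "\<tau> \<le> hd"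
  using \<rho>(1) \<epsilon> g Cd by (simp_all add: \<tau>_def min_def)
 define e :: "real ^ 'n" where "e = axis undefined 1"
 have e1: "norm e = 1" by (simp add: e_def)
 define t where "t i = \<tau> / 4 ^ i" for i :: nat
 have t0: "0 < t i" for i using \<tau> by (simp add: t_def)
 have t\<tau>: "t i \<le> \<tau>" for i
 proof -
  have "\<tau> / 4 ^ i \<le> \<tau> / 1" using \<tau>(1) by (intro divide_left_mono) auto
  then show ?thesis by (simp add: t_def)
 qed
 have t1: "t i \<le> 1" "t i < 1" for i using t\<tau>[of i] \<tau>(2) by linarith+
 have tlim: "t \<longlonglongrightarrow> 0"
 proof -
  have "(\<lambda>i. \<tau> * (1 / 4) ^ i) \<longlonglongrightarrow> \<tau> * 0" by (intro tendsto_mult tendsto_const LIMSEQ_power_zero) simp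
  then show ?thesis by (simp add: t_def[abs_def] power_divide)
 qed
 define z where "z i = t i *\<^sub>R e" for i
 have nz: "norm (z i) = t i" for i using e1 t0[of i] by (simp add: z_def)
 define \<kappa> where "\<kappa> i = k (z i)" for i
 have \<kappa>ab: "a \<le> \<kappa> i" "\<kappa> i \<le> b" for i using kab by (auto simp: \<kappa>_def)
 have \<kappa>0: "0 < \<kappa> i" for i using \<kappa>ab(1)[of i] a0 by linarith
 define \<omega> where "\<omega> i = (SUP x\<in>cball 0 (2 * t i). norm (gradient k x))" for i
 have gb: "norm (gradient k x) \<le> \<eta>0" if "x \<in> cball 0 (2 * t i)" for x i
  by (rule \<rho>(2)) (use that t\<tau>[of i] \<tau>(1,3) in auto)
 have \<omega>g: "norm (gradient k x) \<le> \<omega> i" if "x \<in> cball 0 (2 * t i)" for x i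
  unfolding \<omega>_def by (rule cSUP_upper[OF that bdd_aboveI2[OF gb]])
 have zin: "z i \<in> cball 0 (2 * t i)" for i using nz[of i] t0[of i] by simp
 have \<omega>0: "0 \<le> \<omega> i" for i using \<omega>g[OF zin[of i]] norm_ge_zero order_trans by blast
 have \<omega>le: "\<omega> i \<le> \<eta>" if "\<And>x. x \<in> cball 0 (2 * t i) ==> norm (gradient k x) \<le> \<eta>" for i \<eta>
  unfolding \<omega>_def by (rule cSUP_least) (use zin[of i] that t0[of i] in auto)
 have \<omega>\<eta>: "\<omega> i \<le> \<eta>0" for i by (rule \<omega>le[OF gb])
 have \<omega>lim: "\<omega> \<longlonglongrightarrow> 0"
 proof (rule LIMSEQ_I)
  fix \<eta> :: real assume "0 < \<eta>"
  then have "0 < \<eta> / 2" by simp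
  from gsmall[OF this] obtain \<rho>' where \<rho>': "0 < \<rho>'" "\<And>x. norm x < \<rho>' ==> norm (gradient k x) \<le> \<eta> / 2" by blast
  have "0 < \<rho>' / 2" using \<rho>' by simp
  from tball_eventually_small[OF \<tau>(1) this] obtain i0 where i0: "\<And>i. i0 \<le> i ==> t i < \<rho>' / 2"
   unfolding t_def by blast
  have "norm (\<omega> i - 0) < \<eta>" if "i0 \<le> i" for i
  proof -
   have "\<omega> i \<le> \<eta> / 2" by (rule \<omega>le, rule \<rho>'(2)) (use i0[OF that] in auto)
   then show ?thesis using \<omega>0[of i] \<open>0 < \<eta>\<close> by simp
  qed
  then show "\<exists>no. \<forall>n\<ge>no. norm (\<omega> n - 0) < \<eta>" by blast
 qed
 have osc: "\<bar>k y - \<kappa> i\<bar> \<le> \<omega> i * norm (y - z i)" if "norm (y - z i) \<le> t i" for y i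
 proof -
  have "norm y \<le> 2 * t i" using norm_triangle_ineq[of "y - z i" "z i"] nz[of i] that by simp
  then show ?thesis unfolding \<kappa>_def using zin[of i] \<omega>g
   by (intro lipschitz_from_gradient[OF kG convex_cball[of 0 "2 * t i"]]) auto
 qed
 define hb where "hb = min hd (1 / (A3 * (b * 4 powr p)))"
 have hb: "0 < hb" "hb \<le> hd" "hb \<le> 1 / (A3 * (b * 4 powr p))" using Cd A3(1) b0 by (simp_all add: hb_def)
 define Ma where "Ma i = alpha a * (4 / (t i)\<^sup>2 + 9) powr (N / 2) * (2 * 2 ^ Suc i)" for i
 define Mb where "Mb i = (real i + 1) * \<phi> (t i) * 2" for i
 define M2 where "M2 i = b * A3 * (t i / 2) powr (- (N + 2 * real m))" for i
 have aa: "0 < alpha a" "0 < alpha b" using alpha_pos a0 b0 by auto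
 have Mn: "0 \<le> Ma i" "0 \<le> Mb i" "0 \<le> M2 i" for i
  using aa \<phi>[OF t0 t1(2), of i] b0 A3(1) by (simp_all add: Ma_def Mb_def M2_def)
 define Q where "Q i r \<mu> \<longleftrightarrow> 0 < \<mu> \<and> \<mu> \<le> r \<and> 8 * r \<le> t i \<and> (\<mu> / r) powr (2 * real m) \<le> hb \<and>
  (Ma i / \<delta> + Mb i / alpha b) * \<mu> powr (N / 2) \<le> 1 \<and> M2 i * \<mu> powr (N / 2 + 2 * real m) \<le> 1 \<and>
  t i * \<mu> powr (2 * real m) * r powr (- (2 * real m) - 1) \<le> t i powr (1 / 2) \<and>
  \<mu> powr (- (N / 2)) * r powr (N - 1) \<le> t i powr (1 / 2)" for i r \<mu>
 have "\<exists>r \<mu>. Q i r \<mu>" for i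
  unfolding Q_def by (rule bubble_parameters[OF t0 t1(1) hb(1)]) (use Mn[of i] \<delta>(1) aa in auto)
 then obtain r \<mu> where Q: "\<And>i. Q i (r i) (\<mu> i)" by metis
 have \<mu>0: "0 < \<mu> i" and \<mu>r: "\<mu> i \<le> r i" and r8: "8 * r i \<le> t i" and \<mu>h: "(\<mu> i / r i) powr (2 * real m) \<le> hb"
  and q1: "(Ma i / \<delta> + Mb i / alpha b) * \<mu> i powr (N / 2) \<le> 1" and q2: "M2 i * \<mu> i powr (N / 2 + 2 * real m) \<le> 1"
  and q3: "t i * \<mu> i powr (2 * real m) * r i powr (- (2 * real m) - 1) \<le> t i powr (1 / 2)"
  and q4: "\<mu> i powr (- (N / 2)) * r i powr (N - 1) \<le> t i powr (1 / 2)" for i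
  using Q[of i] unfolding Q_def by blast+
 have r0: "0 < r i" for i using \<mu>0[of i] \<mu>r[of i] by linarith
 have qa: "Ma i * \<mu> i powr (N / 2) \<le> \<delta>" and qb: "Mb i * \<mu> i powr (N / 2) \<le> alpha b" for i
 proof -
  have "0 \<le> Ma i / \<delta> * \<mu> i powr (N / 2)" "0 \<le> Mb i / alpha b * \<mu> i powr (N / 2)"
   using Mn[of i] \<delta>(1) aa by simp_all
  then have "Ma i / \<delta> * \<mu> i powr (N / 2) \<le> 1" "Mb i / alpha b * \<mu> i powr (N / 2) \<le> 1"
   using q1[of i] unfolding distrib_right by linarith+
  then show "Ma i * \<mu> i powr (N / 2) \<le> \<delta>" "Mb i * \<mu> i powr (N / 2) \<le> alpha b"
   using \<delta>(1) aa(2) by (simp_all add: pos_divide_le_eq)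
 qed
 have tb: "tball \<tau> e i = ball (z i) (t i / 2)" for i by (simp only: tball_def z_def t_def)
 have q01: "0 < q 1 0 x" "q 1 0 x \<le> 1" for x using q_pos[of 1 0 x] q_le_max[of 1 0 x] by simp_all
 interpret BS: bubble_sequence m N dim a b k e \<tau> \<kappa> \<mu> r \<delta>
 proof (rule bubble_sequence.intro[OF curvature_bounds_axioms], rule bubble_sequence_axioms.intro)
  show "norm e = 1" by fact
  show "0 < \<tau>" by fact
  show "k \<in> borel_measurable borel" by (rule borel_measurable_continuous_onI[OF kc])
  show "a \<le> k x \<and> k x \<le> b" for x by (rule kab)
  show "a \<le> \<kappa> i" "\<kappa> i \<le> b" "0 < \<mu> i" "\<mu> i \<le> r i" for i by fact+
  show "8 * r i \<le> \<tau> / 4 ^ i" for i using r8[of i] by (simp only: t_def)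
  show "0 < \<delta>" "b * 2 powr p * (\<delta> * (c1 + 1)) powr p \<le> \<delta>" by fact+
  show "T (\<lambda>y. psi (\<kappa> i) (\<mu> i) ((\<tau> / 4 ^ i) *\<^sub>R e) y powr p * indicator (- ball ((\<tau> / 4 ^ i) *\<^sub>R e) (r i)) y) x
    \<le> ennreal (1 / (b * 4 powr p) * psi (\<kappa> i) (\<mu> i) ((\<tau> / 4 ^ i) *\<^sub>R e) x)" for i x
  proof -
   have "A3 * (\<mu> i / r i) powr (2 * real m) \<le> A3 * (1 / (A3 * (b * 4 powr p)))"
    using A3(1) \<mu>h[of i] hb(3) by (intro mult_left_mono) auto
   also have "\<dots> = 1 / (b * 4 powr p)" using A3(1) b4 by simp
   finally have "A3 * (\<mu> i / r i) powr (2 * real m) * psi (\<kappa> i) (\<mu> i) (z i) x \<le> 1 / (b * 4 powr p) * psi (\<kappa> i) (\<mu> i) (z i) x"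
    using psi_pos[OF \<kappa>0 \<mu>0, of i i "z i" x] by (intro mult_right_mono) auto
   from order_trans[OF A3(2)[OF \<kappa>ab \<mu>0 \<mu>r] ennreal_leI[OF this]] show ?thesis unfolding z_def t_def .
  qed
  show "2 * psi (\<kappa> i) (\<mu> i) ((\<tau> / 4 ^ i) *\<^sub>R e) x \<le> \<delta> * (1 / 2) ^ Suc i * q 1 0 x" if "x \<notin> tball \<tau> e i" for i x
  proof -
   have "x \<notin> ball (t i *\<^sub>R e) (t i / 2)" using that unfolding tb z_def .
   from psi_le_off_ball[OF \<kappa>ab e1 t0 this, where \<mu> = "\<mu> i"]
   have "psi (\<kappa> i) (\<mu> i) (z i) x \<le> (alpha a * (4 / (t i)\<^sup>2 + 9) powr (N / 2)) * \<mu> i powr (N / 2) * q 1 0 x"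
    unfolding z_def .
   also have "\<dots> = (Ma i * \<mu> i powr (N / 2)) * (1 / (2 * 2 ^ Suc i)) * q 1 0 x" by (simp add: Ma_def)
   also have "\<dots> \<le> \<delta> * (1 / (2 * 2 ^ Suc i)) * q 1 0 x"
    using qa[of i] q01(1)[of x] by (intro mult_right_mono) auto
   finally show ?thesis unfolding z_def t_def by (simp add: power_divide)
  qed
 qed
 have zc: "BS.zc i = z i" for i by (simp add: BS.zc_def z_def t_def)
 have \<psi>: "BS.\<psi> i = psi (\<kappa> i) (\<mu> i) (z i)" for i by (simp add: BS.\<psi>_def zc)
 obtain f where ft: "tame (- N) f (- {0})"
   and flb: "locally_bounded_on (- {0}) f"
   and f0: "\<And>y. 0 \<le> f y"
   and fin: "\<And>y. T f y < \<infinity>"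
   and feq: "\<And>i y. y \<in> tball \<tau> e i ==> f y = bump (BS.zc i) (r i) y * (\<kappa> i * BS.\<psi> i y powr p)
    + (1 - bump (BS.zc i) (r i) y) * (k y * enn2real (T f y) powr p)"
   and foff: "\<And>y. (\<And>i. y \<notin> tball \<tau> e i) ==> f y = k y * enn2real (T f y) powr p"
   and uin: "\<And>i y. y \<in> tball \<tau> e i ==> enn2real (T f y) \<le> 2 * BS.\<psi> i y + \<delta> * (c1 + 1) * q 1 0 y"
   and uoff: "\<And>y. (\<And>i. y \<notin> tball \<tau> e i) ==> enn2real (T f y) \<le> \<delta> * (c1 + 1) * q 1 0 y"
   and Tout: "\<And>i y. y \<in> tball \<tau> e i ==> T (\<lambda>w. f w * indicator (- tball \<tau> e i) w) y \<le> ennreal (\<delta> * (c1 + 1) * q 1 0 y)"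
  by (fact BS.bubble_solution)
 define u where "u x = enn2real (T f x)" for x
 have fm: "f \<in> borel_measurable borel" by (rule tameD_measurable[OF ft])
 have Q1: "\<delta> * (c1 + 1) * q 1 0 x \<le> 1" for x
  using mult_mono[of "\<delta> * (c1 + 1)" 1 "q 1 0 x" 1] \<delta>(2) q01[of x] by simp
 define X where "X i = \<omega> i * t i * \<mu> i powr (N / 2 + 2 * real m) * r i powr (- (N + 2 * real m)) + 1" for i
 define \<sigma> where "\<sigma> i = C' * ((\<omega> i + 1) * t i powr (1 / 2))" for i
 have X0: "0 \<le> X i" for i using \<omega>0[of i] t0[of i] by (simp add: X_def)
 have X\<sigma>: "C' * X i * \<mu> i powr (- (N / 2)) * r i powr (N - 1) \<le> \<sigma> i" for i
 proof -
  have p1: "\<mu> i powr (N / 2 + 2 * real m) * \<mu> i powr (- (N / 2)) = \<mu> i powr (2 * real m)"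
   unfolding powr_add[symmetric] by simp
  have p2: "r i powr (- (N + 2 * real m)) * r i powr (N - 1) = r i powr (- (2 * real m) - 1)"
   unfolding powr_add[symmetric] by simp
  have "X i * \<mu> i powr (- (N / 2)) * r i powr (N - 1)
    = \<omega> i * (t i * (\<mu> i powr (N / 2 + 2 * real m) * \<mu> i powr (- (N / 2))) * (r i powr (- (N + 2 * real m)) * r i powr (N - 1)))
     + \<mu> i powr (- (N / 2)) * r i powr (N - 1)"
   unfolding X_def by (simp only: distrib_right distrib_left mult_1_left mult_1_right mult_ac)
  also have "\<dots> \<le> \<omega> i * t i powr (1 / 2) + t i powr (1 / 2)"
   unfolding p1 p2 using q3[of i] q4[of i] \<omega>0[of i] by (intro add_mono mult_left_mono)
  finally have "C' * (X i * \<mu> i powr (- (N / 2)) * r i powr (N - 1)) \<le> \<sigma> i"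
   unfolding \<sigma>_def using C'(1) by (intro mult_left_mono) (simp_all add: distrib_right)
  then show ?thesis by (simp only: mult.assoc)
 qed
 have \<sigma>\<eta>: "\<sigma> i \<le> \<eta>1" for i
 proof -
  have "t i powr (1 / 2) \<le> (g\<^sup>2) powr (1 / 2)" using t\<tau>[of i] \<tau>(5) t0[of i] by (intro powr_mono2) auto
  also have "\<dots> = g" using g by (simp add: powr_powr flip: powr_numeral)
  finally have "(\<omega> i + 1) * t i powr (1 / 2) \<le> 2 * g"
   using \<omega>\<eta>[of i] \<eta>(5) \<omega>0[of i] by (intro mult_mono) auto
  then have "\<sigma> i \<le> C' * (2 * g)" unfolding \<sigma>_def using C'(1) by (intro mult_left_mono) auto
  also have "\<dots> = \<eta>1" using C'(1) by (simp add: g_def)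
  finally show ?thesis .
 qed
 have \<sigma>0: "0 \<le> \<sigma> i" for i using C'(1) \<omega>0[of i] by (simp add: \<sigma>_def)
 define S where "S i = Cr * (\<sigma> i + \<omega> i)" for i
 have S\<epsilon>: "S i \<le> \<epsilon> / 3" for i
 proof -
  have "S i \<le> Cr * (\<epsilon> / (6 * Cr) + \<epsilon> / (6 * Cr))"
   unfolding S_def using Cr(1) \<sigma>\<eta>[of i] \<eta>(3,6) \<omega>\<eta>[of i] by (intro mult_left_mono add_mono) auto
  also have "\<dots> = \<epsilon> / 3" using Cr(1) by (simp add: field_simps)
  finally show ?thesis .
 qed
 have Slim: "S \<longlonglongrightarrow> 0"
 proof -
  have "(\<lambda>i. sqrt (t i)) \<longlonglongrightarrow> sqrt 0" by (intro tendsto_real_sqrt tlim)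
  then have "(\<lambda>i. t i powr (1 / 2)) \<longlonglongrightarrow> 0" using t0 by (simp add: powr_half_sqrt less_imp_le)
  then have "(\<lambda>i. Cr * (C' * ((\<omega> i + 1) * t i powr (1 / 2)) + \<omega> i)) \<longlonglongrightarrow> Cr * (C' * ((0 + 1) * 0) + 0)"
   by (intro tendsto_intros \<omega>lim)
  then show ?thesis by (simp add: S_def[abs_def] \<sigma>_def)
 qed
 have D: "(\<forall>x\<in>ball (z i) (t i / 2). \<bar>enn2real (T f x) - psi (\<kappa> i) (\<mu> i) (z i) x\<bar> \<le> Cd * X i) \<and>
  (\<forall>x. norm (x - z i) \<le> 2 * r i -->
   norm (dpot (\<lambda>y. f y - \<kappa> i * psi (\<kappa> i) (\<mu> i) (z i) y powr p) x)
    \<le> Cd * X i / r i)" for i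
 proof -
  have d1: "(\<mu> i / r i) powr (2 * real m) \<le> hd" using \<mu>h[of i] hb(2) by linarith
  have d2: "t i powr (2 * real m) \<le> hd"
  proof -
   have "t i powr (2 * real m) \<le> t i powr 1" using t0[of i] t1[of i] m1r by (intro powr_mono') auto
   then show ?thesis using t0[of i] t\<tau>[of i] \<tau>(6) by simp
  qed
  have d3: "\<forall>y. 0 \<le> f y" and d4: "\<forall>y. T f y < \<infinity>" using f0 fin by blast+
  have d5: "0 \<le> \<omega> i * t i" using \<omega>0[of i] t0[of i] by simp
  have d6: "\<forall>y\<in>ball (z i) (t i / 2). 0 \<le> k y \<and> k y \<le> b \<and> \<bar>k y - \<kappa> i\<bar> \<le> \<omega> i * t i"
  proof
   fix y assume "y \<in> ball (z i) (t i / 2)"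
   then have n: "norm (y - z i) \<le> t i" using t0[of i] by (simp add: dist_norm norm_minus_commute)
   have "\<omega> i * norm (y - z i) \<le> \<omega> i * t i" using n \<omega>0[of i] by (rule mult_left_mono)
   then show "0 \<le> k y \<and> k y \<le> b \<and> \<bar>k y - \<kappa> i\<bar> \<le> \<omega> i * t i" using osc[OF n] kab[of y] a0 by auto
  qed
  have d7: "\<forall>y. 0 \<le> bump (z i) (r i) y \<and> bump (z i) (r i) y \<le> 1" using bump_range by blast
  have d8: "\<forall>y\<in>ball (z i) (r i). bump (z i) (r i) y = 1"
   by (intro ballI bump_1[OF r0]) (simp add: dist_norm norm_minus_commute)
  have d9: "\<forall>y\<in>ball (z i) (t i / 2). f y = bump (z i) (r i) y * (\<kappa> i * psi (\<kappa> i) (\<mu> i) (z i) y powr p) +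
    (1 - bump (z i) (r i) y) * (k y * enn2real (T f y) powr p)"
   using feq[of _ i] unfolding zc \<psi> tb by blast
  have d10: "\<forall>y\<in>ball (z i) (t i / 2). enn2real (T f y) \<le> 2 * psi (\<kappa> i) (\<mu> i) (z i) y + 1"
  proof
   fix y assume "y \<in> ball (z i) (t i / 2)"
   then show "enn2real (T f y) \<le> 2 * psi (\<kappa> i) (\<mu> i) (z i) y + 1"
    using uin[of y i] Q1[of y] unfolding \<psi> tb by linarith
  qed
  have d11: "\<forall>x\<in>ball (z i) (t i / 2). T (\<lambda>y. f y * indicator (- ball (z i) (t i / 2)) y) x \<le> ennreal 1"
  proof
   fix y assume "y \<in> ball (z i) (t i / 2)"
   then have "T (\<lambda>w. f w * indicator (- ball (z i) (t i / 2)) w) y \<le> ennreal (\<delta> * (c1 + 1) * q 1 0 y)"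
    using Tout[of y i] unfolding tb by blast
   from order_trans[OF this ennreal_leI[OF Q1]]
   show "T (\<lambda>w. f w * indicator (- ball (z i) (t i / 2)) w) y \<le> ennreal 1" .
  qed
  have d12: "\<forall>x\<in>ball (z i) (t i / 2). T (\<lambda>y. \<kappa> i * (psi (\<kappa> i) (\<mu> i) (z i) y powr p * indicator (- ball (z i) (t i / 2)) y)) x \<le> ennreal 1"
  proof
   fix x
   let ?h = "\<lambda>y. psi (\<kappa> i) (\<mu> i) (z i) y powr p * indicator (- ball (z i) (t i / 2)) y"
   have Im: "(indicator (- ball (z i) (t i / 2)) :: real^'n => real) \<in> borel_measurable borel"
    by (rule borel_measurable_indicator) auto
   have pm: "(\<lambda>y. psi (\<kappa> i) (\<mu> i) (z i) y powr p) \<in> borel_measurable borel" using measurable_psi[of "\<kappa> i" "\<mu> i" "z i"] by simp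
   have hm: "?h \<in> borel_measurable borel" by (rule borel_measurable_times[OF pm Im])
   have "\<mu> i \<le> t i / 2" using \<mu>r[of i] r8[of i] r0[of i] by linarith
   from A3(3)[OF \<kappa>ab \<mu>0 this]
   have A: "T ?h x \<le> ennreal (A3 * \<mu> i powr (N / 2 + 2 * real m) * (t i / 2) powr (- (N + 2 * real m)))" .
   have "T (\<lambda>y. \<kappa> i * ?h y) x = ennreal (\<kappa> i) * T ?h x" by (rule T_cmult[OF hm less_imp_le[OF \<kappa>0]])
   also have "\<dots> \<le> ennreal b * ennreal (A3 * \<mu> i powr (N / 2 + 2 * real m) * (t i / 2) powr (- (N + 2 * real m)))"
    using A \<kappa>ab(2)[of i] by (intro mult_mono ennreal_leI) auto
   also have "\<dots> = ennreal (M2 i * \<mu> i powr (N / 2 + 2 * real m))"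
    unfolding M2_def using b0 A3(1) by (subst ennreal_mult[symmetric]) (auto simp: mult_ac)
   also have "\<dots> \<le> ennreal 1" by (rule ennreal_leI[OF q2])
   finally show "T (\<lambda>y. \<kappa> i * ?h y) x \<le> ennreal 1" .
  qed
  show ?thesis
   unfolding X_def
   by (rule dev[THEN spec, of "\<kappa> i", THEN spec, of "\<mu> i", THEN spec, of "r i", THEN spec, of "t i", THEN spec, of "z i", THEN spec, of "k", THEN spec, of "\<omega> i * t i", THEN spec, of "1", THEN spec, of "f", THEN spec, of "bump (z i) (r i)",
     THEN mp, OF \<kappa>ab(1)[of i], THEN mp, OF \<kappa>ab(2)[of i], THEN mp, OF \<mu>0[of i], THEN mp, OF \<mu>r[of i], THEN mp, OF r8[of i], THEN mp, OF t1(1)[of i], THEN mp, OF d1, THEN mp, OF d2, THEN mp, OF fm, THEN mp, OF d3, THEN mp, OF d4, THEN mp, OF d5, THEN mp, OF d6, THEN mp, OF d7, THEN mp, OF d8, THEN mp, OF d9, THEN mp, OF d10, THEN mp, OF zero_le_one, THEN mp, OF d11, THEN mp, OF d12])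
 qed
 have main: "psi (\<kappa> i) (\<mu> i) (z i) x / 2 \<le> u x \<and>
   \<bar>corr (\<kappa> i) (\<mu> i) (z i) (r i) (u x) (k x) x\<bar> \<le> S i * r i \<and>
   norm (dcorr (\<kappa> i) (\<mu> i) (z i) (r i) (u x) (k x) ((1 / \<gamma>) *\<^sub>R dpot f x) (gradient k x) x) \<le> S i"
  if x: "norm (x - z i) \<le> 2 * r i" for i x
 proof -
  have n: "norm (x - z i) < t i / 2" using x r8[of i] t0[of i] by linarith
  have xB: "x \<in> ball (z i) (t i / 2)" using n by (simp add: dist_norm norm_minus_commute)
  have x0: "x \<noteq> 0"
  proof
   assume "x = 0"
   then show False using n nz[of i] t0[of i] by simp
  qed
  have xc: "x \<in> cball 0 (2 * t i)"
   using norm_triangle_ineq[of "x - z i" "z i"] nz[of i] n t0[of i] by simp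
  have r1: "r i \<le> 1" using r8[of i] t1(1)[of i] r0[of i] by linarith
  have D0: "0 \<le> C' * X i" using C'(1) X0[of i] by simp
  have e1: "\<bar>u x - psi (\<kappa> i) (\<mu> i) (z i) x\<bar> \<le> C' * X i"
  proof -
   have "Cd * X i \<le> C' * X i" using C'(2) X0[of i] by (rule mult_right_mono)
   then show ?thesis using conjunct1[OF D[of i]] xB unfolding u_def by (meson order_trans)
  qed
  have e2: "norm ((1 / \<gamma>) *\<^sub>R dpot f x - dpsi (\<kappa> i) (\<mu> i) (z i) x) \<le> C' * X i / r i"
  proof -
   let ?g = "\<lambda>y. \<kappa> i * psi (\<kappa> i) (\<mu> i) (z i) y powr p"
   have "(1 / \<gamma>) *\<^sub>R dpot f x - dpsi (\<kappa> i) (\<mu> i) (z i) x = (1 / \<gamma>) *\<^sub>R (dpot f x - dpot ?g x)"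
    unfolding dpsi_eq_dpot[OF \<kappa>ab \<mu>0 x0] by (simp only: scaleR_diff_right)
   also have "dpot f x - dpot ?g x = dpot (\<lambda>y. f y - ?g y) x"
    by (rule dpot_diff[OF ft flb bubble_density_tame[OF \<kappa>ab \<mu>0] x0, symmetric])
   finally have "norm ((1 / \<gamma>) *\<^sub>R dpot f x - dpsi (\<kappa> i) (\<mu> i) (z i) x) = 1 / \<gamma> * norm (dpot (\<lambda>y. f y - ?g y) x)"
    using \<gamma>_pos by simp
   also have "\<dots> \<le> 1 / \<gamma> * (Cd * X i / r i)"
    using conjunct2[OF D[of i]] x \<gamma>_pos by (intro mult_left_mono) auto
   also have "\<dots> = (1 / \<gamma> * Cd) * X i / r i" by simp
   also have "\<dots> \<le> C' * X i / r i"
    using C'(3) X0[of i] r0[of i] by (intro divide_right_mono mult_right_mono) auto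
   finally show ?thesis .
  qed
  note e3 = X\<sigma>[of i]
  have \<sigma>s0: "\<sigma> i \<le> s0" using \<sigma>\<eta>[of i] \<eta>(2) by linarith
  have e4: "\<bar>k x - \<kappa> i\<bar> \<le> 2 * \<omega> i * r i"
  proof -
   have "\<omega> i * norm (x - z i) \<le> \<omega> i * (2 * r i)" using x \<omega>0[of i] by (rule mult_left_mono)
   moreover have "norm (x - z i) \<le> t i" using n t0[of i] by linarith
   ultimately show ?thesis using osc[of x i] by simp
  qed
  have e5: "norm (gradient k x) \<le> \<omega> i" by (rule \<omega>g[OF xc])
  show ?thesis
   unfolding S_def
   by (rule rat[THEN spec, of "\<kappa> i", THEN spec, of "\<mu> i", THEN spec, of "r i", THEN spec, of "z i", THEN spec, of "k x", THEN spec, of "u x", THEN spec, of "(1 / \<gamma>) *\<^sub>R dpot f x", THEN spec, of "gradient k x", THEN spec, of "C' * X i", THEN spec, of "\<sigma> i", THEN spec, of "\<omega> i", THEN spec, of "x",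
     THEN mp, OF \<kappa>ab(1)[of i], THEN mp, OF \<kappa>ab(2)[of i], THEN mp, OF \<mu>0[of i], THEN mp, OF \<mu>r[of i], THEN mp, OF r1, THEN mp, OF x, THEN mp, OF D0, THEN mp, OF e1, THEN mp, OF e2, THEN mp, OF e3, THEN mp, OF \<sigma>s0, THEN mp, OF \<omega>0[of i], THEN mp, OF e4, THEN mp, OF e5])
 qed
 have "\<exists>K. C_k_on 1 K UNIV \<and> (\<forall>x. K x > 0) \<and> gradient K 0 = 0 \<and> K 0 = k 0 \<and>
   (\<forall>x. norm x \<ge> 2 * \<tau> --> K x = k x) \<and> C1_norm (\<lambda>x. K x - k x) \<le> ereal (2 * (\<epsilon> / 3)) \<and>
   C_k_on (2 * m) u (- {0}) \<and> (\<forall>x. x \<noteq> 0 --> u x > 0) \<and>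
   (\<forall>x. x \<noteq> 0 --> neg_laplacian_pow m u x = K x * u x powr p) \<and>
   (\<forall>s\<in>{1..m - 1}. \<forall>x. x \<noteq> 0 --> neg_laplacian_pow s u x > 0)"
  unfolding u_def[abs_def]
 proof (rule BS.glued_curvature[OF kC g0 _ ft flb f0 fin feq foff _ Slim S\<epsilon>])
  show "\<tau> \<le> 1" using \<tau>(2) by simp
  show "\<bar>corr (\<kappa> i) (\<mu> i) (BS.zc i) (r i) (enn2real (T f x)) (k x) x\<bar> \<le> S i * r i \<and>
    norm (dcorr (\<kappa> i) (\<mu> i) (BS.zc i) (r i) (enn2real (T f x)) (k x) ((1 / \<gamma>) *\<^sub>R dpot f x) (gradient k x) x) \<le> S i"
   if "norm (x - BS.zc i) \<le> 2 * r i" for i x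
   using main[of x i] that unfolding zc u_def by blast
 qed assumption+
 then obtain K where K: "C_k_on 1 K UNIV" "\<forall>x. K x > 0" "gradient K 0 = 0" "K 0 = k 0"
   "\<forall>x. norm x \<ge> 2 * \<tau> --> K x = k x" "C1_norm (\<lambda>x. K x - k x) \<le> ereal (2 * (\<epsilon> / 3))"
   "C_k_on (2 * m) u (- {0})" "\<forall>x. x \<noteq> 0 --> u x > 0"
   "\<forall>x. x \<noteq> 0 --> neg_laplacian_pow m u x = K x * u x powr p"
   "\<forall>s\<in>{1..m - 1}. \<forall>x. x \<noteq> 0 --> neg_laplacian_pow s u x > 0"
  by (elim exE conjE) (rule that, assumption+)
 have "ereal (2 * (\<epsilon> / 3)) < ereal \<epsilon>" using \<epsilon> by simp
 with K(6) have K6: "C1_norm (\<lambda>x. K x - k x) < ereal \<epsilon>" by (rule le_less_trans)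
 have K5: "\<forall>x. norm x \<ge> \<epsilon> --> K x = k x" using K(5) \<tau>(4) by (meson order_trans)
 have blow: "\<forall>d>0. \<forall>M. \<exists>x. x \<noteq> 0 \<and> norm x < d \<and> norm x < 1 \<and> M * \<phi> (norm x) < u x"
 proof (intro allI impI)
  fix d M :: real assume "0 < d"
  obtain i0 where i0: "\<And>i. i0 \<le> i ==> t i < d"
   using tball_eventually_small[OF \<tau>(1) \<open>0 < d\<close>] unfolding t_def by blast
  define i where "i = max i0 (nat \<lceil>M\<rceil>)"
  have iM: "M < real i + 1" unfolding i_def by linarith
  have ti: "t i < d" by (rule i0) (simp add: i_def)
  have Y: "0 < \<mu> i powr (N / 2)" using \<mu>0[of i] by simp
  have ph: "0 < \<phi> (t i)" by (rule \<phi>[OF t0 t1(2)])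
  have "(real i + 1) * \<phi> (t i) * 2 * \<mu> i powr (N / 2) \<le> alpha (\<kappa> i)"
   using qb[of i] alpha_range(1)[OF \<kappa>ab, of i] unfolding Mb_def by linarith
  then have "(real i + 1) * \<phi> (t i) * 2 \<le> alpha (\<kappa> i) / \<mu> i powr (N / 2)"
   using Y by (simp only: pos_le_divide_eq)
  also have "\<dots> = psi (\<kappa> i) (\<mu> i) (z i) (z i)" unfolding psi_center[OF \<mu>0] by (simp add: powr_minus_divide)
  finally have "(real i + 1) * \<phi> (t i) \<le> psi (\<kappa> i) (\<mu> i) (z i) (z i) / 2" by simp
  moreover have "psi (\<kappa> i) (\<mu> i) (z i) (z i) / 2 \<le> u (z i)"
   using main[of "z i" i] r0[of i] by simp
  moreover have "M * \<phi> (t i) < (real i + 1) * \<phi> (t i)" using iM ph by (rule mult_strict_right_mono)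
  ultimately have "M * \<phi> (norm (z i)) < u (z i)" unfolding nz by linarith
  moreover have "z i \<noteq> 0" using nz[of i] t0[of i] by auto
  ultimately show "\<exists>x. x \<noteq> 0 \<and> norm x < d \<and> norm x < 1 \<and> M * \<phi> (norm x) < u x"
   using ti t1(2)[of i] nz[of i] by (intro exI[of _ "z i"]) simp
 qed
 have decay: "\<forall>x. 2 \<le> norm x --> u x \<le> norm x powr (- N)"
 proof (intro allI impI)
  fix x :: "real ^ 'n" assume x: "2 \<le> norm x"
  have "x \<notin> tball \<tau> e i" for i
  proof
   assume "x \<in> tball \<tau> e i"
   from tball_norm(2)[OF e1 \<tau>(1) this] have "norm x < 3 / 2 * t i" by (simp only: t_def)
   then show False using t1(1)[of i] x by linarith
  qed
  from uoff[OF this] have "u x \<le> \<delta> * (c1 + 1) * q 1 0 x" unfolding u_def .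
  also have "\<dots> \<le> 1 * q 1 0 x" using \<delta>(2) q01(1)[of x] by (intro mult_right_mono) auto
  also have "\<dots> \<le> norm (x - 0) powr (- N)" unfolding mult_1 by (rule q_le) (use x in auto)
  finally show "u x \<le> norm x powr (- N)" by simp
 qed
 show ?thesis
  by (rule exI[of _ K], rule exI[of _ u], intro conjI K(1-4,7-10) K5 K6 blow decay)
qed

end

section \<open>Singular solutions of arbitrary growth\<close>

theorem theorem1p3:
  fixes m :: nat and k :: "real ^ 'n::finite \<Rightarrow> real" and \<epsilon> :: real and \<phi> :: "real \<Rightarrow> real"
  assumes "m \<ge> 1" and "CARD('n) \<ge> 2 * m + 4"
    and "C_k_on 1 k UNIV"
    and "\<exists>a b. 0 < a \<and> 0 < b \<and> (\<forall>x. a \<le> k x \<and> k x \<le> b)"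
    and "gradient k 0 = 0"
    and "\<epsilon> > 0"
    and "continuous_on {0<..<1} \<phi>" and "\<forall>t\<in>{0<..<1}. \<phi> t > 0"
  shows "\<exists>K :: real ^ 'n \<Rightarrow> real.
      C_k_on 1 K UNIV \<and> (\<forall>x. K x > 0) \<and>
      gradient K 0 = 0 \<and> K 0 = k 0 \<and> (\<forall>x. norm x \<ge> \<epsilon> \<longrightarrow> K x = k x) \<and>
      C1_norm (\<lambda>x. K x - k x) < ereal \<epsilon> \<and>
      (\<exists>u :: real ^ 'n \<Rightarrow> real.
        C_k_on (2 * m) u (- {0}) \<and> (\<forall>x. x \<noteq> 0 \<longrightarrow> u x > 0) \<and>
        (\<forall>x. x \<noteq> 0 \<longrightarrow> neg_laplacian_pow m u x =
           K x * u x powr ((real CARD('n) + 2 * real m) / (real CARD('n) - 2 * real m))) \<and>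
        u \<notin> O[at 0](\<lambda>x. \<phi> (norm x)) \<and>
        u \<in> O[at_infinity](\<lambda>x. norm x powr (2 * real m - real CARD('n))) \<and>
        (\<forall>s\<in>{1..m - 1}. \<forall>x. x \<noteq> 0 \<longrightarrow> neg_laplacian_pow s u x > 0))"
proof -
  define N where "N = real CARD('n) - 2 * real m"
  obtain a b where a: "0 < a" and kab: "\<And>x. a \<le> k x \<and> k x \<le> b" using assms(4) by blast
  have "a \<le> b" using kab[of 0] by linarith
  interpret curvature_bounds m N "TYPE('n)" a b
    by unfold_locales (use assms(1,2) a \<open>a \<le> b\<close> in \<open>simp_all add: N_def\<close>)
  have \<phi>: "0 < \<phi> t" if "0 < t" "t < 1" for t using assms(8) that by simp
  obtain K u where K: "C_k_on 1 K UNIV" "\<forall>x. K x > 0" "gradient K 0 = 0" "K 0 = k 0"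
      "\<forall>x. norm x \<ge> \<epsilon> \<longrightarrow> K x = k x" "C1_norm (\<lambda>x. K x - k x) < ereal \<epsilon>"
      "C_k_on (2 * m) u (- {0})" "\<forall>x. x \<noteq> 0 \<longrightarrow> u x > 0"
      "\<forall>x. x \<noteq> 0 \<longrightarrow> neg_laplacian_pow m u x = K x * u x powr p"
      "\<forall>s\<in>{1..m - 1}. \<forall>x. x \<noteq> 0 \<longrightarrow> neg_laplacian_pow s u x > 0"
      and blow: "\<forall>d>0. \<forall>M. \<exists>x. x \<noteq> 0 \<and> norm x < d \<and> norm x < 1 \<and> M * \<phi> (norm x) < u x"
      and decay: "\<forall>x. 2 \<le> norm x \<longrightarrow> u x \<le> norm x powr (- N)"
    using singular_solution[OF assms(3) kab assms(5,6,8)]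
    by (elim exE conjE) (rule that, assumption+)
  have pe: "(real CARD('n) + 2 * real m) / (real CARD('n) - 2 * real m) = p"
    unfolding p_def unfolding N_def by simp
  have "u \<notin> O[at 0](\<lambda>x. \<phi> (norm x))"
  proof
    assume "u \<in> O[at 0](\<lambda>x. \<phi> (norm x))"
    then obtain c where "eventually (\<lambda>x. norm (u x) \<le> c * norm (\<phi> (norm x))) (at 0)" by (rule landau_o.bigE)
    then obtain d where d: "0 < d" "\<And>x. x \<noteq> 0 \<Longrightarrow> dist x 0 < d \<Longrightarrow> norm (u x) \<le> c * norm (\<phi> (norm x))"
      unfolding eventually_at by blast
    from blow d(1) obtain x where x: "x \<noteq> 0" "norm x < d" "norm x < 1" "c * \<phi> (norm x) < u x" by blast
    have "norm (u x) \<le> c * norm (\<phi> (norm x))" by (rule d(2)) (use x in auto)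
    moreover have "0 < \<phi> (norm x)" by (rule \<phi>) (use x in auto)
    ultimately show False using x(4) by simp
  qed
  moreover have "u \<in> O[at_infinity](\<lambda>x. norm x powr (2 * real m - real CARD('n)))"
  proof (rule bigoI[where c = 1])
    have "norm (u x) \<le> 1 * norm (norm x powr (2 * real m - real CARD('n)))" if "2 \<le> norm x" for x
    proof -
      have "x \<noteq> 0" using that by auto
      then have "0 < u x" using K(8) by blast
      then show ?thesis using decay that by (simp add: N_def)
    qed
    then show "\<forall>\<^sub>F x in at_infinity. norm (u x) \<le> 1 * norm (norm x powr (2 * real m - real CARD('n)))"
      unfolding eventually_at_infinity by blast
  qed
  ultimately show ?thesis
    unfolding pe
    by (intro exI[of _ K] conjI K exI[of _ u])
qed

end
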